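(* Let $k$ be a field and let $b_n^x=b_n^x(\delta,\delta_L,\delta_R,\kappa_L,\kappa_R,\kappa_{LR})$ be the symplectic blob algebra over $k$. If $\delta=\kappa_L=\delta_R$, $\delta_L=\kappa_R=\kappa_{LR}=1$ and $n$ is even and not zero, then there is a quotient of $b_n^x$ that is isomorphic to the Temperley--Lieb algebra $TL_{n+1}$ with loop parameter $\delta=q+q^{-1}$.
   Context: **Temperley--Lieb algebra.** $TL_m$ is the $k$-algebra with basis the planar (non-crossing) pair-partition diagrams on $m$ top and $m$ bottom vertices, multiplication being vertical concatenation with each closed loop replaced by the scalar $\delta$ (written $\delta=q+q^{-1}$). **The symplectic blob algebra $b_n^x$.** A pseudo Temperley--Lieb diagram is a rectangle with vertices $1,\dots,n$ on the top edge and $1',\dots,n'$ on the bottom edge (numbered left to right), joined in pairs by non-crossing lines inside the rectangle, possibly together with closed loops, taken up to isotopy. A line is propagating if it joins a top vertex to a bottom vertex. Lines and loops may be decorated by finitely many left blobs $L$ and right blobs $R$ (read along a line as a word). A left-right blob pseudo-diagram is such a decorated diagram that can be deformed, without crossings, so that all $L$-blobs touch the left side and all $R$-blobs touch the right side of the rectangle simultaneously. The product $dd'$ is obtained by stacking $d$ on top of $d'$. Straightening relations: an undecorated loop is removed with factor $\delta$; a loop with a single $L$ is removed with factor $\kappa_L$; a loop with a single $R$ with factor $\kappa_R$; a loop with one $L$ and one $R$ with factor $\kappa_{LR}$; consecutive blobs on a line (or loop) satisfy $LL=\delta_L L$, $RR=\delta_R R$, $LRL=\kappa_{LR}L$, $RLR=\kappa_{LR}R$.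 Topological relation: if a diagram $D$ has an arc joining two top vertices carrying both an $L$ and an $R$, and also an arc joining two bottom vertices carrying both an $L$ and an $R$, then $D=\kappa_{LR}D'$, where $D'$ is obtained by cutting each of these two arcs between its $L$ and its $R$ and joining the two left halves into one propagating line decorated by a single $L$, and the two right halves into one propagating line decorated by a single $R$. The algebra $b_n^x$ is the $k$-algebra with basis consisting of all left-right blob pseudo-diagrams without loops, with no line carrying $LL$, $RR$, $LRL$ or $RLR$ consecutively, and which do not have simultaneously a top arc carrying both $L$ and $R$ and a bottom arc carrying both $L$ and $R$; multiplication is stacking followed by reduction using the straightening relations (removal of loops with factors $\delta,\kappa_L,\kappa_R,\kappa_{LR}$ according to their decoration, and $LL=\delta_L L$, $RR=\delta_R R$, $LRL=\kappa_{LR}L$, $RLR=\kappa_{LR}R$) and the topological relation $D=\kappa_{LR}D'$ (this is a well-defined associative finite-dimensional algebra). *)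

theory Defs
  imports "HOL-Algebra.QuotRing" "HOL-Algebra.Module" "HOL-Library.Sublist"
begin

section \<open>Algebras over a field spanned by diagrams\<close>

text \<open>
  The scalars form a type of class \<open>field\<close>.  An algebra is a \<open>module\<close> record, that is, a ring
  record with a scalar multiplication.  The free vector space on a finite set \<open>B\<close> consists of
  the functions that vanish outside \<open>B\<close>; a product \<open>mul b b' = (c, b'')\<close> of basis elements,
  read as \<open>c\<close> times \<open>b''\<close>, is extended bilinearly.
\<close>

definition basis_vector :: "'b \<Rightarrow> 'b \<Rightarrow> 'k::field" where
  "basis_vector b = (\<lambda>e. if e = b then 1 else 0)"

definition based_algebra ::
  "'b set \<Rightarrow> 'b \<Rightarrow> ('b \<Rightarrow> 'b \<Rightarrow> 'k \<times> 'b) \<Rightarrow> ('k::field, 'b \<Rightarrow> 'k) module" where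
  "based_algebra B u mul =
    \<lparr>carrier = {f. \<forall>b. b \<notin> B \<longrightarrow> f b = 0},
     mult = (\<lambda>f g e. \<Sum>b\<in>B. \<Sum>b'\<in>B.
       f b * g b' * fst (mul b b') * basis_vector (snd (mul b b')) e),
     one = basis_vector u,
     zero = (\<lambda>_. 0),
     add = (\<lambda>f g e. f e + g e),
     smult = (\<lambda>c f e. c * f e)\<rparr>"

text \<open>
  The first two conjuncts are the locale \<open>ideal\<close> without its part \<open>ring A\<close>, which is a property
  of the algebra alone.
\<close>

definition algebra_ideal :: "'a set \<Rightarrow> ('k, 'a) module \<Rightarrow> bool" where
  "algebra_ideal I A \<longleftrightarrow> additive_subgroup I A \<and> ideal_axioms I A \<and>
    (\<forall>c. \<forall>a\<in>I. c \<odot>\<^bsub>A\<^esub> a \<in> I)"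

definition quotient_algebra :: "('k, 'a) module \<Rightarrow> 'a set \<Rightarrow> ('k, 'a set) module" where
  "quotient_algebra A I =
    ring.extend (A Quot I) (module.fields (\<lambda>c X. \<Union>a\<in>X. I +>\<^bsub>A\<^esub> (c \<odot>\<^bsub>A\<^esub> a)))"

definition algebra_isomorphic :: "('k, 'a) module \<Rightarrow> ('k, 'b) module \<Rightarrow> bool" where
  "algebra_isomorphic A B \<longleftrightarrow>
    (\<exists>h\<in>ring_iso A B. \<forall>c. \<forall>a\<in>carrier A. h (c \<odot>\<^bsub>A\<^esub> a) = c \<odot>\<^bsub>B\<^esub> h a)"


section \<open>Diagrams\<close>

datatype blob = LeftBlob | RightBlob

text \<open>
  Points on the boundary of the rectangle.  The vertices are \<open>Top i\<close> and \<open>Bot i\<close> with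
  \<open>1 \<le> i \<le> n\<close>.  A blob that touches its side of the rectangle occupies two consecutive points
  of that side, \<open>Wall s (2 * j)\<close> and just below it \<open>Wall s (2 * j + 1)\<close>, one for each of the two
  pieces of line that meet in the blob; \<open>j\<close> counts the blobs of this side downwards from 0.
\<close>

datatype point = Top nat | Bot nat | Wall blob nat

definition vertices :: "nat \<Rightarrow> point set" where
  "vertices n = Top ` {1..n} \<union> Bot ` {1..n}"

definition boundary :: "nat \<Rightarrow> nat \<Rightarrow> nat \<Rightarrow> point set" where
  "boundary n l r = vertices n \<union> Wall LeftBlob ` {..<2 * l} \<union> Wall RightBlob ` {..<2 * r}"

text \<open>
  The position (between 1 and \<open>2 * n + 2 * l + 2 * r\<close>) of a point on the boundary, clockwise from
  the top left corner, when there are \<open>l\<close> left blobs and \<open>r\<close> right blobs.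
\<close>

fun clockwise :: "nat \<Rightarrow> nat \<Rightarrow> nat \<Rightarrow> point \<Rightarrow> nat" where
  "clockwise n l r (Top i) = i"
| "clockwise n l r (Wall RightBlob i) = n + 1 + i"
| "clockwise n l r (Bot i) = 2 * n + 2 * r + 1 - i"
| "clockwise n l r (Wall LeftBlob i) = 2 * n + 2 * r + 2 * l - i"

definition pairing :: "'a set \<Rightarrow> ('a \<times> 'a) set \<Rightarrow> bool" where
  "pairing V M \<longleftrightarrow> M \<subseteq> V \<times> V \<and> sym M \<and> irrefl M \<and> (\<forall>p\<in>V. \<exists>!q. (p, q) \<in> M)"

definition noncrossing :: "('a \<Rightarrow> nat) \<Rightarrow> ('a \<times> 'a) set \<Rightarrow> bool" where
  "noncrossing pos M \<longleftrightarrow>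
    \<not> (\<exists>p q r s. (p, q) \<in> M \<and> (r, s) \<in> M \<and> pos p < pos r \<and> pos r < pos q \<and> pos q < pos s)"

text \<open>
  A drawing in which all \<open>l\<close> left blobs touch the left side and all \<open>r\<close> right blobs touch the
  right side: cutting the lines at their blobs leaves non-crossing pieces of line, determined up
  to isotopy by the pairing of their end points on the boundary.
\<close>

definition drawing :: "nat \<Rightarrow> nat \<Rightarrow> nat \<Rightarrow> (point \<times> point) set \<Rightarrow> bool" where
  "drawing n l r M \<longleftrightarrow> pairing (boundary n l r) M \<and> noncrossing (clockwise n l r) M"

definition across :: "nat \<Rightarrow> nat" where
  "across i = (if even i then i + 1 else i - 1)"

inductive thread :: "(point \<times> point) set \<Rightarrow> point \<Rightarrow> blob list \<Rightarrow> point \<Rightarrow> bool"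
  for M where
  start: "(p, q) \<in> M \<Longrightarrow> thread M p [] q"
| blob: "thread M p w (Wall s i) \<Longrightarrow> (Wall s (across i), q) \<in> M \<Longrightarrow> thread M p (w @ [s]) q"

text \<open>
  A decorated diagram without loops is the set of its lines.  A line is a triple \<open>(p, w, q)\<close> of
  its end points and the word \<open>w\<close> of the blobs met on the way from \<open>p\<close> to \<open>q\<close>; every line is
  listed in both directions, as \<open>(p, w, q)\<close> and as \<open>(q, rev w, p)\<close>.
\<close>

type_synonym diagram = "(point \<times> blob list \<times> point) set"

definition lines_of :: "nat \<Rightarrow> (point \<times> point) set \<Rightarrow> diagram" where
  "lines_of n M = {(p, w, q). p \<in> vertices n \<and> q \<in> vertices n \<and> thread M p w q}"

text \<open>
  The left-right blob pseudo-diagrams without loops.  If \<open>M\<close> contains loops as well, they can be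
  erased from the drawing, so that it is harmless that \<open>lines_of\<close> ignores them.
\<close>

definition left_right_diagrams :: "nat \<Rightarrow> diagram set" where
  "left_right_diagrams n = {lines_of n M | M l r. drawing n l r M}"

definition id_diagram :: "nat \<Rightarrow> diagram" where
  "id_diagram n = (\<Union>i\<in>{1..n}. {(Top i, [], Bot i), (Bot i, [], Top i)})"


subsection \<open>Stacking\<close>

text \<open>
  In the stack of \<open>d\<close> (upper layer) on \<open>d'\<close> (lower layer), the vertex \<open>Bot i\<close> of \<open>d\<close> is identified
  with the vertex \<open>Top i\<close> of \<open>d'\<close>.
\<close>

datatype layer = Upper | Lower

inductive walk :: "diagram \<Rightarrow> diagram \<Rightarrow> layer \<times> point \<Rightarrow> blob list \<Rightarrow> layer \<times> point \<Rightarrow> bool"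
  for d d' where
  upper: "(p, w, q) \<in> d \<Longrightarrow> walk d d' (Upper, p) w (Upper, q)"
| lower: "(p, w, q) \<in> d' \<Longrightarrow> walk d d' (Lower, p) w (Lower, q)"
| down: "walk d d' x w (Upper, Bot i) \<Longrightarrow> (Top i, w', q) \<in> d' \<Longrightarrow> walk d d' x (w @ w') (Lower, q)"
| up: "walk d d' x w (Lower, Top i) \<Longrightarrow> (Bot i, w', q) \<in> d \<Longrightarrow> walk d d' x (w @ w') (Upper, q)"

fun outer :: "point \<Rightarrow> layer \<times> point" where
  "outer (Top i) = (Upper, Top i)"
| "outer p = (Lower, p)"

definition stack :: "nat \<Rightarrow> diagram \<Rightarrow> diagram \<Rightarrow> diagram" where
  "stack n d d' =
    {(p, w, q). p \<in> vertices n \<and> q \<in> vertices n \<and> walk d d' (outer p) w (outer q)}"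

definition middle_adjacent :: "diagram \<Rightarrow> diagram \<Rightarrow> (nat \<times> nat) set" where
  "middle_adjacent d d' =
    {(i, j). (\<exists>w. (Bot i, w, Bot j) \<in> d) \<or> (\<exists>w. (Top i, w, Top j) \<in> d')}"

text \<open>
  The loops that arise in the stack, each given by the set of middle vertices it runs through:
  a component all of whose vertices lie on a bottom arc of \<open>d\<close> and on a top arc of \<open>d'\<close>.
\<close>

definition loops :: "nat \<Rightarrow> diagram \<Rightarrow> diagram \<Rightarrow> nat set set" where
  "loops n d d' = {C. (\<exists>i\<in>{1..n}. C = (middle_adjacent d d')\<^sup>* `` {i}) \<and>
    (\<forall>j\<in>C. (\<exists>k w. (Bot j, w, Bot k) \<in> d) \<and> (\<exists>k w. (Top j, w, Top k) \<in> d'))}"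

definition loop_blobs :: "diagram \<Rightarrow> diagram \<Rightarrow> nat set \<Rightarrow> blob \<Rightarrow> nat" where
  "loop_blobs d d' C s =
    (\<Sum>(i, w, j)\<in>{(i, w, j). i \<in> C \<and> i < j \<and> (Bot i, w, Bot j) \<in> d}. count_list w s) +
    (\<Sum>(i, w, j)\<in>{(i, w, j). i \<in> C \<and> i < j \<and> (Top i, w, Top j) \<in> d'}. count_list w s)"


section \<open>The Temperley--Lieb algebra\<close>

definition tl_diagrams :: "nat \<Rightarrow> diagram set" where
  "tl_diagrams m = {(\<lambda>(p, q). (p, [], q)) ` M | M.
    pairing (vertices m) M \<and> noncrossing (clockwise m 0 0) M}"

definition tl_mult :: "nat \<Rightarrow> 'k::field \<Rightarrow> diagram \<Rightarrow> diagram \<Rightarrow> 'k \<times> diagram" where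
  "tl_mult m \<delta> d d' = (\<delta> ^ card (loops m d d'), stack m d d')"

definition temperley_lieb :: "nat \<Rightarrow> 'k::field \<Rightarrow> ('k, diagram \<Rightarrow> 'k) module" where
  "temperley_lieb m \<delta> = based_algebra (tl_diagrams m) (id_diagram m) (tl_mult m \<delta>)"


section \<open>The symplectic blob algebra\<close>

record 'k blob_params =
  delta :: 'k
  delta_L :: 'k
  delta_R :: 'k
  kappa_L :: 'k
  kappa_R :: 'k
  kappa_LR :: 'k


subsection \<open>Basis\<close>

definition reduced_word :: "blob list \<Rightarrow> bool" where
  "reduced_word w \<longleftrightarrow>
    (\<forall>u\<in>{[LeftBlob, LeftBlob], [RightBlob, RightBlob],
         [LeftBlob, RightBlob, LeftBlob], [RightBlob, LeftBlob, RightBlob]}. \<not> sublist u w)"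

definition top_LR_arc :: "diagram \<Rightarrow> nat \<Rightarrow> nat \<Rightarrow> bool" where
  "top_LR_arc D i j \<longleftrightarrow>
    i < j \<and> (\<exists>w. (Top i, w, Top j) \<in> D \<and> LeftBlob \<in> set w \<and> RightBlob \<in> set w)"

definition bottom_LR_arc :: "diagram \<Rightarrow> nat \<Rightarrow> nat \<Rightarrow> bool" where
  "bottom_LR_arc D i j \<longleftrightarrow>
    i < j \<and> (\<exists>w. (Bot i, w, Bot j) \<in> D \<and> LeftBlob \<in> set w \<and> RightBlob \<in> set w)"

definition topological_redex :: "diagram \<Rightarrow> bool" where
  "topological_redex D \<longleftrightarrow> (\<exists>i j. top_LR_arc D i j) \<and> (\<exists>i j. bottom_LR_arc D i j)"

definition blob_diagrams :: "nat \<Rightarrow> diagram set" where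
  "blob_diagrams n = {D \<in> left_right_diagrams n.
    (\<forall>(p, w, q)\<in>D. reduced_word w) \<and> \<not> topological_redex D}"


subsection \<open>Reduction\<close>

definition scale :: "'k::field \<Rightarrow> 'k \<times> 'a \<Rightarrow> 'k \<times> 'a" where
  "scale c = map_prod ((*) c) id"

text \<open>
  The straightening relations for the word of a line; these rewriting rules are confluent.  The
  fifth and sixth equations apply the rules for double blobs behind the first letter.
\<close>

fun straighten :: "'k::field blob_params \<Rightarrow> blob list \<Rightarrow> 'k \<times> blob list" where
  "straighten x (LeftBlob # LeftBlob # w) = scale (delta_L x) (straighten x (LeftBlob # w))"
| "straighten x (RightBlob # RightBlob # w) = scale (delta_R x) (straighten x (RightBlob # w))"
| "straighten x (LeftBlob # RightBlob # LeftBlob # w) =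
    scale (kappa_LR x) (straighten x (LeftBlob # w))"
| "straighten x (RightBlob # LeftBlob # RightBlob # w) =
    scale (kappa_LR x) (straighten x (RightBlob # w))"
| "straighten x (LeftBlob # RightBlob # RightBlob # w) =
    scale (delta_R x) (straighten x (LeftBlob # RightBlob # w))"
| "straighten x (RightBlob # LeftBlob # LeftBlob # w) =
    scale (delta_L x) (straighten x (RightBlob # LeftBlob # w))"
| "straighten x w = (1, w)"

text \<open>
  The factor of a loop with \<open>a\<close> left and \<open>b\<close> right blobs.  A closed curve without
  self-crossings meets the two sides of the rectangle in the cyclic order of the boundary, so all
  its left blobs are consecutive, and so are all its right blobs.  The relations for double blobs
  thus leave at most one blob of each kind.
\<close>

definition loop_factor :: "'k::field blob_params \<Rightarrow> nat \<Rightarrow> nat \<Rightarrow> 'k" where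
  "loop_factor x a b = delta_L x ^ (a - 1) * delta_R x ^ (b - 1) *
    (if a = 0 \<and> b = 0 then delta x
     else if b = 0 then kappa_L x
     else if a = 0 then kappa_R x
     else kappa_LR x)"

text \<open>
  The lines in one direction only; among vertices the clockwise order does not depend on the
  numbers of blobs.
\<close>

definition oriented_lines :: "nat \<Rightarrow> diagram \<Rightarrow> diagram" where
  "oriented_lines n D = {(p, w, q)\<in>D. clockwise n 0 0 p < clockwise n 0 0 q}"

text \<open>
  The diagram \<open>D'\<close> of the topological relation \<open>D = kappa_LR D'\<close>.  By planarity, an arc carrying
  both kinds of blob has its left blobs nearer to its left end point, there is at most one
  such arc at the top and at most one at the bottom, and the left halves of the two arcs contain
  their left end points.
\<close>

definition reconnect :: "diagram \<Rightarrow> diagram" where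
  "reconnect D =
    {(p, w, q)\<in>D. \<not> (\<exists>i j. {p, q} = {Top i, Top j} \<and> top_LR_arc D i j) \<and>
      \<not> (\<exists>i j. {p, q} = {Bot i, Bot j} \<and> bottom_LR_arc D i j)} \<union>
    (\<Union>(i, j, k, l)\<in>{(i, j, k, l). top_LR_arc D i j \<and> bottom_LR_arc D k l}.
      {(Top i, [LeftBlob], Bot k), (Bot k, [LeftBlob], Top i),
       (Top j, [RightBlob], Bot l), (Bot l, [RightBlob], Top j)})"

definition topological_reduce :: "'k::field blob_params \<Rightarrow> diagram \<Rightarrow> 'k \<times> diagram" where
  "topological_reduce x D =
    (if topological_redex D then (kappa_LR x, reconnect D) else (1, D))"

definition blob_mult ::
  "nat \<Rightarrow> 'k::field blob_params \<Rightarrow> diagram \<Rightarrow> diagram \<Rightarrow> 'k \<times> diagram" where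
  "blob_mult n x d d' =
    (let D = stack n d d';
         c = (\<Prod>C\<in>loops n d d'.
               loop_factor x (loop_blobs d d' C LeftBlob) (loop_blobs d d' C RightBlob));
         c' = (\<Prod>(p, w, q)\<in>oriented_lines n D. fst (straighten x w))
     in scale (c * c')
          (topological_reduce x ((\<lambda>(p, w, q). (p, snd (straighten x w), q)) ` D)))"

definition symplectic_blob_algebra ::
  "nat \<Rightarrow> 'k::field blob_params \<Rightarrow> ('k, diagram \<Rightarrow> 'k) module" where
  "symplectic_blob_algebra n x = based_algebra (blob_diagrams n) (id_diagram n) (blob_mult n x)"

end

theory Submission
 imports Defs
begin

text \<open>
  The quotient map redraws a blob diagram with one more vertex at the top and at the bottom. Left
  blobs are erased. At a right blob the line is cut where it touches the right side, and the loose
  ends on that side, read downwards, are joined by a new strand that comes from the top vertex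
  \<open>n + 1\<close> and leaves to the bottom vertex \<open>n + 1\<close>: the vertex \<open>Top (n + 1)\<close> meets the first loose
  end, the two pieces of neighbouring blobs meet between the blobs, and the last loose end meets
  \<open>Bot (n + 1)\<close>. The relations then become relations between planar curves. Two consecutive
  right blobs enclose a closed curve with the strand, whence \<open>RR = delta R\<close>; a loop with a single
  right blob is absorbed by the strand, whence the factor \<open>1\<close>; a loop without right blobs stays a loop,
  whence \<open>kappa_L = delta\<close>. The relations with \<open>kappa_LR = 1\<close>, the topological one included,
  only move curves across places where the left and the right side are joined by parallel pieces of line.
  
  The image of a product has to be compared with the product of the images. As diagrams they agree
  because reduction deletes points of the two walls in a way that does not change the redrawn diagram
  (\<open>delete_pair\<close>, \<open>delete_ladder\<close>, \<open>topological_step\<close>), and because redrawing commutes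
  with stacking (\<open>strand_composite\<close>). In the other algebra the scalar is a power of \<open>delta\<close>
  that counts the closed curves of the stack. Here every loop with \<open>b > 0\<close> right blobs and every line with
  \<open>b > 0\<close> right blobs contributes \<open>b - 1\<close>, and every loop without right blobs contributes \<open>1\<close>.
  The two exponents agree by a form of Euler's relation for planar matchings (\<open>euler\<close>),
  which compares the two ways to join the loose ends on the right side: at the blobs, or along the strand.
  This gives \<open>scalar_degree\<close>.
  
  The parity of \<open>n\<close> enters through \<open>wall_parity\<close>: a piece of line that runs from the left to the
  right side has an even number of end points on either side of it, so that two parallel pieces bound
  the same blobs on both sides, which is what the relations for \<open>LRL\<close> and \<open>RLR\<close> need.
  Finally every Temperley--Lieb diagram on \<open>n + 1\<close> vertices comes from a diagram with one right blob on the
  boundary (\<open>to_tl_onto\<close>), and a map between bases that respects the products and is onto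
  identifies a quotient of one algebra with the other (\<open>based_algebra_quotient\<close>).
\<close>

section \<open>Labelled matchings and gluing\<close>

definition und :: "('a \<times> 'l list \<times> 'a) set \<Rightarrow> ('a \<times> 'a) set" where
 "und E = {(p, q). \<exists>w. (p, w, q) \<in> E}"

abbreviation bond :: "'a \<Rightarrow> 'l list \<Rightarrow> 'a \<Rightarrow> ('a \<times> 'l list \<times> 'a) set" where
 "bond a u b \<equiv> {(a, u, b), (b, rev u, a)}"

text \<open>
  A line is listed in both directions, with the word of its labels reversed; a matching is thus a
  perfect pairing of \<open>V\<close> by labelled lines.
\<close>

definition matching :: "'a set \<Rightarrow> ('a \<times> 'l list \<times> 'a) set \<Rightarrow> bool" where
 "matching V E \<longleftrightarrow>
  (\<forall>p w q. (p, w, q) \<in> E \<longrightarrow> p \<in> V \<and> q \<in> V \<and> p \<noteq> q \<and> (q, rev w, p) \<in> E) \<and>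
  (\<forall>p\<in>V. \<exists>w q. (p, w, q) \<in> E) \<and>
  (\<forall>p w q w' q'. (p, w, q) \<in> E \<longrightarrow> (p, w', q') \<in> E \<longrightarrow> w = w' \<and> q = q')"

lemma matchingI:
 assumes "\<And>p w q. (p, w, q) \<in> E \<Longrightarrow> p \<in> V \<and> q \<in> V \<and> p \<noteq> q \<and> (q, rev w, p) \<in> E"
  and "\<And>p. p \<in> V \<Longrightarrow> \<exists>w q. (p, w, q) \<in> E"
  and "\<And>p w q w' q'. (p, w, q) \<in> E \<Longrightarrow> (p, w', q') \<in> E \<Longrightarrow> w = w' \<and> q = q'"
 shows "matching V E" unfolding matching_def using assms by auto

lemma matchingD:
 assumes "matching V E" "(p, w, q) \<in> E"
 shows "p \<in> V" "q \<in> V" "p \<noteq> q" "(q, rev w, p) \<in> E" using assms unfolding matching_def by blast+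

lemma matching_ex: "matching V E \<Longrightarrow> p \<in> V \<Longrightarrow> \<exists>w q. (p, w, q) \<in> E" unfolding matching_def by blast

lemma matching_uniq:
 "matching V E \<Longrightarrow> (p, w, q) \<in> E \<Longrightarrow> (p, w', q') \<in> E \<Longrightarrow> w = w' \<and> q = q'"
 unfolding matching_def by blast

lemma matching_uniq_left:
 assumes "matching V E" "(p, w, q) \<in> E" "(p', w', q) \<in> E"
 shows "p = p' \<and> w = w'" using assms matchingD(4) matching_uniq by (metis rev_rev_ident)

lemma matching_empty [simp]: "matching {} E \<longleftrightarrow> E = {}" unfolding matching_def by auto

lemma matching_eqI:
 assumes "matching V E" "matching V E'" "E \<subseteq> E'"
 shows "E = E'"
proof (intro subset_antisym assms(3) subrelI)
 fix p wq assume *: "(p, wq) \<in> E'"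
 obtain w q where wq: "wq = (w, q)" by force
 hence "p \<in> V" using * matchingD[OF assms(2)] by blast
 then obtain w' q' where "(p, w', q') \<in> E" using matching_ex[OF assms(1)] by blast
 thus "(p, wq) \<in> E" using assms(3) * wq matching_uniq[OF assms(2)] by blast
qed

text \<open>
  Alternating paths: lines of \<open>E\<close> joined at their ends by the connecting pieces \<open>G\<close>. Blobs,
  the strand and the middle edge of a stack are all gluings of this kind.
\<close>

inductive apath :: "('a \<times> 'l list \<times> 'a) set \<Rightarrow> ('a \<times> 'l list \<times> 'a) set \<Rightarrow> 'a \<Rightarrow> 'l list \<Rightarrow> 'a \<Rightarrow> bool"
 for E G where
 start: "(p, w, q) \<in> E \<Longrightarrow> apath E G p w q"
| step: "apath E G p w a \<Longrightarrow> (a, u, b) \<in> G \<Longrightarrow> (b, w', q) \<in> E \<Longrightarrow> apath E G p (w @ u @ w') q"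

definition dom3 :: "('a \<times> 'l list \<times> 'a) set \<Rightarrow> 'a set" where
 "dom3 G = {a. \<exists>u b. (a, u, b) \<in> G}"

definition glued :: "('a \<times> 'l list \<times> 'a) set \<Rightarrow> ('a \<times> 'l list \<times> 'a) set \<Rightarrow> ('a \<times> 'l list \<times> 'a) set" where
 "glued E G = {(p, w, q). apath E G p w q \<and> p \<notin> dom3 G \<and> q \<notin> dom3 G}"

lemma dom3_matching: "matching W G \<Longrightarrow> dom3 G = W" unfolding dom3_def matching_def by blast

lemma dom3_Un: "dom3 (G1 \<union> G2) = dom3 G1 \<union> dom3 G2" unfolding dom3_def by blast

lemma apath_mono: "apath E G p w q \<Longrightarrow> E \<subseteq> E' \<Longrightarrow> G \<subseteq> G' \<Longrightarrow> apath E' G' p w q"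
 by (induction rule: apath.induct) (auto intro: apath.intros)

lemma apath_trans:
 assumes "apath E G b w' q" "apath E G p w a" "(a, u, b) \<in> G"
 shows "apath E G p (w @ u @ w') q" using assms
proof (induction rule: apath.induct)
 case (start b w' q)
 thus ?case by (auto intro: apath.step)
next
 case (step b w1 a1 u1 b1 w' q)
 from apath.step[OF step.IH[OF step.prems] step.hyps(2,3)] show ?case by simp
qed

lemma apath_glued:
 assumes "snd ` snd ` G2 \<inter> dom3 G1 = {}" "dom3 G2 \<inter> dom3 G1 = {}"
 shows "apath (glued E G1) G2 p w q \<longleftrightarrow> apath E (G1 \<union> G2) p w q \<and> p \<notin> dom3 G1 \<and> q \<notin> dom3 G1"
proof
 assume "apath (glued E G1) G2 p w q"
 thus "apath E (G1 \<union> G2) p w q \<and> p \<notin> dom3 G1 \<and> q \<notin> dom3 G1"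
 proof (induction rule: apath.induct)
  case (start p w q)
  thus ?case unfolding glued_def by (auto intro: apath_mono)
 next
  case (step p w a u b w' q)
  hence "apath E (G1 \<union> G2) b w' q" "q \<notin> dom3 G1" unfolding glued_def by (auto intro: apath_mono)
  with step show ?case by (auto intro: apath_trans)
 qed
next
 assume "apath E (G1 \<union> G2) p w q \<and> p \<notin> dom3 G1 \<and> q \<notin> dom3 G1"
 hence A: "apath E (G1 \<union> G2) p w q" and p: "p \<notin> dom3 G1" and q: "q \<notin> dom3 G1" by auto
 let ?init = "\<lambda>v x. (x = p \<and> v = []) \<or>
   (\<exists>v' a u. apath (glued E G1) G2 p v' a \<and> (a, u, x) \<in> G2 \<and> v = v' @ u)"
 have join: "apath (glued E G1) G2 p (v @ w2) q"
  if "?init v x" "apath E G1 x w2 q" "x \<notin> dom3 G1" "q \<notin> dom3 G1" for v x w2 q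
 proof -
  have "(x, w2, q) \<in> glued E G1" using that unfolding glued_def by auto
  thus ?thesis using that(1) by (auto intro: apath.intros)
 qed
 from A p have "\<exists>v w2 x. w = v @ w2 \<and> ?init v x \<and> apath E G1 x w2 q \<and> x \<notin> dom3 G1"
 proof (induction rule: apath.induct)
  case (start p w q)
  thus ?case using apath.start[OF start(1)] by (intro exI[of _ "[]"] exI[of _ w] exI[of _ p]) simp
 next
  case (step p w a u b w' q)
  then obtain v w2 x where *: "w = v @ w2" "(x = p \<and> v = []) \<or>
   (\<exists>v' a u. apath (glued E G1) G2 p v' a \<and> (a, u, x) \<in> G2 \<and> v = v' @ u)" "apath E G1 x w2 a" "x \<notin> dom3 G1"
   by blast
  show ?case
  proof (cases "(a, u, b) \<in> G1")
   case True
   hence "apath E G1 x (w2 @ u @ w') q" using * step by (auto intro: apath.step)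
   thus ?thesis using * by (intro exI[of _ v] exI[of _ "w2 @ u @ w'"] exI[of _ x]) auto
  next
   case False
   hence g: "(a, u, b) \<in> G2" using step by auto
   hence a: "a \<notin> dom3 G1" using assms(2) unfolding dom3_def by blast
   have b: "b \<notin> dom3 G1" using assms(1) g by force
   have xa: "(x, w2, a) \<in> glued E G1" using * a unfolding glued_def by auto
   have "apath (glued E G1) G2 p w a" using *(1,2) xa by (auto intro: apath.intros)
   thus ?thesis using g b step(3) by (intro exI[of _ "w @ u"] exI[of _ w'] exI[of _ b]) (auto intro: apath.intros)
  qed
 qed
 then obtain v w2 x where "w = v @ w2" "?init v x" "apath E G1 x w2 q" "x \<notin> dom3 G1" by blast
 thus "apath (glued E G1) G2 p w q" using join q by blast
qed

lemma glued_glued: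
 assumes "snd ` snd ` G2 \<inter> dom3 G1 = {}" "dom3 G2 \<inter> dom3 G1 = {}"
 shows "glued (glued E G1) G2 = glued E (G1 \<union> G2)" using apath_glued[OF assms, of E] by (auto simp: glued_def dom3_Un)

lemma matching_range: "matching W G \<Longrightarrow> snd ` snd ` G \<subseteq> W" unfolding matching_def by force

lemma glued_glued_matching:
 assumes "matching W1 G1" "matching W2 G2" "W1 \<inter> W2 = {}"
 shows "glued (glued E G1) G2 = glued E (G1 \<union> G2)" using assms matching_range[OF assms(2)] by (intro glued_glued) (auto simp: dom3_matching)

lemma matching_Un:
 assumes "matching W1 G1" "matching W2 G2" "W1 \<inter> W2 = {}"
 shows "matching (W1 \<union> W2) (G1 \<union> G2)"
proof -
 note m = matchingD[OF assms(1)] matchingD[OF assms(2)]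
 have "w = w' \<and> q = q'" if "(p, w, q) \<in> G1 \<union> G2" "(p, w', q') \<in> G1 \<union> G2" for p w q w' q'
  using that m(1,5) assms(3) matching_uniq[OF assms(1)] matching_uniq[OF assms(2)] by blast
 moreover have "p \<in> W1 \<union> W2 \<and> q \<in> W1 \<union> W2 \<and> p \<noteq> q \<and> (q, rev w, p) \<in> G1 \<union> G2"
  if "(p, w, q) \<in> G1 \<union> G2" for p w q using that m(1-4)[of p w q] m(5-8)[of p w q] by auto
 moreover have "\<exists>w q. (p, w, q) \<in> G1 \<union> G2" if "p \<in> W1 \<union> W2" for p
  using that matching_ex[OF assms(1)] matching_ex[OF assms(2)] by blast
 ultimately show ?thesis unfolding matching_def by blast
qed

lemma glued_empty [simp]: "glued E {} = E"
proof -
 have "apath E {} p w q \<longleftrightarrow> (p, w, q) \<in> E" for p w q by (subst apath.simps) auto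
 thus ?thesis unfolding glued_def dom3_def by auto
qed

subsection \<open>One pair\<close>

lemma apath_pair_cases:
 assumes E: "matching V E" and ab: "a \<noteq> b"
  and A: "apath E (bond a u b) p w q" and p: "p \<noteq> a" "p \<noteq> b"
 shows "(p, w, q) \<in> E \<or> (\<exists>w1 w2. (p, w1, a) \<in> E \<and> (b, w2, q) \<in> E \<and> w = w1 @ u @ w2)
  \<or> (\<exists>w1 w2. (p, w1, b) \<in> E \<and> (a, w2, q) \<in> E \<and> w = w1 @ rev u @ w2)"
 using A p
proof (induction rule: apath.induct)
 case (start p w q) thus ?case by auto
next
 case (step p w c v d w' q)
 from step.IH[OF step.prems] step.hyps step.prems ab show ?case by (auto dest: matchingD[OF E] matching_uniq[OF E] matching_uniq_left[OF E])
qed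

lemma glued_pair_iff:
 assumes E: "matching V E" and ab: "a \<noteq> b"
 shows "(p, w, q) \<in> glued E (bond a u b) \<longleftrightarrow> p \<notin> {a, b} \<and> q \<notin> {a, b} \<and>
  ((p, w, q) \<in> E \<or> (\<exists>w1 w2. (p, w1, a) \<in> E \<and> (b, w2, q) \<in> E \<and> w = w1 @ u @ w2)
  \<or> (\<exists>w1 w2. (p, w1, b) \<in> E \<and> (a, w2, q) \<in> E \<and> w = w1 @ rev u @ w2))"
  (is "?l \<longleftrightarrow> ?r")
proof
 have D: "dom3 (bond a u b) = {a, b}" unfolding dom3_def by auto
 { assume ?l thus ?r using apath_pair_cases[OF E ab] by (auto simp: glued_def D) }
 { assume r: ?r
  have "apath E (bond a u b) p w q" using r by (auto intro: apath.intros)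
  thus ?l using r by (auto simp: glued_def D) }
qed

lemma glued_pair_matching:
 assumes E: "matching V E" and ab: "a \<noteq> b" "a \<in> V" "b \<in> V"
 shows "matching (V - {a, b}) (glued E (bond a u b))"
proof -
 let ?E = "glued E (bond a u b)"
 note iff = glued_pair_iff[OF E ab(1)]
 obtain wa c where c: "(a, wa, c) \<in> E" using matching_ex[OF E] ab by blast
 obtain wb d where d: "(b, wb, d) \<in> E" using matching_ex[OF E] ab by blast
 have c': "(c, rev wa, a) \<in> E" using c matchingD[OF E] by blast
 have d': "(d, rev wb, b) \<in> E" using d matchingD[OF E] by blast
 note MD = matchingD[OF E]
 have 1: "p \<in> V - {a, b} \<and> q \<in> V - {a, b} \<and> p \<noteq> q \<and> (q, rev w, p) \<in> ?E" if "(p, w, q) \<in> ?E" for p w q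
 proof -
  have pq: "p \<notin> {a, b}" "q \<notin> {a, b}" and cases: "(p, w, q) \<in> E \<or>
   (\<exists>w1 w2. (p, w1, a) \<in> E \<and> (b, w2, q) \<in> E \<and> w = w1 @ u @ w2)
   \<or> (\<exists>w1 w2. (p, w1, b) \<in> E \<and> (a, w2, q) \<in> E \<and> w = w1 @ rev u @ w2)"
   using that[unfolded iff] by (simp_all only: simp_thms)
  from cases consider "(p, w, q) \<in> E" | w1 w2 where "(p, w1, a) \<in> E" "(b, w2, q) \<in> E" "w = w1 @ u @ w2"
   | w1 w2 where "(p, w1, b) \<in> E" "(a, w2, q) \<in> E" "w = w1 @ rev u @ w2" by blast
  thus ?thesis
  proof cases
   case 1
   thus ?thesis using MD[OF 1] pq iff by auto
  next
   case 2
   have "p \<noteq> q" using matching_uniq[OF E 2(1)] MD(4)[OF 2(2)] ab(1) by blast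
   have "rev w = rev w2 @ rev u @ rev w1" using 2(3) by simp
   thus ?thesis using \<open>p \<noteq> q\<close> MD[OF 2(1)] MD[OF 2(2)] pq unfolding iff by blast
  next
   case 3
   have "p \<noteq> q" using matching_uniq[OF E 3(1)] MD(4)[OF 3(2)] ab(1) by blast
   have "rev w = rev w2 @ u @ rev w1" using 3(3) by simp
   thus ?thesis using \<open>p \<noteq> q\<close> MD[OF 3(1)] MD[OF 3(2)] pq unfolding iff by blast
  qed
 qed
 have 2: "\<exists>w q. (p, w, q) \<in> ?E" if p: "p \<in> V - {a, b}" for p
 proof -
  obtain w q where wq: "(p, w, q) \<in> E" using matching_ex[OF E] p by blast
  consider "q = a" | "q = b" | "q \<notin> {a, b}" by blast
  thus ?thesis
  proof cases
   case 1
   have "d \<noteq> b" using MD(3)[OF d] by simp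
   moreover have "d \<noteq> a" using matching_uniq_left[OF E, of p w a b wb] wq d 1 p by auto
   ultimately have dn: "d \<notin> {a, b}" by simp
   have "(p, w @ u @ wb, d) \<in> ?E" unfolding iff using dn p wq d 1 by blast
   thus ?thesis by blast
  next
   case 2
   have "c \<noteq> a" using MD(3)[OF c] by simp
   moreover have "c \<noteq> b" using matching_uniq_left[OF E, of p w b a wa] wq c 2 p by auto
   ultimately have cn: "c \<notin> {a, b}" by simp
   have "(p, w @ rev u @ wa, c) \<in> ?E" unfolding iff using cn p wq c 2 by blast
   thus ?thesis by blast
  next
   case 3
   thus ?thesis using p wq unfolding iff by blast
  qed
 qed
 have 3: "w = w' \<and> q = q'" if A: "(p, w, q) \<in> ?E" "(p, w', q') \<in> ?E" for p w q w' q'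
 proof -
  have pq: "p \<notin> {a, b}" "q \<notin> {a, b}" "q' \<notin> {a, b}" using A iff by blast+
  then obtain v r where r: "(p, v, r) \<in> E" using A iff by blast
  have R: "s = r" "y = v" if "(p, y, s) \<in> E" for y s using matching_uniq[OF E r that] by auto
  consider "r = a" | "r = b" | "r \<notin> {a, b}" by blast
  thus ?thesis
  proof cases
   case 1
   hence *: "\<exists>w2. (b, w2, q) \<in> E \<and> w = v @ u @ w2" if "(p, w, q) \<in> ?E" "q \<notin> {a, b}" for w q
    using that R ab unfolding iff by blast
   show ?thesis using *[OF A(1) pq(2)] *[OF A(2) pq(3)] matching_uniq[OF E] by blast
  next
   case 2
   hence *: "\<exists>w2. (a, w2, q) \<in> E \<and> w = v @ rev u @ w2" if "(p, w, q) \<in> ?E" "q \<notin> {a, b}" for w q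
    using that R ab unfolding iff by blast
   show ?thesis using *[OF A(1) pq(2)] *[OF A(2) pq(3)] matching_uniq[OF E] by blast
  next
   case 3
   thus ?thesis using A R unfolding iff by blast
  qed
 qed
 show ?thesis by (rule matchingI) (fact 1, fact 2, fact 3)
qed

lemma matching_pair: "a \<noteq> b \<Longrightarrow> matching {a, b} (bond a u b)" unfolding matching_def by auto

lemma matching_remove_pair:
 assumes "matching W G" "(a, u, b) \<in> G"
 shows "matching (W - {a, b}) (G - (bond a u b))"
proof -
 have g': "(b, rev u, a) \<in> G" by (rule matchingD(4)[OF assms])
 have *: "p \<notin> {a, b} \<and> q \<notin> {a, b}" if A: "(p, w, q) \<in> G - (bond a u b)" for p w q
 proof -
  have G: "(p, w, q) \<in> G" and n: "(p, w, q) \<noteq> (a, u, b)" "(p, w, q) \<noteq> (b, rev u, a)" using A by blast+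
  have "p \<noteq> a" using matching_uniq[OF assms(1) assms(2)] G n(1) by blast
  moreover have "p \<noteq> b" using matching_uniq[OF assms(1) g'] G n(2) by blast
  moreover have "q \<noteq> b" using matching_uniq_left[OF assms(1) assms(2)] G n(1) by blast
  moreover have "q \<noteq> a" using matching_uniq_left[OF assms(1) g'] G n(2) by blast
  ultimately show ?thesis by simp
 qed
 have r: "(q, rev w, p) \<notin> (bond a u b)" if "(p, w, q) \<in> G - (bond a u b)" for p w q using * that by auto
 have ex: "\<exists>w q. (p, w, q) \<in> G - (bond a u b)" if "p \<in> W - {a,b}" for p using that matching_ex[OF assms(1)] by blast
 show ?thesis
 proof (rule matchingI)
  fix p w q assume A: "(p, w, q) \<in> G - (bond a u b)"
  hence "(p, w, q) \<in> G" by simp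
  from matchingD[OF assms(1) this] *[OF A] r[OF A]
  show "p \<in> W - {a, b} \<and> q \<in> W - {a, b} \<and> p \<noteq> q \<and> (q, rev w, p) \<in> G - (bond a u b)" by simp
 next
  fix p w q w' q' assume "(p, w, q) \<in> G - (bond a u b)" "(p, w', q') \<in> G - (bond a u b)"
  thus "w = w' \<and> q = q'" using matching_uniq[OF assms(1), of p w q w' q'] by simp
 qed (rule ex)
qed

lemma glued_pair_step:
 assumes "matching W G" "(a, u, b) \<in> G"
 shows "glued E G = glued (glued E (bond a u b)) (G - (bond a u b))"
proof -
 have ab: "a \<noteq> b" "(b, rev u, a) \<in> G" using assms matchingD by metis+
 have eq: "(bond a u b) \<union> (G - (bond a u b)) = G" using assms ab by auto
 have "{a, b} \<inter> (W - {a, b}) = {}" by auto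
 from glued_glued_matching[OF matching_pair[OF ab(1), of u] matching_remove_pair[OF assms] this, of E]
 show ?thesis unfolding eq by (rule sym)
qed

text \<open>
  Gluing along a matching can be done one pair at a time, in any order.
\<close>

lemma gluing_induct [consumes 4, case_names base step]:
 assumes "matching V E" "matching W G" "W \<subseteq> V" "finite V"
  and base: "\<And>V E. matching V E \<Longrightarrow> finite V \<Longrightarrow> P V E {} {}"
  and step: "\<And>V E W G. matching V E \<Longrightarrow> matching W G \<Longrightarrow> W \<subseteq> V \<Longrightarrow> finite V \<Longrightarrow> W \<noteq> {} \<Longrightarrow>
    (\<exists>a u b. (a, u, b) \<in> G \<and>
    (P (V - {a, b}) (glued E (bond a u b)) (W - {a, b}) (G - (bond a u b)) \<longrightarrow> P V E W G))"
 shows "P V E W G" using assms(1-4)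
proof (induction "card W" arbitrary: V E W G rule: less_induct)
 case less
 show ?case
 proof (cases "W = {}")
  case True
  thus ?thesis using less base by auto
 next
  case False
  then obtain a u b where g: "(a, u, b) \<in> G" and
   imp: "P (V - {a, b}) (glued E (bond a u b)) (W - {a, b}) (G - (bond a u b)) \<longrightarrow> P V E W G"
   using step[OF less.prems False] by blast
  have ab: "a \<noteq> b" "a \<in> W" "b \<in> W" using g matchingD[OF less.prems(2)] by blast+
  have fin: "finite W" using less.prems finite_subset by blast
  have "P (V - {a, b}) (glued E (bond a u b)) (W - {a, b}) (G - (bond a u b))"
  proof (rule less.hyps)
   show "card (W - {a, b}) < card W" using ab fin by (intro psubset_card_mono) auto
   show "matching (V - {a, b}) (glued E (bond a u b))" using glued_pair_matching[OF less.prems(1) ab(1)] ab less.prems(3) by blast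
   show "matching (W - {a, b}) (G - (bond a u b))" by (rule matching_remove_pair[OF less.prems(2) g])
  qed (use less.prems in auto)
  thus ?thesis using imp by blast
 qed
qed

lemma glued_matching:
 assumes "matching V E" "matching W G" "W \<subseteq> V" "finite V"
 shows "matching (V - W) (glued E G)" using assms
proof (induction rule: gluing_induct)
 case (base V E) thus ?case by simp
next
 case (step V E W G)
 then obtain a u b where g: "(a, u, b) \<in> G" using matching_ex[OF step(2)] by blast
 have "V - {a, b} - (W - {a, b}) = V - W" using matchingD[OF step(2) g] by auto
 thus ?case using glued_pair_step[OF step(2) g, of E] g by metis
qed

section \<open>Connected components\<close>

lemma und_iff: "(p, q) \<in> und E \<longleftrightarrow> (\<exists>w. (p, w, q) \<in> E)" unfolding und_def by auto

lemma und_empty [simp]: "und {} = {}" unfolding und_def by auto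

lemma und_Un: "und (E \<union> F) = und E \<union> und F" unfolding und_def by auto

lemma und_sym: "matching V E \<Longrightarrow> sym (und E)" using matchingD(4) by (fastforce intro!: symI simp: und_iff)

lemma und_sub: "matching V E \<Longrightarrow> und E \<subseteq> V \<times> V" using matchingD(1,2) by (fastforce simp: und_iff)

lemma sym_rtrancl_iff: "sym R \<Longrightarrow> (x, y) \<in> R\<^sup>* \<longleftrightarrow> (y, x) \<in> R\<^sup>*" by (meson symD sym_rtrancl)

lemma rtrancl_closed:
 assumes "(x, y) \<in> R\<^sup>*" "x \<in> S" "\<And>u v. (u, v) \<in> R \<Longrightarrow> u \<in> S \<Longrightarrow> v \<in> S"
 shows "y \<in> S" using assms by (induction rule: rtrancl_induct) auto

definition comps :: "('a \<times> 'a) set \<Rightarrow> 'a set \<Rightarrow> 'a set set" where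
 "comps R S = (\<lambda>x. R\<^sup>* `` {x}) ` S"

lemma comp_eq_iff:
 assumes "sym R"
 shows "R\<^sup>* `` {x} = R\<^sup>* `` {y} \<longleftrightarrow> (x, y) \<in> R\<^sup>*"
proof
 assume "R\<^sup>* `` {x} = R\<^sup>* `` {y}"
 thus "(x, y) \<in> R\<^sup>*" by auto
next
 assume xy: "(x, y) \<in> R\<^sup>*"
 hence "(y, x) \<in> R\<^sup>*" using assms sym_rtrancl_iff by metis
 hence "(x, z) \<in> R\<^sup>* \<longleftrightarrow> (y, z) \<in> R\<^sup>*" for z using rtrancl_trans[OF xy, of z] rtrancl_trans[of y x R z] by blast
 thus "R\<^sup>* `` {x} = R\<^sup>* `` {y}" by auto
qed

lemma card_comps_cong:
 assumes "sym R" "sym R'" "\<And>x y. x \<in> S \<Longrightarrow> y \<in> S \<Longrightarrow> (x, y) \<in> R\<^sup>* \<longleftrightarrow> (f x, f y) \<in> R'\<^sup>*"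
 shows "card (comps R S) = card (comps R' (f ` S))"
proof (rule bij_betw_same_card)
 define h where "h X = R'\<^sup>* `` {f (SOME x. x \<in> S \<and> R\<^sup>* `` {x} = X)}" for X
 have h: "h (R\<^sup>* `` {x}) = R'\<^sup>* `` {f x}" if "x \<in> S" for x
 proof -
  obtain y where y: "y = (SOME y. y \<in> S \<and> R\<^sup>* `` {y} = R\<^sup>* `` {x})" by blast
  have "y \<in> S \<and> R\<^sup>* `` {y} = R\<^sup>* `` {x}" unfolding y by (rule someI[of _ x]) (use that in auto)
  hence "y \<in> S" "(y, x) \<in> R\<^sup>*" using comp_eq_iff[OF assms(1)] by blast+
  hence "(f y, f x) \<in> R'\<^sup>*" using assms(3) that by blast
  thus ?thesis unfolding h_def y[symmetric] by (rule iffD2[OF comp_eq_iff[OF assms(2)]])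
 qed
 show "bij_betw h (comps R S) (comps R' (f ` S))" unfolding bij_betw_def
 proof
  show "inj_on h (comps R S)"
  proof (rule inj_onI)
   fix X Y assume XY: "X \<in> comps R S" "Y \<in> comps R S" "h X = h Y"
   then obtain x y where "x \<in> S" "y \<in> S" "X = R\<^sup>* `` {x}" "Y = R\<^sup>* `` {y}" unfolding comps_def by blast
   moreover from this have "(f x, f y) \<in> R'\<^sup>*" using XY(3) h comp_eq_iff[OF assms(2)] by blast
   ultimately have "(x, y) \<in> R\<^sup>*" using assms(3) by blast
   thus "X = Y" unfolding \<open>X = _\<close> \<open>Y = _\<close> by (rule iffD2[OF comp_eq_iff[OF assms(1)]])
  qed
  show "h ` comps R S = comps R' (f ` S)" unfolding comps_def image_image using h by (intro image_cong) auto
 qed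
qed

lemma comps_Un: "comps R (S \<union> T) = comps R S \<union> comps R T" unfolding comps_def by auto

lemma finite_comps [simp]: "finite S \<Longrightarrow> finite (comps R S)" unfolding comps_def by auto

definition ends :: "'a set \<Rightarrow> ('a \<times> 'a) set \<Rightarrow> ('a \<times> 'a) set" where
 "ends V R = {(p, q). p \<in> V \<and> q \<in> V \<and> p \<noteq> q \<and> (p, q) \<in> R\<^sup>*}"

lemma sym_ends: "sym R \<Longrightarrow> sym (ends V R)" unfolding ends_def by (auto intro!: symI dest: symD[OF sym_rtrancl])

text \<open>
  For the connectivity of points of \<open>V'\<close>, a relation can be replaced by the connections that it
  induces on \<open>V'\<close>.
\<close>

lemma ends_rtrancl:
 assumes "sym R" "Y \<subseteq> V' \<times> V'" "p \<in> V'" "q \<in> V'"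
 shows "(p, q) \<in> (R \<union> Y)\<^sup>* \<longleftrightarrow> (p, q) \<in> (ends V' R \<union> Y)\<^sup>*"
proof
 assume "(p, q) \<in> (R \<union> Y)\<^sup>*"
 hence "\<exists>x'\<in>V'. (x', q) \<in> R\<^sup>* \<and> (p, x') \<in> (ends V' R \<union> Y)\<^sup>*"
 proof (induction rule: rtrancl_induct)
  case base thus ?case using assms by auto
 next
  case (step y z)
  then obtain x' where x': "x' \<in> V'" "(x', y) \<in> R\<^sup>*" "(p, x') \<in> (ends V' R \<union> Y)\<^sup>*" by blast
  show ?case
  proof (cases "(y, z) \<in> R")
   case True
   thus ?thesis using x' by (meson rtrancl.simps)
  next
   case False
   hence yz: "(y, z) \<in> Y" using step by auto
   hence y: "y \<in> V'" "z \<in> V'" using assms(2) by auto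
   have "(x', y) \<in> (ends V' R \<union> Y)\<^sup>*" using x' y by (cases "x' = y") (auto simp: ends_def)
   hence "(p, z) \<in> (ends V' R \<union> Y)\<^sup>*" using x'(3) yz by (meson UnCI rtrancl.simps rtrancl_trans)
   thus ?thesis using y by blast
  qed
 qed
 then obtain x' where x': "x' \<in> V'" "(x', q) \<in> R\<^sup>*" "(p, x') \<in> (ends V' R \<union> Y)\<^sup>*" by blast
 hence "(x', q) \<in> (ends V' R \<union> Y)\<^sup>*" using assms(4) by (cases "x' = q") (auto simp: ends_def)
 thus "(p, q) \<in> (ends V' R \<union> Y)\<^sup>*" using x' by auto
next
 assume "(p, q) \<in> (ends V' R \<union> Y)\<^sup>*"
 moreover have "ends V' R \<union> Y \<subseteq> (R \<union> Y)\<^sup>*" unfolding ends_def using rtrancl_mono[of R "R \<union> Y"] by auto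
 ultimately show "(p, q) \<in> (R \<union> Y)\<^sup>*" using rtrancl_subset_rtrancl by blast
qed

text \<open>
  The components that consist of closed curves: \<open>V'\<close> will be the set of points at which curves may end.
\<close>

definition closed_comps :: "('a \<times> 'a) set \<Rightarrow> 'a set \<Rightarrow> 'a set \<Rightarrow> 'a set set" where
 "closed_comps R V V' = {X \<in> comps R V. X \<inter> V' = {}}"

lemma closed_comps_Un:
 assumes "sym R" "R \<subseteq> V \<times> V" "sym Y" "Y \<subseteq> V' \<times> V'" "V' \<subseteq> V"
 shows "closed_comps (R \<union> Y) V V' = closed_comps R V V'"
proof -
 have eq: "(R \<union> Y)\<^sup>* `` {x} = R\<^sup>* `` {x}" if "R\<^sup>* `` {x} \<inter> V' = {}" for x
 proof
  show "(R \<union> Y)\<^sup>* `` {x} \<subseteq> R\<^sup>* `` {x}"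
  proof
   fix y assume "y \<in> (R \<union> Y)\<^sup>* `` {x}"
   hence "(x, y) \<in> (R \<union> Y)\<^sup>*" by auto
   thus "y \<in> R\<^sup>* `` {x}"
   proof (rule rtrancl_closed)
    fix u v assume "(u, v) \<in> R \<union> Y" "u \<in> R\<^sup>* `` {x}"
    thus "v \<in> R\<^sup>* `` {x}" using that assms(4) by (auto intro: rtrancl.rtrancl_into_rtrancl)
   qed auto
  qed
  show "R\<^sup>* `` {x} \<subseteq> (R \<union> Y)\<^sup>* `` {x}" using rtrancl_mono[of R "R \<union> Y"] by auto
 qed
 have sub: "R\<^sup>* `` {x} \<subseteq> (R \<union> Y)\<^sup>* `` {x}" for x using rtrancl_mono[of R "R \<union> Y"] by auto
 show ?thesis
 proof (intro equalityI subsetI)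
  fix X assume "X \<in> closed_comps (R \<union> Y) V V'"
  then obtain x where x: "x \<in> V" "X = (R \<union> Y)\<^sup>* `` {x}" "X \<inter> V' = {}" unfolding closed_comps_def comps_def by auto
  hence "R\<^sup>* `` {x} \<inter> V' = {}" using sub[of x] by auto
  thus "X \<in> closed_comps R V V'" using x eq[of x] unfolding closed_comps_def comps_def by auto
 next
  fix X assume "X \<in> closed_comps R V V'"
  then obtain x where x: "x \<in> V" "X = R\<^sup>* `` {x}" "X \<inter> V' = {}" unfolding closed_comps_def comps_def by auto
  thus "X \<in> closed_comps (R \<union> Y) V V'" using eq[of x] unfolding closed_comps_def comps_def by auto
 qed
qed

lemma card_comps_split:
 assumes "sym R" "V' \<subseteq> V" "finite V"
 shows "card (comps R V) = card (closed_comps R V V') + card (comps R V')"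
proof -
 have "comps R V = closed_comps R V V' \<union> comps R V'"
 proof
  show "comps R V \<subseteq> closed_comps R V V' \<union> comps R V'"
  proof
   fix X assume "X \<in> comps R V"
   then obtain x where x: "x \<in> V" "X = R\<^sup>* `` {x}" unfolding comps_def by auto
   show "X \<in> closed_comps R V V' \<union> comps R V'"
   proof (cases "X \<inter> V' = {}")
    case True thus ?thesis using x unfolding closed_comps_def comps_def by auto
   next
    case False
    then obtain y where y: "y \<in> V'" "(x, y) \<in> R\<^sup>*" using x by auto
    hence "X = R\<^sup>* `` {y}" using comp_eq_iff[OF assms(1)] x by blast
    thus ?thesis using y unfolding comps_def by auto
   qed
  qed
  show "closed_comps R V V' \<union> comps R V' \<subseteq> comps R V" using assms(2) unfolding closed_comps_def comps_def by auto
 qed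
 moreover have "closed_comps R V V' \<inter> comps R V' = {}" unfolding closed_comps_def comps_def by auto
 moreover have "finite (closed_comps R V V')" unfolding closed_comps_def using assms by auto
 moreover have "finite (comps R V')" by (rule finite_comps[OF finite_subset[OF assms(2,3)]])
 ultimately show ?thesis by (simp add: card_Un_disjoint)
qed

lemma card_comps_ends:
 assumes "sym R" "sym Y" "Y \<subseteq> V' \<times> V'" "S \<subseteq> V'"
 shows "card (comps (R \<union> Y) S) = card (comps (ends V' R \<union> Y) S)"
 using card_comps_cong[of "R \<union> Y" "ends V' R \<union> Y" S "\<lambda>x. x"] assms sym_ends[OF assms(1)]
  ends_rtrancl[OF assms(1,3)] by (auto simp: sym_Un subset_iff)

lemma card_comps_glue:
 assumes "sym R" "R \<subseteq> V \<times> V" "sym Y" "Y \<subseteq> V' \<times> V'" "V' \<subseteq> V" "finite V"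
 shows "card (comps (R \<union> Y) V) = card (closed_comps R V V') + card (comps (ends V' R \<union> Y) V')"
 using card_comps_split[of "R \<union> Y" V' V] closed_comps_Un[OF assms(1-5)] assms
  card_comps_ends[OF assms(1,3,4), of V'] by (auto simp: sym_Un)

section \<open>Connectivity of glued matchings\<close>

lemma apath_rtrancl: "apath E G p w q \<Longrightarrow> (p, q) \<in> (und E \<union> und G)\<^sup>*"
proof (induction rule: apath.induct)
 case (start p w q)
 hence "(p, q) \<in> und E \<union> und G" by (auto simp: und_iff)
 thus ?case by (rule r_into_rtrancl)
next
 case (step p w a u b w' q)
 have "(a, b) \<in> und E \<union> und G" "(b, q) \<in> und E \<union> und G" using step by (auto simp: und_iff)
 thus ?case using step.IH by (meson rtrancl.simps)
qed

lemma und_pair [simp]: "und {(a, u, b), (b, v, a)} = {(a, b), (b, a)}" unfolding und_def by auto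

lemma ends_pair:
 assumes E: "matching V E" and ab: "a \<noteq> b" "a \<in> V" "b \<in> V"
 shows "ends (V - {a, b}) (und E \<union> und (bond a u b)) = und (glued E (bond a u b))"
  (is "?L = und ?E")
proof
 let ?R = "und E \<union> und (bond a u b)"
 show "und ?E \<subseteq> ?L"
 proof
  fix z assume "z \<in> und ?E"
  then obtain p q w where z: "z = (p, q)" "(p, w, q) \<in> ?E" unfolding und_def by auto
  hence "(p, q) \<in> ?R\<^sup>*" unfolding glued_def using apath_rtrancl by fastforce
  thus "z \<in> ?L" using z matchingD[OF glued_pair_matching[OF E ab], OF z(2)] unfolding ends_def by auto
 qed
 show "?L \<subseteq> und ?E"
 proof
  fix z assume "z \<in> ?L"
  then obtain p q where z: "z = (p, q)" "p \<in> V - {a, b}" "q \<in> V - {a, b}" "p \<noteq> q" "(p, q) \<in> ?R\<^sup>*" unfolding ends_def by auto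
  obtain w r where r: "(p, w, r) \<in> ?E" using matching_ex[OF glued_pair_matching[OF E ab]] z by blast
  have rV: "r \<in> V - {a, b}" using matchingD[OF glued_pair_matching[OF E ab] r] by blast
  obtain wp c where c: "(p, wp, c) \<in> E" using matching_ex[OF E] z by blast
  have pc: "(x, v, y) \<in> E \<Longrightarrow> x = p \<Longrightarrow> y = c" "(x, v, y) \<in> E \<Longrightarrow> x = c \<Longrightarrow> y = p" for x v y
   using matching_uniq[OF E c, of v y] matching_uniq[OF E matchingD(4)[OF E c], of v y] by auto
  have "q = r"
  proof (cases "c \<in> {a, b}")
   case False
   have "q \<in> {p, c}" using z(5) by (rule rtrancl_closed) (use pc False z in \<open>auto simp: und_iff\<close>)
   moreover have "r = c" using r False pc z unfolding glued_pair_iff[OF E ab(1)] by blast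
   ultimately show ?thesis using z by auto
  next
   case True
   then obtain b' where b': "b' \<noteq> c" "{a, b} = {c, b'}" using ab by fastforce
   have r: "\<exists>v. (b', v, r) \<in> E"
   proof -
    have *: "(a, b) = (c, b') \<or> (a, b) = (b', c)" using b' ab by (auto simp: doubleton_eq_iff)
    have n: "(p, v, b') \<notin> E" for v using pc(1)[of p v b'] b' by blast
    have "\<not> (p, w, r) \<in> E" using pc(1)[of p w r] rV True by blast
    with r * n show ?thesis unfolding glued_pair_iff[OF E ab(1)] by auto
   qed
   then obtain v' where r': "(b', v', r) \<in> E" by blast
   have rr: "(x, v, y) \<in> E \<Longrightarrow> x = b' \<Longrightarrow> y = r" "(x, v, y) \<in> E \<Longrightarrow> x = r \<Longrightarrow> y = b'" for x v y
    using matching_uniq[OF E r', of v y] matching_uniq[OF E matchingD(4)[OF E r'], of v y] by auto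
   have "q \<in> {p, c, b', r}" using z(5)
   proof (rule rtrancl_closed)
    fix x y assume *: "(x, y) \<in> ?R" "x \<in> {p, c, b', r}"
    have "(a, b) = (c, b') \<or> (a, b) = (b', c)" using b' ab by (auto simp: doubleton_eq_iff)
    thus "y \<in> {p, c, b', r}" using * pc rr by (auto simp: und_iff)
   qed auto
   moreover have "q \<noteq> c" "q \<noteq> b'" using z b' by auto
   ultimately show ?thesis using z by auto
  qed
  thus "z \<in> und ?E" using z r by (auto simp: und_iff)
 qed
qed

lemma und_pair_step:
 assumes "matching W G" "(a, u, b) \<in> G"
 shows "und G = und (bond a u b) \<union> und (G - (bond a u b))"
 using matchingD(4)[OF assms] assms(2) unfolding und_def by auto

text \<open>
  Gluing keeps track of which points are connected; only the closed curves get lost. This is why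
  loops are counted by components and not by gluing.
\<close>

theorem ends_glued:
 assumes "matching V E" "matching W G" "W \<subseteq> V" "finite V"
 shows "ends (V - W) (und E \<union> und G) = und (glued E G)" using assms
proof (induction rule: gluing_induct)
 case (base V E)
 have "(p, q) \<in> und E" if "(p, q) \<in> (und E)\<^sup>*" "p \<noteq> q" for p q
 proof -
  from that obtain r where r: "(p, r) \<in> und E" by (metis converse_rtranclE)
  have "q \<in> {p, r}" using that(1) by (rule rtrancl_closed)
    (use r in \<open>auto simp: und_iff dest: matching_uniq[OF base(1)] matchingD[OF base(1)]\<close>)
  thus ?thesis using that r by auto
 qed
 moreover have "p \<in> V \<and> q \<in> V \<and> p \<noteq> q" if "(p, q) \<in> und E" for p q
  using that by (auto simp: und_iff dest: matchingD(1-3)[OF base(1)])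
 ultimately have "(p, q) \<in> ends V (und E) \<longleftrightarrow> (p, q) \<in> und E" for p q unfolding ends_def by blast
 thus ?case by auto
next
 case (step V E W G)
 obtain a u b where g: "(a, u, b) \<in> G" using matching_ex[OF step(2)] step(5) by blast
 let ?P = "(bond a u b)"
 note gD = matchingD[OF step(2) g]
 have Veq: "V - {a, b} - (W - {a, b}) = V - W" using gD by auto
 have ab: "a \<noteq> b" "a \<in> V" "b \<in> V" using gD step by auto
 have "ends (V - W) (und E \<union> und G) = und (glued E G)"
  if IH: "ends (V - W) (und (glued E ?P) \<union> und (G - ?P)) = und (glued (glued E ?P) (G - ?P))"
 proof -
  have m: "matching (W - {a, b}) (G - ?P)" using matching_remove_pair[OF step(2) g] .
  have "(p, q) \<in> (und E \<union> und G)\<^sup>* \<longleftrightarrow> (p, q) \<in> (und (glued E ?P) \<union> und (G - ?P))\<^sup>*"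
   if "p \<in> V - W" "q \<in> V - W" for p q
  proof -
   have "und (G - ?P) \<subseteq> (V - {a, b}) \<times> (V - {a, b})" using und_sub[OF m] step(3) by blast
   moreover have "sym (und E \<union> und ?P)" using und_sym[OF step(1)] by (intro sym_Un) (auto simp: sym_def)
   ultimately have "(p, q) \<in> (und E \<union> und ?P \<union> und (G - ?P))\<^sup>* \<longleftrightarrow>
     (p, q) \<in> (ends (V - {a, b}) (und E \<union> und ?P) \<union> und (G - ?P))\<^sup>*"
    using that gD by (intro ends_rtrancl) auto
   thus ?thesis unfolding ends_pair[OF step(1) ab] und_pair_step[OF step(2) g] by (simp add: Un_assoc)
  qed
  hence "ends (V - W) (und E \<union> und G) = ends (V - W) (und (glued E ?P) \<union> und (G - ?P))" unfolding ends_def by auto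
  thus ?thesis using IH glued_pair_step[OF step(2) g, of E] by simp
 qed
 thus ?case using g Veq by metis
qed

section \<open>Planarity of gluing\<close>

lemma noncrossing_iff:
 assumes E: "matching V E" and inj: "inj_on pos V"
 shows "noncrossing pos (und E) \<longleftrightarrow>
  (\<forall>p q x y. (p, q) \<in> und E \<longrightarrow> (x, y) \<in> und E \<longrightarrow> pos p < pos x \<longrightarrow> pos x < pos q \<longrightarrow>
   pos p < pos y \<and> pos y < pos q)" (is "?l \<longleftrightarrow> ?r")
proof
 assume l: ?l
 show ?r
 proof (intro allI impI)
  fix p q x y assume A: "(p, q) \<in> und E" "(x, y) \<in> und E" "pos p < pos x" "pos x < pos q"
  have V: "p \<in> V" "q \<in> V" "x \<in> V" "y \<in> V" using A und_sub[OF E] by blast+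
  have A': "(y, x) \<in> und E" "(q, p) \<in> und E" using A(1,2) und_sym[OF E] by (auto dest: symD)
  have uq: "(u, v) \<in> und E \<Longrightarrow> (u, v') \<in> und E \<Longrightarrow> v = v'" for u v v'
   using matching_uniq[OF E] unfolding und_iff by blast
  have "y \<noteq> p" using uq[OF A(1)] A'(1) A(4) by blast
  moreover have "y \<noteq> q" using uq[OF A'(2)] A'(1) A(3) by blast
  ultimately have "pos y \<noteq> pos p" "pos y \<noteq> pos q" using V inj by (auto simp: inj_on_def)
  moreover have "\<not> pos y < pos p" using l A A' unfolding noncrossing_def by blast
  moreover have "\<not> pos q < pos y" using l A A' unfolding noncrossing_def by blast
  ultimately show "pos p < pos y \<and> pos y < pos q" by linarith
 qed
next
 assume ?r thus ?l unfolding noncrossing_def by (meson order.asym)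
qed

text \<open>
  If no other point lies between \<open>a\<close> and \<open>b\<close>, the lines at \<open>a\<close> and \<open>b\<close> can be joined along the
  boundary without a crossing.
\<close>

lemma noncrossing_glued_pair:
 assumes E: "matching V E" and ab: "a \<noteq> b" "a \<in> V" "b \<in> V" and inj: "inj_on pos V"
  and nc: "noncrossing pos (und E)" and adj: "pos a < pos b" "\<And>x. x \<in> V \<Longrightarrow> pos a < pos x \<Longrightarrow> pos x < pos b \<Longrightarrow> False"
 shows "noncrossing pos (und (glued E (bond a u b)))"
proof -
 define F where "F = und E"
 let ?E1 = "glued E (bond a u b)"
 note m1 = glued_pair_matching[OF E ab, of u]
 have iff: "(p, q) \<in> und ?E1 \<longleftrightarrow> p \<notin> {a, b} \<and> q \<notin> {a, b} \<and>
  ((p, q) \<in> F \<or> ((p, a) \<in> F \<and> (b, q) \<in> F) \<or> ((p, b) \<in> F \<and> (a, q) \<in> F))" for p q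
  unfolding und_iff glued_pair_iff[OF E ab(1)] F_def by blast
 have ncF: "pos p < pos y \<and> pos y < pos q"
  if "(p, q) \<in> F" "(x, y) \<in> F" "pos p < pos x" "pos x < pos q" for p q x y using that noncrossing_iff[OF E inj] nc unfolding F_def by blast
 have FV: "p \<in> V" "q \<in> V" if "(p, q) \<in> F" for p q using that und_sub[OF E] unfolding F_def by auto
 have Fs: "(q, p) \<in> F" if "(p, q) \<in> F" for p q using that und_sym[OF E] unfolding F_def by (auto dest: symD)
 have Fu: "q = q'" if "(p, q) \<in> F" "(p, q') \<in> F" for p q q' using that matching_uniq[OF E] unfolding F_def und_iff by blast
 have tr: "(pos v < pos a \<and> pos a < pos w) = (pos v < pos b \<and> pos b < pos w)"
  if "v \<in> V" "w \<in> V" "v \<notin> {a, b}" "w \<notin> {a, b}" for v w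
 proof -
  have "pos v \<noteq> pos a" "pos v \<noteq> pos b" "pos w \<noteq> pos a" "pos w \<noteq> pos b" using that ab inj by (auto simp: inj_on_def)
  moreover have "\<not> (pos a < pos v \<and> pos v < pos b)" "\<not> (pos a < pos w \<and> pos w < pos b)" using adj(2) that by blast+
  ultimately show ?thesis using adj(1) by arith
 qed
 have main: "pos p < pos y \<and> pos y < pos q"
  if A: "(p, q) \<in> und ?E1" "(x, y) \<in> und ?E1" "pos p < pos x" "pos x < pos q" for p q x y
 proof -
  have V: "p \<in> V" "q \<in> V" "x \<in> V" "y \<in> V" using A(1,2) und_sub[OF m1] by blast+
  have n: "p \<notin> {a, b}" "q \<notin> {a, b}" "x \<notin> {a, b}" "y \<notin> {a, b}" using A(1,2) iff by blast+
  have pq: "(p, q) \<in> F \<or> (\<exists>c d. {c, d} = {a, b} \<and> (p, c) \<in> F \<and> (d, q) \<in> F)" using A(1) unfolding iff by blast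
  have xy: "(x, y) \<in> F \<or> (\<exists>c d. {c, d} = {a, b} \<and> (x, c) \<in> F \<and> (d, y) \<in> F)" using A(2) unfolding iff by blast
  have tr': "pos v < pos d \<and> pos d < pos w"
   if "{c, d} = {a, b}" "pos v < pos c" "pos c < pos w" "v \<in> V" "w \<in> V" "v \<notin> {a, b}" "w \<notin> {a, b}" for v w c d
   using tr[OF that(4-7)] that(1-3) by (auto simp: doubleton_eq_iff)
  show ?thesis
  proof (cases "(p, q) \<in> F")
   case True
   show ?thesis
   proof (cases "(x, y) \<in> F")
    case True' : True
    show ?thesis by (rule ncF[OF True True' A(3,4)])
   next
    case False
    then obtain c d where cd: "{c, d} = {a, b}" "(x, c) \<in> F" "(d, y) \<in> F" using xy by blast
    have "pos p < pos c \<and> pos c < pos q" by (rule ncF[OF True cd(2) A(3,4)])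
    hence "pos p < pos d \<and> pos d < pos q" using tr'[OF cd(1)] V n by blast
    thus ?thesis using ncF[OF True cd(3)] by blast
   qed
  next
   case False
   then obtain c d where cd: "{c, d} = {a, b}" "(p, c) \<in> F" "(d, q) \<in> F" using pq by blast
   hence dc: "{d, c} = {a, b}" by auto
   show ?thesis
   proof (cases "(x, y) \<in> F")
    case True
    have "y \<noteq> p" using Fu[OF cd(2)] Fs[OF True] n cd(1) by blast
    moreover have "y \<noteq> q" using Fu[OF Fs[OF cd(3)]] Fs[OF True] n cd(1) by blast
    ultimately have "pos y \<noteq> pos p" "pos y \<noteq> pos q" using V inj by (auto simp: inj_on_def)
    moreover have "\<not> pos y < pos p"
    proof
     assume y: "pos y < pos p"
     have "pos y < pos c \<and> pos c < pos x" by (rule ncF[OF Fs[OF True] cd(2) y A(3)])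
     hence "pos y < pos d \<and> pos d < pos x" using tr'[OF cd(1)] V n by blast
     hence "pos y < pos q \<and> pos q < pos x" using ncF[OF Fs[OF True] cd(3)] by blast
     thus False using A by linarith
    qed
    moreover have "\<not> pos q < pos y"
    proof
     assume y: "pos q < pos y"
     have "pos x < pos d \<and> pos d < pos y" by (rule ncF[OF True Fs[OF cd(3)] A(4) y])
     hence "pos x < pos c \<and> pos c < pos y" using tr'[OF dc] V n by blast
     hence "pos x < pos p \<and> pos p < pos y" using ncF[OF True Fs[OF cd(2)]] by blast
     thus False using A by linarith
    qed
    ultimately show ?thesis by linarith
   next
    case False
    then obtain c' d' where cd': "{c', d'} = {a, b}" "(x, c') \<in> F" "(d', y) \<in> F" using xy by blast
    hence "c' = c \<or> c' = d" using cd(1) by auto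
    hence "x = p \<or> x = q" using Fu[OF Fs[OF cd'(2)]] Fs[OF cd(2)] cd(3) by blast
    thus ?thesis using A by auto
   qed
  qed
 qed
 have "inj_on pos (V - {a, b})" using inj by (rule inj_on_subset) auto
 from noncrossing_iff[OF m1 this] main show ?thesis by blast
qed

text \<open>
  The connecting pieces can be drawn outside the disc: below a piece from \<open>a\<close> to \<open>b\<close> there are only
  points that are joined to each other below the same piece.
\<close>

definition outer_planar :: "('a \<Rightarrow> nat) \<Rightarrow> 'a set \<Rightarrow> 'a set \<Rightarrow> ('a \<times> 'l list \<times> 'a) set \<Rightarrow> bool" where
 "outer_planar pos V W G \<longleftrightarrow> (\<forall>a u b x. (a, u, b) \<in> G \<longrightarrow> x \<in> V \<longrightarrow> pos a < pos x \<longrightarrow> pos x < pos b \<longrightarrow>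
  x \<in> W \<and> (\<forall>v y. (x, v, y) \<in> G \<longrightarrow> pos a < pos y \<and> pos y < pos b))"

text \<open>
  An innermost connecting piece joins neighbours, so the pieces can be glued from the inside outwards.
\<close>

theorem noncrossing_glued:
 assumes "matching V E" "matching W G" "W \<subseteq> V" "finite V"
  and "inj_on pos V" "noncrossing pos (und E)" "outer_planar pos V W G"
 shows "noncrossing pos (und (glued E G))"
proof -
 have "inj_on pos V \<longrightarrow> noncrossing pos (und E) \<longrightarrow> outer_planar pos V W G \<longrightarrow> noncrossing pos (und (glued E G))"
  using assms(1-4)
 proof (induction rule: gluing_induct)
  case (base V E) thus ?case by simp
 next
  case (step V E W G)
  show ?case
  proof (cases "inj_on pos V \<and> outer_planar pos V W G")
   case False
   thus ?thesis using step matching_ex[OF step(2)] by blast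
  next
   case True
   hence inj: "inj_on pos V" and out: "outer_planar pos V W G" by auto
   note gD = matchingD[OF step(2)]
   have lin: "pos c < pos d \<or> pos d < pos c" if "(c, v, d) \<in> G" for c v d
    using gD(1-3)[OF that] inj step(3) by (metis inj_onD linorder_neqE_nat subsetD)
   obtain c v d where c: "(c, v, d) \<in> G" using matching_ex[OF step(2)] step(5) by blast
   have "\<exists>z. z \<in> G \<and> pos (fst z) < pos (snd (snd z))"
   proof (cases "pos c < pos d")
    case True thus ?thesis using c by (intro exI[of _ "(c, v, d)"]) auto
   next
    case False thus ?thesis using gD(4)[OF c] lin[OF c] by (intro exI[of _ "(d, rev v, c)"]) auto
   qed
   then obtain z where z: "z \<in> G" "pos (fst z) < pos (snd (snd z))" by blast
   from ex_has_least_nat[of "\<lambda>z. z \<in> G \<and> pos (fst z) < pos (snd (snd z))" z "\<lambda>z. pos (snd (snd z)) - pos (fst z)"] z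
   obtain z where z: "z \<in> G" "pos (fst z) < pos (snd (snd z))"
    and least: "\<And>y. y \<in> G \<Longrightarrow> pos (fst y) < pos (snd (snd y)) \<Longrightarrow>
      pos (snd (snd z)) - pos (fst z) \<le> pos (snd (snd y)) - pos (fst y)" by blast
   obtain a u b where zz: "z = (a, u, b)" by (cases z)
   have g: "(a, u, b) \<in> G" and lt: "pos a < pos b" using z zz by simp_all
   have least: "pos b - pos a \<le> pos d - pos c" if "(c, v, d) \<in> G" "pos c < pos d" for c v d using least[of "(c, v, d)"] that zz by simp
   have adj: "False" if x: "x \<in> V" "pos a < pos x" "pos x < pos b" for x
   proof -
    have xW: "x \<in> W" "\<And>v y. (x, v, y) \<in> G \<Longrightarrow> pos a < pos y \<and> pos y < pos b"
     using out g x unfolding outer_planar_def by blast+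
    obtain v y where y: "(x, v, y) \<in> G" using matching_ex[OF step(2) xW(1)] by blast
    have yb: "pos a < pos y" "pos y < pos b" using xW(2)[OF y] by auto
    show False using lin[OF y] least[OF y] least[OF gD(4)[OF y]] yb x by linarith
   qed
   have ab: "a \<noteq> b" "a \<in> V" "b \<in> V" using gD[OF g] step(3) by auto
   have out': "outer_planar pos (V - {a, b}) (W - {a, b}) (G - (bond a u b))" using out unfolding outer_planar_def by blast
   have inj': "inj_on pos (V - {a, b})" using inj by (rule inj_on_subset) auto
   have "noncrossing pos (und E) \<Longrightarrow> noncrossing pos (und (glued E (bond a u b)))"
    by (rule noncrossing_glued_pair[OF step(1) ab inj _ lt]) (use adj in blast)+
   thus ?thesis using g out' inj' glued_pair_step[OF step(2) g, of E] by (intro exI[of _ a] exI[of _ u] exI[of _ b]) simp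
  qed
 qed
 thus ?thesis using assms by blast
qed

section \<open>Counting labels\<close>

text \<open>
  The number of blobs of kind \<open>s\<close> on the line that starts at \<open>x\<close>.
\<close>

definition wt :: "'l \<Rightarrow> ('a \<times> 'l list \<times> 'a) set \<Rightarrow> 'a \<Rightarrow> nat" where
 "wt s E x = (\<Sum>e\<in>{e \<in> E. fst e = x}. count_list (fst (snd e)) s)"

lemma wt_eq:
 assumes "matching V E" "(x, w, q) \<in> E"
 shows "wt s E x = count_list w s"
proof -
 have "{e \<in> E. fst e = x} = {(x, w, q)}"
 proof (intro equalityI subsetI)
  fix e assume "e \<in> {e \<in> E. fst e = x}"
  then obtain v y where "e = (x, v, y)" "(x, v, y) \<in> E" by (cases e) auto
  thus "e \<in> {(x, w, q)}" using matching_uniq[OF assms, of v y] by simp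
 qed (use assms in simp)
 thus ?thesis unfolding wt_def by simp
qed

lemma count_list_rev [simp]: "count_list (rev w) s = count_list w s" by (induction w) auto

lemma comp_matching:
 assumes E: "matching V E" and e: "(p, w, q) \<in> E"
 shows "(und E)\<^sup>* `` {p} = {p, q}"
proof
 have u: "(x, v, y) \<in> E \<Longrightarrow> x = p \<Longrightarrow> y = q" "(x, v, y) \<in> E \<Longrightarrow> x = q \<Longrightarrow> y = p" for x v y
  using matching_uniq[OF E e, of v y] matching_uniq[OF E matchingD(4)[OF E e], of v y] by auto
 show "(und E)\<^sup>* `` {p} \<subseteq> {p, q}"
 proof
  fix y assume "y \<in> (und E)\<^sup>* `` {p}"
  hence "(p, y) \<in> (und E)\<^sup>*" by simp
  thus "y \<in> {p, q}" by (rule rtrancl_closed) (use u in \<open>auto simp: und_iff\<close>)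
 qed
 have "(p, q) \<in> und E" using e by (auto simp: und_iff)
 thus "{p, q} \<subseteq> (und E)\<^sup>* `` {p}" by auto
qed

lemma rtrancl_in:
 assumes "(x, y) \<in> R\<^sup>*" "R \<subseteq> V \<times> V" "x \<in> V" shows "y \<in> V"
 using assms(1,3) by (rule rtrancl_closed) (use assms(2) in auto)

lemma wt_pair_sum:
 assumes E: "matching V E" and ab: "a \<noteq> b" "a \<in> V" "b \<in> V" and fin: "finite V"
  and X: "X \<subseteq> V" "\<And>x y. (x, y) \<in> und E \<union> {(a, b), (b, a)} \<Longrightarrow> x \<in> X \<longleftrightarrow> y \<in> X"
  and ne: "X - {a, b} \<noteq> {}" and nab: "(a, b) \<in> und E \<Longrightarrow> a \<notin> X"
 shows "(\<Sum>x\<in>X. wt s E x) = (\<Sum>x\<in>X - {a, b}. wt s (glued E {(a, [], b), (b, [], a)}) x)"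
proof -
 let ?E1 = "glued E {(a, [], b), (b, [], a)}"
 have m1: "matching (V - {a, b}) ?E1" using glued_pair_matching[OF E ab, of "[]"] by simp
 note iff = glued_pair_iff[OF E ab(1), of _ _ _ "[]", simplified]
 have finX: "finite X" using X(1) fin finite_subset by blast
 have same: "wt s ?E1 x = wt s E x" if "x \<in> V - {a, b}" "(x, w, y) \<in> E" "y \<notin> {a, b}" for x w y
 proof -
  have "(x, w, y) \<in> ?E1" using that iff by blast
  thus ?thesis using wt_eq[OF m1] wt_eq[OF E that(2)] by auto
 qed
 show ?thesis
 proof (cases "a \<in> X")
  case False
  hence b: "b \<notin> X" using X(2)[of a b] by auto
  have "wt s E x = wt s ?E1 x" if x: "x \<in> X" for x
  proof -
   obtain w y where wy: "(x, w, y) \<in> E" using matching_ex[OF E] X(1) x by blast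
   hence "y \<in> X" using X(2)[of x y] x by (auto simp: und_iff)
   hence "y \<notin> {a, b}" using False b by auto
   moreover have "x \<in> V - {a, b}" using x X(1) False b by blast
   ultimately show ?thesis using same[OF _ wy] by simp
  qed
  moreover have "X - {a, b} = X" using False b by auto
  ultimately show ?thesis by (simp cong: sum.cong)
 next
  case True
  hence b: "b \<in> X" using X(2)[of a b] by auto
  obtain wa c where c: "(a, wa, c) \<in> E" using matching_ex[OF E ab(2)] by blast
  obtain wb d where d: "(b, wb, d) \<in> E" using matching_ex[OF E ab(3)] by blast
  have c': "(c, rev wa, a) \<in> E" by (rule matchingD(4)[OF E c])
  have d': "(d, rev wb, b) \<in> E" by (rule matchingD(4)[OF E d])
  have cX: "c \<in> X" using X(2)[of a c] c True by (auto simp: und_iff)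
  have dX: "d \<in> X" using X(2)[of b d] d b by (auto simp: und_iff)
  have "c \<noteq> b" using nab True c by (auto simp: und_iff)
  moreover have "d \<noteq> a" using nab True d' by (auto simp: und_iff)
  moreover have "c \<noteq> a" using matchingD(3)[OF E c] by simp
  moreover have "d \<noteq> b" using matchingD(3)[OF E d] by simp
  moreover have "c \<noteq> d" using matching_uniq[OF E c', of "rev wb" b] d' ab by blast
  ultimately have neq: "c \<noteq> a" "c \<noteq> b" "d \<noteq> a" "d \<noteq> b" "c \<noteq> d" by auto
  have "\<exists>w1 w2. (c, w1, a) \<in> E \<and> (b, w2, d) \<in> E \<and> rev wa @ wb = w1 @ w2"
   by (intro exI[of _ "rev wa"] exI[of _ wb]) (simp add: c' d)
  hence nc1: "(c, rev wa @ wb, d) \<in> ?E1" unfolding iff using neq by simp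
  have "\<exists>w1 w2. (d, w1, b) \<in> E \<and> (a, w2, c) \<in> E \<and> rev wb @ wa = w1 @ w2"
   by (intro exI[of _ "rev wb"] exI[of _ wa]) (simp add: c d')
  hence nc2: "(d, rev wb @ wa, c) \<in> ?E1" unfolding iff using neq by simp
  have w1: "wt s ?E1 c = count_list wa s + count_list wb s" "wt s ?E1 d = count_list wa s + count_list wb s"
   using wt_eq[OF m1 nc1, of s] wt_eq[OF m1 nc2, of s] by simp_all
  have w0: "wt s E a = count_list wa s" "wt s E b = count_list wb s" "wt s E c = count_list wa s" "wt s E d = count_list wb s"
   using wt_eq[OF E c, of s] wt_eq[OF E d, of s] wt_eq[OF E c', of s] wt_eq[OF E d', of s] by simp_all
  let ?Z = "X - {a, b, c, d}"
  have z: "wt s E x = wt s ?E1 x" if x: "x \<in> ?Z" for x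
  proof -
   obtain w y where wy: "(x, w, y) \<in> E" using matching_ex[OF E] X(1) x by blast
   have "y \<noteq> a" "y \<noteq> b" using matching_uniq_left[OF E c', of x w] matching_uniq_left[OF E d', of x w] wy x by auto
   thus ?thesis using same[OF _ wy] x X(1) by auto
  qed
  have "X = ?Z \<union> {a, b, c, d}" using True b cX dX by auto
  hence "(\<Sum>x\<in>X. wt s E x) = (\<Sum>x\<in>?Z \<union> {a, b, c, d}. wt s E x)" by simp
  also have "\<dots> = (\<Sum>x\<in>?Z. wt s E x) + (\<Sum>x\<in>{a, b, c, d}. wt s E x)" using finX by (intro sum.union_disjoint) auto
  also have "(\<Sum>x\<in>{a, b, c, d}. wt s E x) = 2 * (count_list wa s + count_list wb s)" using neq ab w0 by simp
  finally have L: "(\<Sum>x\<in>X. wt s E x) = (\<Sum>x\<in>?Z. wt s E x) + 2 * (count_list wa s + count_list wb s)" .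
  have "X - {a, b} = ?Z \<union> {c, d}" using cX dX neq by auto
  hence "(\<Sum>x\<in>X - {a, b}. wt s ?E1 x) = (\<Sum>x\<in>?Z \<union> {c, d}. wt s ?E1 x)" by simp
  also have "\<dots> = (\<Sum>x\<in>?Z. wt s ?E1 x) + (\<Sum>x\<in>{c, d}. wt s ?E1 x)" using finX by (intro sum.union_disjoint) auto
  also have "(\<Sum>x\<in>{c, d}. wt s ?E1 x) = 2 * (count_list wa s + count_list wb s)" using neq w1 by simp
  also have "(\<Sum>x\<in>?Z. wt s ?E1 x) = (\<Sum>x\<in>?Z. wt s E x)" using z by (intro sum.cong) auto
  finally show ?thesis using L by simp
 qed
qed

text \<open>
  The points of a component of the unglued lines see each line from both of its ends, hence the factor 2.
\<close>

theorem count_glued: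
 assumes "matching V E" "matching W G" "W \<subseteq> V" "finite V"
  and "\<And>a u b. (a, u, b) \<in> G \<Longrightarrow> u = []" and "(p, w, q) \<in> glued E G"
 shows "2 * count_list w s = (\<Sum>x\<in>(und E \<union> und G)\<^sup>* `` {p}. wt s E x)"
proof -
 have "(\<forall>a u b. (a, u, b) \<in> G \<longrightarrow> u = []) \<longrightarrow>
   (\<forall>p w q. (p, w, q) \<in> glued E G \<longrightarrow> 2 * count_list w s = (\<Sum>x\<in>(und E \<union> und G)\<^sup>* `` {p}. wt s E x))"
  using assms(1-4)
 proof (induction rule: gluing_induct)
  case (base V E)
  have "2 * count_list w s = (\<Sum>x\<in>(und E)\<^sup>* `` {p}. wt s E x)" if "(p, w, q) \<in> E" for p w q
   using wt_eq[OF base(1) that, of s] wt_eq[OF base(1) matchingD(4)[OF base(1) that], of s] matchingD(3)[OF base(1) that]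
    comp_matching[OF base(1) that] by simp
  thus ?case by (auto simp: und_def)
 next
  case (step V E W G)
  obtain a u b where g: "(a, u, b) \<in> G" using matching_ex[OF step(2)] step(5) by blast
  let ?P = "(bond a u b)"
  note gD = matchingD[OF step(2) g]
  have ab: "a \<noteq> b" "a \<in> V" "b \<in> V" using gD step by auto
  have "2 * count_list w s = (\<Sum>x\<in>(und E \<union> und G)\<^sup>* `` {p}. wt s E x)"
   if G: "\<forall>a u b. (a, u, b) \<in> G \<longrightarrow> u = []" and pw: "(p, w, q) \<in> glued E G" and
    IH: "(\<forall>a u b. (a, u, b) \<in> G - ?P \<longrightarrow> u = []) \<longrightarrow> (\<forall>p w q. (p, w, q) \<in> glued (glued E ?P) (G - ?P) \<longrightarrow>
     2 * count_list w s = (\<Sum>x\<in>(und (glued E ?P) \<union> und (G - ?P))\<^sup>* `` {p}. wt s (glued E ?P) x))" for p w q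
  proof -
   have u: "u = []" using G g by blast
   let ?R = "und E \<union> und G" and ?R1 = "und (glued E ?P) \<union> und (G - ?P)"
   have pV: "p \<in> V - W" using matchingD[OF glued_matching[OF step(1-4)] pw] by blast
   have m: "matching (W - {a, b}) (G - ?P)" using matching_remove_pair[OF step(2) g] .
   have m1: "matching (V - {a, b}) (glued E ?P)" using glued_pair_matching[OF step(1) ab] .
   have RV: "?R \<subseteq> V \<times> V" using und_sub[OF step(1)] und_sub[OF step(2)] step(3) by blast
   have GV: "und (G - ?P) \<subseteq> (V - {a, b}) \<times> (V - {a, b})" using und_sub[OF m] step(3) by blast
   have R1V: "?R1 \<subseteq> (V - {a, b}) \<times> (V - {a, b})" using und_sub[OF m1] GV by blast
   have symR: "sym ?R" using und_sym[OF step(1)] und_sym[OF step(2)] by (intro sym_Un)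
   have conn: "(x, y) \<in> ?R\<^sup>* \<longleftrightarrow> (x, y) \<in> ?R1\<^sup>*"
    if "x \<in> V - {a, b}" "y \<in> V - {a, b}" for x y
   proof -
    have "sym (und E \<union> und ?P)" using und_sym[OF step(1)] by (intro sym_Un) (auto simp: sym_def)
    from ends_rtrancl[OF this GV that] show ?thesis unfolding ends_pair[OF step(1) ab] und_pair_step[OF step(2) g] by (simp add: Un_assoc)
   qed
   let ?X = "?R\<^sup>* `` {p}"
   have pab: "p \<in> V - {a, b}" using pV gD by auto
   have "?R1\<^sup>* `` {p} = ?X - {a, b}"
   proof (intro equalityI subsetI)
    fix y assume "y \<in> ?R1\<^sup>* `` {p}"
    moreover from this have "y \<in> V - {a, b}" using rtrancl_in[OF _ R1V pab] by blast
    ultimately show "y \<in> ?X - {a, b}" using conn[OF pab] by auto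
   next
    fix y assume "y \<in> ?X - {a, b}"
    moreover from this have "y \<in> V" using rtrancl_in[OF _ RV, of p y] pV by blast
    ultimately show "y \<in> ?R1\<^sup>* `` {p}" using conn[OF pab, of y] by auto
   qed
   moreover have "2 * count_list w s = (\<Sum>x\<in>?R1\<^sup>* `` {p}. wt s (glued E ?P) x)"
    using IH G pw unfolding glued_pair_step[OF step(2) g, of E] by blast
   moreover have "(\<Sum>x\<in>?X. wt s E x) = (\<Sum>x\<in>?X - {a, b}. wt s (glued E {(a, [], b), (b, [], a)}) x)"
   proof (rule wt_pair_sum[OF step(1) ab step(4)])
    show "?X \<subseteq> V" using rtrancl_in[OF _ RV, of p] pV by blast
    have P: "{(a, b), (b, a)} \<subseteq> und G" using g gD(4) by (auto simp: und_iff)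
    show "x \<in> ?X \<longleftrightarrow> y \<in> ?X" if "(x, y) \<in> und E \<union> {(a, b), (b, a)}" for x y
    proof -
     have "(x, y) \<in> ?R" using that P by blast
     moreover from this have "(y, x) \<in> ?R" using symR by (auto dest: symD)
     ultimately show ?thesis by (auto intro: rtrancl.rtrancl_into_rtrancl)
    qed
    show "?X - {a, b} \<noteq> {}" using pab by blast
    show "a \<notin> ?X" if F: "(a, b) \<in> und E"
    proof
     assume "a \<in> ?X"
     hence "(a, p) \<in> ?R\<^sup>*" using symD[OF sym_rtrancl[OF symR]] by blast
     hence "p \<in> {a, b}"
     proof (rule rtrancl_closed)
      fix x y assume xy: "(x, y) \<in> ?R" "x \<in> {a, b}"
      have "(b, a) \<in> und E" using F und_sym[OF step(1)] by (auto dest: symD)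
      thus "y \<in> {a, b}"
      proof -
       have f: "y = b" if "(a, y) \<in> und E" for y using that F matching_uniq[OF step(1), of a _ b _ y] unfolding und_iff by blast
       have f': "y = a" if "(b, y) \<in> und E" for y
        using that \<open>(b, a) \<in> und E\<close> matching_uniq[OF step(1), of b _ a _ y] unfolding und_iff by blast
       have h: "y = b" if "(a, y) \<in> und G" for y using that matching_uniq[OF step(2) g, of _ y] unfolding und_iff by blast
       have h': "y = a" if "(b, y) \<in> und G" for y using that matching_uniq[OF step(2) gD(4), of _ y] unfolding und_iff by blast
       show ?thesis using xy f f' h h' by blast
      qed
     qed simp
     thus False using pab by blast
    qed
   qed
   ultimately show ?thesis using u by simp
  qed
  thus ?case using g by (intro exI[of _ a] exI[of _ u] exI[of _ b]) blast
 qed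
 thus ?thesis using assms(5,6) by blast
qed

lemma card_comps_matching:
 assumes E: "matching V E" and fin: "finite V"
 shows "2 * card (comps (und E) V) = card V"
proof -
 have c: "\<exists>q. q \<noteq> p \<and> q \<in> V \<and> (und E)\<^sup>* `` {p} = {p, q}" if p: "p \<in> V" for p
 proof -
  obtain w q where e: "(p, w, q) \<in> E" using matching_ex[OF E p] by blast
  show ?thesis using comp_matching[OF E e] matchingD(2,3)[OF E e] by (intro exI[of _ q]) simp
 qed
 have U: "\<Union> (comps (und E) V) = V"
 proof (intro equalityI subsetI)
  fix x assume "x \<in> \<Union> (comps (und E) V)"
  then obtain p where "p \<in> V" "x \<in> (und E)\<^sup>* `` {p}" unfolding comps_def by blast
  thus "x \<in> V" using c[of p] by auto
 qed (auto simp: comps_def)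
 have "2 * card (comps (und E) V) = card (\<Union> (comps (und E) V))"
 proof (rule card_partition)
  show "finite (comps (und E) V)" using fin by simp
  show "finite (\<Union> (comps (und E) V))" using fin U by simp
  show "card X = 2" if X: "X \<in> comps (und E) V" for X
  proof -
   obtain p where "p \<in> V" "X = (und E)\<^sup>* `` {p}" using X unfolding comps_def by blast
   thus ?thesis using c[of p] by (metis card_2_iff)
  qed
  show "X \<inter> Y = {}" if XY: "X \<in> comps (und E) V" "Y \<in> comps (und E) V" "X \<noteq> Y" for X Y
  proof (rule ccontr)
   assume "X \<inter> Y \<noteq> {}"
   then obtain z where z: "z \<in> X" "z \<in> Y" by blast
   obtain x y where xy: "X = (und E)\<^sup>* `` {x}" "Y = (und E)\<^sup>* `` {y}" using XY unfolding comps_def by blast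
   note eq = comp_eq_iff[OF und_sym[OF E]]
   have "X = (und E)\<^sup>* `` {z}" "Y = (und E)\<^sup>* `` {z}" using z xy eq by blast+
   thus False using XY by simp
  qed
 qed
 thus ?thesis using U by simp
qed

lemma card_comps_glued:
 fixes E G :: "('a \<times> 'l list \<times> 'a) set"
 assumes "matching V E" "matching W G" "W \<subseteq> V" "finite V"
 shows "2 * card (comps (und E \<union> und G) V) = 2 * card (closed_comps (und E \<union> und G) V (V - W)) + card (V - W)"
proof -
 have "sym (und E \<union> und G)" using und_sym[OF assms(1)] und_sym[OF assms(2)] by (rule sym_Un)
 moreover have "und E \<union> und G \<subseteq> V \<times> V" using und_sub[OF assms(1)] und_sub[OF assms(2)] assms(3) by blast
 ultimately have "card (comps (und E \<union> und G) V) = card (closed_comps (und E \<union> und G) V (V - W))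
   + card (comps (und (glued E G)) (V - W))"
  using card_comps_glue[of "und E \<union> und G" V "{}" "V - W"] assms(4) ends_glued[OF assms(1-4)] by (simp add: sym_def)
 thus ?thesis using card_comps_matching[OF glued_matching[OF assms(1-4)]] assms(4) by simp
qed

section \<open>Walls\<close>

fun pairs :: "'a list \<Rightarrow> ('a \<times> 'a) list" where
 "pairs (a # b # xs) = (a, b) # pairs xs"
| "pairs xs = []"

text \<open>
  Joins the first point of a list to the second one, the third to the fourth, and so on. For the points of
  a wall these are the blobs; for the same points preceded by \<open>Top 0\<close> and followed by \<open>Bot 0\<close> they are the
  pieces of the strand.
\<close>

definition link :: "'l list \<Rightarrow> 'a list \<Rightarrow> ('a \<times> 'l list \<times> 'a) set" where
 "link u xs = (\<Union>(a, b)\<in>set (pairs xs). (bond a u b))"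

lemma link_simps [simp]:
 "link u [] = {}" "link u [a] = {}" "link u (a # b # xs) = (bond a u b) \<union> link u xs" unfolding link_def by auto

lemma link_append: "even (length xs) \<Longrightarrow> link u (xs @ ys) = link u xs \<union> link u ys" by (induction xs rule: pairs.induct) auto

lemma link_sub: "(a, v, b) \<in> link u xs \<Longrightarrow> a \<in> set xs \<and> b \<in> set xs \<and> (v = u \<or> v = rev u)"
 by (induction xs rule: pairs.induct) auto

lemma und_link_sub: "(a, b) \<in> und (link u xs) \<Longrightarrow> a \<in> set xs \<and> b \<in> set xs" by (auto simp: und_iff dest: link_sub)

lemma matching_link: "distinct xs \<Longrightarrow> even (length xs) \<Longrightarrow> matching (set xs) (link u xs)"
proof (induction xs rule: pairs.induct)
 case (1 a b xs)
 have "matching ({a, b} \<union> set xs) ((bond a u b) \<union> link u xs)" using 1 by (intro matching_Un matching_pair) auto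
 thus ?case by simp
qed auto

lemma ex_nat_split: "(\<exists>j. P j) \<longleftrightarrow> P 0 \<or> (\<exists>j. P (Suc j))" by (metis not0_implies_Suc)

lemma link_nth:
 "(a, v, b) \<in> link u xs \<longleftrightarrow> (\<exists>j. 2 * j + 1 < length xs \<and>
  ((a = xs ! (2 * j) \<and> b = xs ! (2 * j + 1) \<and> v = u) \<or> (a = xs ! (2 * j + 1) \<and> b = xs ! (2 * j) \<and> v = rev u)))"
proof (induction xs rule: pairs.induct)
 case (1 x y xs)
 show ?case (is "?l \<longleftrightarrow> (\<exists>j. ?P j)")
 proof -
  have "(\<exists>j. ?P j) \<longleftrightarrow> ?P 0 \<or> (\<exists>j. ?P (Suc j))" by (rule ex_nat_split)
  also have "(\<exists>j. ?P (Suc j)) \<longleftrightarrow> (a, v, b) \<in> link u xs" unfolding 1 by simp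
  finally have "(\<exists>j. ?P j) \<longleftrightarrow> ?P 0 \<or> (a, v, b) \<in> link u xs" .
  thus ?thesis by auto
 qed
qed auto

lemma und_link_any:
 fixes u :: "'z list" and v :: "'y list"
 shows "und (link u xs) = und (link v xs)"
proof -
 have "(p, q) \<in> und (link w xs) \<longleftrightarrow> (\<exists>j. 2 * j + 1 < length xs \<and>
   (p = xs ! (2 * j) \<and> q = xs ! (2 * j + 1) \<or> p = xs ! (2 * j + 1) \<and> q = xs ! (2 * j)))" for p q and w :: "'z list"
  unfolding und_iff link_nth by auto
 moreover have "(p, q) \<in> und (link w xs) \<longleftrightarrow> (\<exists>j. 2 * j + 1 < length xs \<and>
   (p = xs ! (2 * j) \<and> q = xs ! (2 * j + 1) \<or> p = xs ! (2 * j + 1) \<and> q = xs ! (2 * j)))" for p q and w :: "'y list"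
  unfolding und_iff link_nth by auto
 ultimately show ?thesis by auto
qed

lemma link_odd:
 assumes "odd (length A)" "A = A' @ [x]" "C = y # C'"
 shows "link u (A @ [a, b] @ C) = link u A' \<union> {(x, u, a), (a, rev u, x), (b, u, y), (y, rev u, b)} \<union> link u C'"
  and "link u (A @ C) = link u A' \<union> {(x, u, y), (y, rev u, x)} \<union> link u C'" using assms by (auto simp: link_append)

lemma link_even:
 assumes "even (length A)"
 shows "link u (A @ [a, b] @ C) = link u (A @ C) \<union> (bond a u b)" using assms by (auto simp: link_append)

definition del :: "'a set \<Rightarrow> ('a \<times> 'l list \<times> 'a) set \<Rightarrow> ('a \<times> 'l list \<times> 'a) set" where
 "del X E = {(p, w, q) \<in> E. p \<notin> X \<and> q \<notin> X}"

lemma del_iff: "(p, w, q) \<in> del X E \<longleftrightarrow> (p, w, q) \<in> E \<and> p \<notin> X \<and> q \<notin> X" unfolding del_def by auto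

lemma und_del_sub: "(p, q) \<in> und (del X E) \<Longrightarrow> p \<notin> X \<and> q \<notin> X" by (auto simp: und_iff del_iff)

lemma matching_del:
 assumes E: "matching V E" and X: "\<And>p w q. (p, w, q) \<in> E \<Longrightarrow> p \<in> X \<Longrightarrow> q \<in> X"
 shows "matching (V - X) (del X E)"
proof (rule matchingI)
 fix p w q assume "(p, w, q) \<in> del X E"
 thus "p \<in> V - X \<and> q \<in> V - X \<and> p \<noteq> q \<and> (q, rev w, p) \<in> del X E"
  using matchingD[OF E, of p w q] by (simp add: del_iff)
next
 fix p assume p: "p \<in> V - X"
 then obtain w q where e: "(p, w, q) \<in> E" using matching_ex[OF E] by blast
 have "q \<notin> X" using X[OF matchingD(4)[OF E e]] p by blast
 thus "\<exists>w q. (p, w, q) \<in> del X E" using e p unfolding del_iff by blast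
next
 fix p w q w' q' assume "(p, w, q) \<in> del X E" "(p, w', q') \<in> del X E"
 thus "w = w' \<and> q = q'" using matching_uniq[OF E, of p w q w' q'] by (simp add: del_iff)
qed

text \<open>
  A map that fixes \<open>p\<close> and \<open>q\<close> and sends edges to connected pairs shows that no connection between
  them is lost in the smaller graph.
\<close>

lemma rtrancl_retract:
 assumes "\<And>x y. (x, y) \<in> R \<Longrightarrow> (f x, f y) \<in> R'\<^sup>*" "R' \<subseteq> R\<^sup>*" "f p = p" "f q = q"
 shows "(p, q) \<in> R\<^sup>* \<longleftrightarrow> (p, q) \<in> R'\<^sup>*"
proof
 assume "(p, q) \<in> R\<^sup>*"
 hence "(f p, f q) \<in> R'\<^sup>*" by (induction rule: rtrancl_induct) (use assms(1) in \<open>auto intro: rtrancl_trans\<close>)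
 thus "(p, q) \<in> R'\<^sup>*" using assms by simp
qed (use rtrancl_subset_rtrancl[OF assms(2)] in blast)

lemma rtrancl_path3: "(a, b) \<in> R \<Longrightarrow> (b, c) \<in> R \<Longrightarrow> (c, d) \<in> R \<Longrightarrow> (a, d) \<in> R\<^sup>*"
 by (meson r_into_rtrancl rtrancl_trans)

lemma sub_rtrancl2: "R' \<subseteq> R \<union> {p, q} \<Longrightarrow> p \<in> R\<^sup>* \<Longrightarrow> q \<in> R\<^sup>* \<Longrightarrow> R' \<subseteq> R\<^sup>*"
 by blast

text \<open>
  Neighbouring points \<open>a\<close>, \<open>b\<close> that are joined by a line are either glued to each other, and form
  a closed curve, or are a detour between their other neighbours.
\<close>

lemma rtrancl_delete_pair:
 assumes E: "matching V E" and ab: "(a, w0, b) \<in> E" and d: "distinct (A @ [a, b] @ C)" "even (length (A @ C))"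
  and Y: "\<And>x y. (x, y) \<in> Y \<Longrightarrow> x \<notin> {a, b} \<and> y \<notin> {a, b}"
  and pq: "p \<notin> {a, b}" "q \<notin> {a, b}"
 shows "(p, q) \<in> (und E \<union> und (link u (A @ [a, b] @ C)) \<union> Y)\<^sup>* \<longleftrightarrow>
  (p, q) \<in> (und (del {a, b} E) \<union> und (link u (A @ C)) \<union> Y)\<^sup>*" (is "_ \<in> ?R\<^sup>* \<longleftrightarrow> _ \<in> ?R'\<^sup>*")
proof -
 have Eab: "(x, y) \<in> und (del {a, b} E) \<or> (x, y) = (a, b) \<or> (x, y) = (b, a)" if xy: "(x, y) \<in> und E" for x y
 proof -
  obtain w where w: "(x, w, y) \<in> E" using xy by (auto simp: und_iff)
  have "x = a \<Longrightarrow> y = b" using matching_uniq[OF E ab, of w y] w by simp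
  moreover have "x = b \<Longrightarrow> y = a" using matching_uniq[OF E matchingD(4)[OF E ab], of w y] w by simp
  moreover have "y = b \<Longrightarrow> x = a" using matching_uniq_left[OF E ab, of x w] w by simp
  moreover have "y = a \<Longrightarrow> x = b" using matching_uniq_left[OF E matchingD(4)[OF E ab], of x w] w by simp
  moreover have "x \<notin> {a, b} \<Longrightarrow> y \<notin> {a, b} \<Longrightarrow> (x, y) \<in> und (del {a, b} E)"
   using w unfolding und_iff del_iff by blast
  ultimately show ?thesis by blast
 qed
 have sub: "und (del {a, b} E) \<subseteq> und E" by (auto simp: und_iff del_iff)
 show ?thesis
 proof (cases "even (length A)")
  case True
  have ln: "und (link u (A @ [a, b] @ C)) = und (link u (A @ C)) \<union> {(a, b), (b, a)}" unfolding link_even[OF True] und_Un by simp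
  have lC: "(x, y) \<in> und (link u (A @ C)) \<Longrightarrow> x \<notin> {a, b} \<and> y \<notin> {a, b}" for x y
   using d(1) by (auto simp: und_iff dest: link_sub)
  show ?thesis
  proof (rule rtrancl_retract[where f = "\<lambda>x. if x \<in> {a, b} then a else x"])
   fix x y assume "(x, y) \<in> ?R"
   then consider "(x, y) \<in> ?R'" | "(x, y) = (a, b)" | "(x, y) = (b, a)" using Eab ln by blast
   thus "(if x \<in> {a, b} then a else x, if y \<in> {a, b} then a else y) \<in> ?R'\<^sup>*"
   proof cases
    case 1
    have "x \<notin> {a, b} \<and> y \<notin> {a, b}" using 1
    proof (elim UnE)
     assume "(x, y) \<in> Y" thus ?thesis by (rule Y)
    next
     assume "(x, y) \<in> und (link u (A @ C))" thus ?thesis by (rule lC)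
    next
     assume "(x, y) \<in> und (del {a, b} E)" from und_del_sub[OF this] show ?thesis .
    qed
    hence "(if x \<in> {a, b} then a else x, if y \<in> {a, b} then a else y) = (x, y)" by simp
    thus ?thesis using r_into_rtrancl[OF 1] by simp
   next
    case 2 thus ?thesis by simp
   next
    case 3 thus ?thesis by simp
   qed
  next
   show "?R' \<subseteq> ?R\<^sup>*" using sub ln by blast
  qed (use pq in simp_all)
 next
  case False
  hence "A \<noteq> []" "C \<noteq> []" using d(2) by auto
  then obtain A' x y C' where AC: "A = A' @ [x]" "C = y # C'" by (metis rev_exhaust neq_Nil_conv)
  let ?f = "\<lambda>z. if z = a then x else if z = b then y else z"
  have dd: "x \<noteq> a" "x \<noteq> b" "y \<noteq> a" "y \<noteq> b" "a \<noteq> b" using d(1) AC by auto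
  have ln: "und (link u (A @ [a, b] @ C)) = und (link u A') \<union> und (link u C') \<union> {(x, a), (a, x), (b, y), (y, b)}"
   unfolding link_odd(1)[OF False AC] by (auto simp: und_iff)
  have ln': "und (link u (A @ C)) = und (link u A') \<union> und (link u C') \<union> {(x, y), (y, x)}"
   unfolding link_odd(2)[OF False AC] by (auto simp: und_iff)
  have lC: "(v, w) \<in> und (link u A') \<union> und (link u C') \<Longrightarrow> v \<notin> {a, b} \<and> w \<notin> {a, b}" for v w
   using d(1) AC by (auto simp: und_iff dest: link_sub)
  show ?thesis
  proof (rule rtrancl_retract[where f = ?f])
   fix v w assume "(v, w) \<in> ?R"
   then consider "(v, w) \<in> und (del {a, b} E) \<union> und (link u A') \<union> und (link u C') \<union> Y"
    | "(v, w) = (a, b)" | "(v, w) = (b, a)" | "(v, w) \<in> {(x, a), (a, x), (b, y), (y, b)}" using Eab[of v w] unfolding ln Un_iff by argo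
   thus "(?f v, ?f w) \<in> ?R'\<^sup>*"
   proof cases
    case 1
    have "v \<notin> {a, b} \<and> w \<notin> {a, b}" using 1
    proof (elim UnE)
     assume "(v, w) \<in> Y" thus ?thesis by (rule Y)
    next
     assume "(v, w) \<in> und (del {a, b} E)" from und_del_sub[OF this] show ?thesis .
    qed (use lC in blast)+
    hence "(?f v, ?f w) = (v, w)" by simp
    moreover have "(v, w) \<in> ?R'" using 1 ln' by blast
    ultimately show ?thesis by (simp only: r_into_rtrancl)
   next
    case 2
    have "(x, y) \<in> ?R'\<^sup>*" using ln' by auto
    thus ?thesis using 2 dd by simp
   next
    case 3
    have "(y, x) \<in> ?R'\<^sup>*" using ln' by auto
    thus ?thesis using 3 dd by simp
   next
    case 4
    hence "?f v = ?f w" using dd by auto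
    thus ?thesis by simp
   qed
  next
   have e: "(a, b) \<in> ?R" "(b, a) \<in> ?R" using ab matchingD(4)[OF E ab] by (auto simp: und_iff)
   have f: "(x, a) \<in> ?R" "(a, x) \<in> ?R" "(b, y) \<in> ?R" "(y, b) \<in> ?R" using ln by auto
   have "(x, y) \<in> ?R\<^sup>*" by (rule rtrancl_path3[OF f(1) e(1) f(3)])
   moreover have "(y, x) \<in> ?R\<^sup>*" by (rule rtrancl_path3[OF f(4) e(2) f(2)])
   moreover have "?R' \<subseteq> ?R \<union> {(x, y), (y, x)}"
   proof
    fix z assume "z \<in> ?R'"
    thus "z \<in> ?R \<union> {(x, y), (y, x)}" using subsetD[OF sub, of z] unfolding ln ln' Un_iff by argo
   qed
   ultimately show "?R' \<subseteq> ?R\<^sup>*" by (intro sub_rtrancl2)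
  qed (use pq in simp_all)
 qed
qed

text \<open>
  Of two parallel pieces \<open>a c\<close> and \<open>b d\<close>, the parity conditions say that \<open>a\<close> is glued to \<open>b\<close> on
  one wall, whereas \<open>c\<close> and \<open>d\<close> are glued to their outer neighbours on the other: the
  pieces form a detour between these neighbours.
\<close>

lemma rtrancl_delete_ladder:
 assumes E: "matching V E" and e: "(a, w0, c) \<in> E" "(b, w1, d) \<in> E"
  and dist: "distinct (A @ [a, b] @ B)" "distinct (C @ [c, d] @ D)" "(set A \<union> {a, b} \<union> set B) \<inter> (set C \<union> {c, d} \<union> set D) = {}"
  and len: "even (length A)" "odd (length C)" "even (length (C @ D))"
  and pq: "p \<notin> {a, b, c, d}" "q \<notin> {a, b, c, d}"
 shows "(p, q) \<in> (und E \<union> und (link u (A @ [a, b] @ B)) \<union> und (link v (C @ [c, d] @ D)))\<^sup>* \<longleftrightarrow>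
  (p, q) \<in> (und (del {a, b, c, d} E) \<union> und (link u (A @ B)) \<union> und (link v (C @ D)))\<^sup>*" (is "_ \<in> ?R\<^sup>* \<longleftrightarrow> _ \<in> ?R'\<^sup>*")
proof -
 have "C \<noteq> []" "D \<noteq> []" using len by auto
 then obtain C' x y D' where CD: "C = C' @ [x]" "D = y # D'" by (metis rev_exhaust neq_Nil_conv)
 let ?X = "{a, b, c, d}"
 have e': "(c, rev w0, a) \<in> E" "(d, rev w1, b) \<in> E" using e matchingD(4)[OF E] by auto
 have Eab: "(x, y) \<in> und (del ?X E) \<or> (x, y) \<in> {(a, c), (c, a), (b, d), (d, b)}" if xy: "(x, y) \<in> und E" for x y
 proof -
  obtain w where w: "(x, w, y) \<in> E" using xy by (auto simp: und_iff)
  have "x = a \<Longrightarrow> y = c" using matching_uniq[OF E e(1), of w y] w by simp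
  moreover have "y = c \<Longrightarrow> x = a" using matching_uniq_left[OF E e(1), of x w] w by simp
  moreover have "x = b \<Longrightarrow> y = d" using matching_uniq[OF E e(2), of w y] w by simp
  moreover have "y = d \<Longrightarrow> x = b" using matching_uniq_left[OF E e(2), of x w] w by simp
  moreover have "x = c \<Longrightarrow> y = a" using matching_uniq[OF E e'(1), of w y] w by simp
  moreover have "y = a \<Longrightarrow> x = c" using matching_uniq_left[OF E e'(1), of x w] w by simp
  moreover have "x = d \<Longrightarrow> y = b" using matching_uniq[OF E e'(2), of w y] w by simp
  moreover have "y = b \<Longrightarrow> x = d" using matching_uniq_left[OF E e'(2), of x w] w by simp
  moreover have "x \<notin> ?X \<Longrightarrow> y \<notin> ?X \<Longrightarrow> (x, y) \<in> und (del ?X E)"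
   using w unfolding und_iff del_iff by blast
  ultimately show ?thesis by blast
 qed
 have sub: "und (del ?X E) \<subseteq> und E" by (auto simp: und_iff del_iff)
 let ?f = "\<lambda>z. if z \<in> {a, c} then x else if z \<in> {b, d} then y else z"
 have dd: "x \<notin> ?X" "y \<notin> ?X" "a \<noteq> b" "c \<noteq> d" "a \<noteq> c" "a \<noteq> d" "b \<noteq> c" "b \<noteq> d" using dist CD by auto
 have la: "und (link u (A @ [a, b] @ B)) = und (link u (A @ B)) \<union> {(a, b), (b, a)}" unfolding link_even[OF len(1)] und_Un by simp
 have lC: "und (link v (C @ [c, d] @ D)) = und (link v C') \<union> und (link v D') \<union> {(x, c), (c, x), (d, y), (y, d)}"
  unfolding link_odd(1)[OF len(2) CD] by (auto simp: und_iff)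
 have lC': "und (link v (C @ D)) = und (link v C') \<union> und (link v D') \<union> {(x, y), (y, x)}"
  unfolding link_odd(2)[OF len(2) CD] by (auto simp: und_iff)
 have lX: "v' \<notin> ?X \<and> w \<notin> ?X" if vw: "(v', w) \<in> und (link u (A @ B)) \<union> und (link v C') \<union> und (link v D')" for v' w
 proof -
  have "set (A @ B) \<inter> ?X = {}" "set C' \<inter> ?X = {}" "set D' \<inter> ?X = {}" using dist CD by auto
  moreover have "v' \<in> set (A @ B) \<and> w \<in> set (A @ B) \<or> v' \<in> set C' \<and> w \<in> set C' \<or> v' \<in> set D' \<and> w \<in> set D'"
   using vw by (elim UnE) (auto dest: und_link_sub)
  ultimately show ?thesis by blast
 qed
 show ?thesis
 proof (rule rtrancl_retract[where f = ?f])
  fix v' w assume "(v', w) \<in> ?R"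
  then consider "(v', w) \<in> und (del ?X E) \<union> und (link u (A @ B)) \<union> und (link v C') \<union> und (link v D')"
   | "(v', w) \<in> {(a, b), (b, a)}" | "(v', w) \<in> {(a, c), (c, a), (b, d), (d, b)}" | "(v', w) \<in> {(x, c), (c, x), (d, y), (y, d)}"
   using Eab[of v' w] unfolding la lC Un_iff by argo
  thus "(?f v', ?f w) \<in> ?R'\<^sup>*"
  proof cases
   case 1
   hence "v' \<notin> ?X \<and> w \<notin> ?X"
   proof (elim UnE)
    assume "(v', w) \<in> und (del ?X E)" thus ?thesis by (auto simp: und_iff del_iff)
   qed (use lX in blast)+
   hence "(?f v', ?f w) = (v', w)" by simp
   moreover have "(v', w) \<in> ?R'" using 1 lC' by blast
   ultimately show ?thesis by (simp only: r_into_rtrancl)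
  next
   case 2
   have "(x, y) \<in> ?R'\<^sup>*" "(y, x) \<in> ?R'\<^sup>*" using lC' by auto
   moreover have "(?f v', ?f w) = (x, y) \<or> (?f v', ?f w) = (y, x)" using 2 dd by auto
   ultimately show ?thesis by (elim disjE) (simp_all only: simp_thms)
  next
   case 3
   hence "?f v' = ?f w" using dd by auto
   thus ?thesis by simp
  next
   case 4
   hence "?f v' = ?f w" using dd by auto
   thus ?thesis by simp
  qed
 next
  have g: "(a, b) \<in> ?R" "(b, a) \<in> ?R" using la by auto
  have h: "(a, c) \<in> ?R" "(c, a) \<in> ?R" "(b, d) \<in> ?R" "(d, b) \<in> ?R" using e e' by (auto simp: und_iff)
  have f: "(x, c) \<in> ?R" "(c, x) \<in> ?R" "(d, y) \<in> ?R" "(y, d) \<in> ?R" using lC by auto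
  have "(x, y) \<in> ?R\<^sup>*" by (rule rtrancl_trans[OF rtrancl_path3[OF f(1) h(2) g(1)] rtrancl_trans[OF r_into_rtrancl[OF h(3)] r_into_rtrancl[OF f(3)]]])
  moreover have "(y, x) \<in> ?R\<^sup>*" by (rule rtrancl_trans[OF rtrancl_path3[OF f(4) h(4) g(2)] rtrancl_trans[OF r_into_rtrancl[OF h(1)] r_into_rtrancl[OF f(2)]]])
  moreover have "?R' \<subseteq> ?R \<union> {(x, y), (y, x)}"
  proof
   fix z assume "z \<in> ?R'"
   thus "z \<in> ?R \<union> {(x, y), (y, x)}" using subsetD[OF sub, of z] unfolding la lC lC' Un_iff by argo
  qed
  ultimately show "?R' \<subseteq> ?R\<^sup>*" by (intro sub_rtrancl2)
 qed (use pq in simp_all)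
qed

section \<open>Words of lines under deletion\<close>

lemma apath_del:
 assumes "apath E G p w q" "p \<notin> X"
  and "\<And>p w q. (p, w, q) \<in> E \<Longrightarrow> p \<in> X \<longleftrightarrow> q \<in> X" "\<And>p w q. (p, w, q) \<in> G \<Longrightarrow> p \<in> X \<longleftrightarrow> q \<in> X"
 shows "apath (del X E) (del X G) p w q \<and> q \<notin> X" using assms(1,2)
proof (induction rule: apath.induct)
 case (start p w q)
 hence "(p, w, q) \<in> del X E" "q \<notin> X" using assms(3)[of p w q] by (auto simp: del_iff)
 thus ?case by (auto intro: apath.start)
next
 case (step p w a u b w' q)
 hence *: "apath (del X E) (del X G) p w a" "a \<notin> X" by auto
 have b: "b \<notin> X" using assms(4)[OF step(2)] * by simp
 have q: "q \<notin> X" using assms(3)[OF step(3)] b by simp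
 have "(a, u, b) \<in> del X G" "(b, w', q) \<in> del X E" using step * b q by (simp_all add: del_iff)
 thus ?case using apath.step[OF *(1)] q by blast
qed

lemma remdups_adj_append_cong: "remdups_adj w = remdups_adj w' \<Longrightarrow> remdups_adj (w @ u) = remdups_adj (w' @ u)"
proof -
 assume *: "remdups_adj w = remdups_adj w'"
 have "remdups_adj (v @ u) = remdups_adj (remdups_adj v @ u)" for v :: "'a list"
 proof (induction v)
  case (Cons a v)
  note IH = Cons.IH
  have hd: "\<exists>zs. remdups_adj (y # ys) = y # zs" for y :: 'a and ys by (metis remdups_adj_Cons')
  show ?case
  proof (cases "remdups_adj v")
   case Nil
   thus ?thesis using Cons by simp
  next
   case (Cons y ys)
   obtain zs where zs: "remdups_adj (y # ys @ u) = y # zs" using hd by blast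
   have "remdups_adj (a # v @ u) = (if a = y then y # zs else a # y # zs)" using IH zs Cons by (simp add: remdups_adj_Cons[of a "v @ u"])
   moreover have "remdups_adj (remdups_adj (a # v) @ u) = (if a = y then y # zs else a # y # zs)"
    using zs Cons by (simp add: remdups_adj_Cons[of a v])
   ultimately show ?thesis by simp
  qed
 qed simp
 thus ?thesis using * by metis
qed

lemma remdups_adj_snoc2: "remdups_adj (w @ [s, s]) = remdups_adj (w @ [s])" by (induction w rule: remdups_adj.induct) auto

text \<open>
  Here \<open>a\<close> and \<open>b\<close> belong to two consecutive blobs of one line. Deleting both points merges the
  blobs into one, which \<open>remdups_adj\<close> does not see. The cases \<open>q = a\<close> and \<open>q = b\<close> serve the induction.
\<close>

lemma apath_merge:
 assumes E: "matching V E" and lab: "\<And>p w q. (p, w, q) \<in> E \<Longrightarrow> w = []" and ab: "(a, [], b) \<in> E"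
  and d: "distinct (A @ [a, b] @ C)" and odd: "odd (length A)" and AC: "A = A' @ [x]" "C = y # C'"
  and Y: "\<And>p w q. (p, w, q) \<in> Y \<Longrightarrow> p \<notin> {a, b} \<and> q \<notin> {a, b}"
  and path: "apath E (link [s] (A @ [a, b] @ C) \<union> Y) p w q" and p: "p \<notin> {a, b}"
 shows "(q \<notin> {a, b} \<longrightarrow> (\<exists>w'. apath (del {a, b} E) (link [s] (A @ C) \<union> Y) p w' q \<and> remdups_adj w' = remdups_adj w)) \<and>
  (q = b \<longrightarrow> (\<exists>w'. apath (del {a, b} E) (link [s] (A @ C) \<union> Y) p w' x \<and> remdups_adj (w' @ [s]) = remdups_adj w)) \<and>
  (q = a \<longrightarrow> (\<exists>w'. apath (del {a, b} E) (link [s] (A @ C) \<union> Y) p w' y \<and> remdups_adj (w' @ [s]) = remdups_adj w))"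
 using path p
proof (induction rule: apath.induct)
 case (start p w q)
 have "q \<notin> {a, b}" using matching_uniq_left[OF E ab, of p w] matching_uniq_left[OF E matchingD(4)[OF E ab], of p w] start by auto
 moreover from this have "(p, w, q) \<in> del {a, b} E" using start by (simp add: del_iff)
 ultimately show ?case by (auto intro: apath.start)
next
 case (step p w c u e w2 q)
 let ?E = "del {a, b} E" and ?G = "link [s] (A @ C) \<union> Y"
 have w2: "w2 = []" using lab step by blast
 have ba: "(b, [], a) \<in> E" using matchingD(4)[OF E ab] by simp
 have ne: "a \<noteq> b" "x \<notin> {a, b}" "y \<notin> {a, b}" using d AC by auto
 have G: "(c, u, e) \<in> ?G \<and> c \<notin> {a, b} \<and> e \<notin> {a, b} \<or> u = [s] \<and> (c, e) \<in> {(x, a), (a, x), (b, y), (y, b)}"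
 proof -
  have "c \<notin> {a, b} \<and> e \<notin> {a, b}" if "(c, u, e) \<in> link [s] A' \<union> link [s] C'" using that d AC by (auto dest!: link_sub)
  thus ?thesis using step(2) Y[of c u e] unfolding link_odd(1)[OF odd AC] link_odd(2)[OF odd AC] by auto
 qed
 have xy: "(x, [s], y) \<in> ?G" "(y, [s], x) \<in> ?G" unfolding link_odd(2)[OF odd AC] by auto
 from step.IH[OF step.prems] have
  IH1: "c \<notin> {a, b} \<Longrightarrow> \<exists>w'. apath ?E ?G p w' c \<and> remdups_adj w' = remdups_adj w" and
  IH2: "c = b \<Longrightarrow> \<exists>w'. apath ?E ?G p w' x \<and> remdups_adj (w' @ [s]) = remdups_adj w" and
  IH3: "c = a \<Longrightarrow> \<exists>w'. apath ?E ?G p w' y \<and> remdups_adj (w' @ [s]) = remdups_adj w" by blast+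
 have qb: "e = a" if "q = b" using matching_uniq_left[OF E ab, of e w2] step(3) that by simp
 have qa: "e = b" if "q = a" using matching_uniq_left[OF E ba, of e w2] step(3) that by simp
 have eq: "(e, [], q) \<in> ?E" if "e \<notin> {a, b}"
 proof -
  have "q \<notin> {a, b}" using that qa qb by blast
  thus ?thesis using that step(3) w2 by (simp add: del_iff)
 qed
 have ab_q: "q = b" if "e = a" using matching_uniq[OF E ab, of w2 q] step(3) that by simp
 have ba_q: "q = a" if "e = b" using matching_uniq[OF E ba, of w2 q] step(3) that by simp
 consider (1) "(c, u, e) \<in> ?G" "c \<notin> {a, b}" "e \<notin> {a, b}" | (2) "u = [s]" "c = x" "e = a" | (3) "u = [s]" "c = a" "e = x"
  | (4) "u = [s]" "c = b" "e = y" | (5) "u = [s]" "c = y" "e = b" using G by blast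
 thus ?case
 proof cases
  case 1
  then obtain w' where w': "apath ?E ?G p w' c" "remdups_adj w' = remdups_adj w" using IH1 by blast
  have "apath ?E ?G p (w' @ u @ []) q" by (rule apath.step[OF w'(1) 1(1) eq[OF 1(3)]])
  moreover have "remdups_adj (w' @ u) = remdups_adj (w @ u)" by (rule remdups_adj_append_cong[OF w'(2)])
  moreover have "q \<notin> {a, b}" using qa qb 1(3) by blast
  ultimately show ?thesis using w2 by auto
 next
  case 2
  then obtain w' where w': "apath ?E ?G p w' x" "remdups_adj w' = remdups_adj w" using IH1 ne by blast
  have "remdups_adj (w' @ [s]) = remdups_adj (w @ [s])" by (rule remdups_adj_append_cong[OF w'(2)])
  moreover have "q = b" using ab_q 2 by simp
  ultimately show ?thesis using w'(1) w2 2(1) ne by auto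
 next
  case 3
  then obtain w' where w': "apath ?E ?G p w' y" "remdups_adj (w' @ [s]) = remdups_adj w" using IH3 by blast
  have "e \<notin> {a, b}" using 3 ne by simp
  hence "apath ?E ?G p (w' @ [s] @ []) q" using 3 by (intro apath.step[OF w'(1) xy(2)]) (use eq in blast)
  moreover have "remdups_adj (w' @ [s]) = remdups_adj (w @ [s])" using remdups_adj_append_cong[OF w'(2), of "[s]"] remdups_adj_snoc2[of w' s] by simp
  moreover have "q \<notin> {a, b}" using qa qb \<open>e \<notin> {a, b}\<close> by blast
  ultimately show ?thesis using w2 3(1) by auto
 next
  case 4
  then obtain w' where w': "apath ?E ?G p w' x" "remdups_adj (w' @ [s]) = remdups_adj w" using IH2 by blast
  have "e \<notin> {a, b}" using 4 ne by simp
  hence "apath ?E ?G p (w' @ [s] @ []) q" using 4 by (intro apath.step[OF w'(1) xy(1)]) (use eq in blast)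
  moreover have "remdups_adj (w' @ [s]) = remdups_adj (w @ [s])" using remdups_adj_append_cong[OF w'(2), of "[s]"] remdups_adj_snoc2[of w' s] by simp
  moreover have "q \<notin> {a, b}" using qa qb \<open>e \<notin> {a, b}\<close> by blast
  ultimately show ?thesis using w2 4(1) by auto
 next
  case 5
  then obtain w' where w': "apath ?E ?G p w' y" "remdups_adj w' = remdups_adj w" using IH1 ne by blast
  have "remdups_adj (w' @ [s]) = remdups_adj (w @ [s])" by (rule remdups_adj_append_cong[OF w'(2)])
  moreover have "q = a" using ba_q 5 by simp
  ultimately show ?thesis using w'(1) w2 5(1) ne by auto
 qed
qed

section \<open>Planar drawings\<close>

abbreviation hook_edges :: "nat \<Rightarrow> (point \<times> point) set" where
 "hook_edges n \<equiv> {(Top (n + 1), Top 0), (Top 0, Top (n + 1)), (Bot (n + 1), Bot 0), (Bot 0, Bot (n + 1))}"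

abbreviation hook_ends :: "nat \<Rightarrow> point set" where
 "hook_ends n \<equiv> {Top 0, Bot 0, Top (n + 1), Bot (n + 1)}"

abbreviation short_words :: "blob list set" where
 "short_words \<equiv> {[], [LeftBlob], [RightBlob], [LeftBlob, RightBlob], [RightBlob, LeftBlob]}"

abbreviation ascending :: "('a \<Rightarrow> nat) \<Rightarrow> 'a list \<Rightarrow> bool" where
 "ascending pos \<equiv> sorted_wrt (\<lambda>a b. pos a < pos b)"

text \<open>
  The boundary of the disc in clockwise order. The points \<open>Top 0\<close> and \<open>Bot 0\<close> are the two ends
  of the strand on the right wall; a planar drawing hooks them to the vertices \<open>Top (n + 1)\<close> and \<open>Bot (n + 1)\<close>.
  Blob diagrams ignore the hooks, so that one drawing carries a blob diagram on \<open>n\<close> vertices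
  (\<open>drawn_lines\<close>) and a Temperley--Lieb diagram on \<open>n + 1\<close> vertices (\<open>strand_diagram\<close>).
\<close>

definition circ :: "nat \<Rightarrow> point list \<Rightarrow> point list \<Rightarrow> point list" where
 "circ n ls rs = map Top [1..<n + 2] @ [Top 0] @ rs @ [Bot 0] @ rev (map Bot [1..<n + 2]) @ rev ls"

definition planar_drawing ::
 "nat \<Rightarrow> point list \<Rightarrow> point list \<Rightarrow> (point \<Rightarrow> nat) \<Rightarrow> diagram \<Rightarrow> bool" where
 "planar_drawing n ls rs pos E \<longleftrightarrow>
  ascending pos (circ n ls rs) \<and> even (length ls) \<and> even (length rs) \<and>
  matching (set (circ n ls rs)) E \<and> (\<forall>p w q. (p, w, q) \<in> E \<longrightarrow> w = []) \<and> noncrossing pos (und E) \<and>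
  (Top (n + 1), [], Top 0) \<in> E \<and> (Bot 0, [], Bot (n + 1)) \<in> E"

definition blob_glue :: "point list \<Rightarrow> point list \<Rightarrow> diagram" where
 "blob_glue ls rs = link [LeftBlob] ls \<union> link [RightBlob] rs"

definition strand_glue :: "point list \<Rightarrow> point list \<Rightarrow> diagram" where
 "strand_glue ls rs = link [] ls \<union> link [] ([Top 0] @ rs @ [Bot 0])"

definition drawn_lines :: "nat \<Rightarrow> point list \<Rightarrow> point list \<Rightarrow> diagram \<Rightarrow> diagram" where
 "drawn_lines n ls rs E = {(p, w, q). p \<in> vertices n \<and> q \<in> vertices n \<and> apath E (blob_glue ls rs) p w q}"

definition strand_diagram :: "point list \<Rightarrow> point list \<Rightarrow> diagram \<Rightarrow> diagram" where
 "strand_diagram ls rs E = glued E (strand_glue ls rs)"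

lemma asc_distinct: "ascending pos xs \<Longrightarrow> distinct xs" by (induction xs) auto

lemma asc_inj: "ascending pos xs \<Longrightarrow> inj_on pos (set xs)"
proof (induction xs)
 case (Cons a xs)
 have "pos a \<notin> pos ` set xs" using Cons.prems by auto
 with Cons show ?case by auto
qed simp

lemma asc_nth_less_iff:
 assumes "ascending pos xs" "i < length xs" "j < length xs"
 shows "pos (xs ! i) < pos (xs ! j) \<longleftrightarrow> i < j"
 using assms sorted_wrt_nth_less[OF assms(1)] by (metis linorder_neqE_nat order_less_asym)

lemma vertices_alt: "vertices n = set (map Top [1..<n + 1]) \<union> set (map Bot [1..<n + 1])"
proof -
 have "{1..n} = {1..<n + 1}" by auto
 thus ?thesis unfolding vertices_def by (simp only: set_map set_upt)
qed

lemma set_circ: "set (circ n ls rs) = vertices (n + 1) \<union> {Top 0, Bot 0} \<union> set ls \<union> set rs"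
 unfolding circ_def vertices_alt by auto

lemma hooks_notin_vertices [simp]: "Top 0 \<notin> vertices n" "Bot 0 \<notin> vertices n"
 "Top (Suc n) \<notin> vertices n" "Bot (Suc n) \<notin> vertices n" unfolding vertices_def by auto

lemma vertices_Suc: "vertices (Suc n) = vertices n \<union> {Top (Suc n), Bot (Suc n)}" unfolding vertices_def by (auto simp: atLeastAtMostSuc_conv)

locale planar =
 fixes n :: nat and ls rs :: "point list" and pos :: "point \<Rightarrow> nat" and E :: "diagram"
 assumes planar: "planar_drawing n ls rs pos E"
begin

abbreviation "V \<equiv> set (circ n ls rs)"

lemma asc: "ascending pos (circ n ls rs)"
 and even_ls: "even (length ls)" and even_rs: "even (length rs)"
 and E: "matching V E" and lab: "\<And>p w q. (p, w, q) \<in> E \<Longrightarrow> w = []"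
 and nc: "noncrossing pos (und E)"
 and hook_top: "(Top (n + 1), [], Top 0) \<in> E" and hook_bot: "(Bot 0, [], Bot (n + 1)) \<in> E" using planar unfolding planar_drawing_def by blast+

lemma inj: "inj_on pos V" by (rule asc_inj[OF asc])

lemma distinct_circ: "distinct (circ n ls rs)" by (rule asc_distinct[OF asc])

lemma disj: "vertices (n + 1) \<inter> set ls = {}" "vertices (n + 1) \<inter> set rs = {}" "set ls \<inter> set rs = {}"
 "Top 0 \<notin> set ls" "Top 0 \<notin> set rs" "Bot 0 \<notin> set ls" "Bot 0 \<notin> set rs" "distinct ls" "distinct rs"
proof -
 obtain T B where T: "T = map Top [1..<n + 2]" and B: "B = map Bot [1..<n + 2]" by blast
 have v: "vertices (n + 1) = set T \<union> set B" unfolding vertices_alt T B by simp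
 have "distinct (T @ [Top 0] @ rs @ [Bot 0] @ rev B @ rev ls)" using distinct_circ unfolding circ_def T B .
 thus "vertices (n + 1) \<inter> set ls = {}" "vertices (n + 1) \<inter> set rs = {}" "set ls \<inter> set rs = {}"
  "Top 0 \<notin> set ls" "Top 0 \<notin> set rs" "Bot 0 \<notin> set ls" "Bot 0 \<notin> set rs" "distinct ls" "distinct rs" unfolding v by auto
qed

lemma symE: "(p, [], q) \<in> E \<Longrightarrow> (q, [], p) \<in> E" using matchingD(4)[OF E, of p "[]" q] by simp

lemma und_E: "(p, q) \<in> und E \<longleftrightarrow> (p, [], q) \<in> E" using lab unfolding und_iff by blast

lemma uniqE: "(p, [], q) \<in> E \<Longrightarrow> (p, [], q') \<in> E \<Longrightarrow> q = q'" using matching_uniq[OF E] by blast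

lemma exE': "p \<in> V \<Longrightarrow> \<exists>q. (p, [], q) \<in> E" using matching_ex[OF E] lab by blast

lemma finite_V: "finite V" by simp

lemma ncE: "(p, [], q) \<in> E \<Longrightarrow> (x, [], y) \<in> E \<Longrightarrow> pos p < pos x \<Longrightarrow> pos x < pos q \<Longrightarrow> pos p < pos y \<and> pos y < pos q"
 using noncrossing_iff[OF E inj] nc und_E by blast

lemma blob_glue: "matching (set ls \<union> set rs) (blob_glue ls rs)"
 unfolding blob_glue_def using disj even_ls even_rs by (intro matching_Un matching_link) auto

lemma strand_list: "distinct ([Top 0] @ rs @ [Bot 0])" "even (length ([Top 0] @ rs @ [Bot 0]))"
 "set ls \<inter> set ([Top 0] @ rs @ [Bot 0]) = {}" using disj even_rs by auto

lemma strand_glue: "matching (set ls \<union> set ([Top 0] @ rs @ [Bot 0])) (strand_glue ls rs)"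
 unfolding strand_glue_def using disj even_ls strand_list by (intro matching_Un matching_link) auto

lemma strand_rest: "V - (set ls \<union> set ([Top 0] @ rs @ [Bot 0])) = vertices (n + 1)" unfolding set_circ using disj by auto

lemma strand_sub: "set ls \<union> set ([Top 0] @ rs @ [Bot 0]) \<subseteq> V" unfolding set_circ by auto

lemma blob_sub: "set ls \<union> set rs \<subseteq> V" unfolding set_circ by auto

lemma blob_rest: "V - (set ls \<union> set rs) = vertices (n + 1) \<union> {Top 0, Bot 0}" unfolding set_circ using disj by auto

lemma blob_dom: "dom3 (blob_glue ls rs) = set ls \<union> set rs" by (rule dom3_matching[OF blob_glue])

lemma strand_matching: "matching (vertices (n + 1)) (strand_diagram ls rs E)"
 using glued_matching[OF E strand_glue strand_sub] unfolding strand_diagram_def strand_rest by simp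

lemma und_strand: "und (strand_diagram ls rs E) = ends (vertices (n + 1)) (und E \<union> und (strand_glue ls rs))"
 using ends_glued[OF E strand_glue strand_sub] unfolding strand_diagram_def strand_rest by simp

lemma apath_nil:
 assumes "apath E G p w q" "\<And>a u b. (a, u, b) \<in> G \<Longrightarrow> u = []"
 shows "w = []" using assms(1) by (induction rule: apath.induct) (use lab assms(2) in auto)

lemma strand_nil: "(p, w, q) \<in> strand_diagram ls rs E \<Longrightarrow> w = []" unfolding strand_diagram_def glued_def strand_glue_def
 by (auto dest!: apath_nil dest: link_sub)

lemma strand_eqI:
 assumes "planar n ls' rs' pos' E'"
  and "\<And>p q. p \<in> vertices (n + 1) \<Longrightarrow> q \<in> vertices (n + 1) \<Longrightarrow>
   (p, q) \<in> (und E \<union> und (strand_glue ls rs))\<^sup>* \<longleftrightarrow> (p, q) \<in> (und E' \<union> und (strand_glue ls' rs'))\<^sup>*"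
 shows "strand_diagram ls' rs' E' = strand_diagram ls rs E"
proof -
 interpret P: planar n ls' rs' pos' E' by fact
 have "und (strand_diagram ls' rs' E') = und (strand_diagram ls rs E)" unfolding und_strand P.und_strand ends_def using assms(2) by auto
 moreover have "(p, w, q) \<in> strand_diagram ls rs E \<longleftrightarrow> w = [] \<and> (p, q) \<in> und (strand_diagram ls rs E)" for p w q
  using strand_nil unfolding und_iff by blast
 moreover have "(p, w, q) \<in> strand_diagram ls' rs' E' \<longleftrightarrow> w = [] \<and> (p, q) \<in> und (strand_diagram ls' rs' E')" for p w q
  using P.strand_nil unfolding und_iff by blast
 ultimately show ?thesis by auto
qed

lemma lines_glued: "(p, w, q) \<in> drawn_lines n ls rs E \<longleftrightarrow> (p, w, q) \<in> glued E (blob_glue ls rs) \<and> p \<in> vertices n"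
proof -
 have v: "vertices n \<inter> (set ls \<union> set rs) = {}" using disj by (auto simp: vertices_Suc)
 have "(p, w, q) \<in> glued E (blob_glue ls rs) \<longleftrightarrow> apath E (blob_glue ls rs) p w q \<and> p \<notin> set ls \<union> set rs \<and> q \<notin> set ls \<union> set rs"
  unfolding glued_def blob_dom by auto
 moreover have "q \<in> vertices n" if "(p, w, q) \<in> glued E (blob_glue ls rs)" "p \<in> vertices n"
 proof -
  have m: "matching (vertices (n + 1) \<union> {Top 0, Bot 0}) (glued E (blob_glue ls rs))"
   using glued_matching[OF E blob_glue blob_sub] unfolding blob_rest by simp
  have d: "dom3 (blob_glue ls rs) \<inter> hook_ends n = {}" unfolding blob_dom using disj by (auto simp: vertices_Suc)
  have t: "(Top (n + 1), [], Top 0) \<in> glued E (blob_glue ls rs)" unfolding glued_def using d hook_top by (auto intro: apath.start)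
  have b: "(Bot 0, [], Bot (n + 1)) \<in> glued E (blob_glue ls rs)" unfolding glued_def using d hook_bot by (auto intro: apath.start)
  have "q \<noteq> Top 0" using matching_uniq_left[OF m t, of p w] that by auto
  moreover have "q \<noteq> Bot (n + 1)" using matching_uniq_left[OF m b, of p w] that by auto
  moreover have "q \<noteq> Top (n + 1)" using matching_uniq_left[OF m matchingD(4)[OF m t], of p w] that by auto
  moreover have "q \<noteq> Bot 0" using matching_uniq_left[OF m matchingD(4)[OF m b], of p w] that by auto
  moreover have "q \<in> vertices (n + 1) \<union> {Top 0, Bot 0}" using matchingD[OF m that(1)] by blast
  ultimately show ?thesis by (auto simp: vertices_Suc)
 qed
 ultimately show ?thesis unfolding drawn_lines_def using v by auto
qed

lemma lines_matching: "matching (vertices n) (drawn_lines n ls rs E)"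
proof -
 have m: "matching (vertices (n + 1) \<union> {Top 0, Bot 0}) (glued E (blob_glue ls rs))"
  using glued_matching[OF E blob_glue blob_sub] unfolding blob_rest by simp
 show ?thesis
 proof (rule matchingI)
  fix p w q assume A: "(p, w, q) \<in> drawn_lines n ls rs E"
  hence g: "(p, w, q) \<in> glued E (blob_glue ls rs)" "q \<in> vertices n" "p \<in> vertices n"
   unfolding lines_glued by (simp_all add: A[unfolded drawn_lines_def, simplified])
  from matchingD[OF m g(1)] g show "p \<in> vertices n \<and> q \<in> vertices n \<and> p \<noteq> q \<and> (q, rev w, p) \<in> drawn_lines n ls rs E"
   unfolding lines_glued by simp
 next
  fix p assume "p \<in> vertices n"
  thus "\<exists>w q. (p, w, q) \<in> drawn_lines n ls rs E" using matching_ex[OF m, of p] unfolding lines_glued by (simp add: vertices_Suc)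
 next
  fix p w q w' q' assume "(p, w, q) \<in> drawn_lines n ls rs E" "(p, w', q') \<in> drawn_lines n ls rs E"
  thus "w = w' \<and> q = q'" using matching_uniq[OF m, of p w q w' q'] unfolding lines_glued by simp
 qed
qed

end

subsection \<open>Deleting points of the walls\<close>

lemma sorted_wrt_filter': "sorted_wrt P xs \<Longrightarrow> sorted_wrt P (filter Q xs)" by (induction xs) auto

lemma noncrossing_mono: "noncrossing pos M \<Longrightarrow> M' \<subseteq> M \<Longrightarrow> noncrossing pos M'" unfolding noncrossing_def by blast

lemma (in planar) planar_del:
 assumes X: "X \<subseteq> set ls \<union> set rs" "\<And>p w q. (p, w, q) \<in> E \<Longrightarrow> p \<in> X \<Longrightarrow> q \<in> X"
  and l: "ls' = filter (\<lambda>x. x \<notin> X) ls" "even (length ls')" and r: "rs' = filter (\<lambda>x. x \<notin> X) rs" "even (length rs')"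
 shows "planar n ls' rs' pos (del X E)"
proof -
 have out: "x \<notin> X" if "x \<in> vertices (n + 1) \<union> {Top 0, Bot 0}" for x using X disj that by blast
 have vt: "x \<in> vertices (n + 1) \<union> {Top 0, Bot 0}"
  if "x \<in> set (map Top [1..<n + 2] @ [Top 0]) \<union> set ([Bot 0] @ rev (map Bot [1..<n + 2]))" for x using that unfolding vertices_alt by auto
 obtain T B where T: "T = map Top [1..<n + 2] @ [Top 0]" and B: "B = [Bot 0] @ rev (map Bot [1..<n + 2])" by blast
 have f: "filter (\<lambda>x. x \<notin> X) T = T" "filter (\<lambda>x. x \<notin> X) B = B" unfolding T B by (rule filter_True; use out vt in blast)+
 have c: "circ n ls' rs' = filter (\<lambda>x. x \<notin> X) (circ n ls rs)"
 proof -
  have "circ n ls rs = T @ rs @ B @ rev ls" for ls rs unfolding circ_def T B by simp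
  thus ?thesis unfolding l r by (simp add: f rev_filter)
 qed
 have "set (circ n ls' rs') = V - X" unfolding c by auto
 hence m: "matching (set (circ n ls' rs')) (del X E)" using matching_del[OF E X(2)] by simp
 have "noncrossing pos (und (del X E))" by (rule noncrossing_mono[OF nc]) (auto simp: und_iff del_iff)
 moreover have "(Top (n + 1), [], Top 0) \<in> del X E" "(Bot 0, [], Bot (n + 1)) \<in> del X E"
  unfolding del_iff using hook_top hook_bot out by (simp_all add: vertices_Suc)
 moreover have "ascending pos (circ n ls' rs')" unfolding c by (rule sorted_wrt_filter'[OF asc])
 moreover have "\<forall>p w q. (p, w, q) \<in> del X E \<longrightarrow> w = []" using lab unfolding del_iff by blast
 ultimately show ?thesis using l r m unfolding planar_def planar_drawing_def by simp
qed

lemma filter_pair: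
 assumes "distinct (A @ [a, b] @ C)"
 shows "filter (\<lambda>x. x \<notin> {a, b}) (A @ [a, b] @ C) = A @ C"
proof -
 have "filter (\<lambda>x. x \<notin> {a, b}) A = A" "filter (\<lambda>x. x \<notin> {a, b}) C = C" by (rule filter_True; use assms in auto)+
 thus ?thesis by simp
qed

text \<open>
  The lines agree up to \<open>LL = L\<close> and \<open>RR = R\<close>; scalars are counted separately.
\<close>

definition collapses :: "diagram \<Rightarrow> diagram \<Rightarrow> bool" where
 "collapses D D' \<longleftrightarrow> (\<forall>p w q. (p, w, q) \<in> D \<longrightarrow> (\<exists>w'. (p, w', q) \<in> D' \<and> remdups_adj w' = remdups_adj w))"

lemma collapses_refl: "collapses D D" unfolding collapses_def by blast

lemma collapses_trans: "collapses D D' \<Longrightarrow> collapses D' D'' \<Longrightarrow> collapses D D''" unfolding collapses_def by metis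

lemma del_subset_Un: "del X (A \<union> B) = del X A \<union> del X B" unfolding del_def by auto

lemma del_disjoint: "(\<And>p w q. (p, w, q) \<in> G \<Longrightarrow> p \<notin> X \<and> q \<notin> X) \<Longrightarrow> del X G = G"
 unfolding del_def by auto

context planar begin

text \<open>
  Two neighbouring points of a wall joined by a line: either they belong to the same blob, and the blob
  sits on a loop of its own, or the line carries two consecutive blobs, which become one.
\<close>

lemma delete_pair:
 assumes ab: "(a, [], b) \<in> E"
  and cs: "(ls = A @ [a, b] @ C \<and> ls' = A @ C \<and> rs' = rs) \<or> (rs = A @ [a, b] @ C \<and> rs' = A @ C \<and> ls' = ls)"
 shows "planar n ls' rs' pos (del {a, b} E)"
  and "strand_diagram ls' rs' (del {a, b} E) = strand_diagram ls rs E"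
  and "collapses (drawn_lines n ls rs E) (drawn_lines n ls' rs' (del {a, b} E))"
proof -
 have Eab: "p \<in> {a, b} \<longleftrightarrow> q \<in> {a, b}" if "(p, w, q) \<in> E" for p w q
  using that matching_uniq[OF E ab, of w q] matching_uniq[OF E symE[OF ab], of w q]
   matching_uniq_left[OF E ab, of p w] matching_uniq_left[OF E symE[OF ab], of p w] by blast
 have X: "{a, b} \<subseteq> set ls \<union> set rs" using cs by auto
 have dist: "distinct ls" "distinct rs" "set ls \<inter> set rs = {}" using disj by auto
 have dAC: "distinct (A @ [a, b] @ C)" using cs dist by auto
 have lenAC: "even (length (A @ C))" using cs even_ls even_rs by auto
 have fl: "ls' = filter (\<lambda>x. x \<notin> {a, b}) ls" "even (length ls')" "rs' = filter (\<lambda>x. x \<notin> {a, b}) rs" "even (length rs')"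
 proof -
  have *: "filter (\<lambda>x. x \<notin> {a, b}) zs = zs" if "{a, b} \<inter> set zs = {}" for zs by (rule filter_True) (use that in blast)
  from cs have "(ls' = filter (\<lambda>x. x \<notin> {a, b}) ls \<and> even (length ls')) \<and> (rs' = filter (\<lambda>x. x \<notin> {a, b}) rs \<and> even (length rs'))"
  proof (elim disjE conjE)
   assume h: "ls = A @ [a, b] @ C" "ls' = A @ C" "rs' = rs"
   have "{a, b} \<inter> set rs = {}" using h dist by auto
   with h show ?thesis using filter_pair[OF dAC] *[of rs] lenAC even_rs by simp
  next
   assume h: "rs = A @ [a, b] @ C" "rs' = A @ C" "ls' = ls"
   have "{a, b} \<inter> set ls = {}" using h dist by auto
   with h show ?thesis using filter_pair[OF dAC] *[of ls] lenAC even_ls by simp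
  qed
  thus "ls' = filter (\<lambda>x. x \<notin> {a, b}) ls" "even (length ls')" "rs' = filter (\<lambda>x. x \<notin> {a, b}) rs" "even (length rs')"
   by blast+
 qed
 show P: "planar n ls' rs' pos (del {a, b} E)" by (rule planar_del[OF X _ fl]) (use Eab in blast)
 have vab: "p \<notin> {a, b}" if "p \<in> vertices (n + 1)" for p using that X disj by blast
 show "strand_diagram ls' rs' (del {a, b} E) = strand_diagram ls rs E"
 proof (rule strand_eqI[OF P])
  fix p q assume pq: "p \<in> vertices (n + 1)" "q \<in> vertices (n + 1)"
  from cs show "(p, q) \<in> (und E \<union> und (strand_glue ls rs))\<^sup>* \<longleftrightarrow>
    (p, q) \<in> (und (del {a, b} E) \<union> und (strand_glue ls' rs'))\<^sup>*"
  proof (elim disjE conjE)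
   assume h: "ls = A @ [a, b] @ C" "ls' = A @ C" "rs' = rs"
   have Y: "x \<notin> {a, b} \<and> y \<notin> {a, b}" if "(x, y) \<in> und (link [] ([Top 0] @ rs @ [Bot 0]) :: diagram)" for x y
    using und_link_sub[OF that] h strand_list(3) by auto
   show ?thesis using rtrancl_delete_pair[OF E ab dAC lenAC Y vab[OF pq(1)] vab[OF pq(2)], where u = "[] :: blob list"]
    unfolding strand_glue_def und_Un h by (simp only: Un_assoc)
  next
   assume h: "rs = A @ [a, b] @ C" "rs' = A @ C" "ls' = ls"
   have Y: "x \<notin> {a, b} \<and> y \<notin> {a, b}" if "(x, y) \<in> und (link [] ls :: diagram)" for x y
    using und_link_sub[OF that] h strand_list(3) by auto
   have d': "distinct (([Top 0] @ A) @ [a, b] @ (C @ [Bot 0]))" "even (length (([Top 0] @ A) @ (C @ [Bot 0])))"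
    using strand_list(1) lenAC unfolding h by auto
   have eq: "[Top 0] @ rs @ [Bot 0] = ([Top 0] @ A) @ [a, b] @ (C @ [Bot 0])"
    "[Top 0] @ rs' @ [Bot 0] = ([Top 0] @ A) @ (C @ [Bot 0])" using h by simp_all
   show ?thesis using rtrancl_delete_pair[OF E ab d', where u = "[] :: blob list" and p = p and q = q
      and Y = "und (link [] ls :: diagram)", OF Y vab[OF pq(1)] vab[OF pq(2)]] unfolding strand_glue_def und_Un eq h(3) by (simp only: ac_simps)
  qed
 qed
 obtain s zs where sz: "blob_glue ls rs = link [s] (A @ [a, b] @ C) \<union> zs" "blob_glue ls' rs' = link [s] (A @ C) \<union> zs"
  "\<And>p w q. (p, w, q) \<in> zs \<Longrightarrow> p \<notin> {a, b} \<and> q \<notin> {a, b}"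
 proof -
  from cs show ?thesis
  proof (elim disjE conjE)
   assume h: "ls = A @ [a, b] @ C" "ls' = A @ C" "rs' = rs"
   have "p \<notin> {a, b} \<and> q \<notin> {a, b}" if "(p, w, q) \<in> link [RightBlob] rs" for p w q using link_sub[OF that] dist h by auto
   thus ?thesis using h by (intro that[of LeftBlob "link [RightBlob] rs"]) (auto simp: blob_glue_def)
  next
   assume h: "rs = A @ [a, b] @ C" "rs' = A @ C" "ls' = ls"
   have "p \<notin> {a, b} \<and> q \<notin> {a, b}" if "(p, w, q) \<in> link [LeftBlob] ls" for p w q using link_sub[OF that] dist h by auto
   thus ?thesis using h by (intro that[of RightBlob "link [LeftBlob] ls"]) (auto simp: blob_glue_def)
  qed
 qed
 show "collapses (drawn_lines n ls rs E) (drawn_lines n ls' rs' (del {a, b} E))" unfolding collapses_def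
 proof (intro allI impI)
  fix p w q assume "(p, w, q) \<in> drawn_lines n ls rs E"
  hence pq: "p \<in> vertices n" "q \<in> vertices n" "apath E (blob_glue ls rs) p w q" unfolding drawn_lines_def by auto
  have nab: "p \<notin> {a, b}" "q \<notin> {a, b}" using vab[of p] vab[of q] pq by (simp_all add: vertices_Suc)
  have "\<exists>w'. apath (del {a, b} E) (blob_glue ls' rs') p w' q \<and> remdups_adj w' = remdups_adj w"
  proof (cases "even (length A)")
   case True
   have GX: "p \<in> {a, b} \<longleftrightarrow> q \<in> {a, b}" if G: "(p, w, q) \<in> blob_glue ls rs" for p w q
   proof -
    have AC: "x \<notin> {a, b} \<and> y \<notin> {a, b}" if "(x, v, y) \<in> link [s] (A @ C)" for x v y using link_sub[OF that] dAC by auto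
    from G have "(p, w, q) \<in> link [s] (A @ C) \<or> (p, w, q) \<in> {(a, [s], b), (b, rev [s], a)} \<or> (p, w, q) \<in> zs"
     unfolding sz link_even[OF True] by blast
    thus ?thesis using AC[of p w q] sz(3)[of p w q] by auto
   qed
   have "apath (del {a, b} E) (del {a, b} (blob_glue ls rs)) p w q" by (rule conjunct1[OF apath_del[OF pq(3) nab(1)]]) (erule Eab, erule GX)
   moreover have "del {a, b} (blob_glue ls rs) \<subseteq> blob_glue ls' rs'" unfolding sz link_even[OF True] del_def by auto
   ultimately have "apath (del {a, b} E) (blob_glue ls' rs') p w q" by (rule apath_mono[OF _ subset_refl])
   thus ?thesis by blast
  next
   case False
   have "A \<noteq> []" "C \<noteq> []" using False lenAC by auto
   then obtain A' x y C' where AC: "A = A' @ [x]" "C = y # C'" by (metis rev_exhaust neq_Nil_conv)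
   show ?thesis unfolding sz(2) by (rule mp[OF conjunct1[OF apath_merge[OF E _ ab dAC False AC _ pq(3)[unfolded sz(1)] nab(1)]] nab(2)])
     (erule lab, erule sz(3))
  qed
  thus "\<exists>w'. (p, w', q) \<in> drawn_lines n ls' rs' (del {a, b} E) \<and> remdups_adj w' = remdups_adj w"
   unfolding drawn_lines_def using pq by auto
 qed
qed

text \<open>
  Two parallel lines between the walls. If they sit at one blob on the left and at one blob on the
  right (\<open>A\<close> and \<open>C\<close> even) they form a loop with both kinds of blob, which vanishes. In the odd case the blob
  diagram changes as in the topological relation; the strand diagram stays the same in both cases.
\<close>

lemma delete_ladder:
 assumes e: "(a, [], c) \<in> E" "(b, [], d) \<in> E"
  and l: "ls = A @ [a, b] @ B" and r: "rs = C @ [c, d] @ D" and par: "even (length A) \<longleftrightarrow> even (length C)"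
 shows "planar n (A @ B) (C @ D) pos (del {a, b, c, d} E)"
  and "strand_diagram (A @ B) (C @ D) (del {a, b, c, d} E) = strand_diagram ls rs E"
  and "even (length A) \<Longrightarrow> collapses (drawn_lines n ls rs E) (drawn_lines n (A @ B) (C @ D) (del {a, b, c, d} E))"
proof -
 let ?X = "{a, b, c, d}"
 have EX: "p \<in> ?X \<longleftrightarrow> q \<in> ?X" if "(p, w, q) \<in> E" for p w q
 proof -
  have "p = a \<Longrightarrow> q = c" using matching_uniq[OF E e(1), of w q] that by simp
  moreover have "p = b \<Longrightarrow> q = d" using matching_uniq[OF E e(2), of w q] that by simp
  moreover have "p = c \<Longrightarrow> q = a" using matching_uniq[OF E symE[OF e(1)], of w q] that by simp
  moreover have "p = d \<Longrightarrow> q = b" using matching_uniq[OF E symE[OF e(2)], of w q] that by simp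
  moreover have "q = c \<Longrightarrow> p = a" using matching_uniq_left[OF E e(1), of p w] that by simp
  moreover have "q = d \<Longrightarrow> p = b" using matching_uniq_left[OF E e(2), of p w] that by simp
  moreover have "q = a \<Longrightarrow> p = c" using matching_uniq_left[OF E symE[OF e(1)], of p w] that by simp
  moreover have "q = b \<Longrightarrow> p = d" using matching_uniq_left[OF E symE[OF e(2)], of p w] that by simp
  ultimately show ?thesis by blast
 qed
 have X: "?X \<subseteq> set ls \<union> set rs" using l r by auto
 have dl: "distinct (A @ [a, b] @ B)" and dr: "distinct (C @ [c, d] @ D)" using disj l r by auto
 have lr: "(set A \<union> {a, b} \<union> set B) \<inter> (set C \<union> {c, d} \<union> set D) = {}" using disj(3) unfolding l r by auto
 have len: "even (length (A @ B))" "even (length (C @ D))" using even_ls even_rs l r by auto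
 have fl: "A @ B = filter (\<lambda>x. x \<notin> ?X) ls"
 proof -
  have "filter (\<lambda>x. x \<notin> ?X) ls = filter (\<lambda>x. x \<notin> {a, b}) ls" by (rule filter_cong) (use lr l in auto)
  thus ?thesis using filter_pair[OF dl] l by simp
 qed
 have fr: "C @ D = filter (\<lambda>x. x \<notin> ?X) rs"
 proof -
  have "filter (\<lambda>x. x \<notin> ?X) rs = filter (\<lambda>x. x \<notin> {c, d}) rs" by (rule filter_cong) (use lr r in auto)
  thus ?thesis using filter_pair[OF dr] r by simp
 qed
 show P: "planar n (A @ B) (C @ D) pos (del ?X E)" by (rule planar_del[OF X _ fl len(1) fr len(2)]) (use EX in blast)
 have vX: "p \<notin> ?X" if "p \<in> vertices (n + 1)" for p using that X disj by blast
 have s: "[Top 0] @ rs @ [Bot 0] = ([Top 0] @ C) @ [c, d] @ (D @ [Bot 0])"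
  "[Top 0] @ (C @ D) @ [Bot 0] = ([Top 0] @ C) @ (D @ [Bot 0])" unfolding r by simp_all
 have dr': "distinct (([Top 0] @ C) @ [c, d] @ (D @ [Bot 0]))" using strand_list(1) unfolding s(1) .
 have lr': "(set A \<union> {a, b} \<union> set B) \<inter> (set ([Top 0] @ C) \<union> {c, d} \<union> set (D @ [Bot 0])) = {}"
  using strand_list(3) unfolding s(1) l by auto
 show "strand_diagram (A @ B) (C @ D) (del ?X E) = strand_diagram ls rs E"
 proof (rule strand_eqI[OF P])
  fix p q assume pq: "p \<in> vertices (n + 1)" "q \<in> vertices (n + 1)"
  show "(p, q) \<in> (und E \<union> und (strand_glue ls rs))\<^sup>* \<longleftrightarrow>
    (p, q) \<in> (und (del ?X E) \<union> und (strand_glue (A @ B) (C @ D)))\<^sup>*"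
  proof (cases "even (length A)")
   case True
   have o: "odd (length ([Top 0] @ C))" "even (length (([Top 0] @ C) @ (D @ [Bot 0])))" using True par len by auto
   show ?thesis using rtrancl_delete_ladder[OF E e dl dr' lr' True o vX[OF pq(1)] vX[OF pq(2)], where u = "[] :: blob list" and v = "[] :: blob list"]
    unfolding strand_glue_def und_Un s l by (simp only: Un_assoc)
  next
   case False
   have o: "even (length ([Top 0] @ C))" using False par by auto
   have X': "{c, d, a, b} = ?X" by blast
   have lr'': "(set ([Top 0] @ C) \<union> {c, d} \<union> set (D @ [Bot 0])) \<inter> (set A \<union> {a, b} \<union> set B) = {}" using lr' by blast
   show ?thesis
    using rtrancl_delete_ladder[OF E symE[OF e(1)] symE[OF e(2)] dr' dl lr'' o False len(1), where p = p and q = q and u = "[] :: blob list" and v = "[] :: blob list"]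
     vX[OF pq(1)] vX[OF pq(2)] unfolding strand_glue_def und_Un s l X' by (simp only: ac_simps simp_thms)
  qed
 qed
 assume even: "even (length A)"
 hence evenC: "even (length C)" using par by simp
 show "collapses (drawn_lines n ls rs E) (drawn_lines n (A @ B) (C @ D) (del ?X E))" unfolding collapses_def
 proof (intro allI impI)
  fix p w q assume "(p, w, q) \<in> drawn_lines n ls rs E"
  hence pq: "p \<in> vertices n" "q \<in> vertices n" "apath E (blob_glue ls rs) p w q" unfolding drawn_lines_def by auto
  have nX: "p \<notin> ?X" using vX[of p] pq by (simp add: vertices_Suc)
  have gl: "blob_glue ls rs = blob_glue (A @ B) (C @ D) \<union> {(a, [LeftBlob], b), (b, [LeftBlob], a), (c, [RightBlob], d), (d, [RightBlob], c)}"
   unfolding blob_glue_def l r link_even[OF even] link_even[OF evenC] by auto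
  have out: "x \<notin> ?X \<and> y \<notin> ?X" if "(x, v, y) \<in> blob_glue (A @ B) (C @ D)" for x v y
  proof -
   have "x \<in> set A \<union> set B \<and> y \<in> set A \<union> set B \<or> x \<in> set C \<union> set D \<and> y \<in> set C \<union> set D"
    using that unfolding blob_glue_def by (auto dest: link_sub)
   thus ?thesis using dl dr lr by auto
  qed
  have GX: "x \<in> ?X \<longleftrightarrow> y \<in> ?X" if "(x, v, y) \<in> blob_glue ls rs" for x v y using that out[of x v y] unfolding gl by auto
  have "apath (del ?X E) (del ?X (blob_glue ls rs)) p w q" by (rule conjunct1[OF apath_del[OF pq(3) nX]]) (erule EX, erule GX)
  moreover have "del ?X (blob_glue ls rs) \<subseteq> blob_glue (A @ B) (C @ D)" unfolding gl del_def by auto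
  ultimately have "apath (del ?X E) (blob_glue (A @ B) (C @ D)) p w q" by (rule apath_mono[OF _ subset_refl])
  thus "\<exists>w'. (p, w', q) \<in> drawn_lines n (A @ B) (C @ D) (del ?X E) \<and> remdups_adj w' = remdups_adj w"
   unfolding drawn_lines_def using pq by auto
 qed
qed

end

subsection \<open>Reducing a drawing\<close>

text \<open>
  No loop is left that could be deleted, and no two consecutive blobs of the same kind; two parallel lines between
  the walls can only be the rungs of the topological relation.
\<close>

definition irreducible_drawing :: "point list \<Rightarrow> point list \<Rightarrow> diagram \<Rightarrow> bool" where
 "irreducible_drawing ls rs E \<longleftrightarrow>
  (\<forall>A a b C. ls = A @ [a, b] @ C \<or> rs = A @ [a, b] @ C \<longrightarrow> (a, [], b) \<notin> E) \<and>
  (\<forall>A a b B C c d D. ls = A @ [a, b] @ B \<longrightarrow> rs = C @ [c, d] @ D \<longrightarrow> even (length A) \<longrightarrow> even (length C) \<longrightarrow>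
   (a, [], c) \<in> E \<longrightarrow> (b, [], d) \<notin> E)"

text \<open>
  Each deletion shortens the walls.
\<close>

theorem ex_irreducible:
 assumes "planar n ls rs pos E"
 shows "\<exists>ls' rs' E'. planar n ls' rs' pos E' \<and> irreducible_drawing ls' rs' E' \<and>
  strand_diagram ls' rs' E' = strand_diagram ls rs E \<and> collapses (drawn_lines n ls rs E) (drawn_lines n ls' rs' E')"
 using assms
proof (induction "length ls + length rs" arbitrary: ls rs E rule: less_induct)
 case less
 interpret planar n ls rs pos E by fact
 have finish: ?case if "planar n ls' rs' pos E'" "strand_diagram ls' rs' E' = strand_diagram ls rs E"
  "collapses (drawn_lines n ls rs E) (drawn_lines n ls' rs' E')" "length ls' + length rs' < length ls + length rs" for ls' rs' E'
  using less.hyps[OF that(4,1)] that(2,3) collapses_trans by metis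
 show ?case
 proof (cases "irreducible_drawing ls rs E")
  case True
  thus ?thesis using less.prems collapses_refl by blast
 next
  case False
  then consider (1) A a b C where "ls = A @ [a, b] @ C" "(a, [], b) \<in> E"
   | (2) A a b C where "rs = A @ [a, b] @ C" "(a, [], b) \<in> E"
   | (3) A a b B C c d D where "ls = A @ [a, b] @ B" "rs = C @ [c, d] @ D" "even (length A)" "even (length C)"
    "(a, [], c) \<in> E" "(b, [], d) \<in> E" unfolding irreducible_drawing_def by blast
  thus ?thesis
  proof cases
   case 1
   hence c: "(ls = A @ [a, b] @ C \<and> A @ C = A @ C \<and> rs = rs) \<or> (rs = A @ [a, b] @ C \<and> rs = A @ C \<and> A @ C = ls)" by blast
   show ?thesis by (rule finish[OF delete_pair[OF 1(2) c]]) (simp add: 1)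
  next
   case 2
   hence c: "(ls = A @ [a, b] @ C \<and> ls = A @ C \<and> A @ C = rs) \<or> (rs = A @ [a, b] @ C \<and> A @ C = A @ C \<and> ls = ls)" by blast
   show ?thesis by (rule finish[OF delete_pair[OF 2(2) c]]) (simp add: 2)
  next
   case 3
   have par: "even (length A) \<longleftrightarrow> even (length C)" using 3 by simp
   show ?thesis by (rule finish[OF delete_ladder(1,2)[OF 3(5,6,1,2) par] delete_ladder(3)[OF 3(5,6,1,2) par 3(3)]]) (simp add: 3)
  qed
 qed
qed

section \<open>Irreducible drawings\<close>

lemma matching_total_eq:
 assumes "matching V E'" "E \<subseteq> E'" "\<And>p. p \<in> V \<Longrightarrow> \<exists>w q. (p, w, q) \<in> E"
 shows "E = E'"
proof (intro equalityI assms(2) subrelI)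
 fix p z assume A: "(p, z) \<in> E'"
 obtain w q where z: "z = (w, q)" by (cases z)
 hence "p \<in> V" using A matchingD[OF assms(1)] by blast
 then obtain w' q' where "(p, w', q') \<in> E" using assms(3) by blast
 thus "(p, z) \<in> E" using A z assms(2) matching_uniq[OF assms(1), of p w q w' q'] by auto
qed

lemma even_card_matching: "matching V E \<Longrightarrow> finite V \<Longrightarrow> even (card V)" using card_comps_matching by (metis dvd_triv_left)

context planar begin

definition "tops = map Top [1..<n + 2] @ [Top 0]"
definition "bots = [Bot 0] @ rev (map Bot [1..<n + 2])"

lemma circ_split: "circ n ls rs = tops @ rs @ bots @ rev ls" unfolding circ_def tops_def bots_def by simp

lemma set_tops: "set tops = insert (Top 0) (Top ` {1..n + 1})"
 and set_bots: "set bots = insert (Bot 0) (Bot ` {1..n + 1})"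
proof -
 have "{1..n + 1} = {1..<n + 2}" by auto
 thus "set tops = insert (Top 0) (Top ` {1..n + 1})" "set bots = insert (Bot 0) (Bot ` {1..n + 1})"
  unfolding tops_def bots_def by (simp_all only: set_append set_map set_upt set_rev list.set Un_insert_right Un_insert_left sup_bot_left sup_bot_right)
qed

lemma V_split: "V = set tops \<union> set rs \<union> set bots \<union> set ls" unfolding circ_split by auto

lemma asc_parts:
 "ascending pos tops" "ascending pos rs"
 "ascending pos bots" "ascending pos (rev ls)"
 "x \<in> set tops \<Longrightarrow> y \<in> set rs \<union> set bots \<union> set ls \<Longrightarrow> pos x < pos y"
 "x \<in> set rs \<Longrightarrow> y \<in> set bots \<union> set ls \<Longrightarrow> pos x < pos y"
 "x \<in> set bots \<Longrightarrow> y \<in> set ls \<Longrightarrow> pos x < pos y" using asc unfolding circ_split sorted_wrt_append by auto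

lemma pos_rs: "i < length rs \<Longrightarrow> j < length rs \<Longrightarrow> pos (rs ! i) < pos (rs ! j) \<longleftrightarrow> i < j"
 by (rule asc_nth_less_iff[OF asc_parts(2)])

lemma pos_ls: assumes "i < length ls" "j < length ls" shows "pos (ls ! i) < pos (ls ! j) \<longleftrightarrow> j < i"
proof -
 have "ls ! i = rev ls ! (length ls - 1 - i)" "ls ! j = rev ls ! (length ls - 1 - j)" using assms by (simp_all add: rev_nth)
 thus ?thesis using asc_nth_less_iff[OF asc_parts(4), of "length ls - 1 - i" "length ls - 1 - j"] assms by auto
qed

lemma pos_Top: assumes "i \<in> {1..n}" "j \<in> {1..n}" shows "pos (Top i) < pos (Top j) \<longleftrightarrow> i < j"
proof -
 have "i - Suc 0 < Suc n" "j - Suc 0 < Suc n" using assms unfolding atLeastAtMost_iff by linarith+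
 hence "Top i = tops ! (i - 1)" "Top j = tops ! (j - 1)" using assms unfolding tops_def by (simp_all add: nth_append del: upt_Suc)
 moreover have "i - 1 < length tops" "j - 1 < length tops"
 proof -
  have lt: "length tops = n + 2" unfolding tops_def by simp
  show "i - 1 < length tops" "j - 1 < length tops" using assms unfolding lt atLeastAtMost_iff by linarith+
 qed
 ultimately have "pos (Top i) < pos (Top j) \<longleftrightarrow> i - 1 < j - 1" using asc_nth_less_iff[OF asc_parts(1)] by simp
 thus ?thesis using assms by auto
qed

lemma pos_Bot: assumes "i \<in> {1..n}" "j \<in> {1..n}" shows "pos (Bot i) < pos (Bot j) \<longleftrightarrow> j < i"
proof -
 have "ascending pos (rev (map Bot [1..<n + 2]))" using asc_parts(3) unfolding bots_def by simp
 hence s: "sorted_wrt (\<lambda>a b. pos b < pos a) (map Bot [1..<n + 2])" unfolding sorted_wrt_rev .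
 have *: "pos (Bot l) < pos (Bot k)" if "k < l" "k \<in> {1..n}" "l \<in> {1..n}" for k l
 proof -
  have "Bot k = map Bot [1..<n + 2] ! (k - 1)" "Bot l = map Bot [1..<n + 2] ! (l - 1)" using that by (simp_all del: upt_Suc)
  thus ?thesis using sorted_wrt_nth_less[OF s, of "k - 1" "l - 1"] that by auto
 qed
 show ?thesis using *[of i j] *[of j i] assms by (metis linorder_neqE_nat order_less_asym)
qed

text \<open>
  The points strictly between the ends of a line are paired with each other.
\<close>

lemma parity:
 assumes e: "(circ n ls rs ! i, [], circ n ls rs ! j) \<in> E" and ij: "i < j" "j < length (circ n ls rs)"
 shows "odd (i + j)"
proof -
 let ?c = "circ n ls rs"
 define S where "S = (\<lambda>k. ?c ! k) ` {i<..<j}"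
 have S: "x \<in> S \<longleftrightarrow> x \<in> V \<and> pos (?c ! i) < pos x \<and> pos x < pos (?c ! j)" for x
 proof
  assume "x \<in> S"
  thus "x \<in> V \<and> pos (?c ! i) < pos x \<and> pos x < pos (?c ! j)" unfolding S_def using asc_nth_less_iff[OF asc] ij by auto
 next
  assume x: "x \<in> V \<and> pos (?c ! i) < pos x \<and> pos x < pos (?c ! j)"
  then obtain k where "k < length ?c" "x = ?c ! k" by (metis in_set_conv_nth)
  thus "x \<in> S" unfolding S_def using asc_nth_less_iff[OF asc, of i k] asc_nth_less_iff[OF asc, of k j] x ij by auto
 qed
 have cl: "q \<in> S" if "(p, w, q) \<in> E" "p \<in> S" for p w q
 proof -
  have w: "(p, [], q) \<in> E" using that lab by blast
  have "q \<in> V" using matchingD[OF E that(1)] by blast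
  thus ?thesis using ncE[OF e w] that(2) S by blast
 qed
 have "q \<in> V - S" if "(p, w, q) \<in> E" "p \<in> V - S" for p w q
  using cl[OF matchingD(4)[OF E that(1)]] matchingD[OF E that(1)] that(2) by blast
 hence "matching (V - (V - S)) (del (V - S) E)" by (intro matching_del[OF E])
 moreover have "V - (V - S) = S" using S by blast
 ultimately have "even (card S)" using even_card_matching[of S] finite_V by (simp add: S_def)
 moreover have "card S = j - i - 1"
 proof -
  have "inj_on (\<lambda>k. ?c ! k) {i<..<j}" using nth_eq_iff_index_eq[OF distinct_circ] ij by (auto simp: inj_on_def)
  thus ?thesis unfolding S_def by (simp add: card_image)
 qed
 ultimately have "even (j - i - 1)" by simp
 thus ?thesis using ij(1) by presburger
qed

text \<open>
  The \<open>n + 2\<close> points at the bottom, hooks included, lie between the two walls.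
\<close>

lemma wall_parity:
 assumes "even n" "(ls ! a, [], rs ! b) \<in> E" "a < length ls" "b < length rs"
 shows "even a \<longleftrightarrow> even b"
proof -
 let ?c = "circ n ls rs"
 have lt: "length tops = n + 2" "length bots = n + 2" unfolding tops_def bots_def by auto
 have r: "?c ! (n + 2 + b) = rs ! b" unfolding circ_split using lt assms(4) by (simp add: nth_append)
 have l: "?c ! (n + 2 + length rs + (n + 2) + (length ls - 1 - a)) = ls ! a"
 proof -
  have "((tops @ rs @ bots) @ rev ls) ! (length (tops @ rs @ bots) + (length ls - 1 - a)) = ls ! a"
   unfolding nth_append_length_plus using assms(3) by (simp add: rev_nth)
  moreover have "length (tops @ rs @ bots) = n + 2 + length rs + (n + 2)" using lt by simp
  ultimately show ?thesis unfolding circ_split by (simp only: append_assoc)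
 qed
 have "odd ((n + 2 + b) + (n + 2 + length rs + (n + 2) + (length ls - 1 - a)))"
  by (rule parity) (use r l symE[OF assms(2)] assms lt in \<open>auto simp: circ_split\<close>)
 moreover have "length ls - 1 - a + a + 1 = length ls" using assms(3) by simp
 ultimately show ?thesis using assms(1) even_rs even_ls by presburger
qed

text \<open>
  A line between two points of a wall encloses an innermost one, which joins neighbours.
\<close>

lemma no_pair:
 assumes c: "circ n ls rs = P @ zs @ Q"
  and adj: "\<And>A a b C. zs = A @ [a, b] @ C \<Longrightarrow> (a, [], b) \<notin> E"
  and ij: "i < j" "j < length zs"
 shows "(zs ! i, [], zs ! j) \<notin> E" using ij
proof (induction "j - i" arbitrary: i j rule: less_induct)
 case less
 show ?case
 proof
  assume e: "(zs ! i, [], zs ! j) \<in> E"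
  have zc: "zs ! k = circ n ls rs ! (length P + k)" if "k < length zs" for k using that unfolding c by (simp add: nth_append)
  have len: "length P + length zs \<le> length (circ n ls rs)" unfolding c by simp
  have less_iff: "pos (zs ! k) < pos (zs ! m) \<longleftrightarrow> k < m" if "k < length zs" "m < length zs" for k m
   using asc_nth_less_iff[OF asc, of "length P + k" "length P + m"] that len by (simp add: zc)
  show False
  proof (cases "j = Suc i")
   case True
   have "zs = take i zs @ [zs ! i, zs ! j] @ drop (Suc (Suc i)) zs" using True less.prems by (simp add: Cons_nth_drop_Suc id_take_nth_drop[symmetric])
   thus False using adj e by metis
  next
   case False
   let ?k = "Suc i"
   have k: "?k < j" using False less.prems by simp
   have "zs ! ?k \<in> V" unfolding c using k less.prems by simp
   then obtain y where y: "(zs ! ?k, [], y) \<in> E" using exE' by blast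
   have b: "pos (zs ! i) < pos y \<and> pos y < pos (zs ! j)" by (rule ncE[OF e y]) (use k less.prems less_iff in auto)
   have "y \<in> V" using matchingD[OF E y] by blast
   then obtain m where m: "m < length (circ n ls rs)" "y = circ n ls rs ! m" by (metis in_set_conv_nth)
   have "length P + i < m" "m < length P + j"
    using b m less.prems len asc_nth_less_iff[OF asc, of "length P + i" m] asc_nth_less_iff[OF asc, of m "length P + j"] by (simp_all add: zc)
   hence m': "y = zs ! (m - length P)" "i < m - length P" "m - length P < j" using m zc[of "m - length P"] less.prems by auto
   have "m - length P \<noteq> ?k" using m'(1) y matchingD(3)[OF E y] by auto
   hence "?k < m - length P" using m' by simp
   thus False using less.hyps[of "m - length P" ?k] m' y less.prems by auto
  qed
 qed
qed

end

locale irreducible = planar +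
 assumes irr: "irreducible_drawing ls rs E" and even_n: "even n"
begin

lemma no_rs: assumes "x \<in> set rs" "y \<in> set rs" shows "(x, [], y) \<notin> E"
proof
 assume e: "(x, [], y) \<in> E"
 obtain i j where ij: "i < length rs" "j < length rs" "x = rs ! i" "y = rs ! j" using assms by (metis in_set_conv_nth)
 have *: "(rs ! k, [], rs ! l) \<notin> E" if "k < l" "l < length rs" for k l
  by (rule no_pair[OF circ_split _ that]) (use irr in \<open>auto simp: irreducible_drawing_def\<close>)
 have "i \<noteq> j" using matchingD(3)[OF E e] ij by auto
 thus False using *[of i j] *[of j i] e symE[OF e] ij by (metis linorder_neqE_nat)
qed

lemma no_ls: assumes "x \<in> set ls" "y \<in> set ls" shows "(x, [], y) \<notin> E"
proof
 assume e: "(x, [], y) \<in> E"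
 have "x \<in> set (rev ls)" "y \<in> set (rev ls)" using assms by auto
 then obtain i j where ij: "i < length (rev ls)" "j < length (rev ls)" "x = rev ls ! i" "y = rev ls ! j" by (metis in_set_conv_nth)
 have adj: "(a, [], b) \<notin> E" if "rev ls = A @ [a, b] @ C" for A a b C
 proof
  assume ab: "(a, [], b) \<in> E"
  have "ls = rev C @ [b, a] @ rev A" using arg_cong[OF that, of rev] by simp
  thus False using irr symE[OF ab] unfolding irreducible_drawing_def by blast
 qed
 have *: "(rev ls ! k, [], rev ls ! l) \<notin> E" if "k < l" "l < length (rev ls)" for k l
 proof (rule no_pair[OF _ adj that])
  show "circ n ls rs = (tops @ rs @ bots) @ rev ls @ []" unfolding circ_split by simp
 qed
 have "i \<noteq> j" using matchingD(3)[OF E e] ij by auto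
 thus False using *[of i j] *[of j i] e symE[OF e] ij by (metis linorder_neqE_nat)
qed

text \<open>
  The points of the left wall between two lines that cross the rectangle can only be joined to the
  right wall, because neither wall is joined to itself.
\<close>

lemma ladder_step:
 assumes e: "(ls ! a, [], rs ! b) \<in> E" "(ls ! a', [], rs ! b') \<in> E" and len: "a' < length ls" "b < length rs" "b' < length rs"
  and aa: "a < a'"
 shows "b < b'" "(ls ! Suc a, [], rs ! Suc b) \<in> E"
proof -
 have al: "a < length ls" "Suc a < length ls" using aa len by auto
 have ml: "ls ! a \<in> set ls" "ls ! a' \<in> set ls" "ls ! Suc a \<in> set ls" using al len by auto
 have mr: "rs ! b \<in> set rs" "rs ! b' \<in> set rs" using len by auto
 note s = symE[OF e(1)] symE[OF e(2)]
 have rl: "pos x < pos y" if "x \<in> set rs" "y \<in> set ls" for x y using asc_parts(6)[of x y] that by simp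
 have "pos (rs ! b) < pos (rs ! b') \<and> pos (rs ! b') < pos (ls ! a)" by (rule ncE[OF s(1) e(2)]) (use rl mr ml pos_ls aa al len in auto)
 thus bb: "b < b'" using pos_rs len by blast
 have sb: "Suc b < length rs" using bb len by simp
 obtain y where y: "(ls ! Suc a, [], y) \<in> E" using exE'[of "ls ! Suc a"] ml unfolding V_split by blast
 have yV: "y \<in> V" using matchingD[OF E y] by blast
 have y1: "pos (rs ! b) < pos y \<and> pos y < pos (ls ! a)" by (rule ncE[OF s(1) y]) (use rl mr ml pos_ls al in auto)
 have yls: "y \<notin> set ls" using no_ls[OF ml(3)] y by blast
 have y2: "pos y \<le> pos (rs ! b')"
 proof (cases "Suc a = a'")
  case True
  thus ?thesis using uniqE[OF y] e(2) by auto
 next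
  case False
  have "\<not> (pos (rs ! b') < pos y \<and> pos y < pos (ls ! a'))"
  proof
   assume "pos (rs ! b') < pos y \<and> pos y < pos (ls ! a')"
   hence "pos (ls ! Suc a) < pos (ls ! a')" using ncE[OF s(2) symE[OF y]] by blast
   thus False using pos_ls al len aa by simp
  qed
  moreover have "\<not> pos (ls ! a') \<le> pos y"
  proof
   assume "pos (ls ! a') \<le> pos y"
   hence "y \<notin> set tops \<union> set rs \<union> set bots" using asc_parts(5)[of y "ls ! a'"] asc_parts(6)[of y "ls ! a'"] asc_parts(7)[of y "ls ! a'"] ml by auto
   thus False using yV yls unfolding V_split by blast
  qed
  ultimately show ?thesis by linarith
 qed
 have "y \<notin> set tops" using asc_parts(5)[of y "rs ! b"] y1 mr by auto
 moreover have "y \<notin> set bots" using asc_parts(6)[of "rs ! b'" y] y2 mr by auto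
 ultimately have "y \<in> set rs" using yV yls unfolding V_split by blast
 then obtain c where c: "c < length rs" "y = rs ! c" by (metis in_set_conv_nth)
 have bc: "b < c" using y1 pos_rs[OF len(2) c(1)] c by simp
 have "c = Suc b"
 proof (rule ccontr)
  assume "c \<noteq> Suc b"
  hence sbc: "Suc b < c" using bc by simp
  obtain z where z: "(rs ! Suc b, [], z) \<in> E" using exE'[of "rs ! Suc b"] sb unfolding V_split by auto
  have zV: "z \<in> V" using matchingD[OF E z] by blast
  have zrs: "z \<notin> set rs" using no_rs[of "rs ! Suc b" z] z sb by auto
  have z1: "pos (rs ! b) < pos z \<and> pos z < pos (ls ! a)" by (rule ncE[OF s(1) z]) (use rl[of "rs ! Suc b"] ml pos_rs sb len in auto)
  have z2: "\<not> (pos (rs ! c) < pos z \<and> pos z < pos (ls ! Suc a))"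
  proof
   assume "pos (rs ! c) < pos z \<and> pos z < pos (ls ! Suc a)"
   hence "pos (rs ! c) < pos (rs ! Suc b)" using ncE[OF symE[OF y[unfolded c(2)]] symE[OF z]] by blast
   thus False using pos_rs[OF c(1) sb] sbc by simp
  qed
  have "z \<notin> set tops" using asc_parts(5)[of z "rs ! b"] z1 mr by auto
  then consider "z \<in> set bots" | "z \<in> set ls" using zV zrs unfolding V_split by blast
  thus False
  proof cases
   case 1
   thus False using z2 asc_parts(6)[of "rs ! c" z] asc_parts(7)[of z "ls ! Suc a"] c ml by auto
  next
   case 2
   then obtain m where m: "m < length ls" "z = ls ! m" by (metis in_set_conv_nth)
   have "a < m" using z1 pos_ls m al by simp
   moreover have "\<not> Suc a < m" using z2 rl[of "rs ! c" z] 2 pos_ls[of m "Suc a"] m al c by auto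
   ultimately have "m = Suc a" by simp
   hence "rs ! Suc b = y" using uniqE[OF y] symE[OF z] m by blast
   thus False using c sbc nth_eq_iff_index_eq[OF disj(9) sb c(1)] by simp
  qed
 qed
 thus "(ls ! Suc a, [], rs ! Suc b) \<in> E" using y c by simp
qed

text \<open>
  A third crossing line, or a pair at an even position, would be a removable ladder; so there are
  at most two crossing lines, and they sit at consecutive blobs.
\<close>

lemma ladder:
 assumes e: "(ls ! a, [], rs ! b) \<in> E" "(ls ! a', [], rs ! b') \<in> E" and len: "a' < length ls" "b < length rs" "b' < length rs"
  and aa: "a < a'"
 shows "odd a" "odd b" "a' = Suc a" "b' = Suc b"
proof -
 have odd: "odd a" if e: "(ls ! a, [], rs ! b) \<in> E" "(ls ! a', [], rs ! b') \<in> E" and len: "a' < length ls" "b < length rs" "b' < length rs"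
  and aa: "a < a'" for a b
 proof
  assume ev: "even a"
  have al: "Suc a < length ls" "Suc b < length rs" using aa len ladder_step(1)[OF e len aa] by auto
  have "even b" using wall_parity[OF even_n e(1)] ev al by simp
  moreover have "ls = take a ls @ [ls ! a, ls ! Suc a] @ drop (Suc (Suc a)) ls" "rs = take b rs @ [rs ! b, rs ! Suc b] @ drop (Suc (Suc b)) rs"
   using al by (simp_all add: Cons_nth_drop_Suc id_take_nth_drop[symmetric])
  moreover have "even (length (take a ls))" "length (take b rs) = b" using ev al by simp_all
  ultimately show False using irr e(1) ladder_step(2)[OF e len aa] unfolding irreducible_drawing_def by metis
 qed
 show oa: "odd a" by (rule odd[OF e len aa])
 show "odd b" using wall_parity[OF even_n e(1)] oa len aa by auto
 show a': "a' = Suc a"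
 proof (rule ccontr)
  assume "a' \<noteq> Suc a"
  hence "Suc a < a'" using aa by simp
  moreover have "Suc b < length rs" using ladder_step(1)[OF e len aa] len by simp
  ultimately have "odd (Suc a)" using odd[OF ladder_step(2)[OF e len aa] e(2)] len by blast
  thus False using oa by simp
 qed
 have "rs ! Suc b = rs ! b'" using uniqE[OF ladder_step(2)[OF e len aa]] e(2) a' by blast
 moreover have "Suc b < length rs" using ladder_step(1)[OF e len aa] len by simp
 ultimately show "b' = Suc b" using nth_eq_iff_index_eq[OF disj(9)] len by metis
qed

abbreviation "W \<equiv> set ls \<union> set rs"

lemma link_index:
 assumes "(zs ! i, u, y) \<in> link v zs" "i < length zs" "distinct zs"
 shows "\<exists>j. j < length zs \<and> y = zs ! j \<and> (even i \<and> j = Suc i \<or> odd i \<and> Suc j = i)"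
proof -
 obtain k where k: "2 * k + 1 < length zs" "zs ! i = zs ! (2 * k) \<and> y = zs ! (2 * k + 1) \<or> zs ! i = zs ! (2 * k + 1) \<and> y = zs ! (2 * k)"
  using assms(1) unfolding link_nth by blast
 from k(2) show ?thesis
 proof (elim disjE conjE)
  assume h: "zs ! i = zs ! (2 * k)" "y = zs ! (2 * k + 1)"
  have "i = 2 * k" using nth_eq_iff_index_eq[OF assms(3,2), of "2 * k"] h(1) k(1) by simp
  thus ?thesis using h(2) k(1) by (intro exI[of _ "2 * k + 1"]) simp
 next
  assume h: "zs ! i = zs ! (2 * k + 1)" "y = zs ! (2 * k)"
  have "i = 2 * k + 1" using nth_eq_iff_index_eq[OF assms(3,2), of "2 * k + 1"] h(1) k(1) by simp
  thus ?thesis using h(2) k(1) by (intro exI[of _ "2 * k"]) simp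
 qed
qed

lemma blob_glue_cases:
 assumes "(x, u, x') \<in> blob_glue ls rs"
 shows "(u = [LeftBlob] \<and> x \<in> set ls \<and> x' \<in> set ls \<and> (x, u, x') \<in> link [LeftBlob] ls) \<or>
  (u = [RightBlob] \<and> x \<in> set rs \<and> x' \<in> set rs \<and> (x, u, x') \<in> link [RightBlob] rs)"
 using assms unfolding blob_glue_def by (auto dest: link_sub)

lemma rung_end:
 assumes xy: "(x, [], y) \<in> E" "x \<in> W" "y \<in> W" and g: "(y, u, y') \<in> blob_glue ls rs" and z: "(y', [], z) \<in> E"
 shows "z \<notin> W"
proof
 assume zW: "z \<in> W"
 from blob_glue_cases[OF g] show False
 proof (elim disjE conjE)
  assume h: "y \<in> set ls" "y' \<in> set ls" "(y, u, y') \<in> link [LeftBlob] ls"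
  have xr: "x \<in> set rs" "z \<in> set rs" using no_ls h xy zW z by blast+
  obtain a where a: "a < length ls" "y = ls ! a" using h by (metis in_set_conv_nth)
  obtain a' where a': "a' < length ls" "y' = ls ! a'" "even a \<and> a' = Suc a \<or> odd a \<and> Suc a' = a"
   using link_index[OF h(3)[unfolded a(2)] a(1) disj(8)] by blast
  obtain b where b: "b < length rs" "x = rs ! b" using xr by (metis in_set_conv_nth)
  obtain b' where b': "b' < length rs" "z = rs ! b'" using xr by (metis in_set_conv_nth)
  have e: "(ls ! a, [], rs ! b) \<in> E" "(ls ! a', [], rs ! b') \<in> E" using symE[OF xy(1)] z a a' b b' by simp_all
  from a'(3) show False using ladder(1)[OF e a'(1) b(1) b'(1)] ladder(1)[OF e(2,1) a(1) b'(1) b(1)] by auto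
 next
  assume h: "y \<in> set rs" "y' \<in> set rs" "(y, u, y') \<in> link [RightBlob] rs"
  have xr: "x \<in> set ls" "z \<in> set ls" using no_rs h xy zW z by blast+
  obtain a where a: "a < length rs" "y = rs ! a" using h by (metis in_set_conv_nth)
  obtain a' where a': "a' < length rs" "y' = rs ! a'" "even a \<and> a' = Suc a \<or> odd a \<and> Suc a' = a"
   using link_index[OF h(3)[unfolded a(2)] a(1) disj(9)] by blast
  obtain b where b: "b < length ls" "x = ls ! b" using xr by (metis in_set_conv_nth)
  obtain b' where b': "b' < length ls" "z = ls ! b'" using xr by (metis in_set_conv_nth)
  have e: "(ls ! b, [], rs ! a) \<in> E" "(ls ! b', [], rs ! a') \<in> E" using xy(1) symE[OF z] a a' b b' by simp_all
  have "b \<noteq> b'" using uniqE e a a' nth_eq_iff_index_eq[OF disj(9) a(1) a'(1)] by force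
  thus False using ladder(2,4)[OF e b'(1) a(1) a'(1)] ladder(2,4)[OF e(2,1) b(1) a'(1) a(1)] a'(3) by force
 qed
qed

text \<open>
  Between two blobs on a path there is a line from one wall to the other, so the blobs are of different kinds, and a
  third blob would make two crossing lines at the same blob.
\<close>

lemma path_shape:
 assumes "apath E (blob_glue ls rs) p w q" "p \<notin> W"
 shows "(w = [] \<and> (p, [], q) \<in> E) \<or>
  (\<exists>s x x'. w = [s] \<and> (p, [], x) \<in> E \<and> (x, [s], x') \<in> blob_glue ls rs \<and> (x', [], q) \<in> E) \<or>
  (\<exists>s s' x x' y y'. w = [s, s'] \<and> s \<noteq> s' \<and> (p, [], x) \<in> E \<and> (x, [s], x') \<in> blob_glue ls rs \<and> (x', [], y) \<in> E \<and>
   (y, [s'], y') \<in> blob_glue ls rs \<and> (y', [], q) \<in> E \<and> q \<notin> W)"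
 using assms
proof (induction rule: apath.induct)
 case (start p w q)
 thus ?case using lab by blast
next
 case (step p w a u b w' q)
 have w': "w' = []" using lab step by blast
 have aW: "a \<in> W" using blob_glue_cases[OF step(2)] by blast
 obtain s where s: "u = [s]" using blob_glue_cases[OF step(2)] by blast
 from step.IH[OF step.prems] show ?case
 proof (elim disjE conjE exE)
  assume "w = []" "(p, [], a) \<in> E"
  thus ?thesis using s w' step(2,3) by auto
 next
  fix s0 x x' assume h: "w = [s0]" "(p, [], x) \<in> E" "(x, [s0], x') \<in> blob_glue ls rs" "(x', [], a) \<in> E"
  have x'W: "x' \<in> W" using blob_glue_cases[OF h(3)] by blast
  have "q \<notin> W" using rung_end[OF h(4) x'W aW step(2)] step(3) w' by blast
  moreover have "s0 \<noteq> s" using blob_glue_cases[OF h(3)] blob_glue_cases[OF step(2)] s no_ls[of x' a] no_rs[of x' a] h(4) by auto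
  moreover have "w @ u @ w' = [s0, s]" using h(1) s w' by simp
  ultimately show ?thesis using h(2,3,4) step(2,3) s w' by blast
 next
  assume "a \<notin> W" thus ?thesis using aW by blast
 qed
qed

lemma line_shape:
 assumes "(p, w, q) \<in> drawn_lines n ls rs E"
 shows "p \<in> vertices n" "q \<in> vertices n" "p \<notin> W" "q \<notin> W" "apath E (blob_glue ls rs) p w q"
  "w \<in> short_words"
proof -
 show pq: "p \<in> vertices n" "q \<in> vertices n" "apath E (blob_glue ls rs) p w q" using assms unfolding drawn_lines_def by auto
 show pW: "p \<notin> W" "q \<notin> W" using pq disj by (auto simp: vertices_Suc)
 have b: "s = LeftBlob \<or> s = RightBlob" for s by (cases s) auto
 from path_shape[OF pq(3) pW(1)] show "w \<in> short_words"
 proof (elim disjE conjE exE)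
  fix s assume "w = [s]"
  thus ?thesis using b[of s] by auto
 next
  fix s s' assume "w = [s, s']" "s \<noteq> s'"
  thus ?thesis using b[of s] b[of s'] by auto
 qed simp
qed

lemma line_reduced: "(p, w, q) \<in> drawn_lines n ls rs E \<Longrightarrow> reduced_word w"
 using line_shape(6)[of p w q] unfolding reduced_word_def by (auto simp: sublist_Cons_right)

lemma line_remdups: "(p, w, q) \<in> drawn_lines n ls rs E \<Longrightarrow> remdups_adj w = w" using line_shape(6)[of p w q] by auto

text \<open>
  A line with both kinds of blob crosses the rectangle once, between these blobs.
\<close>

lemma rung:
 assumes "(p, w, q) \<in> drawn_lines n ls rs E" "LeftBlob \<in> set w" "RightBlob \<in> set w"
 obtains a b x y p' q' where "a < length ls" "b < length rs" "(ls ! a, [], rs ! b) \<in> E"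
  "(ls ! a, [LeftBlob], x) \<in> blob_glue ls rs" "(rs ! b, [RightBlob], y) \<in> blob_glue ls rs"
  "(x, [], p') \<in> E" "(y, [], q') \<in> E" "{p, q} = {p', q'}"
proof -
 note L = line_shape[OF assms(1)]
 have sy: "(x', u, x) \<in> blob_glue ls rs" if "(x, u, x') \<in> blob_glue ls rs" for x u x'
  using matchingD(4)[OF blob_glue that] blob_glue_cases[OF that] by auto
 from path_shape[OF L(5,3)] show ?thesis
 proof (elim disjE conjE exE)
  fix s s' x x' y y'
  assume h: "w = [s, s']" "s \<noteq> s'" "(p, [], x) \<in> E" "(x, [s], x') \<in> blob_glue ls rs" "(x', [], y) \<in> E"
   "(y, [s'], y') \<in> blob_glue ls rs" "(y', [], q) \<in> E"
  show ?thesis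
  proof (cases s)
   case LeftBlob
   hence s': "s' = RightBlob" using h(2) by (cases s') auto
   have "x' \<in> set ls" "y \<in> set rs" using blob_glue_cases[OF h(4)] blob_glue_cases[OF h(6)] LeftBlob s' by auto
   then obtain a b where "a < length ls" "x' = ls ! a" "b < length rs" "y = rs ! b" by (metis in_set_conv_nth)
   thus ?thesis using that[of a b x y' p q] h LeftBlob s' sy[OF h(4)] symE[OF h(3)] by auto
  next
   case RightBlob
   hence s': "s' = LeftBlob" using h(2) by (cases s') auto
   have "x' \<in> set rs" "y \<in> set ls" using blob_glue_cases[OF h(4)] blob_glue_cases[OF h(6)] RightBlob s' by auto
   then obtain a b where "a < length ls" "y = ls ! a" "b < length rs" "x' = rs ! b" by (metis in_set_conv_nth)
   thus ?thesis using that[of a b y' x q p] h RightBlob s' sy[OF h(4)] symE[OF h(3)] symE[OF h(5)] by auto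
  qed
 qed (use assms in auto)
qed

end

section \<open>The topological relation\<close>

lemma ex_take_drop4:
 assumes "Suc (Suc (Suc k)) < length xs"
 shows "xs = take k xs @ [xs ! k, xs ! Suc k, xs ! Suc (Suc k), xs ! Suc (Suc (Suc k))] @ drop (Suc (Suc (Suc (Suc k)))) xs"
 using assms by (simp add: Cons_nth_drop_Suc id_take_nth_drop[symmetric])

context irreducible begin

lemma vertex_partner:
 assumes "(x, [], p) \<in> E" "x \<in> W" "p \<notin> W"
 shows "p \<in> vertices n"
proof -
 have pV: "p \<in> V" using matchingD[OF E assms(1)] by blast
 have x: "x \<notin> hook_ends n" using assms(2) disj by (auto simp: vertices_Suc)
 note s = symE[OF assms(1)]
 have "p \<noteq> Top 0" using uniqE[OF symE[OF hook_top]] s x by blast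
 moreover have "p \<noteq> Bot 0" using uniqE[OF hook_bot] s x by blast
 moreover have "p \<noteq> Top (n + 1)" using uniqE[OF hook_top] s x by blast
 moreover have "p \<noteq> Bot (n + 1)" using uniqE[OF symE[OF hook_bot]] s x by blast
 ultimately show ?thesis using pV assms(3) unfolding set_circ by (auto simp: vertices_Suc)
qed

lemma vertex_top_or_bot:
 assumes "p \<in> vertices n"
 shows "(\<exists>i\<in>{1..n}. p = Top i \<and> p \<in> set tops) \<or> (\<exists>i\<in>{1..n}. p = Bot i \<and> p \<in> set bots)"
 using assms unfolding vertices_def set_tops set_bots by auto

lemma blob_glue_uniq: "(x, u, y) \<in> blob_glue ls rs \<Longrightarrow> (x, u', y') \<in> blob_glue ls rs \<Longrightarrow> y = y'"
 using matching_uniq[OF blob_glue] by blast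

text \<open>
  The arc at the top and the arc at the bottom cross the rectangle in two different lines.
\<close>

lemma two_rungs:
 assumes "topological_redex (drawn_lines n ls rs E)"
 obtains a b where "odd a" "odd b" "Suc a < length ls" "Suc b < length rs"
  "(ls ! a, [], rs ! b) \<in> E" "(ls ! Suc a, [], rs ! Suc b) \<in> E"
proof -
 obtain i j k l where "top_LR_arc (drawn_lines n ls rs E) i j" "bottom_LR_arc (drawn_lines n ls rs E) k l"
  using assms unfolding topological_redex_def by blast
 then obtain w v where w: "(Top i, w, Top j) \<in> drawn_lines n ls rs E" "LeftBlob \<in> set w" "RightBlob \<in> set w"
  and v: "(Bot k, v, Bot l) \<in> drawn_lines n ls rs E" "LeftBlob \<in> set v" "RightBlob \<in> set v"
  unfolding top_LR_arc_def bottom_LR_arc_def by blast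
 from w obtain a b x y p q where A: "a < length ls" "b < length rs" "(ls ! a, [], rs ! b) \<in> E"
  "(ls ! a, [LeftBlob], x) \<in> blob_glue ls rs" "(rs ! b, [RightBlob], y) \<in> blob_glue ls rs"
  "(x, [], p) \<in> E" "(y, [], q) \<in> E" "{Top i, Top j} = {p, q}" by (rule rung)
 from v obtain a' b' x' y' p' q' where B: "a' < length ls" "b' < length rs" "(ls ! a', [], rs ! b') \<in> E"
  "(ls ! a', [LeftBlob], x') \<in> blob_glue ls rs" "(rs ! b', [RightBlob], y') \<in> blob_glue ls rs"
  "(x', [], p') \<in> E" "(y', [], q') \<in> E" "{Bot k, Bot l} = {p', q'}" by (rule rung)
 have "a \<noteq> a'"
 proof
  assume a: "a = a'"
  have "x = x'" using blob_glue_uniq A(4) B(4) a by blast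
  hence "p = p'" using uniqE A(6) B(6) by blast
  thus False using A(8) B(8) by (metis insertCI insertE point.distinct(1) singletonD)
 qed
 then consider "a < a'" | "a' < a" by linarith
 thus ?thesis
 proof cases
  case 1
  from ladder[OF A(3) B(3,1) A(2) B(2) 1] show ?thesis using that[of a b] A B by simp
 next
  case 2
  from ladder[OF B(3) A(3,1) B(2) A(2) 2] show ?thesis using that[of a' b'] A B by simp
 qed
qed

text \<open>
  The crossing parts of the two arcs are parallel lines. Deleting them from the drawing is exactly the
  reconnection of the topological relation.
\<close>

theorem topological_step:
 assumes redex: "topological_redex (drawn_lines n ls rs E)"
 shows "\<exists>ls' rs' E'. irreducible n ls' rs' pos E' \<and> strand_diagram ls' rs' E' = strand_diagram ls rs E \<and>
  drawn_lines n ls' rs' E' = reconnect (drawn_lines n ls rs E) \<and> \<not> topological_redex (drawn_lines n ls' rs' E')"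
proof -
 let ?D = "drawn_lines n ls rs E"
 from two_rungs[OF redex] obtain a b where ab: "odd a" "odd b" "Suc a < length ls" "Suc b < length rs"
  and rung1: "(ls ! a, [], rs ! b) \<in> E" and rung2: "(ls ! Suc a, [], rs ! Suc b) \<in> E" by blast
 obtain a0 b0 where a0: "a = Suc a0" "even a0" and b0: "b = Suc b0" "even b0" using ab by (metis dvd_0_right not0_implies_Suc even_Suc)
 have len4: "Suc (Suc (Suc a0)) < length ls" "Suc (Suc (Suc b0)) < length rs" using ab a0 b0 even_ls even_rs by (metis Suc_lessI even_Suc)+
 define A x1 al be y1 B where "A = take a0 ls" and "x1 = ls ! a0" and "al = ls ! a" and "be = ls ! Suc a" and "y1 = ls ! Suc (Suc a)"
  and "B = drop (Suc (Suc (Suc (Suc a0)))) ls"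
 define C x2 ga ze y2 D where "C = take b0 rs" and "x2 = rs ! b0" and "ga = rs ! b" and "ze = rs ! Suc b" and "y2 = rs ! Suc (Suc b)"
  and "D = drop (Suc (Suc (Suc (Suc b0)))) rs"
 have ls: "ls = A @ [x1, al, be, y1] @ B" using ex_take_drop4[OF len4(1)] unfolding A_def x1_def al_def be_def y1_def B_def a0 .
 have rs: "rs = C @ [x2, ga, ze, y2] @ D" using ex_take_drop4[OF len4(2)] unfolding C_def x2_def ga_def ze_def y2_def D_def b0 .
 have lA: "even (length A)" "even (length C)" unfolding A_def C_def using len4 a0 b0 by simp_all
 have lB: "even (length B)" "even (length D)" using even_ls even_rs lA unfolding ls rs by simp_all
 have r: "(al, [], ga) \<in> E" "(be, [], ze) \<in> E" "(ga, [], al) \<in> E" "(ze, [], be) \<in> E"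
  using rung1 rung2 symE unfolding al_def be_def ga_def ze_def by blast+
 have onlyrungs: "(c = a \<and> d = b) \<or> (c = Suc a \<and> d = Suc b)"
  if "(ls ! c, [], rs ! d) \<in> E" "c < length ls" "d < length rs" for c d
 proof -
  have *: "rs ! d = rs ! d' \<Longrightarrow> d' < length rs \<Longrightarrow> d = d'" for d'
   using nth_eq_iff_index_eq[OF disj(9) that(3), of d'] by simp
  consider "c < a" | "c = a" | "c = Suc a" | "Suc a < c" by linarith
  thus ?thesis
  proof cases
   case 1
   thus ?thesis using ladder(1,3)[OF that(1) rung1 _ that(3) _ 1] ab by simp
  next
   case 2
   have "rs ! d = rs ! b" using uniqE[OF that(1)[unfolded 2] rung1] .
   thus ?thesis using *[of b] ab 2 by simp
  next
   case 3
   have "rs ! d = rs ! Suc b" using uniqE[OF that(1)[unfolded 3] rung2] .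
   thus ?thesis using *[of "Suc b"] ab 3 by simp
  next
   case 4
   thus ?thesis using ladder(1)[OF rung2 that(1,2) ab(4) that(3) 4] ab(1) by simp
  qed
 qed
 have mem: "x1 \<in> set ls" "al \<in> set ls" "be \<in> set ls" "y1 \<in> set ls" "x2 \<in> set rs" "ga \<in> set rs" "ze \<in> set rs" "y2 \<in> set rs"
  unfolding ls rs by auto
 have dist: "distinct (A @ [x1, al, be, y1] @ B)" "distinct (C @ [x2, ga, ze, y2] @ D)"
  "set (A @ [x1, al, be, y1] @ B) \<inter> set (C @ [x2, ga, ze, y2] @ D) = {}" using disj(8,9,3) unfolding ls rs .
 have lkl: "link u ls = link u A \<union> {(x1, u, al), (al, rev u, x1), (be, u, y1), (y1, rev u, be)} \<union> link u B" for u :: "blob list"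
  unfolding ls using lA(1) by (auto simp: link_append)
 have lkr: "link u rs = link u C \<union> {(x2, u, ga), (ga, rev u, x2), (ze, u, y2), (y2, rev u, ze)} \<union> link u D" for u :: "blob list"
  unfolding rs using lA(2) by (auto simp: link_append)
 have bg: "blob_glue ls rs = link [LeftBlob] A \<union> link [LeftBlob] B \<union> link [RightBlob] C \<union> link [RightBlob] D \<union>
   {(x1, [LeftBlob], al), (al, [LeftBlob], x1), (be, [LeftBlob], y1), (y1, [LeftBlob], be)} \<union>
   {(x2, [RightBlob], ga), (ga, [RightBlob], x2), (ze, [RightBlob], y2), (y2, [RightBlob], ze)}"
  unfolding blob_glue_def lkl lkr by auto
 have g: "(x1, [LeftBlob], al) \<in> blob_glue ls rs" "(al, [LeftBlob], x1) \<in> blob_glue ls rs"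
  "(be, [LeftBlob], y1) \<in> blob_glue ls rs" "(y1, [LeftBlob], be) \<in> blob_glue ls rs"
  "(x2, [RightBlob], ga) \<in> blob_glue ls rs" "(ga, [RightBlob], x2) \<in> blob_glue ls rs"
  "(ze, [RightBlob], y2) \<in> blob_glue ls rs" "(y2, [RightBlob], ze) \<in> blob_glue ls rs" unfolding bg by simp_all
 have memV: "x1 \<in> V" "x2 \<in> V" "y1 \<in> V" "y2 \<in> V" using mem unfolding V_split by blast+
 obtain p1 where p1: "(x1, [], p1) \<in> E" using exE'[OF memV(1)] by blast
 obtain p2 where p2: "(x2, [], p2) \<in> E" using exE'[OF memV(2)] by blast
 obtain q1 where q1: "(y1, [], q1) \<in> E" using exE'[OF memV(3)] by blast
 obtain q2 where q2: "(y2, [], q2) \<in> E" using exE'[OF memV(4)] by blast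
 have nW: "p1 \<notin> W" "p2 \<notin> W" "q1 \<notin> W" "q2 \<notin> W"
  using rung_end[OF r(3) _ _ g(2) p1] rung_end[OF r(1) _ _ g(6) p2] rung_end[OF r(4) _ _ g(3) q1] rung_end[OF r(2) _ _ g(7) q2]
   mem by simp_all
 have vn: "p1 \<in> vertices n" "p2 \<in> vertices n" "q1 \<in> vertices n" "q2 \<in> vertices n"
  using vertex_partner[OF p1 _ nW(1)] vertex_partner[OF p2 _ nW(2)] vertex_partner[OF q1 _ nW(3)] vertex_partner[OF q2 _ nW(4)] mem by simp_all
 have il: "pos al < pos x1" "pos be < pos al" "pos y1 < pos be" "pos x2 < pos ga" "pos ga < pos ze" "pos ze < pos y2"
  using pos_ls len4 pos_rs unfolding x1_def al_def be_def y1_def x2_def ga_def ze_def y2_def a0 b0 by simp_all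
 have rl: "pos x < pos y" if "x \<in> set rs" "y \<in> set ls" for x y using asc_parts(6)[of x y] that by simp
 \<comment> \<open>planarity leaves only one side of the rectangle for each of the four end points\<close>
 obtain i where i: "i \<in> {1..n}" "p1 = Top i" "p1 \<in> set tops"
 proof -
  have "\<not> (\<exists>k\<in>{1..n}. p1 = Bot k \<and> p1 \<in> set bots)"
  proof
   assume "\<exists>k\<in>{1..n}. p1 = Bot k \<and> p1 \<in> set bots"
   hence "pos ga < pos p1" "pos p1 < pos al" using asc_parts(6)[of ga p1] asc_parts(7)[of p1 al] mem by auto
   thus False using ncE[OF r(3) symE[OF p1]] il by auto
  qed
  thus ?thesis using vertex_top_or_bot[OF vn(1)] that by blast
 qed
 obtain j where j: "j \<in> {1..n}" "p2 = Top j" "p2 \<in> set tops"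
 proof -
  have "\<not> (\<exists>k\<in>{1..n}. p2 = Bot k \<and> p2 \<in> set bots)"
  proof
   assume "\<exists>k\<in>{1..n}. p2 = Bot k \<and> p2 \<in> set bots"
   hence "pos ga < pos p2" "pos p2 < pos al" using asc_parts(6)[of ga p2] asc_parts(7)[of p2 al] mem by auto
   thus False using ncE[OF r(3) symE[OF p2]] il by auto
  qed
  thus ?thesis using vertex_top_or_bot[OF vn(2)] that by blast
 qed
 obtain k where k: "k \<in> {1..n}" "q1 = Bot k" "q1 \<in> set bots"
 proof -
  have "\<not> (\<exists>k\<in>{1..n}. q1 = Top k \<and> q1 \<in> set tops)"
  proof
   assume "\<exists>k\<in>{1..n}. q1 = Top k \<and> q1 \<in> set tops"
   hence "pos q1 < pos ze" using asc_parts(5)[of q1 ze] mem by auto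
   moreover have "pos ze < pos q1 \<and> pos q1 < pos be" by (rule ncE[OF r(4) q1]) (use il rl[OF mem(7) mem(4)] in auto)
   ultimately show False by simp
  qed
  thus ?thesis using vertex_top_or_bot[OF vn(3)] that by blast
 qed
 obtain l where l: "l \<in> {1..n}" "q2 = Bot l" "q2 \<in> set bots"
 proof -
  have "\<not> (\<exists>k\<in>{1..n}. q2 = Top k \<and> q2 \<in> set tops)"
  proof
   assume "\<exists>k\<in>{1..n}. q2 = Top k \<and> q2 \<in> set tops"
   hence "pos q2 < pos ze" using asc_parts(5)[of q2 ze] mem by auto
   moreover have "pos ze < pos q2 \<and> pos q2 < pos be" by (rule ncE[OF r(4) q2]) (use il rl[OF mem(8) mem(3)] in auto)
   ultimately show False by simp
  qed
  thus ?thesis using vertex_top_or_bot[OF vn(4)] that by blast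
 qed
 have "i \<noteq> j"
 proof
  assume "i = j"
  hence "x1 = x2" using uniqE[OF symE[OF p1]] symE[OF p2] i j by simp
  thus False using mem disj(3) by blast
 qed
 moreover have "\<not> j < i"
 proof
  assume "j < i"
  hence "pos p2 < pos p1" using pos_Top i j by simp
  moreover have "pos p1 < pos x2" using asc_parts(5)[of p1 x2] i(3) mem by simp
  ultimately have "pos p2 < pos x1 \<and> pos x1 < pos x2" by (rule ncE[OF symE[OF p2] symE[OF p1]])
  thus False using rl[OF mem(5) mem(1)] by simp
 qed
 ultimately have ij: "i < j" by simp
 have "k \<noteq> l"
 proof
  assume "k = l"
  hence "y1 = y2" using uniqE[OF symE[OF q1]] symE[OF q2] k l by simp
  thus False using mem disj(3) by blast
 qed
 moreover have "\<not> l < k"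
 proof
  assume "l < k"
  hence "pos q1 < pos q2" using pos_Bot k l by simp
  moreover have "pos y2 < pos q1" using asc_parts(6)[of y2 q1] k(3) mem by simp
  ultimately have "pos y2 < pos y1 \<and> pos y1 < pos q2" using ncE[OF q2 symE[OF q1]] by blast
  moreover have "pos q2 < pos y1" using asc_parts(7)[of q2 y1] l(3) mem by simp
  ultimately show False by simp
 qed
 ultimately have kl: "k < l" by simp
 have top_line: "(Top i, [LeftBlob, RightBlob], Top j) \<in> ?D"
 proof -
  have "apath E (blob_glue ls rs) p1 (([] @ [LeftBlob] @ []) @ [RightBlob] @ []) p2"
   by (rule apath.step[OF apath.step[OF apath.start[OF symE[OF p1]] g(1) r(1)] g(6) p2])
  thus ?thesis unfolding drawn_lines_def using vn i j by simp
 qed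
 have bot_line: "(Bot k, [LeftBlob, RightBlob], Bot l) \<in> ?D"
 proof -
  have "apath E (blob_glue ls rs) q1 (([] @ [LeftBlob] @ []) @ [RightBlob] @ []) q2"
   by (rule apath.step[OF apath.step[OF apath.start[OF symE[OF q1]] g(4) r(2)] g(7) q2])
  thus ?thesis unfolding drawn_lines_def using vn k l by simp
 qed
 have LR_ends: "{p, q} = {p1, p2} \<or> {p, q} = {q1, q2}"
  if "(p, w, q) \<in> ?D" "LeftBlob \<in> set w" "RightBlob \<in> set w" for p w q using that
 proof (rule rung)
  fix c d x y p' q' assume h: "c < length ls" "d < length rs" "(ls ! c, [], rs ! d) \<in> E"
   "(ls ! c, [LeftBlob], x) \<in> blob_glue ls rs" "(rs ! d, [RightBlob], y) \<in> blob_glue ls rs"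
   "(x, [], p') \<in> E" "(y, [], q') \<in> E" "{p, q} = {p', q'}"
  from onlyrungs[OF h(3,1,2)] show ?thesis
  proof (elim disjE conjE)
   assume "c = a" "d = b"
   hence "x = x1" "y = x2" using blob_glue_uniq h(4,5) g(2,6) unfolding al_def ga_def by blast+
   hence "p' = p1" "q' = p2" using uniqE h(6,7) p1 p2 by blast+
   thus ?thesis using h(8) by simp
  next
   assume "c = Suc a" "d = Suc b"
   hence "x = y1" "y = y2" using blob_glue_uniq h(4,5) g(3,7) unfolding be_def ze_def by blast+
   hence "p' = q1" "q' = q2" using uniqE h(6,7) q1 q2 by blast+
   thus ?thesis using h(8) by simp
  qed
 qed
 have top_arc: "top_LR_arc ?D i' j' \<longleftrightarrow> i' = i \<and> j' = j" for i' j'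
 proof
  assume "top_LR_arc ?D i' j'"
  then obtain w where w: "i' < j'" "(Top i', w, Top j') \<in> ?D" "LeftBlob \<in> set w" "RightBlob \<in> set w" unfolding top_LR_arc_def by blast
  thus "i' = i \<and> j' = j" using LR_ends[OF w(2-4)] i j k l ij by (auto simp: doubleton_eq_iff)
 next
  assume "i' = i \<and> j' = j"
  thus "top_LR_arc ?D i' j'" unfolding top_LR_arc_def using top_line ij by auto
 qed
 have bot_arc: "bottom_LR_arc ?D i' j' \<longleftrightarrow> i' = k \<and> j' = l" for i' j'
 proof
  assume "bottom_LR_arc ?D i' j'"
  then obtain w where w: "i' < j'" "(Bot i', w, Bot j') \<in> ?D" "LeftBlob \<in> set w" "RightBlob \<in> set w" unfolding bottom_LR_arc_def by blast
  thus "i' = k \<and> j' = l" using LR_ends[OF w(2-4)] i j k l kl by (auto simp: doubleton_eq_iff)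
 next
  assume "i' = k \<and> j' = l"
  thus "bottom_LR_arc ?D i' j'" unfolding bottom_LR_arc_def using bot_line kl by auto
 qed
 have rec: "reconnect ?D = {(p, w, q) \<in> ?D. {p, q} \<noteq> {p1, p2} \<and> {p, q} \<noteq> {q1, q2}} \<union>
   {(p1, [LeftBlob], q1), (q1, [LeftBlob], p1), (p2, [RightBlob], q2), (q2, [RightBlob], p2)}"
  unfolding reconnect_def top_arc bot_arc i(2) j(2) k(2) l(2) by auto
 \<comment> \<open>deleting both rungs joins the left halves of the two arcs, and the right halves\<close>
 define ls' rs' E' where "ls' = (A @ [x1]) @ ([y1] @ B)" and "rs' = (C @ [x2]) @ ([y2] @ D)" and "E' = del {al, be, ga, ze} E"
 have l2: "ls = (A @ [x1]) @ [al, be] @ ([y1] @ B)" and r2: "rs = (C @ [x2]) @ [ga, ze] @ ([y2] @ D)" using ls rs by simp_all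
 have par: "even (length (A @ [x1])) \<longleftrightarrow> even (length (C @ [x2]))" using lA by simp
 have P: "planar n ls' rs' pos E'" and S: "strand_diagram ls' rs' E' = strand_diagram ls rs E"
  unfolding ls'_def rs'_def E'_def using delete_ladder(1,2)[OF r(1,2) l2 r2 par] by blast+
 interpret P: planar n ls' rs' pos E' by (rule P)
 have E'iff: "(p, w, q) \<in> E' \<longleftrightarrow> (p, w, q) \<in> E \<and> p \<notin> {al, be, ga, ze} \<and> q \<notin> {al, be, ga, ze}" for p w q
  unfolding E'_def del_iff by simp
 have sub: "set ls' \<subseteq> set ls" "set rs' \<subseteq> set rs" unfolding ls'_def rs'_def ls rs by auto
 have norung: "(c, [], d) \<notin> E'" if cd: "c \<in> set ls'" "d \<in> set rs'" for c d
 proof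
  assume e: "(c, [], d) \<in> E'"
  obtain m where m: "m < length ls" "c = ls ! m" using sub cd by (metis in_set_conv_nth subsetD)
  obtain m' where m': "m' < length rs" "d = rs ! m'" using sub cd by (metis in_set_conv_nth subsetD)
  have "c = al \<or> c = be" using onlyrungs[of m m'] e m m' unfolding E'iff al_def be_def by blast
  thus False using e unfolding E'iff by blast
 qed
 have irr': "irreducible_drawing ls' rs' E'" unfolding irreducible_drawing_def
 proof (intro conjI allI impI)
  fix A' a' b' C' assume h: "ls' = A' @ [a', b'] @ C' \<or> rs' = A' @ [a', b'] @ C'"
  show "(a', [], b') \<notin> E'" using h
  proof
   assume "ls' = A' @ [a', b'] @ C'"
   hence "a' \<in> set ls" "b' \<in> set ls" using sub(1) by auto
   thus ?thesis using no_ls E'iff by blast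
  next
   assume "rs' = A' @ [a', b'] @ C'"
   hence "a' \<in> set rs" "b' \<in> set rs" using sub(2) by auto
   thus ?thesis using no_rs E'iff by blast
  qed
 next
  fix A' a' b' B' C' c' d' D' assume "ls' = A' @ [a', b'] @ B'" "rs' = C' @ [c', d'] @ D'"
  thus "(b', [], d') \<notin> E'" using norung[of b' d'] by simp
 qed
 have I: "irreducible n ls' rs' pos E'" using P irr' even_n by (simp add: irreducible_def irreducible_axioms_def)
 interpret I: irreducible n ls' rs' pos E' by (rule I)
 have noredex: "\<not> topological_redex (drawn_lines n ls' rs' E')"
 proof
  assume "topological_redex (drawn_lines n ls' rs' E')"
  from I.two_rungs[OF this] obtain a b where "Suc a < length ls'" "Suc b < length rs'" "(ls' ! a, [], rs' ! b) \<in> E'" by blast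
  thus False using norung[of "ls' ! a" "rs' ! b"] by simp
 qed
 have lk1: "link u ls' = link u A \<union> {(x1, u, y1), (y1, rev u, x1)} \<union> link u B" for u :: "blob list"
  unfolding ls'_def using lA(1) by (auto simp: link_append)
 have lk2: "link u rs' = link u C \<union> {(x2, u, y2), (y2, rev u, x2)} \<union> link u D" for u :: "blob list"
  unfolding rs'_def using lA(2) by (auto simp: link_append)
 have bg': "blob_glue ls' rs' = link [LeftBlob] A \<union> link [LeftBlob] B \<union> link [RightBlob] C \<union> link [RightBlob] D \<union>
   {(x1, [LeftBlob], y1), (y1, [LeftBlob], x1), (x2, [RightBlob], y2), (y2, [RightBlob], x2)}"
  unfolding blob_glue_def lk1 lk2 by auto
 have vW: "p \<notin> W" if "p \<in> vertices n" for p using that disj by (auto simp: vertices_Suc)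
 have x4: "x1 \<notin> {al, be, ga, ze}" "y1 \<notin> {al, be, ga, ze}" "x2 \<notin> {al, be, ga, ze}" "y2 \<notin> {al, be, ga, ze}"
  using dist by auto
 have v4: "p \<notin> {al, be, ga, ze}" if "p \<in> vertices n" for p using vW[OF that] mem by blast
 have e': "(x1, [], p1) \<in> E'" "(x2, [], p2) \<in> E'" "(y1, [], q1) \<in> E'" "(y2, [], q2) \<in> E'"
  "(p1, [], x1) \<in> E'" "(p2, [], x2) \<in> E'" "(q1, [], y1) \<in> E'" "(q2, [], y2) \<in> E'"
  unfolding E'iff using p1 p2 q1 q2 symE[OF p1] symE[OF p2] symE[OF q1] symE[OF q2] x4 v4[OF vn(1)] v4[OF vn(2)] v4[OF vn(3)] v4[OF vn(4)] by simp_all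
 have g': "(x1, [LeftBlob], y1) \<in> blob_glue ls' rs'" "(y1, [LeftBlob], x1) \<in> blob_glue ls' rs'"
  "(x2, [RightBlob], y2) \<in> blob_glue ls' rs'" "(y2, [RightBlob], x2) \<in> blob_glue ls' rs'" unfolding bg' by simp_all
 have new: "apath E' (blob_glue ls' rs') p1 ([] @ [LeftBlob] @ []) q1" "apath E' (blob_glue ls' rs') q1 ([] @ [LeftBlob] @ []) p1"
  "apath E' (blob_glue ls' rs') p2 ([] @ [RightBlob] @ []) q2" "apath E' (blob_glue ls' rs') q2 ([] @ [RightBlob] @ []) p2"
  by (rule apath.step[OF apath.start[OF e'(5)] g'(1) e'(3)], rule apath.step[OF apath.start[OF e'(7)] g'(2) e'(1)],
    rule apath.step[OF apath.start[OF e'(6)] g'(3) e'(4)], rule apath.step[OF apath.start[OF e'(8)] g'(4) e'(2)])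
 let ?Y = "{al, be, ga, ze, x1, x2, y1, y2, p1, p2, q1, q2}"
 have Yv: "p \<in> ?Y \<longleftrightarrow> p \<in> {p1, p2, q1, q2}" if "p \<in> vertices n" for p using vW[OF that] mem by blast
 have YE1: "q \<in> ?Y" if e: "(p, [], q) \<in> E" and p: "p \<in> ?Y" for p q
 proof -
  have *: "\<exists>q'\<in>?Y. (p, [], q') \<in> E" using p
  proof (elim insertE emptyE)
   assume "p = al" thus ?thesis using r(1) by blast
  next assume "p = be" thus ?thesis using r(2) by blast
  next assume "p = ga" thus ?thesis using r(3) by blast
  next assume "p = ze" thus ?thesis using r(4) by blast
  next assume "p = x1" thus ?thesis using p1 by blast
  next assume "p = x2" thus ?thesis using p2 by blast
  next assume "p = y1" thus ?thesis using q1 by blast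
  next assume "p = y2" thus ?thesis using q2 by blast
  next assume "p = p1" thus ?thesis using symE[OF p1] by blast
  next assume "p = p2" thus ?thesis using symE[OF p2] by blast
  next assume "p = q1" thus ?thesis using symE[OF q1] by blast
  next assume "p = q2" thus ?thesis using symE[OF q2] by blast
  qed
  then obtain q' where "q' \<in> ?Y" "(p, [], q') \<in> E" by blast
  moreover from this have "q = q'" using uniqE[OF e] by blast
  ultimately show ?thesis by simp
 qed
 have YE: "p \<in> ?Y \<longleftrightarrow> q \<in> ?Y" if "(p, w, q) \<in> E" for p w q
 proof -
  have "(p, [], q) \<in> E" using that lab by blast
  thus ?thesis using YE1 symE by blast
 qed
 have nY: "z \<notin> ?Y" if "z \<in> set A \<union> set B \<union> set C \<union> set D" for z
 proof -
  have "z \<in> W" using that unfolding ls rs by auto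
  hence "z \<notin> {p1, p2, q1, q2}" using nW by blast
  moreover have "z \<notin> {al, be, ga, ze, x1, x2, y1, y2}" using that dist by auto
  ultimately show ?thesis by blast
 qed
 have old: "(p, u, q) \<in> blob_glue ls' rs' \<and> p \<notin> ?Y \<and> q \<notin> ?Y \<or> p \<in> ?Y \<and> q \<in> ?Y" if "(p, u, q) \<in> blob_glue ls rs" for p u q
 proof -
  from that consider "(p, u, q) \<in> link [LeftBlob] A \<union> link [LeftBlob] B \<union> link [RightBlob] C \<union> link [RightBlob] D"
   | "(p, u, q) \<in> {(x1, [LeftBlob], al), (al, [LeftBlob], x1), (be, [LeftBlob], y1), (y1, [LeftBlob], be)}"
   | "(p, u, q) \<in> {(x2, [RightBlob], ga), (ga, [RightBlob], x2), (ze, [RightBlob], y2), (y2, [RightBlob], ze)}" unfolding bg Un_iff by argo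
  thus ?thesis
  proof cases
   case 1
   hence "p \<in> set A \<union> set B \<union> set C \<union> set D" "q \<in> set A \<union> set B \<union> set C \<union> set D" by (auto dest: link_sub)
   hence "p \<notin> ?Y" "q \<notin> ?Y" using nY by blast+
   moreover have "(p, u, q) \<in> blob_glue ls' rs'" using 1 unfolding bg' by blast
   ultimately show ?thesis by blast
  next
   case 2
   thus ?thesis by auto
  next
   case 3
   thus ?thesis by auto
  qed
 qed
 have YG: "p \<in> ?Y \<longleftrightarrow> q \<in> ?Y" if "(p, u, q) \<in> blob_glue ls rs" for p u q using old[OF that] by blast
 have keep: "(p, w, q) \<in> drawn_lines n ls' rs' E'" if "(p, w, q) \<in> ?D" "p \<notin> {p1, p2, q1, q2}" for p w q
 proof -
  note L = line_shape[OF that(1)]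
  have pY: "p \<notin> ?Y" using Yv[OF L(1)] that(2) by blast
  have "apath (del ?Y E) (del ?Y (blob_glue ls rs)) p w q" by (rule conjunct1[OF apath_del[OF L(5) pY]]) (erule YE, erule YG)
  moreover have "del ?Y E \<subseteq> E'" unfolding E'_def del_def by auto
  moreover have "del ?Y (blob_glue ls rs) \<subseteq> blob_glue ls' rs'"
  proof
   fix z assume z: "z \<in> del ?Y (blob_glue ls rs)"
   obtain p u q where zz: "z = (p, u, q)" by (cases z)
   have "(p, u, q) \<in> blob_glue ls rs" "p \<notin> ?Y" using z unfolding zz del_iff by blast+
   thus "z \<in> blob_glue ls' rs'" using old[of p u q] zz by blast
  qed
  ultimately have "apath E' (blob_glue ls' rs') p w q" by (rule apath_mono)
  thus ?thesis unfolding drawn_lines_def using L by simp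
 qed
 have "reconnect ?D = drawn_lines n ls' rs' E'"
 proof (rule matching_total_eq[OF P.lines_matching])
  show "reconnect ?D \<subseteq> drawn_lines n ls' rs' E'"
  proof
   fix z assume z: "z \<in> reconnect ?D"
   obtain p w q where zz: "z = (p, w, q)" by (cases z)
   have "((p, w, q) \<in> ?D \<and> {p, q} \<noteq> {p1, p2} \<and> {p, q} \<noteq> {q1, q2}) \<or>
     (p, w, q) \<in> {(p1, [LeftBlob], q1), (q1, [LeftBlob], p1), (p2, [RightBlob], q2), (q2, [RightBlob], p2)}"
    using z unfolding zz rec Un_iff mem_Collect_eq prod.case .
   then consider "(p, w, q) \<in> ?D \<and> {p, q} \<noteq> {p1, p2} \<and> {p, q} \<noteq> {q1, q2}"
    | "(p, w, q) \<in> {(p1, [LeftBlob], q1), (q1, [LeftBlob], p1), (p2, [RightBlob], q2), (q2, [RightBlob], p2)}" by (elim disjE)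
   thus "z \<in> drawn_lines n ls' rs' E'"
   proof cases
    case 1
    note u = matching_uniq[OF lines_matching]
    have t: "(p1, [LeftBlob, RightBlob], p2) \<in> ?D" "(q1, [LeftBlob, RightBlob], q2) \<in> ?D" using top_line bot_line i j k l by simp_all
    note t' = matchingD(4)[OF lines_matching t(1)] matchingD(4)[OF lines_matching t(2)]
    have "p \<noteq> p1" using u[OF t(1)] 1 by blast
    moreover have "p \<noteq> p2" using u[OF t'(1)] 1 by blast
    moreover have "p \<noteq> q1" using u[OF t(2)] 1 by blast
    moreover have "p \<noteq> q2" using u[OF t'(2)] 1 by blast
    ultimately show ?thesis using keep 1(1) zz by blast
   next
    case 2
    thus ?thesis using new vn zz unfolding drawn_lines_def by auto
   qed
  qed
  fix p assume p: "p \<in> vertices n"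
  show "\<exists>w q. (p, w, q) \<in> reconnect ?D"
  proof (cases "p \<in> {p1, p2, q1, q2}")
   case True
   thus ?thesis unfolding rec by blast
  next
   case False
   obtain w q where "(p, w, q) \<in> ?D" using matching_ex[OF lines_matching p] by blast
   moreover have "{p, q} \<noteq> {p1, p2}" "{p, q} \<noteq> {q1, q2}" using False by blast+
   ultimately show ?thesis unfolding rec Un_iff mem_Collect_eq prod.case by (intro exI[of _ w] exI[of _ q] disjI1 conjI)
  qed
 qed
 thus ?thesis using I S noredex by (intro exI[of _ ls'] exI[of _ rs'] exI[of _ E']) simp
qed

end

section \<open>Drawings on the rectangle\<close>

lemma asc_order_iso:
 assumes "ascending f xs" "ascending h xs" "x \<in> set xs" "y \<in> set xs"
 shows "f x < f y \<longleftrightarrow> h x < h y"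
proof -
 obtain i j where "i < length xs" "j < length xs" "x = xs ! i" "y = xs ! j" using assms(3,4) by (metis in_set_conv_nth)
 thus ?thesis using asc_nth_less_iff[OF assms(1)] asc_nth_less_iff[OF assms(2)] by simp
qed

lemma noncrossing_order_iso:
 assumes "M \<subseteq> S \<times> S" "\<And>x y. x \<in> S \<Longrightarrow> y \<in> S \<Longrightarrow> h (g x) < h (g y) \<longleftrightarrow> f x < f y" "noncrossing f M"
 shows "noncrossing h (map_prod g g ` M)" unfolding noncrossing_def
proof (intro notI, elim exE conjE)
 fix p q r s assume A: "(p, q) \<in> map_prod g g ` M" "(r, s) \<in> map_prod g g ` M" "h p < h r" "h r < h q" "h q < h s"
 obtain p' q' where 1: "(p', q') \<in> M" "p = g p'" "q = g q'" using A(1) by auto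
 obtain r' s' where 2: "(r', s') \<in> M" "r = g r'" "s = g s'" using A(2) by auto
 have "p' \<in> S" "q' \<in> S" "r' \<in> S" "s' \<in> S" using 1 2 assms(1) by auto
 hence "f p' < f r'" "f r' < f q'" "f q' < f s'" using A assms(2) 1 2 by auto
 thus False using assms(3) 1 2 unfolding noncrossing_def by blast
qed

definition wall :: "blob \<Rightarrow> nat \<Rightarrow> point list" where
 "wall s k = map (Wall s) [0..<2 * k]"

definition small_circ :: "nat \<Rightarrow> point list \<Rightarrow> point list \<Rightarrow> point list" where
 "small_circ n ls rs = map Top [1..<n + 1] @ rs @ rev (map Bot [1..<n + 1]) @ rev ls"

lemma set_small_circ: "set (small_circ n ls rs) = vertices n \<union> set ls \<union> set rs" unfolding small_circ_def vertices_alt by auto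

lemma set_wall: "set (wall s k) = Wall s ` {..<2 * k}" unfolding wall_def by auto

lemma boundary_walls: "boundary n l r = set (small_circ n (wall LeftBlob l) (wall RightBlob r))"
 unfolding boundary_def set_small_circ set_wall by auto

lemma sorted_clockwise:
 "ascending (clockwise n l r) (small_circ n (wall LeftBlob l) (wall RightBlob r))" unfolding small_circ_def wall_def sorted_wrt_append
 by (auto simp: sorted_wrt_map rev_map[symmetric] sorted_wrt_rev simp del: upt_Suc
   intro!: sorted_wrt_mono_rel[OF _ sorted_wrt_upt])

text \<open>
  The abstract wall points of a drawing are renamed to the points \<open>Wall s i\<close> of the rectangle.
\<close>

definition relabel :: "nat \<Rightarrow> point list \<Rightarrow> point list \<Rightarrow> point \<Rightarrow> point" where
 "relabel n ls rs p = (if p \<in> set ls then Wall LeftBlob (THE i. i < length ls \<and> ls ! i = p)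
   else if p \<in> set rs then Wall RightBlob (THE i. i < length rs \<and> rs ! i = p) else p)"

lemma across_iff: "(\<exists>j. 2 * j + 1 < N \<and> ((a = 2 * j \<and> b = 2 * j + 1) \<or> (a = 2 * j + 1 \<and> b = 2 * j))) \<longleftrightarrow> a < N \<and> b = across a"
 if "even N" for a b N :: nat
proof
 assume "a < N \<and> b = across a"
 thus "\<exists>j. 2 * j + 1 < N \<and> ((a = 2 * j \<and> b = 2 * j + 1) \<or> (a = 2 * j + 1 \<and> b = 2 * j))"
  using that unfolding across_def by (intro exI[of _ "a div 2"]) (auto elim!: evenE oddE split: if_splits)
qed (auto simp: across_def)

context planar begin

definition "g = relabel n ls rs"

lemma g_ls: "i < length ls \<Longrightarrow> g (ls ! i) = Wall LeftBlob i"
 unfolding g_def relabel_def using nth_eq_iff_index_eq[OF disj(8)] by (auto intro!: the_equality)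

lemma g_rs: assumes "i < length rs" shows "g (rs ! i) = Wall RightBlob i"
proof -
 have "rs ! i \<notin> set ls" "rs ! i \<in> set rs" using disj(3) assms by auto
 thus ?thesis unfolding g_def relabel_def using nth_eq_iff_index_eq[OF disj(9)] assms by (auto intro!: the_equality)
qed

lemma g_vertex: "p \<in> vertices n \<Longrightarrow> g p = p" unfolding g_def relabel_def using disj by (auto simp: vertices_Suc)

definition "B = set (small_circ n ls rs)"

lemma B: "B = vertices n \<union> set ls \<union> set rs" unfolding B_def set_small_circ ..

lemma map_g: "map g (small_circ n ls rs) = small_circ n (wall LeftBlob (length ls div 2)) (wall RightBlob (length rs div 2))"
proof -
 have "map g ls = wall LeftBlob (length ls div 2)" unfolding wall_def using even_ls by (intro nth_equalityI) (auto simp: g_ls)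
 moreover have "map g rs = wall RightBlob (length rs div 2)" unfolding wall_def using even_rs by (intro nth_equalityI) (auto simp: g_rs)
 moreover have "map g (map Top [1..<n + 1]) = map Top [1..<n + 1]" "map g (map Bot [1..<n + 1]) = map Bot [1..<n + 1]"
  by (rule map_idI, rule g_vertex, simp add: vertices_alt)+
 ultimately show ?thesis unfolding small_circ_def map_append rev_map[symmetric] by simp
qed

lemma g_image: "g ` B = boundary n (length ls div 2) (length rs div 2)" unfolding B_def boundary_walls map_g[symmetric] by simp

lemma small_asc: "ascending pos (small_circ n ls rs)"
proof -
 have "small_circ n ls rs = filter (\<lambda>x. x \<notin> {Top (n + 1), Bot (n + 1), Top 0, Bot 0}) (circ n ls rs)"
 proof -
  have "filter (\<lambda>x. x \<notin> {Top (n + 1), Bot (n + 1), Top 0, Bot 0}) ls = ls" "filter (\<lambda>x. x \<notin> {Top (n + 1), Bot (n + 1), Top 0, Bot 0}) rs = rs"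
   by (rule filter_True; use disj in \<open>auto simp: vertices_Suc\<close>)+
  moreover have "filter (\<lambda>x. x \<notin> {Top (n + 1), Bot (n + 1), Top 0, Bot 0}) (map Top [1..<n + 1]) = map Top [1..<n + 1]"
   "filter (\<lambda>x. x \<notin> {Top (n + 1), Bot (n + 1), Top 0, Bot 0}) (map Bot [1..<n + 1]) = map Bot [1..<n + 1]" by (rule filter_True; auto)+
  moreover have "[1..<n + 2] = [1..<n + 1] @ [n + 1]" by simp
  ultimately show ?thesis unfolding circ_def small_circ_def by (simp add: rev_filter[symmetric] del: upt_Suc)
 qed
 thus ?thesis using sorted_wrt_filter'[OF asc] by simp
qed

lemma g_order: "x \<in> B \<Longrightarrow> y \<in> B \<Longrightarrow>
 clockwise n (length ls div 2) (length rs div 2) (g x) < clockwise n (length ls div 2) (length rs div 2) (g y) \<longleftrightarrow> pos x < pos y"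
proof -
 assume xy: "x \<in> B" "y \<in> B"
 have s: "sorted_wrt (\<lambda>a b. clockwise n (length ls div 2) (length rs div 2) (g a) < clockwise n (length ls div 2) (length rs div 2) (g b)) (small_circ n ls rs)"
  using sorted_clockwise[of n "length ls div 2" "length rs div 2"] unfolding map_g[symmetric] sorted_wrt_map .
 show ?thesis by (rule asc_order_iso[OF s small_asc]) (use xy in \<open>simp_all add: B_def\<close>)
qed

lemma g_inj: "inj_on g B"
proof (rule inj_onI)
 fix x y assume A: "x \<in> B" "y \<in> B" "g x = g y"
 hence "\<not> pos x < pos y" "\<not> pos y < pos x" using g_order[of x y] g_order[of y x] by auto
 hence "pos x = pos y" by simp
 thus "x = y" using asc_inj[OF small_asc] A unfolding B_def by (auto simp: inj_on_def)
qed

definition "EB = {(p, q). (p, [], q) \<in> E \<and> p \<in> B \<and> q \<in> B}"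
definition "M = map_prod g g ` EB"

lemma B_closed: "(p, [], q) \<in> E \<Longrightarrow> p \<in> B \<Longrightarrow> q \<in> B"
proof -
 assume e: "(p, [], q) \<in> E" and p: "p \<in> B"
 have p': "p \<notin> hook_ends n" using p disj unfolding B by (auto simp: vertices_Suc)
 have "q \<in> V" using matchingD[OF E e] by blast
 moreover have "q \<noteq> Top 0" "q \<noteq> Bot 0" "q \<noteq> Top (n + 1)" "q \<noteq> Bot (n + 1)"
  using uniqE[OF symE[OF e]] symE[OF hook_top] hook_top symE[OF hook_bot] hook_bot p' by blast+
 ultimately show "q \<in> B" unfolding B set_circ by (auto simp: vertices_Suc)
qed

lemma drawing_M: "drawing n (length ls div 2) (length rs div 2) M" unfolding drawing_def
proof
 have EB: "(p, q) \<in> EB \<longleftrightarrow> (p, [], q) \<in> E \<and> p \<in> B" for p q using B_closed unfolding EB_def by blast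
 show "noncrossing (clockwise n (length ls div 2) (length rs div 2)) M" unfolding M_def
 proof (rule noncrossing_order_iso[where f = pos and S = B])
  show "noncrossing pos EB" by (rule noncrossing_mono[OF nc]) (auto simp: EB und_E)
 qed (use g_order in \<open>auto simp: EB_def\<close>)
 show "pairing (boundary n (length ls div 2) (length rs div 2)) M" unfolding pairing_def g_image[symmetric]
 proof (intro conjI ballI)
  show "M \<subseteq> g ` B \<times> g ` B" unfolding M_def EB_def by auto
  show "sym M"
  proof (rule symI)
   fix P Q assume "(P, Q) \<in> M"
   then obtain p q where "(p, q) \<in> EB" "P = g p" "Q = g q" unfolding M_def by auto
   moreover from this have "(q, p) \<in> EB" unfolding EB_def using symE by blast
   ultimately show "(Q, P) \<in> M" unfolding M_def by force
  qed
  show "irrefl M"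
  proof (rule irreflI, rule notI)
   fix P assume "(P, P) \<in> M"
   then obtain p q where h: "(p, q) \<in> EB" "P = g p" "P = g q" unfolding M_def by auto
   hence "p = q" using inj_onD[OF g_inj, of p q] unfolding EB_def by simp
   thus False using h(1) matchingD(3)[OF E, of p "[]" q] unfolding EB_def by simp
  qed
  fix P assume "P \<in> g ` B"
  then obtain p where p: "p \<in> B" "P = g p" by blast
  then obtain q where q: "(p, [], q) \<in> E" using exE'[of p] unfolding B set_circ by (auto simp: vertices_Suc)
  have qB: "q \<in> B" using B_closed q p by blast
  show "\<exists>!Q. (P, Q) \<in> M"
  proof (rule ex1I[of _ "g q"])
   show "(P, g q) \<in> M" unfolding M_def EB_def using p q qB by auto
   fix Q assume "(P, Q) \<in> M"
   then obtain p' q' where h: "(p', [], q') \<in> E" "p' \<in> B" "P = g p'" "Q = g q'" unfolding M_def EB_def by auto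
   hence "p' = p" using g_inj p by (auto simp: inj_on_def)
   thus "Q = g q" using uniqE[OF q] h by blast
  qed
 qed
qed

lemma glue_wall:
 assumes "x \<in> B" "x' \<in> B"
 shows "(x, [s], x') \<in> blob_glue ls rs \<longleftrightarrow> (\<exists>i. g x = Wall s i \<and> g x' = Wall s (across i))"
proof -
 have wl: "(x, [s], x') \<in> link [s] zs \<longleftrightarrow> (\<exists>i. i < length zs \<and> x = zs ! i \<and> x' = zs ! across i)" if "even (length zs)" for zs
 proof -
  have "(x, [s], x') \<in> link [s] zs \<longleftrightarrow> (\<exists>i k. (\<exists>j. 2 * j + 1 < length zs \<and> ((i = 2 * j \<and> k = 2 * j + 1) \<or> (i = 2 * j + 1 \<and> k = 2 * j))) \<and> x = zs ! i \<and> x' = zs ! k)"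
   unfolding link_nth by auto
  thus ?thesis unfolding across_iff[OF that] by blast
 qed
 have ac: "across i < N" if "i < N" "even N" for i N using that unfolding across_def by presburger
 have gv: "\<exists>i. i < length zs \<and> y = zs ! i" if "y \<in> B" "g y = Wall s i" "zs = (case s of LeftBlob \<Rightarrow> ls | RightBlob \<Rightarrow> rs)" for y i zs
 proof -
  have "y \<notin> vertices n" using that g_vertex[of y] unfolding vertices_def by auto
  hence "y \<in> set ls \<or> y \<in> set rs" using that unfolding B by blast
  hence "y \<in> set zs" using that g_ls g_rs by (cases s) (auto simp: in_set_conv_nth)
  thus ?thesis by (metis in_set_conv_nth)
 qed
 show ?thesis
 proof (cases s)
  case LeftBlob
  have "(x, [s], x') \<in> blob_glue ls rs \<longleftrightarrow> (x, [s], x') \<in> link [s] ls"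
   unfolding blob_glue_def LeftBlob by (auto dest: link_sub)
  also have "\<dots> \<longleftrightarrow> (\<exists>i. g x = Wall s i \<and> g x' = Wall s (across i))" unfolding wl[OF even_ls]
  proof
   assume "\<exists>i. i < length ls \<and> x = ls ! i \<and> x' = ls ! across i"
   then obtain i where i: "i < length ls" "x = ls ! i" "x' = ls ! across i" by blast
   thus "\<exists>i. g x = Wall s i \<and> g x' = Wall s (across i)" using g_ls ac[OF _ even_ls] LeftBlob by auto
  next
   assume "\<exists>i. g x = Wall s i \<and> g x' = Wall s (across i)"
   then obtain i where i: "g x = Wall s i" "g x' = Wall s (across i)" by blast
   obtain k where k: "k < length ls" "x = ls ! k" using gv[OF assms(1) i(1), of ls] LeftBlob by auto
   obtain k' where k': "k' < length ls" "x' = ls ! k'" using gv[OF assms(2) i(2), of ls] LeftBlob by auto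
   have "k = i" "k' = across i" using g_ls k k' i by auto
   thus "\<exists>i. i < length ls \<and> x = ls ! i \<and> x' = ls ! across i" using k k' by blast
  qed
  finally show ?thesis .
 next
  case RightBlob
  have "(x, [s], x') \<in> blob_glue ls rs \<longleftrightarrow> (x, [s], x') \<in> link [s] rs"
   unfolding blob_glue_def RightBlob by (auto dest: link_sub)
  also have "\<dots> \<longleftrightarrow> (\<exists>i. g x = Wall s i \<and> g x' = Wall s (across i))" unfolding wl[OF even_rs]
  proof
   assume "\<exists>i. i < length rs \<and> x = rs ! i \<and> x' = rs ! across i"
   then obtain i where i: "i < length rs" "x = rs ! i" "x' = rs ! across i" by blast
   thus "\<exists>i. g x = Wall s i \<and> g x' = Wall s (across i)" using g_rs ac[OF _ even_rs] RightBlob by auto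
  next
   assume "\<exists>i. g x = Wall s i \<and> g x' = Wall s (across i)"
   then obtain i where i: "g x = Wall s i" "g x' = Wall s (across i)" by blast
   obtain k where k: "k < length rs" "x = rs ! k" using gv[OF assms(1) i(1), of rs] RightBlob by auto
   obtain k' where k': "k' < length rs" "x' = rs ! k'" using gv[OF assms(2) i(2), of rs] RightBlob by auto
   have "k = i" "k' = across i" using g_rs k k' i by auto
   thus "\<exists>i. i < length rs \<and> x = rs ! i \<and> x' = rs ! across i" using k k' by blast
  qed
  finally show ?thesis .
 qed
qed

lemma thread_apath: "thread M P w Q \<Longrightarrow> p \<in> B \<Longrightarrow> P = g p \<Longrightarrow> \<exists>q\<in>B. Q = g q \<and> apath E (blob_glue ls rs) p w q"
proof (induction rule: thread.induct)
 case (start P Q)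
 then obtain p' q where h: "(p', [], q) \<in> E" "p' \<in> B" "q \<in> B" "P = g p'" "Q = g q" unfolding M_def EB_def by auto
 hence "p' = p" using g_inj start by (auto simp: inj_on_def)
 thus ?case using h by (auto intro: apath.start)
next
 case (blob P w s i Q)
 then obtain q where q: "q \<in> B" "Wall s i = g q" "apath E (blob_glue ls rs) p w q" by blast
 obtain b r where h: "(b, [], r) \<in> E" "b \<in> B" "r \<in> B" "Wall s (across i) = g b" "Q = g r" using blob(2) unfolding M_def EB_def by auto
 have "(q, [s], b) \<in> blob_glue ls rs" using glue_wall[OF q(1) h(2)] q(2) h(4) by metis
 hence "apath E (blob_glue ls rs) p (w @ [s] @ []) r" using q h by (blast intro: apath.step)
 thus ?case using h by auto
qed

lemma apath_thread: "apath E (blob_glue ls rs) p w q \<Longrightarrow> p \<in> B \<Longrightarrow> q \<in> B \<and> thread M (g p) w (g q)"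
proof (induction rule: apath.induct)
 case (start p w q)
 hence w: "w = []" "(p, [], q) \<in> E" using lab by blast+
 hence "q \<in> B" using B_closed start by blast
 hence "(g p, g q) \<in> M" unfolding M_def EB_def using start w by auto
 thus ?case using \<open>q \<in> B\<close> w by (auto intro: thread.start)
next
 case (step p w a u b w' q)
 hence IH: "a \<in> B" "thread M (g p) w (g a)" by auto
 have w': "w' = []" "(b, [], q) \<in> E" using lab step by blast+
 have b: "b \<in> B" using matchingD(2)[OF blob_glue step(2)] unfolding B by blast
 obtain s where s: "u = [s]" using step(2) unfolding blob_glue_def by (auto dest: link_sub)
 obtain i where i: "g a = Wall s i" "g b = Wall s (across i)" using glue_wall[OF IH(1) b] step(2) s by blast
 have q: "q \<in> B" using B_closed w' b by blast
 have "(g b, g q) \<in> M" unfolding M_def EB_def using w' b q by auto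
 hence "thread M (g p) (w @ [s]) (g q)" using thread.blob[of M "g p" w s i "g q"] IH(2) i by simp
 thus ?case using q s w' by simp
qed

lemma lines_of_M: "lines_of n M = drawn_lines n ls rs E"
proof -
 have "(p, w, q) \<in> lines_of n M \<longleftrightarrow> (p, w, q) \<in> drawn_lines n ls rs E" for p w q
 proof
  assume "(p, w, q) \<in> lines_of n M"
  hence h: "p \<in> vertices n" "q \<in> vertices n" "thread M p w q" unfolding lines_of_def by auto
  have pB: "p \<in> B" "q \<in> B" using h unfolding B by auto
  obtain q' where q': "q' \<in> B" "q = g q'" "apath E (blob_glue ls rs) p w q'"
   using thread_apath[OF h(3) pB(1) g_vertex[OF h(1), symmetric]] by blast
  have "g q' = g q" using q'(2) g_vertex[OF h(2)] by (rule trans[OF sym sym])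
  hence "q' = q" by (rule inj_onD[OF g_inj _ q'(1) pB(2)])
  moreover note q'
  ultimately show "(p, w, q) \<in> drawn_lines n ls rs E" unfolding drawn_lines_def using h by auto
 next
  assume "(p, w, q) \<in> drawn_lines n ls rs E"
  hence h: "p \<in> vertices n" "q \<in> vertices n" "apath E (blob_glue ls rs) p w q" unfolding drawn_lines_def by auto
  have "thread M (g p) w (g q)" using apath_thread[OF h(3)] h unfolding B by blast
  thus "(p, w, q) \<in> lines_of n M" unfolding lines_of_def using h g_vertex by auto
 qed
 thus ?thesis by auto
qed

theorem left_right: "drawn_lines n ls rs E \<in> left_right_diagrams n" unfolding left_right_diagrams_def using lines_of_M drawing_M by blast

end

lemma ex_pos: "distinct xs \<Longrightarrow> \<exists>pos :: 'a \<Rightarrow> nat. \<forall>i<length xs. pos (xs ! i) = i"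
proof -
 assume d: "distinct xs"
 have "(THE k. k < length xs \<and> xs ! k = xs ! i) = i" if "i < length xs" for i using that nth_eq_iff_index_eq[OF d] by (intro the_equality) auto
 thus ?thesis by (intro exI[of _ "\<lambda>x. THE k. k < length xs \<and> xs ! k = x"]) auto
qed

lemma index_asc: "\<forall>i<length xs. pos (xs ! i) = i \<Longrightarrow> ascending pos xs" by (auto simp: sorted_wrt_iff_nth_less)

definition unlabelled :: "('a \<times> 'a) set \<Rightarrow> ('a \<times> 'l list \<times> 'a) set" where
 "unlabelled M = (\<lambda>(p, q). (p, [], q)) ` M"

lemma unlabelled_iff: "(p, w, q) \<in> unlabelled M \<longleftrightarrow> w = [] \<and> (p, q) \<in> M" unfolding unlabelled_def by auto

lemma und_unlabelled: "und (unlabelled M) = M" unfolding und_def unlabelled_iff by auto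

lemma matching_pairing: "matching V (unlabelled M) \<longleftrightarrow> pairing V M"
 unfolding matching_def pairing_def unlabelled_iff sym_def irrefl_def by auto blast

text \<open>
  The ends of a hook are neighbours on the boundary, so hooks cross nothing.
\<close>

lemma planar_add_hooks:
 assumes small: "distinct (small_circ n ls rs)" "even (length ls)" "even (length rs)"
  and out: "\<And>x. x \<in> set ls \<union> set rs \<Longrightarrow> x \<notin> hook_ends n"
  and M: "pairing (set (small_circ n ls rs)) M"
  and f: "ascending f (small_circ n ls rs)" "noncrossing f M"
 shows "\<exists>pos. planar n ls rs pos (unlabelled (M \<union> hook_edges n))"
proof -
 let ?H = "hook_edges n"
 let ?S = "set (small_circ n ls rs)"
 have hS: "Top 0 \<notin> ?S" "Bot 0 \<notin> ?S" "Top (n + 1) \<notin> ?S" "Bot (n + 1) \<notin> ?S" using out unfolding set_small_circ by auto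
 have set_eq: "set (circ n ls rs) = ?S \<union> {Top (n + 1), Top 0, Bot (n + 1), Bot 0}"
  unfolding set_circ set_small_circ by (auto simp: vertices_Suc)
 define T B where "T = map Top [1..<n + 1]" and "B = rev (map Bot [1..<n + 1])"
 have c: "circ n ls rs = T @ [Top (n + 1), Top 0] @ rs @ [Bot 0, Bot (n + 1)] @ B @ rev ls" unfolding circ_def T_def B_def by simp
 have sc: "small_circ n ls rs = T @ rs @ B @ rev ls" unfolding small_circ_def T_def B_def by simp
 have d: "distinct (circ n ls rs)" using small(1) hS unfolding c sc by auto
 from ex_pos[OF d] obtain pos :: "point \<Rightarrow> nat" where pos: "\<And>i. i < length (circ n ls rs) \<Longrightarrow> pos (circ n ls rs ! i) = i" by blast
 have asc: "ascending pos (circ n ls rs)" using index_asc pos by blast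
 have asc': "ascending pos (small_circ n ls rs)" using asc unfolding c sc by (auto simp: sorted_wrt_append)
 have tt: "pos (Top (n + 1)) = length T" "pos (Top 0) = Suc (length T)"
  "pos (Bot 0) = length T + 2 + length rs" "pos (Bot (n + 1)) = Suc (length T + 2 + length rs)"
  using pos[of "length T"] pos[of "Suc (length T)"] pos[of "length T + 2 + length rs"] pos[of "Suc (length T + 2 + length rs)"]
  unfolding c by (simp_all add: nth_append)
 have MS: "M \<subseteq> ?S \<times> ?S" using M unfolding pairing_def by blast
 have m: "matching (set (circ n ls rs)) (unlabelled (M \<union> ?H) :: diagram)"
 proof -
  have "matching {Top (n + 1), Top 0} {(Top (n + 1), ([] :: blob list), Top 0), (Top 0, rev [], Top (n + 1))}" by (rule matching_pair) simp
  moreover have "matching {Bot (n + 1), Bot 0} {(Bot (n + 1), ([] :: blob list), Bot 0), (Bot 0, rev [], Bot (n + 1))}" by (rule matching_pair) simp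
  ultimately have h: "matching ({Top (n + 1), Top 0} \<union> {Bot (n + 1), Bot 0}) ({(Top (n + 1), ([] :: blob list), Top 0), (Top 0, rev [], Top (n + 1))} \<union> {(Bot (n + 1), ([] :: blob list), Bot 0), (Bot 0, rev [], Bot (n + 1))})"
   by (rule matching_Un) simp
  have m1: "matching ?S (unlabelled M :: diagram)" using M matching_pairing by blast
  have "matching (?S \<union> ({Top (n + 1), Top 0} \<union> {Bot (n + 1), Bot 0})) (unlabelled M \<union> ({(Top (n + 1), ([] :: blob list), Top 0), (Top 0, rev [], Top (n + 1))} \<union> {(Bot (n + 1), ([] :: blob list), Bot 0), (Bot 0, rev [], Bot (n + 1))}))"
   by (rule matching_Un[OF m1 h]) (use hS in blast)
  moreover have "unlabelled M \<union> ({(Top (n + 1), ([] :: blob list), Top 0), (Top 0, rev [], Top (n + 1))} \<union> {(Bot (n + 1), ([] :: blob list), Bot 0), (Bot 0, rev [], Bot (n + 1))}) = unlabelled (M \<union> ?H)"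
   unfolding unlabelled_def by auto
  moreover have "?S \<union> ({Top (n + 1), Top 0} \<union> {Bot (n + 1), Bot 0}) = set (circ n ls rs)" unfolding set_eq by blast
  ultimately show ?thesis by (simp only:)
 qed
 have ncM: "noncrossing pos M"
 proof -
  have "noncrossing pos (map_prod id id ` M)" by (rule noncrossing_order_iso[OF MS _ f(2)]) (use asc_order_iso[OF asc' f(1)] in auto)
  thus ?thesis by (simp only: prod.map_id0 image_id id_apply)
 qed
 have nc: "noncrossing pos (M \<union> ?H)" unfolding noncrossing_def
 proof (intro notI, elim exE conjE)
  fix p q r s assume h: "(p, q) \<in> M \<union> ?H" "(r, s) \<in> M \<union> ?H" "pos p < pos r" "pos r < pos q" "pos q < pos s"
  have H: "pos b \<le> Suc (pos a)" if "(a, b) \<in> ?H" for a b using that tt by auto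
  have "(p, q) \<notin> ?H"
  proof
   assume "(p, q) \<in> ?H"
   hence "pos q \<le> Suc (pos p)" by (rule H)
   thus False using h(3,4) by linarith
  qed
  moreover have "(r, s) \<notin> ?H"
  proof
   assume "(r, s) \<in> ?H"
   hence "pos s \<le> Suc (pos r)" by (rule H)
   thus False using h(4,5) by linarith
  qed
  ultimately have "(p, q) \<in> M" "(r, s) \<in> M" using h(1,2) by blast+
  thus False using ncM h unfolding noncrossing_def by blast
 qed
 have "planar n ls rs pos (unlabelled (M \<union> ?H))"
  unfolding planar_def planar_drawing_def und_unlabelled using asc small(2,3) m nc by (auto simp: unlabelled_iff)
 thus ?thesis by blast
qed

theorem planar_of_drawing:
 assumes "drawing n l r M"
 shows "\<exists>ls rs pos E. planar n ls rs pos E \<and> drawn_lines n ls rs E = lines_of n M"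
proof -
 let ?ls = "wall LeftBlob l" and ?rs = "wall RightBlob r"
 have M: "pairing (boundary n l r) M" "noncrossing (clockwise n l r) M" using assms unfolding drawing_def by auto
 have out: "x \<notin> hook_ends n" if "x \<in> set ?ls \<union> set ?rs" for x using that unfolding set_wall by auto
 have len: "length ?ls = 2 * l" "length ?rs = 2 * r" unfolding wall_def by auto
 have sc: "ascending (clockwise n l r) (small_circ n ?ls ?rs)" by (rule sorted_clockwise)
 let ?E = "unlabelled (M \<union> hook_edges n) :: diagram"
 obtain pos where P: "planar n ?ls ?rs pos ?E"
  using planar_add_hooks[OF asc_distinct[OF sc] _ _ out M(1)[unfolded boundary_walls] sc M(2)] len by auto
 interpret planar n ?ls ?rs pos ?E by (rule P)
 have gid: "g x = x" if "x \<in> B" for x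
 proof -
  have "g (Wall LeftBlob i) = Wall LeftBlob i" if "i < 2 * l" for i using g_ls[of i] that len unfolding wall_def by simp
  moreover have "g (Wall RightBlob i) = Wall RightBlob i" if "i < 2 * r" for i using g_rs[of i] that len unfolding wall_def by simp
  ultimately show ?thesis using that g_vertex unfolding B set_wall by auto
 qed
 have BM: "M \<subseteq> B \<times> B" using M(1) unfolding pairing_def boundary_walls B_def by blast
 have hB: "x \<notin> B" if "x \<in> hook_ends n" for x using that out unfolding B by auto
 have "EB = M"
 proof (intro equalityI subrelI)
  fix p q assume "(p, q) \<in> EB"
  hence "(p, q) \<in> M \<union> hook_edges n" "p \<in> B"
   unfolding EB_def unlabelled_iff by blast+
  thus "(p, q) \<in> M" using hB[of p] by blast
 next
  fix p q assume "(p, q) \<in> M"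
  thus "(p, q) \<in> EB" unfolding EB_def unlabelled_iff using BM by blast
 qed
 moreover have "map_prod g g ` M = M"
 proof -
  have "map_prod g g ` M = (\<lambda>z. z) ` M"
  proof (rule image_cong)
   fix z assume z: "z \<in> M"
   obtain p q where "z = (p, q)" by (cases z)
   thus "map_prod g g z = z" using gid[of p] gid[of q] z BM by auto
  qed simp
  thus ?thesis by simp
 qed
 ultimately have "planar.M n ?ls ?rs ?E = M" unfolding M_def by simp
 hence "drawn_lines n ?ls ?rs ?E = lines_of n M" using lines_of_M by simp
 thus ?thesis using P by blast
qed

lemma noncrossing_change:
 assumes "M \<subseteq> S \<times> S" "\<And>x y. x \<in> S \<Longrightarrow> y \<in> S \<Longrightarrow> h x < h y \<longleftrightarrow> f x < f y" "noncrossing f M"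
 shows "noncrossing h M" using noncrossing_order_iso[of M S h "\<lambda>x. x" f] assms by (simp add: map_prod_def)

section \<open>From blob diagrams to Temperley--Lieb diagrams\<close>

text \<open>
  The order in which lines from the vertices reach the right side without crossings: from the top right
  vertex to the left one, then along the bottom from left to right.
\<close>

fun wall_order :: "point \<Rightarrow> int" where
 "wall_order (Top i) = - int i"
| "wall_order (Bot i) = int i"
| "wall_order (Wall s i) = 0"

definition right_vertices :: "diagram \<Rightarrow> point set" where
 "right_vertices D = {p. \<exists>w q. (p, w, q) \<in> D \<and> RightBlob \<in> set w}"

definition right_list :: "diagram \<Rightarrow> point list" where
 "right_list D = (THE vs. sorted_wrt (\<lambda>a b. wall_order a < wall_order b) vs \<and> set vs = right_vertices D)"

text \<open>
  In a blob diagram every line has at most one right blob up to scalars, so the loose ends at the right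
  side can be listed by the vertices from which they come. The result is only meaningful for
  diagrams without consecutive right blobs.
\<close>

definition to_tl :: "nat \<Rightarrow> diagram \<Rightarrow> diagram" where
 "to_tl n D = {(p, [], q) | p q. \<exists>w. (p, w, q) \<in> D \<and> RightBlob \<notin> set w} \<union>
  link [] ([Top (n + 1)] @ right_list D @ [Bot (n + 1)])"

lemma wall_order_inj: "inj_on wall_order (vertices n)" unfolding vertices_def by (auto simp: inj_on_def)

lemma right_list_eq:
 assumes "sorted_wrt (\<lambda>a b. wall_order a < wall_order b) vs" "set vs = right_vertices D" "right_vertices D \<subseteq> vertices n"
 shows "right_list D = vs" unfolding right_list_def
proof (rule the_equality)
 show "sorted_wrt (\<lambda>a b. wall_order a < wall_order b) vs \<and> set vs = right_vertices D" using assms by simp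
 fix us assume us: "sorted_wrt (\<lambda>a b. wall_order a < wall_order b) us \<and> set us = right_vertices D"
 have "map wall_order us = map wall_order vs" by (rule strict_sorted_equal) (use us assms in \<open>simp_all add: sorted_wrt_map\<close>)
 thus "us = vs" by (rule map_inj_on) (use us assms wall_order_inj[of n] in \<open>auto intro: inj_on_subset\<close>)
qed

lemma apath_labels:
 assumes "apath E G p w q" "\<And>p w q. (p, w, q) \<in> E \<Longrightarrow> set w \<subseteq> S" "\<And>p w q. (p, w, q) \<in> G \<Longrightarrow> set w \<subseteq> S"
 shows "set w \<subseteq> S" using assms(1)
proof (induction rule: apath.induct)
 case (start p w q) thus ?case by (rule assms(2))
next
 case (step p w a u b w' q)
 thus ?case using assms(2)[OF step(3)] assms(3)[OF step(2)] by simp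
qed

lemma outer_planar_link:
 assumes asc: "ascending pos (P @ zs @ Q)"
  and g: "(a, u, b) \<in> link v zs \<or> (a, u, b) \<in> link v (rev zs)" and x: "x \<in> set (P @ zs @ Q)" "pos a < pos x" "pos x < pos b"
 shows False
proof -
 have c: "\<exists>A C. zs = A @ [a, b] @ C \<or> zs = A @ [b, a] @ C"
 proof -
  have *: "\<exists>A C. ys = A @ [a, b] @ C \<or> ys = A @ [b, a] @ C" if "(a, u, b) \<in> link v ys" for ys using that
  proof (induction ys rule: pairs.induct)
   case (1 y z ys)
   then consider "(a, u, b) \<in> {(y, v, z), (z, rev v, y)}" | "(a, u, b) \<in> link v ys" by auto
   thus ?case
   proof cases
    case 1
    hence "y # z # ys = [] @ [a, b] @ ys \<or> y # z # ys = [] @ [b, a] @ ys" by auto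
    thus ?thesis by blast
   next
    case 2
    then obtain A C where "ys = A @ [a, b] @ C \<or> ys = A @ [b, a] @ C" using "1.IH" by blast
    hence "y # z # ys = (y # z # A) @ [a, b] @ C \<or> y # z # ys = (y # z # A) @ [b, a] @ C" by auto
    thus ?thesis by blast
   qed
  qed auto
  from g show ?thesis
  proof
   assume "(a, u, b) \<in> link v (rev zs)"
   then obtain A C where "rev zs = A @ [a, b] @ C \<or> rev zs = A @ [b, a] @ C" using * by blast
   hence "zs = rev (A @ [a, b] @ C) \<or> zs = rev (A @ [b, a] @ C)" by (metis rev_rev_ident)
   hence "zs = rev C @ [b, a] @ rev A \<or> zs = rev C @ [a, b] @ rev A" by simp
   thus ?thesis by blast
  qed (rule *)
 qed
 then obtain A C where "zs = A @ [a, b] @ C \<or> zs = A @ [b, a] @ C" by blast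
 thus False
 proof
  assume zs: "zs = A @ [a, b] @ C"
  have s: "\<forall>y\<in>set (P @ A). pos y < pos a" "\<forall>y\<in>set (C @ Q). pos b < pos y"
   using asc unfolding zs by (auto simp: sorted_wrt_append)
  have "x \<in> set (P @ A) \<union> {a, b} \<union> set (C @ Q)" using x(1) unfolding zs by auto
  thus False using s x(2,3) by (elim UnE insertE emptyE) (auto dest!: bspec)
 next
  assume zs: "zs = A @ [b, a] @ C"
  have "pos b < pos a" using asc unfolding zs by (simp add: sorted_wrt_append)
  thus False using x(2,3) by simp
 qed
qed

context planar begin

lemma left_glue: "matching (set ls) (link u ls)" for u :: "blob list" using disj even_ls by (intro matching_link) auto

lemma outer_left: "outer_planar pos V (set ls) (link u ls)" for u :: "blob list" unfolding outer_planar_def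
proof (intro allI impI)
 fix a v b x assume A: "(a, v, b) \<in> link u ls" "x \<in> V" "pos a < pos x" "pos x < pos b"
 have c: "circ n ls rs = (tops @ rs @ bots) @ rev ls @ []" unfolding circ_split by simp
 have "False" by (rule outer_planar_link[OF asc[unfolded c], of a v b u x]) (use A in \<open>auto simp: circ_split\<close>)
 thus "x \<in> set ls \<and> (\<forall>v y. (x, v, y) \<in> link u ls \<longrightarrow> pos a < pos y \<and> pos y < pos b)" ..
qed

lemma outer_strand: "outer_planar pos V (set ls \<union> set ([Top 0] @ rs @ [Bot 0])) (strand_glue ls rs)" unfolding outer_planar_def
proof (intro allI impI)
 fix a v b x assume A: "(a, v, b) \<in> strand_glue ls rs" "x \<in> V" "pos a < pos x" "pos x < pos b"
 have c: "circ n ls rs = (tops @ rs @ bots) @ rev ls @ []" unfolding circ_split by simp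
 have c': "circ n ls rs = map Top [1..<n + 2] @ ([Top 0] @ rs @ [Bot 0]) @ (rev (map Bot [1..<n + 2]) @ rev ls)" unfolding circ_def by simp
 have "False" using A(1) unfolding strand_glue_def
 proof
  assume "(a, v, b) \<in> link [] ls"
  thus False by (intro outer_planar_link[OF asc[unfolded c], of a v b "[]" x]) (use A in \<open>auto simp: circ_split\<close>)
 next
  assume "(a, v, b) \<in> link [] ([Top 0] @ rs @ [Bot 0])"
  thus False by (intro outer_planar_link[OF asc[unfolded c'], of a v b "[]" x]) (use A c' in auto)
 qed
 thus "x \<in> set ls \<union> set ([Top 0] @ rs @ [Bot 0]) \<and> (\<forall>v y. (x, v, y) \<in> strand_glue ls rs \<longrightarrow> pos a < pos y \<and> pos y < pos b)" ..
qed

lemma strand_noncrossing: "noncrossing pos (und (strand_diagram ls rs E))" unfolding strand_diagram_def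
 by (rule noncrossing_glued[OF E strand_glue strand_sub finite_V inj nc outer_strand])

theorem strand_tl: "strand_diagram ls rs E \<in> tl_diagrams (n + 1)"
proof -
 let ?M = "und (strand_diagram ls rs E)"
 let ?vs = "map Top [1..<n + 2] @ rev (map Bot [1..<n + 2])"
 have eq: "strand_diagram ls rs E = unlabelled ?M"
 proof -
  have "(p, w, q) \<in> strand_diagram ls rs E \<longleftrightarrow> (p, w, q) \<in> unlabelled ?M" for p w q
   unfolding unlabelled_iff und_iff using strand_nil by blast
  thus ?thesis by auto
 qed
 have p: "pairing (vertices (n + 1)) ?M" using strand_matching eq matching_pairing by metis
 have sv: "set ?vs = vertices (n + 1)" unfolding vertices_alt by auto
 have asc1: "ascending pos ?vs" using asc unfolding circ_def by (auto simp: sorted_wrt_append simp del: upt_Suc)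
 have asc2: "ascending (clockwise (n + 1) 0 0) ?vs"
  using sorted_clockwise[of "n + 1" 0 0] unfolding small_circ_def wall_def by (simp add: add.commute)
 have "?M \<subseteq> set ?vs \<times> set ?vs" using p unfolding sv pairing_def by blast
 hence "noncrossing (clockwise (n + 1) 0 0) ?M"
 proof (rule noncrossing_change)
  fix x y assume "x \<in> set ?vs" "y \<in> set ?vs"
  thus "clockwise (n + 1) 0 0 x < clockwise (n + 1) 0 0 y \<longleftrightarrow> pos x < pos y" by (rule asc_order_iso[OF asc2 asc1])
 qed (rule strand_noncrossing)
 hence "\<exists>M. strand_diagram ls rs E = (\<lambda>(p, q). (p, [], q)) ` M \<and> pairing (vertices (n + 1)) M \<and> noncrossing (clockwise (n + 1) 0 0) M"
  using p eq unfolding unlabelled_def by blast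
 thus ?thesis unfolding tl_diagrams_def by blast
qed

end

context irreducible begin

definition "N0 = glued E (link [] ls)"

lemma N0: "matching (V - set ls) N0" unfolding N0_def by (rule glued_matching[OF E left_glue _ finite_V]) (use blob_sub in blast)

lemma N0_nil: "(p, w, q) \<in> N0 \<Longrightarrow> w = []" unfolding N0_def glued_def by (auto dest!: apath_nil dest: link_sub)

lemma N0_uniq: "(p, [], q) \<in> N0 \<Longrightarrow> (p, [], q') \<in> N0 \<Longrightarrow> q = q'" using matching_uniq[OF N0] by blast

lemma N0_sym: "(p, [], q) \<in> N0 \<Longrightarrow> (q, [], p) \<in> N0" using matchingD(4)[OF N0, of p "[]" q] by simp

lemma E_N0: "(p, [], q) \<in> E \<Longrightarrow> p \<notin> set ls \<Longrightarrow> q \<notin> set ls \<Longrightarrow> (p, [], q) \<in> N0"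
 unfolding N0_def glued_def dom3_matching[OF left_glue] by (auto intro: apath.start)

lemma N0_noncrossing: "noncrossing pos (und N0)" unfolding N0_def
 by (rule noncrossing_glued[OF E left_glue _ finite_V inj nc outer_left]) (use blob_sub in blast)

lemma N0_nc: "(p, [], q) \<in> N0 \<Longrightarrow> (x, [], y) \<in> N0 \<Longrightarrow> pos p < pos x \<Longrightarrow> pos x < pos q \<Longrightarrow> pos p < pos y \<and> pos y < pos q"
proof -
 have "inj_on pos (V - set ls)" using inj by (rule inj_on_subset) auto
 from noncrossing_iff[OF N0 this] N0_noncrossing
 show "(p, [], q) \<in> N0 \<Longrightarrow> (x, [], y) \<in> N0 \<Longrightarrow> pos p < pos x \<Longrightarrow> pos x < pos q \<Longrightarrow> pos p < pos y \<and> pos y < pos q"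
  unfolding und_iff by blast
qed

text \<open>
  From a point of the right wall a line goes to a vertex, or crosses to a left blob and goes from there to a vertex.
\<close>

lemma right_wall_end:
 assumes x: "x \<in> set rs"
 shows "\<exists>v. (x, [], v) \<in> N0 \<and> v \<in> vertices n"
proof -
 have xV: "x \<in> V" "x \<notin> set ls" "x \<in> W" using x disj blob_sub by blast+
 obtain y where y: "(x, [], y) \<in> E" using exE'[OF xV(1)] by blast
 show ?thesis
 proof (cases "y \<in> W")
  case False
  thus ?thesis using vertex_partner[OF y xV(3)] E_N0[OF y] xV by blast
 next
  case True
  hence yl: "y \<in> set ls" using no_rs[OF x] y by blast
  obtain u y' where g: "(y, u, y') \<in> link [LeftBlob] ls" using matching_ex[OF left_glue yl] by blast
  have y'l: "y' \<in> set ls" using link_sub[OF g] by blast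
  obtain v where v: "(y', [], v) \<in> E" using exE'[of y'] y'l blob_sub by blast
  have "(y, u, y') \<in> blob_glue ls rs" using g unfolding blob_glue_def by blast
  hence vW: "v \<notin> W" using rung_end[OF y xV(3) True _ v] by blast
  have "(y, [], y') \<in> link [] ls" using g unfolding link_nth by auto
  from apath.step[OF apath.start[OF y] this v] have "apath E (link [] ls) x [] v" by simp
  hence "(x, [], v) \<in> N0" unfolding N0_def glued_def dom3_matching[OF left_glue] using xV vW by auto
  moreover have "v \<in> vertices n" by (rule vertex_partner[OF v _ vW]) (use y'l in blast)
  ultimately show ?thesis by blast
 qed
qed

definition "vs = map (\<lambda>x. SOME v. (x, [], v) \<in> N0) rs"

lemma length_vs: "length vs = length rs" unfolding vs_def by simp

lemma vs_nth: assumes "i < length rs" shows "(rs ! i, [], vs ! i) \<in> N0" "vs ! i \<in> vertices n"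
proof -
 obtain v where v: "(rs ! i, [], v) \<in> N0" "v \<in> vertices n" using right_wall_end[of "rs ! i"] assms by auto
 have "(rs ! i, [], SOME v. (rs ! i, [], v) \<in> N0) \<in> N0" using v(1) by (rule someI)
 thus 1: "(rs ! i, [], vs ! i) \<in> N0" unfolding vs_def using assms by simp
 show "vs ! i \<in> vertices n" using N0_uniq[OF v(1) 1] v(2) by simp
qed

lemma set_vs: "p \<in> set vs \<longleftrightarrow> (\<exists>x\<in>set rs. (p, [], x) \<in> N0)"
proof
 assume "p \<in> set vs"
 then obtain i where "i < length rs" "p = vs ! i" using length_vs by (metis in_set_conv_nth)
 thus "\<exists>x\<in>set rs. (p, [], x) \<in> N0" using N0_sym[OF vs_nth(1)[of i]] by (intro bexI[of _ "rs ! i"]) simp_all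
next
 assume "\<exists>x\<in>set rs. (p, [], x) \<in> N0"
 then obtain i where i: "i < length rs" "(p, [], rs ! i) \<in> N0" by (metis in_set_conv_nth)
 have "p = vs ! i" using N0_uniq[OF N0_sym[OF i(2)] vs_nth(1)[OF i(1)]] .
 thus "p \<in> set vs" using i length_vs by simp
qed

lemma vs_vertices: "set vs \<subseteq> vertices n" using vs_nth(2) length_vs by (metis in_set_conv_nth subsetI)

text \<open>
  The lines from the right wall to the vertices do not cross each other.
\<close>

lemma vs_sorted: "sorted_wrt (\<lambda>a b. wall_order a < wall_order b) vs" unfolding sorted_wrt_iff_nth_less length_vs
proof (intro allI impI)
 fix i j assume ij: "i < j" "j < length rs"
 hence il: "i < length rs" by simp
 note e = vs_nth(1)[OF il] vs_nth(1)[OF ij(2)]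
 have r: "rs ! i \<in> set rs" "rs ! j \<in> set rs" "pos (rs ! i) < pos (rs ! j)" using il ij pos_rs by auto
 have ne: "vs ! i \<noteq> vs ! j"
 proof
  assume "vs ! i = vs ! j"
  hence "rs ! i = rs ! j" using N0_uniq[OF N0_sym[OF e(1)]] N0_sym[OF e(2)] by simp
  thus False using r by simp
 qed
 note ti = vertex_top_or_bot[OF vs_nth(2)[OF il]] and tj = vertex_top_or_bot[OF vs_nth(2)[OF ij(2)]]
 show "wall_order (vs ! i) < wall_order (vs ! j)" using ti
 proof (elim disjE bexE conjE)
  fix a assume a: "a \<in> {1..n}" "vs ! i = Top a" "vs ! i \<in> set tops"
  show ?thesis using tj
  proof (elim disjE bexE conjE)
   fix b assume b: "b \<in> {1..n}" "vs ! j = Top b" "vs ! j \<in> set tops"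
   have "\<not> a < b"
   proof
    assume "a < b"
    hence "pos (vs ! i) < pos (vs ! j)" using pos_Top a b by simp
    moreover have "pos (vs ! j) < pos (rs ! i)" using asc_parts(5)[of "vs ! j" "rs ! i"] b r by simp
    ultimately have "pos (rs ! j) < pos (rs ! i)" using N0_nc[OF N0_sym[OF e(1)] N0_sym[OF e(2)]] by blast
    thus False using r by simp
   qed
   thus ?thesis using a b ne by (cases "a = b") auto
  next
   fix b assume "b \<in> {1..n}" "vs ! j = Bot b"
   thus ?thesis using a by simp
  qed
 next
  fix a assume a: "a \<in> {1..n}" "vs ! i = Bot a" "vs ! i \<in> set bots"
  show ?thesis using tj
  proof (elim disjE bexE conjE)
   fix b assume b: "b \<in> {1..n}" "vs ! j = Top b" "vs ! j \<in> set tops"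
   have "pos (rs ! j) < pos (vs ! i)" using asc_parts(6)[of "rs ! j" "vs ! i"] a r by simp
   hence "pos (rs ! i) < pos (vs ! j)" using N0_nc[OF e(1,2) r(3)] by blast
   moreover have "pos (vs ! j) < pos (rs ! i)" using asc_parts(5)[of "vs ! j" "rs ! i"] b r by simp
   ultimately show ?thesis by simp
  next
   fix b assume b: "b \<in> {1..n}" "vs ! j = Bot b" "vs ! j \<in> set bots"
   have "\<not> b < a"
   proof
    assume "b < a"
    hence "pos (vs ! i) < pos (vs ! j)" using pos_Bot a b by simp
    moreover have "pos (rs ! j) < pos (vs ! i)" using asc_parts(6)[of "rs ! j" "vs ! i"] a r by simp
    ultimately have "pos (rs ! j) < pos (rs ! i)" using N0_nc[OF e(2) N0_sym[OF e(1)]] by blast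
    thus False using r by simp
   qed
   thus ?thesis using a b ne by (cases "a = b") auto
  qed
 qed
qed

definition "NL = glued E (link [LeftBlob] ls)"

lemma NL: "matching (V - set ls) NL" unfolding NL_def by (rule glued_matching[OF E left_glue _ finite_V]) (use blob_sub in blast)

lemma und_NL: "und NL = und N0"
proof -
 have s: "set ls \<subseteq> V" using blob_sub by blast
 show ?thesis
  unfolding NL_def N0_def ends_glued[OF E left_glue s finite_V, symmetric] und_link_any[of "[LeftBlob]" ls "[] :: blob list"] by (rule refl)
qed

lemma NL_ex: "(p, [], q) \<in> N0 \<Longrightarrow> \<exists>w. (p, w, q) \<in> NL" using und_NL unfolding und_def by blast

lemma NL_labels: "(p, w, q) \<in> NL \<Longrightarrow> RightBlob \<notin> set w"
proof -
 assume "(p, w, q) \<in> NL"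
 hence "apath E (link [LeftBlob] ls) p w q" unfolding NL_def glued_def by auto
 hence "set w \<subseteq> {LeftBlob}" by (rule apath_labels) (auto dest!: lab dest: link_sub)
 thus ?thesis by auto
qed

lemma NL_lines: "glued NL (link [RightBlob] rs) = glued E (blob_glue ls rs)" unfolding NL_def blob_glue_def
 using disj even_rs by (intro glued_glued_matching[OF left_glue matching_link]) auto

lemma line_without_right:
 assumes p: "p \<in> vertices n" and q: "(p, [], q) \<in> N0" "q \<notin> set rs"
 obtains w where "(p, w, q) \<in> drawn_lines n ls rs E" "RightBlob \<notin> set w"
proof -
 obtain w where w: "(p, w, q) \<in> NL" using NL_ex[OF q(1)] by blast
 have d: "dom3 (link [RightBlob] rs) = set rs" using disj even_rs by (intro dom3_matching matching_link) auto
 have "p \<notin> set rs" using p disj by (auto simp: vertices_Suc)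
 hence "(p, w, q) \<in> glued NL (link [RightBlob] rs)" unfolding glued_def d using w q by (auto intro: apath.start)
 hence "(p, w, q) \<in> drawn_lines n ls rs E" unfolding lines_glued NL_lines using p by simp
 thus ?thesis using that NL_labels[OF w] by blast
qed

lemma line_with_right:
 assumes j: "2 * j + 1 < length rs"
 obtains w where "(vs ! (2 * j), w, vs ! (2 * j + 1)) \<in> drawn_lines n ls rs E" "RightBlob \<in> set w"
proof -
 have l: "2 * j < length rs" using j by simp
 obtain w where w: "(vs ! (2 * j), w, rs ! (2 * j)) \<in> NL" using NL_ex[OF N0_sym[OF vs_nth(1)[OF l]]] by blast
 obtain w' where w': "(rs ! (2 * j + 1), w', vs ! (2 * j + 1)) \<in> NL" using NL_ex[OF vs_nth(1)[OF j]] by blast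
 have "(rs ! (2 * j), [RightBlob], rs ! (2 * j + 1)) \<in> link [RightBlob] rs" unfolding link_nth using j by auto
 from apath.step[OF apath.start[OF w] this w']
 have a: "apath NL (link [RightBlob] rs) (vs ! (2 * j)) (w @ [RightBlob] @ w') (vs ! (2 * j + 1))" .
 have d: "dom3 (link [RightBlob] rs) = set rs" using disj even_rs by (intro dom3_matching matching_link) auto
 have v: "vs ! (2 * j) \<notin> set rs" "vs ! (2 * j + 1) \<notin> set rs" using vs_nth(2)[OF l] vs_nth(2)[OF j] disj by (auto simp: vertices_Suc)
 have "(vs ! (2 * j), w @ [RightBlob] @ w', vs ! (2 * j + 1)) \<in> drawn_lines n ls rs E"
  unfolding lines_glued NL_lines[symmetric] using a v vs_nth(2)[OF l] by (auto simp: glued_def d)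
 thus ?thesis using that by simp
qed

lemma N0_vertex:
 assumes p: "p \<in> vertices n"
 obtains "p \<in> set vs" | q where "(p, [], q) \<in> N0" "q \<notin> set rs" "p \<notin> set vs"
proof -
 have "p \<in> V - set ls" unfolding set_circ using p disj by (auto simp: vertices_Suc)
 then obtain w q where "(p, w, q) \<in> N0" using matching_ex[OF N0] by blast
 hence q: "(p, [], q) \<in> N0" using N0_nil by blast
 show ?thesis
 proof (cases "q \<in> set rs")
  case True
  thus ?thesis using that(1) set_vs q by blast
 next
  case False
  hence "p \<notin> set vs" using set_vs N0_uniq[OF q] by blast
  thus ?thesis using that(2) q False by blast
 qed
qed

lemma line_right_iff:
 assumes "(p, w, q) \<in> drawn_lines n ls rs E"
 shows "RightBlob \<in> set w \<longleftrightarrow> p \<in> set vs"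
proof -
 have p: "p \<in> vertices n" using line_shape(1)[OF assms] .
 note u = matching_uniq[OF lines_matching assms]
 show ?thesis using p
 proof (cases rule: N0_vertex)
  case 1
  then obtain i where i: "i < length rs" "p = vs ! i" using length_vs by (metis in_set_conv_nth)
  have "\<exists>w q. (p, w, q) \<in> drawn_lines n ls rs E \<and> RightBlob \<in> set w"
  proof (cases "even i")
   case True
   then obtain j where j: "i = 2 * j" by blast
   have "2 * j + 1 < length rs" using i j even_rs by presburger
   thus ?thesis using line_with_right[of j] i j by metis
  next
   case False
   then obtain j where j: "i = 2 * j + 1" by (metis oddE)
   obtain w where w: "(vs ! (2 * j), w, vs ! (2 * j + 1)) \<in> drawn_lines n ls rs E" "RightBlob \<in> set w"
    using line_with_right[of j] i j by metis
   from matchingD(4)[OF lines_matching w(1)] w(2) show ?thesis using i j by (intro exI[of _ "rev w"] exI[of _ "vs ! (2 * j)"]) simp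
  qed
  thus ?thesis using u 1 by blast
 next
  case (2 q')
  from line_without_right[OF p 2(1,2)] obtain w' where "(p, w', q') \<in> drawn_lines n ls rs E" "RightBlob \<notin> set w'" .
  thus ?thesis using u 2 by blast
 qed
qed

lemma line_count_right:
 assumes "(p, w, q) \<in> drawn_lines n ls rs E"
 shows "count_list w RightBlob = (if p \<in> set vs then 1 else 0)" using line_right_iff[OF assms] line_shape(6)[OF assms] by auto

lemma right_vertices_eq: "right_vertices (drawn_lines n ls rs E) = set vs"
proof -
 have "p \<in> set vs \<Longrightarrow> \<exists>w q. (p, w, q) \<in> drawn_lines n ls rs E" for p
  using matching_ex[OF lines_matching, of p] vs_nth(2) length_vs by (metis in_set_conv_nth)
 thus ?thesis unfolding right_vertices_def using line_right_iff by blast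
qed

lemma right_list_lines: "right_list (drawn_lines n ls rs E) = vs"
proof (rule right_list_eq[OF vs_sorted right_vertices_eq[symmetric]])
 show "right_vertices (drawn_lines n ls rs E) \<subseteq> vertices n" unfolding right_vertices_eq by (rule vs_vertices)
qed

lemma N0_strand: "strand_diagram ls rs E = glued N0 (link [] ([Top 0] @ rs @ [Bot 0]))" unfolding strand_diagram_def strand_glue_def N0_def
 by (rule glued_glued_matching[OF left_glue matching_link[OF strand_list(1,2)] strand_list(3), symmetric])

lemma hooks_N0: "(Top (n + 1), [], Top 0) \<in> N0" "(Bot 0, [], Bot (n + 1)) \<in> N0"
 using E_N0[OF hook_top] E_N0[OF hook_bot] disj by (auto simp: vertices_Suc)

text \<open>
  The strand visits the lines with right blobs in the order of the wall, which by \<open>vs_sorted\<close> is the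
  order of \<open>right_list\<close>.
\<close>

theorem to_tl_lines: "to_tl n (drawn_lines n ls rs E) = strand_diagram ls rs E"
proof (rule matching_total_eq[OF strand_matching])
 let ?sg = "[Top 0] @ rs @ [Bot 0]" and ?u = "[Top (n + 1)] @ vs @ [Bot (n + 1)]"
 have d: "dom3 (link [] ?sg :: diagram) = set ?sg" by (rule dom3_matching[OF matching_link[OF strand_list(1,2)]])
 have lu: "length ?u = length ?sg" using length_vs by simp
 have u: "(?u ! i, [], ?sg ! i) \<in> N0" "(?sg ! i, [], ?u ! i) \<in> N0" if il: "i < length ?sg" for i
 proof -
  consider "i = 0" | k where "i = Suc k" "k < length rs" | "i = Suc (length rs)" using il by (cases i) (auto simp: less_Suc_eq)
  thus 1: "(?u ! i, [], ?sg ! i) \<in> N0"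
  proof cases
   case 1 thus ?thesis using hooks_N0 by simp
  next
   case (2 k) thus ?thesis using N0_sym[OF vs_nth(1)[of k]] length_vs by (simp add: nth_append)
  next
   case 3 thus ?thesis using N0_sym[OF hooks_N0(2)] length_vs by (simp add: nth_append)
  qed
  show "(?sg ! i, [], ?u ! i) \<in> N0" by (rule N0_sym[OF 1])
 qed
 have su: "x \<in> vertices (n + 1)" if "x \<in> set ?u" for x using that vs_nth(2) length_vs by (auto simp: vertices_Suc in_set_conv_nth)
 have vsg: "x \<notin> set ?sg" if "x \<in> vertices (n + 1)" for x using that disj by auto
 show "to_tl n (drawn_lines n ls rs E) \<subseteq> strand_diagram ls rs E"
 proof
  fix z assume z: "z \<in> to_tl n (drawn_lines n ls rs E)"
  obtain p v q where zz: "z = (p, v, q)" by (cases z)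
  from z consider (1) w where "v = []" "(p, w, q) \<in> drawn_lines n ls rs E" "RightBlob \<notin> set w" | (2) "(p, v, q) \<in> link [] ?u"
   unfolding to_tl_def right_list_lines zz by blast
  thus "z \<in> strand_diagram ls rs E"
  proof cases
   case 1
   have p: "p \<in> vertices n" "q \<in> vertices n" "p \<notin> set vs" using line_shape(1,2)[OF 1(2)] line_right_iff[OF 1(2)] 1(3) by auto
   from p(1) have "(p, [], q) \<in> N0"
   proof (cases rule: N0_vertex)
    case 1 thus ?thesis using p by simp
   next
    case h: (2 q')
    from line_without_right[OF p(1) h(1,2)] obtain w' where "(p, w', q') \<in> drawn_lines n ls rs E" by blast
    hence "q' = q" using matching_uniq[OF lines_matching 1(2)] by blast
    thus ?thesis using h by simp
   qed
   thus ?thesis unfolding N0_strand zz glued_def d 1(1) using vsg[of p] vsg[of q] p by (auto simp: vertices_Suc intro: apath.start)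
  next
   case 2
   have gl: "(?u ! i, [], ?u ! k) \<in> glued N0 (link [] ?sg)"
    if "i < length ?sg" "k < length ?sg" "(?sg ! i, [] :: blob list, ?sg ! k) \<in> link [] ?sg" for i k
   proof -
    have "apath N0 (link [] ?sg) (?u ! i) ([] @ [] @ []) (?u ! k)" by (rule apath.step[OF apath.start[OF u(1)[OF that(1)]] that(3) u(2)[OF that(2)]])
    hence "apath N0 (link [] ?sg) (?u ! i) [] (?u ! k)" by (simp only: append_Nil)
    moreover have "?u ! i \<in> set ?u" "?u ! k \<in> set ?u" using that(1,2) lu by (metis nth_mem)+
    moreover from this have "?u ! i \<notin> set ?sg" "?u ! k \<notin> set ?sg" using vsg su by blast+
    ultimately show ?thesis unfolding glued_def d mem_Collect_eq prod.case by (intro conjI)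
   qed
   from 2 obtain j where j: "2 * j + 1 < length ?sg" and
    "(p = ?u ! (2 * j) \<and> q = ?u ! (2 * j + 1) \<and> v = []) \<or> (p = ?u ! (2 * j + 1) \<and> q = ?u ! (2 * j) \<and> v = [])"
    unfolding link_nth lu by auto
   moreover have "(?sg ! (2 * j), [], ?sg ! (2 * j + 1)) \<in> link [] ?sg" "(?sg ! (2 * j + 1), [], ?sg ! (2 * j)) \<in> link [] ?sg"
    unfolding link_nth using j by auto
   ultimately show ?thesis unfolding N0_strand zz using gl[of "2 * j" "2 * j + 1"] gl[of "2 * j + 1" "2 * j"] by auto
  qed
 qed
 fix p assume p: "p \<in> vertices (n + 1)"
 show "\<exists>w q. (p, w, q) \<in> to_tl n (drawn_lines n ls rs E)"
 proof (cases "p \<in> set ?u")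
  case True
  have "distinct ?u"
  proof -
   have "distinct vs" using vs_sorted by (auto simp: distinct_conv_nth sorted_wrt_iff_nth_less) (metis linorder_neqE_nat order_less_irrefl)
   moreover have "Top (n + 1) \<notin> set vs" "Bot (n + 1) \<notin> set vs" using vs_vertices by auto
   ultimately show ?thesis by simp
  qed
  moreover have "even (length ?u)" using even_rs length_vs by simp
  ultimately have "matching (set ?u) (link [] ?u :: diagram)" by (rule matching_link)
  from matching_ex[OF this True] show ?thesis unfolding to_tl_def right_list_lines by blast
 next
  case False
  hence p': "p \<in> vertices n" "p \<notin> set vs" using p by (auto simp: vertices_Suc)
  obtain w q where w: "(p, w, q) \<in> drawn_lines n ls rs E" using matching_ex[OF lines_matching p'(1)] by blast
  thus ?thesis unfolding to_tl_def using line_right_iff[OF w] p'(2) by blast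
 qed
qed

end

section \<open>Normal forms\<close>

definition collapse :: "diagram \<Rightarrow> diagram" where
 "collapse D = (\<lambda>(p, w, q). (p, remdups_adj w, q)) ` D"

definition resolve :: "diagram \<Rightarrow> diagram" where
 "resolve D = (if topological_redex D then reconnect D else D)"

text \<open>
  The straightening and topological relations, with scalars left aside, lead to a basis diagram with the same
  strand diagram. Irreducible drawings have reduced words, so that collapsing double blobs already gives the reduced words.
\<close>

theorem normal_form:
 assumes P: "planar n ls rs pos E" and n: "even n"
 defines "D \<equiv> resolve (collapse (drawn_lines n ls rs E))"
 shows "D \<in> blob_diagrams n" "to_tl n D = strand_diagram ls rs E"
  "\<And>p w q. (p, w, q) \<in> drawn_lines n ls rs E \<Longrightarrow>
   remdups_adj w \<in> short_words"
  "\<exists>ls' rs' E'. irreducible n ls' rs' pos E' \<and> drawn_lines n ls' rs' E' = D"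
proof -
 interpret planar n ls rs pos E by fact
 obtain ls1 rs1 E1 where 1: "planar n ls1 rs1 pos E1" "irreducible_drawing ls1 rs1 E1"
  "strand_diagram ls1 rs1 E1 = strand_diagram ls rs E" "collapses (drawn_lines n ls rs E) (drawn_lines n ls1 rs1 E1)"
  using ex_irreducible[OF P] by blast
 have I: "irreducible n ls1 rs1 pos E1" using 1(1,2) n by (simp add: irreducible_def irreducible_axioms_def)
 interpret I: irreducible n ls1 rs1 pos E1 by (rule I)
 have col: "(p, remdups_adj w, q) \<in> drawn_lines n ls1 rs1 E1" if pw: "(p, w, q) \<in> drawn_lines n ls rs E" for p w q
 proof -
  obtain w' where w': "(p, w', q) \<in> drawn_lines n ls1 rs1 E1" "remdups_adj w' = remdups_adj w" using 1(4) pw unfolding collapses_def by blast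
  thus ?thesis using I.line_remdups[OF w'(1)] by simp
 qed
 thus "remdups_adj w \<in> short_words"
  if "(p, w, q) \<in> drawn_lines n ls rs E" for p w q using I.line_shape(6) that by blast
 have c: "collapse (drawn_lines n ls rs E) = drawn_lines n ls1 rs1 E1"
 proof (rule matching_total_eq[OF I.lines_matching])
  show "collapse (drawn_lines n ls rs E) \<subseteq> drawn_lines n ls1 rs1 E1" unfolding collapse_def using col by auto
  fix p assume "p \<in> vertices n"
  then obtain w q where "(p, w, q) \<in> drawn_lines n ls rs E" using matching_ex[OF lines_matching] by blast
  thus "\<exists>w q. (p, w, q) \<in> collapse (drawn_lines n ls rs E)" unfolding collapse_def by force
 qed
 have "\<exists>ls' rs' E'. irreducible n ls' rs' pos E' \<and> strand_diagram ls' rs' E' = strand_diagram ls1 rs1 E1 \<and>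
   drawn_lines n ls' rs' E' = D \<and> \<not> topological_redex (drawn_lines n ls' rs' E')"
 proof (cases "topological_redex (drawn_lines n ls1 rs1 E1)")
  case True
  thus ?thesis using I.topological_step unfolding D_def c resolve_def by simp
 next
  case False
  thus ?thesis using I unfolding D_def c resolve_def by auto
 qed
 then obtain ls2 rs2 E2 where 2: "irreducible n ls2 rs2 pos E2" "strand_diagram ls2 rs2 E2 = strand_diagram ls1 rs1 E1"
   "drawn_lines n ls2 rs2 E2 = D" "\<not> topological_redex (drawn_lines n ls2 rs2 E2)" by blast
 interpret J: irreducible n ls2 rs2 pos E2 by (rule 2(1))
 show "to_tl n D = strand_diagram ls rs E" using J.to_tl_lines 2 1(3) by simp
 show "D \<in> blob_diagrams n" unfolding blob_diagrams_def using J.left_right J.line_reduced 2(3,4) by auto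
 show "\<exists>ls' rs' E'. irreducible n ls' rs' pos E' \<and> drawn_lines n ls' rs' E' = D" using 2 by blast
qed

theorem blob_diagram_drawing:
 assumes D: "D \<in> blob_diagrams n" and n: "even n"
 shows "\<exists>ls rs pos E. irreducible n ls rs pos E \<and> drawn_lines n ls rs E = D"
proof -
 have lr: "D \<in> left_right_diagrams n" and red: "\<And>p w q. (p, w, q) \<in> D \<Longrightarrow> reduced_word w" and top: "\<not> topological_redex D"
  using D unfolding blob_diagrams_def by auto
 obtain M l r where "drawing n l r M" "D = lines_of n M" using lr unfolding left_right_diagrams_def by blast
 then obtain ls rs pos E where P: "planar n ls rs pos E" "drawn_lines n ls rs E = D" using planar_of_drawing by metis
 have rem: "remdups_adj w = w" if "reduced_word w" for w
 proof -
  have "(\<forall>s. \<not> sublist [s, s] w) \<Longrightarrow> remdups_adj w = w" for w :: "blob list"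
  proof (induction w rule: remdups_adj.induct)
   case (3 x y xs)
   have "x \<noteq> y" using 3(3) by (metis append_Cons append_Nil sublist_appendI)
   moreover have "\<forall>s. \<not> sublist [s, s] (y # xs)" using 3(3) by (meson sublist_Cons_right)
   ultimately show ?case using 3(2) by simp
  qed auto
  moreover have "\<not> sublist [s, s] w" for s using that unfolding reduced_word_def by (cases s) auto
  ultimately show ?thesis by blast
 qed
 have "collapse D = D"
 proof -
  have "collapse D = (\<lambda>z. z) ` D" unfolding collapse_def by (rule image_cong) (use red rem in auto)
  thus ?thesis by simp
 qed
 thus ?thesis using normal_form(4)[OF P(1) n] P(2) top unfolding resolve_def by auto
qed

section \<open>Stacking\<close>

definition img :: "('a \<Rightarrow> 'b) \<Rightarrow> ('a \<times> 'l list \<times> 'a) set \<Rightarrow> ('b \<times> 'l list \<times> 'b) set" where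
 "img f E = (\<lambda>(p, w, q). (f p, w, f q)) ` E"

lemma imgI: "(p, w, q) \<in> E \<Longrightarrow> (f p, w, f q) \<in> img f E" unfolding img_def by force

lemma imgE: assumes "(x, w, y) \<in> img f E" obtains p q where "x = f p" "y = f q" "(p, w, q) \<in> E" using assms unfolding img_def by auto

lemma img_Un: "img f (E \<union> F) = img f E \<union> img f F" unfolding img_def by (rule image_Un)

lemma und_mono: "E \<subseteq> F \<Longrightarrow> und E \<subseteq> und F" unfolding und_def by blast

lemma und_img: "und (img f E) = map_prod f f ` und E" unfolding und_def img_def by force

lemma matching_img:
 assumes f: "inj f" and E: "matching V E"
 shows "matching (f ` V) (img f E)"
proof (rule matchingI)
 fix x w y assume "(x, w, y) \<in> img f E"
 then obtain p q where h: "x = f p" "y = f q" "(p, w, q) \<in> E" by (rule imgE)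
 thus "x \<in> f ` V \<and> y \<in> f ` V \<and> x \<noteq> y \<and> (y, rev w, x) \<in> img f E"
  using matchingD[OF E h(3)] imgI[of q "rev w" p E f] f by (auto simp: inj_eq)
next
 fix x assume "x \<in> f ` V"
 then obtain p where p: "p \<in> V" "x = f p" by blast
 then obtain w q where "(p, w, q) \<in> E" using matching_ex[OF E] by blast
 thus "\<exists>w q. (x, w, q) \<in> img f E" using imgI p by fast
next
 fix x w y w' y' assume "(x, w, y) \<in> img f E" "(x, w', y') \<in> img f E"
 then obtain p q p' q' where "x = f p" "y = f q" "(p, w, q) \<in> E" "x = f p'" "y' = f q'" "(p', w', q') \<in> E" by (elim imgE)
 moreover from this have "p = p'" using f by (simp add: inj_eq)
 ultimately show "w = w' \<and> y = y'" using matching_uniq[OF E] by blast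
qed

lemma link_map: "link u (map f xs) = img f (link u xs)" by (induction xs rule: pairs.induct) (auto simp: img_def)

lemma apath_img: "apath E G p w q \<Longrightarrow> apath (img f E) (img f G) (f p) w (f q)"
 by (induction rule: apath.induct) (auto intro: apath.intros imgI)

lemma glued_img:
 assumes f: "inj f" "inj g" "range f \<inter> range g = {}" and E: "matching V1 E1" "matching V2 E2"
  and G: "matching W1 G1" "matching W2 G2" "W1 \<subseteq> V1" "W2 \<subseteq> V2" "finite V1" "finite V2"
 shows "glued (img f E1 \<union> img g E2) (img f G1 \<union> img g G2) = img f (glued E1 G1) \<union> img g (glued E2 G2)"
proof (rule sym, rule matching_eqI)
 have dis: "f ` X \<inter> g ` Y = {}" for X Y using f(3) by blast
 have mE: "matching (f ` V1 \<union> g ` V2) (img f E1 \<union> img g E2)"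
  by (rule matching_Un[OF matching_img[OF f(1) E(1)] matching_img[OF f(2) E(2)] dis])
 have mG: "matching (f ` W1 \<union> g ` W2) (img f G1 \<union> img g G2)"
  by (rule matching_Un[OF matching_img[OF f(1) G(1)] matching_img[OF f(2) G(2)] dis])
 have diff: "(f ` V1 \<union> g ` V2) - (f ` W1 \<union> g ` W2) = f ` (V1 - W1) \<union> g ` (V2 - W2)"
  unfolding image_set_diff[OF f(1)] image_set_diff[OF f(2)] using dis by blast
 show "matching (f ` (V1 - W1) \<union> g ` (V2 - W2)) (glued (img f E1 \<union> img g E2) (img f G1 \<union> img g G2))"
  using glued_matching[OF mE mG] G(3-6) unfolding diff by blast
 show "matching (f ` (V1 - W1) \<union> g ` (V2 - W2)) (img f (glued E1 G1) \<union> img g (glued E2 G2))"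
  using glued_matching[OF E(1) G(1,3,5)] glued_matching[OF E(2) G(2,4,6)] by (intro matching_Un matching_img f(1,2) dis)
 have d: "dom3 (img f G1 \<union> img g G2) = f ` W1 \<union> g ` W2" by (rule dom3_matching[OF mG])
 note d1 = dom3_matching[OF G(1)] and d2 = dom3_matching[OF G(2)]
 show "img f (glued E1 G1) \<union> img g (glued E2 G2) \<subseteq> glued (img f E1 \<union> img g E2) (img f G1 \<union> img g G2)"
 proof
  fix z assume z: "z \<in> img f (glued E1 G1) \<union> img g (glued E2 G2)"
  obtain x w y where zz: "z = (x, w, y)" by (cases z)
  from z zz consider "(x, w, y) \<in> img f (glued E1 G1)" | "(x, w, y) \<in> img g (glued E2 G2)" by blast
  thus "z \<in> glued (img f E1 \<union> img g E2) (img f G1 \<union> img g G2)"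
  proof cases
   case 1
   then obtain p q where h: "x = f p" "y = f q" "(p, w, q) \<in> glued E1 G1" by (rule imgE)
   hence a: "apath E1 G1 p w q" and n: "p \<notin> W1" "q \<notin> W1" unfolding glued_def d1 by auto
   have "apath (img f E1 \<union> img g E2) (img f G1 \<union> img g G2) x w y"
    using apath_mono[OF apath_img[OF a, of f] Un_upper1 Un_upper1] h by simp
   moreover have "x \<notin> f ` W1 \<union> g ` W2" "y \<notin> f ` W1 \<union> g ` W2" using n h f by (auto simp: inj_eq)
   ultimately show ?thesis unfolding zz glued_def d by simp
  next
   case 2
   then obtain p q where h: "x = g p" "y = g q" "(p, w, q) \<in> glued E2 G2" by (rule imgE)
   hence a: "apath E2 G2 p w q" and n: "p \<notin> W2" "q \<notin> W2" unfolding glued_def d2 by auto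
   have "apath (img f E1 \<union> img g E2) (img f G1 \<union> img g G2) x w y"
    using apath_mono[OF apath_img[OF a, of g] Un_upper2 Un_upper2] h by simp
   moreover have "x \<notin> f ` W1 \<union> g ` W2" "y \<notin> f ` W1 \<union> g ` W2" using n h f by (auto simp: inj_eq)
   ultimately show ?thesis unfolding zz glued_def d by simp
  qed
 qed
qed

text \<open>
  Both layers of a stack are coded as points, so that the stack of two drawings is again a drawing. The outer
  vertices keep their names, and the middle ones and the wall points become new wall points; residues modulo 3
  keep the three kinds apart.
\<close>

fun up :: "point \<Rightarrow> point" where
 "up (Top i) = Top i"
| "up (Bot i) = Wall LeftBlob (3 * i + 2)"
| "up (Wall s i) = Wall s (3 * i)"

fun dn :: "point \<Rightarrow> point" where
 "dn (Top i) = Wall RightBlob (3 * i + 2)"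
| "dn (Bot i) = Bot i"
| "dn (Wall s i) = Wall s (3 * i + 1)"

fun lay :: "layer \<times> point \<Rightarrow> point" where
 "lay (Upper, p) = up p"
| "lay (Lower, p) = dn p"

lemma mod3 [simp]: "3 * i \<noteq> Suc (3 * j)" "Suc (3 * j) \<noteq> 3 * i" "3 * i \<noteq> Suc (Suc (3 * j))" "Suc (Suc (3 * j)) \<noteq> 3 * i"
 "Suc (3 * i) \<noteq> Suc (Suc (3 * j))" "Suc (3 * i) = 3 * (j :: nat) \<longleftrightarrow> False" by presburger+

lemma inj_up: "inj up"
proof (rule injI)
 fix x y assume "up x = up y" thus "x = y" by (cases x; cases y) auto
qed

lemma inj_dn: "inj dn"
proof (rule injI)
 fix x y assume "dn x = dn y" thus "x = y" by (cases x; cases y) auto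
qed

lemma up_dn [simp]: "up x \<noteq> dn y" "dn y \<noteq> up x" by (cases x; cases y; auto)+

lemma up_dn_range: "range up \<inter> range dn = {}" using up_dn by blast

lemma inj_lay: "inj lay"
proof (rule injI)
 fix x y :: "layer \<times> point" assume h: "lay x = lay y"
 obtain a p where x: "x = (a, p)" by (cases x)
 obtain b q where y: "y = (b, q)" by (cases y)
 show "x = y" using h unfolding x y by (cases a; cases b) (auto simp: inj_eq[OF inj_up] inj_eq[OF inj_dn])
qed

definition mid :: "nat \<Rightarrow> (point \<times> 'l list \<times> point) set" where
 "mid k = (\<Union>i\<in>{1..k}. {(up (Bot i), [], dn (Top i)), (dn (Top i), [], up (Bot i))})"

definition mids :: "nat \<Rightarrow> point set" where
 "mids k = (\<lambda>i. up (Bot i)) ` {1..k} \<union> (\<lambda>i. dn (Top i)) ` {1..k}"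

lemma mid_iff: "(x, u, y) \<in> mid k \<longleftrightarrow> u = [] \<and> (\<exists>i\<in>{1..k}. (x = up (Bot i) \<and> y = dn (Top i)) \<or> (x = dn (Top i) \<and> y = up (Bot i)))"
 unfolding mid_def by auto

lemma matching_mid: "matching (mids k) (mid k)"
proof (rule matchingI)
 fix p w q assume "(p, w, q) \<in> (mid k :: (point \<times> 'l list \<times> point) set)"
 thus "p \<in> mids k \<and> q \<in> mids k \<and> p \<noteq> q \<and> (q, rev w, p) \<in> mid k" unfolding mid_iff mids_def by auto
next
 fix p assume "p \<in> mids k"
 thus "\<exists>w q. (p, w, q) \<in> mid k" unfolding mid_iff mids_def by blast
next
 fix p w q w' q' assume "(p, w, q) \<in> (mid k :: (point \<times> 'l list \<times> point) set)" "(p, w', q') \<in> (mid k :: (point \<times> 'l list \<times> point) set)"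
 thus "w = w' \<and> q = q'" unfolding mid_iff by (auto simp del: up.simps dn.simps simp: inj_eq[OF inj_up] inj_eq[OF inj_dn])
qed

definition layers :: "diagram \<Rightarrow> diagram \<Rightarrow> diagram" where
 "layers d d' = img up d \<union> img dn d'"

definition layer_vertices :: "nat \<Rightarrow> point set" where
 "layer_vertices n = up ` vertices n \<union> dn ` vertices n"

lemma layers_matching:
 assumes "matching (vertices n) d" "matching (vertices n) d'"
 shows "matching (layer_vertices n) (layers d d')" unfolding layers_def layer_vertices_def
 by (rule matching_Un[OF matching_img[OF inj_up assms(1)] matching_img[OF inj_dn assms(2)]]) (use up_dn_range in blast)

lemma layer_vertices_split: "layer_vertices n = vertices n \<union> mids n" "vertices n \<inter> mids n = {}"
 unfolding layer_vertices_def vertices_def mids_def by (auto simp: image_Un image_image)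

lemma lay_outer: "p \<in> vertices n \<Longrightarrow> lay (outer p) = p" unfolding vertices_def by auto

lemma walk_apath:
 assumes d: "matching (vertices n) d" "matching (vertices n) d'"
 shows "walk d d' x w y \<longleftrightarrow> apath (layers d d') (mid n) (lay x) w (lay y)"
proof
 assume "walk d d' x w y"
 thus "apath (layers d d') (mid n) (lay x) w (lay y)"
 proof (induction rule: walk.induct)
  case (upper p w q)
  thus ?case unfolding layers_def by (auto intro!: apath.start imgI)
 next
  case (lower p w q)
  thus ?case unfolding layers_def by (auto intro!: apath.start imgI)
 next
  case (down x w i w' q)
  have i: "i \<in> {1..n}" using matchingD(1)[OF d(2) down(2)] unfolding vertices_def by auto
  have "(lay (Upper, Bot i), [], dn (Top i)) \<in> mid n" unfolding mid_iff using i by auto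
  moreover have "(dn (Top i), w', lay (Lower, q)) \<in> layers d d'" unfolding layers_def using imgI[OF down(2), of dn] by simp
  ultimately show ?case using apath.step[OF down.IH] by fastforce
 next
  case (up x w i w' q)
  have i: "i \<in> {1..n}" using matchingD(1)[OF d(1) up(2)] unfolding vertices_def by auto
  have "(lay (Lower, Top i), [], up (Bot i)) \<in> mid n" unfolding mid_iff using i by auto
  moreover have "(up (Bot i), w', lay (Upper, q)) \<in> layers d d'" unfolding layers_def using imgI[OF up(2), of up] by simp
  ultimately show ?case using apath.step[OF up.IH] by fastforce
 qed
next
 have edge: "\<exists>y. b = lay y \<and> (\<exists>q. y = (fst x, q) \<and> (snd x, w, q) \<in> (case fst x of Upper \<Rightarrow> d | Lower \<Rightarrow> d'))"
  if e: "(lay x, w, b) \<in> layers d d'" for x w b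
 proof -
  obtain a p where x: "x = (a, p)" by (cases x)
  from e consider "(lay x, w, b) \<in> img up d" | "(lay x, w, b) \<in> img dn d'" unfolding layers_def by blast
  thus ?thesis
  proof cases
   case 1
   then obtain p' q where h: "lay x = up p'" "b = up q" "(p', w, q) \<in> d" by (rule imgE)
   have "x = (Upper, p')" using injD[OF inj_lay, of x "(Upper, p')"] h by simp
   thus ?thesis using h by (intro exI[of _ "(Upper, q)"]) simp
  next
   case 2
   then obtain p' q where h: "lay x = dn p'" "b = dn q" "(p', w, q) \<in> d'" by (rule imgE)
   have "x = (Lower, p')" using injD[OF inj_lay, of x "(Lower, p')"] h by simp
   thus ?thesis using h by (intro exI[of _ "(Lower, q)"]) simp
  qed
 qed
 have main: "\<exists>y. b = lay y \<and> walk d d' x w y" if "apath (layers d d') (mid n) a w b" "a = lay x" for a b w x using that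
 proof (induction rule: apath.induct)
  case (start a w b)
  then obtain q where h: "b = lay (fst x, q)" "(snd x, w, q) \<in> (case fst x of Upper \<Rightarrow> d | Lower \<Rightarrow> d')" using edge by blast
  have "walk d d' (fst x, snd x) w (fst x, q)"
  proof (cases "fst x")
   case Upper thus ?thesis using h(2) by (simp add: walk.upper)
  next
   case Lower thus ?thesis using h(2) by (simp add: walk.lower)
  qed
  thus ?case using h(1) by (intro exI[of _ "(fst x, q)"]) simp
 next
  case (step a w c u e w' b)
  then obtain y where y: "c = lay y" "walk d d' x w y" by blast
  from step(2) obtain i where i: "u = []" "i \<in> {1..n}" "(c = up (Bot i) \<and> e = dn (Top i)) \<or> (c = dn (Top i) \<and> e = up (Bot i))"
   unfolding mid_iff by blast
  from i(3) show ?case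
  proof (elim disjE conjE)
   assume h: "c = up (Bot i)" "e = dn (Top i)"
   have y': "y = (Upper, Bot i)" using injD[OF inj_lay, of y "(Upper, Bot i)"] h y by simp
   have "(lay (Lower, Top i), w', b) \<in> layers d d'" using step(3) h by simp
   then obtain q where q: "b = lay (Lower, q)" "(Top i, w', q) \<in> d'" using edge by fastforce
   thus ?thesis using walk.down[OF y(2)[unfolded y'] q(2)] i(1) by (intro exI[of _ "(Lower, q)"]) simp
  next
   assume h: "c = dn (Top i)" "e = up (Bot i)"
   have y': "y = (Lower, Top i)" using injD[OF inj_lay, of y "(Lower, Top i)"] h y by simp
   have "(lay (Upper, Bot i), w', b) \<in> layers d d'" using step(3) h by simp
   then obtain q where q: "b = lay (Upper, q)" "(Bot i, w', q) \<in> d" using edge by fastforce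
   thus ?thesis using walk.up[OF y(2)[unfolded y'] q(2)] i(1) by (intro exI[of _ "(Upper, q)"]) simp
  qed
 qed
 assume "apath (layers d d') (mid n) (lay x) w (lay y)"
 from main[OF this refl] obtain y' where "lay y = lay y'" "walk d d' x w y'" by blast
 thus "walk d d' x w y" using injD[OF inj_lay] by blast
qed

theorem stack_glued:
 assumes d: "matching (vertices n) d" "matching (vertices n) d'"
 shows "stack n d d' = glued (layers d d') (mid n)"
proof -
 have mids: "dom3 (mid n :: diagram) = mids n" by (rule dom3_matching[OF matching_mid])
 have m: "matching (vertices n) (glued (layers d d') (mid n))"
 proof -
  have "mids n \<subseteq> layer_vertices n" "layer_vertices n - mids n = vertices n" using layer_vertices_split[of n] by blast+
  moreover have "finite (layer_vertices n)" unfolding layer_vertices_def vertices_def by simp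
  ultimately show ?thesis using glued_matching[OF layers_matching[OF d] matching_mid, of n] by simp
 qed
 have "(p, w, q) \<in> stack n d d' \<longleftrightarrow> (p, w, q) \<in> glued (layers d d') (mid n)" for p w q
 proof -
  have "(p, w, q) \<in> glued (layers d d') (mid n) \<longleftrightarrow> p \<in> vertices n \<and> q \<in> vertices n \<and> apath (layers d d') (mid n) p w q"
   using matchingD(1,2)[OF m, of p w q] layer_vertices_split(2)[of n] unfolding glued_def mids by auto
  moreover have "(p, w, q) \<in> stack n d d' \<longleftrightarrow> p \<in> vertices n \<and> q \<in> vertices n \<and> apath (layers d d') (mid n) (lay (outer p)) w (lay (outer q))"
   unfolding stack_def walk_apath[OF d] by simp
  ultimately show ?thesis using lay_outer by metis
 qed
 thus ?thesis by auto
qed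

subsection \<open>The composite drawing\<close>

context planar begin

definition "hooks = hook_ends n"
definition "core = del hooks E"

lemma core: "matching (vertices n \<union> set ls \<union> set rs) core"
proof -
 have "p \<in> hooks \<Longrightarrow> q \<in> hooks" if "(p, w, q) \<in> E" for p w q
 proof -
  assume p: "p \<in> hooks"
  have e: "(p, [], q) \<in> E" using that lab by blast
  from p show "q \<in> hooks" unfolding hooks_def using uniqE[OF e] hook_top hook_bot symE[OF hook_top] symE[OF hook_bot] by blast
 qed
 hence "matching (V - hooks) core" unfolding core_def by (rule matching_del[OF E])
 moreover have "V - hooks = vertices n \<union> set ls \<union> set rs" unfolding set_circ hooks_def using disj by (auto simp: vertices_Suc)
 ultimately show ?thesis by simp
qed

lemma core_sub: "core \<subseteq> E" unfolding core_def del_def by auto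

lemma lines_core: "glued core (blob_glue ls rs) = drawn_lines n ls rs E"
proof (rule matching_total_eq[OF lines_matching])
 have "vertices n \<inter> (set ls \<union> set rs) = {}" using disj by (auto simp: vertices_Suc)
 hence eq: "vertices n \<union> set ls \<union> set rs - (set ls \<union> set rs) = vertices n" by blast
 have m: "matching (vertices n) (glued core (blob_glue ls rs))" using glued_matching[OF core blob_glue] unfolding eq by (auto simp: vertices_def)
 show "glued core (blob_glue ls rs) \<subseteq> drawn_lines n ls rs E"
 proof
  fix z assume z: "z \<in> glued core (blob_glue ls rs)"
  obtain p w q where zz: "z = (p, w, q)" by (cases z)
  have "apath E (blob_glue ls rs) p w q" using z apath_mono[OF _ core_sub subset_refl] unfolding zz glued_def by blast
  thus "z \<in> drawn_lines n ls rs E" unfolding zz drawn_lines_def using matchingD[OF m z[unfolded zz]] by simp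
 qed
 show "\<exists>w q. (p, w, q) \<in> glued core (blob_glue ls rs)" if "p \<in> vertices n" for p using matching_ex[OF m that] .
qed

lemma core_nil: "(p, w, q) \<in> core \<Longrightarrow> w = []" using lab core_sub by blast

lemma core_noncrossing: "noncrossing pos (und core)" by (rule noncrossing_mono[OF nc und_mono[OF core_sub]])

end

locale stacking = P: planar n ls1 rs1 pos1 E1 + Q: planar n ls2 rs2 pos2 E2
 for n ls1 rs1 pos1 E1 ls2 rs2 pos2 E2
begin

definition "ls = map up ls1 @ map dn ls2"
definition "rs = map up rs1 @ map dn rs2"
definition "core12 = layers P.core Q.core"
definition "V12 = up ` (vertices n \<union> set ls1 \<union> set rs1) \<union> dn ` (vertices n \<union> set ls2 \<union> set rs2)"
definition "inner = glued core12 (mid n)"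

lemma core12: "matching V12 core12" unfolding core12_def V12_def layers_def
 by (rule matching_Un[OF matching_img[OF inj_up P.core] matching_img[OF inj_dn Q.core]]) (use up_dn_range in blast)

lemma mids_sub: "mids n \<subseteq> V12" unfolding mids_def V12_def vertices_def by blast

lemma finite_V12: "finite V12" unfolding V12_def vertices_def by auto

lemma walls_off: "x \<in> set ls1 \<union> set rs1 \<Longrightarrow> up x \<notin> vertices (n + 1) \<union> {Top 0, Bot 0} \<union> mids k"
 "x \<in> set ls2 \<union> set rs2 \<Longrightarrow> dn x \<notin> vertices (n + 1) \<union> {Top 0, Bot 0} \<union> mids k" if "k \<le> n + 1" for k
proof -
 assume x: "x \<in> set ls1 \<union> set rs1"
 have "x \<notin> vertices (n + 1) \<union> {Top 0, Bot 0}" using x P.disj by blast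
 thus "up x \<notin> vertices (n + 1) \<union> {Top 0, Bot 0} \<union> mids k" using that unfolding vertices_def mids_def by (cases x) auto
next
 assume x: "x \<in> set ls2 \<union> set rs2"
 have "x \<notin> vertices (n + 1) \<union> {Top 0, Bot 0}" using x Q.disj by blast
 thus "dn x \<notin> vertices (n + 1) \<union> {Top 0, Bot 0} \<union> mids k" using that unfolding vertices_def mids_def by (cases x) auto
qed

lemma V12_split: "V12 - mids n = vertices n \<union> set ls \<union> set rs"
proof -
 have "V12 = layer_vertices n \<union> (set ls \<union> set rs)" unfolding V12_def layer_vertices_def ls_def rs_def by auto
 moreover have "mids n \<inter> (set ls \<union> set rs) = {}" using walls_off[of n] unfolding ls_def rs_def by auto
 ultimately show ?thesis using layer_vertices_split[of n] by blast
qed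

lemma inner: "matching (vertices n \<union> set ls \<union> set rs) inner"
 using glued_matching[OF core12 matching_mid mids_sub finite_V12] unfolding inner_def V12_split .

lemma inner_nil: "(p, w, q) \<in> inner \<Longrightarrow> w = []"
proof -
 assume "(p, w, q) \<in> inner"
 hence a: "apath core12 (mid n) p w q" unfolding inner_def glued_def by auto
 have c: "w = []" if "(p, w, q) \<in> core12" for p w q using that P.core_nil Q.core_nil unfolding core12_def layers_def by (auto elim!: imgE)
 have "set w \<subseteq> {}" by (rule apath_labels[OF a]) (auto dest!: c simp: mid_iff)
 thus ?thesis by simp
qed

lemma blob_glue_layers: "blob_glue ls rs = img up (blob_glue ls1 rs1) \<union> img dn (blob_glue ls2 rs2)"
 unfolding blob_glue_def ls_def rs_def using P.even_ls P.even_rs by (auto simp: link_append link_map img_Un)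

lemma glued_layers: "glued core12 (blob_glue ls rs) = layers (drawn_lines n ls1 rs1 E1) (drawn_lines n ls2 rs2 E2)"
 unfolding blob_glue_layers core12_def layers_def P.lines_core[symmetric] Q.lines_core[symmetric]
 by (rule glued_img[OF inj_up inj_dn up_dn_range P.core Q.core P.blob_glue Q.blob_glue]) (auto simp: vertices_def)

lemma blob_glue12: "matching (set ls \<union> set rs) (blob_glue ls rs)"
proof -
 have "matching (up ` (set ls1 \<union> set rs1) \<union> dn ` (set ls2 \<union> set rs2)) (blob_glue ls rs)" unfolding blob_glue_layers
  by (rule matching_Un[OF matching_img[OF inj_up P.blob_glue] matching_img[OF inj_dn Q.blob_glue]]) (use up_dn_range in blast)
 moreover have "up ` (set ls1 \<union> set rs1) \<union> dn ` (set ls2 \<union> set rs2) = set ls \<union> set rs" unfolding ls_def rs_def by auto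
 ultimately show ?thesis by simp
qed

lemma mids_walls: "mids n \<inter> (set ls \<union> set rs) = {}" using walls_off[of n] unfolding ls_def rs_def by auto

text \<open>
  The order of gluing does not matter: at the blobs first gives a stack of diagrams, along the
  middle edge first gives a diagram drawn by one composite.
\<close>

theorem glued_inner: "glued inner (blob_glue ls rs) = stack n (drawn_lines n ls1 rs1 E1) (drawn_lines n ls2 rs2 E2)"
proof -
 have "glued inner (blob_glue ls rs) = glued core12 (mid n \<union> blob_glue ls rs)"
  unfolding inner_def by (rule glued_glued_matching[OF matching_mid blob_glue12 mids_walls])
 also have "\<dots> = glued core12 (blob_glue ls rs \<union> mid n)" by (simp only: Un_commute)
 also have "\<dots> = glued (glued core12 (blob_glue ls rs)) (mid n)"
  by (rule glued_glued_matching[OF blob_glue12 matching_mid, symmetric]) (use mids_walls in blast)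
 finally show ?thesis unfolding glued_layers stack_glued[OF P.lines_matching Q.lines_matching] .
qed

definition "A1 = map Top [1..<n + 1] @ map up rs1"
definition "A2 = rev (map up ls1)"
definition "Mu = rev (map (\<lambda>i. up (Bot i)) [1..<n + 1])"
definition "Md = map (\<lambda>i. dn (Top i)) [1..<n + 1]"
definition "D2 = map dn rs2 @ rev (map Bot [1..<n + 1]) @ rev (map dn ls2)"

lemma up_circ: "map up (small_circ n ls1 rs1) = A1 @ Mu @ A2" unfolding small_circ_def A1_def A2_def Mu_def by (simp add: rev_map comp_def)

lemma dn_circ: "map dn (small_circ n ls2 rs2) = Md @ D2" unfolding small_circ_def Md_def D2_def by (simp add: rev_map comp_def)

lemma inner_circ: "small_circ n ls rs = A1 @ D2 @ A2" unfolding small_circ_def A1_def A2_def D2_def ls_def rs_def by simp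

definition "Z = A1 @ Mu @ Md @ D2 @ A2"

lemma distinct_Z: "distinct Z"
proof -
 have 1: "distinct (A1 @ Mu @ A2)" unfolding up_circ[symmetric]
  using asc_distinct[OF P.small_asc] by (simp add: distinct_map inj_on_subset[OF inj_up])
 have 2: "distinct (Md @ D2)" unfolding dn_circ[symmetric] using asc_distinct[OF Q.small_asc] by (simp add: distinct_map inj_on_subset[OF inj_dn])
 have "set (A1 @ Mu @ A2) \<inter> set (Md @ D2) = {}" unfolding up_circ[symmetric] dn_circ[symmetric] using up_dn_range by auto
 thus ?thesis using 1 2 unfolding Z_def by auto
qed

lemma set_Z: "set Z = V12"
proof -
 have "set Z = set (A1 @ Mu @ A2) \<union> set (Md @ D2)" unfolding Z_def by auto
 thus ?thesis unfolding up_circ[symmetric] dn_circ[symmetric] V12_def by (simp add: set_small_circ)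
qed

text \<open>
  Listing the upper points up to the middle edge, the lower points, and the rest of the upper points, the two
  layers do not cross, and the middle vertices are nested: \<open>up (Bot i)\<close> mirrors \<open>dn (Top i)\<close>.
\<close>

lemma ex_composite:
 "\<exists>pos. planar n ls rs pos (unlabelled (und inner \<union> hook_edges n))"
proof -
 from ex_pos[OF distinct_Z] obtain f :: "point \<Rightarrow> nat" where f: "\<And>i. i < length Z \<Longrightarrow> f (Z ! i) = i" by blast
 have ascZ: "ascending f Z" using index_asc f by blast
 have fu: "sorted_wrt (\<lambda>a b. f (up a) < f (up b)) (small_circ n ls1 rs1)"
 proof -
  have "ascending f (map up (small_circ n ls1 rs1))" unfolding up_circ using ascZ unfolding Z_def by (auto simp: sorted_wrt_append)
  thus ?thesis unfolding sorted_wrt_map .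
 qed
 have fd: "sorted_wrt (\<lambda>a b. f (dn a) < f (dn b)) (small_circ n ls2 rs2)"
 proof -
  have "ascending f (map dn (small_circ n ls2 rs2))" unfolding dn_circ using ascZ unfolding Z_def by (auto simp: sorted_wrt_append)
  thus ?thesis unfolding sorted_wrt_map .
 qed
 have fo: "ascending f (small_circ n ls rs)" using ascZ unfolding Z_def inner_circ by (auto simp: sorted_wrt_append)
 have s1: "und P.core \<subseteq> set (small_circ n ls1 rs1) \<times> set (small_circ n ls1 rs1)" using und_sub[OF P.core] unfolding set_small_circ .
 have s2: "und Q.core \<subseteq> set (small_circ n ls2 rs2) \<times> set (small_circ n ls2 rs2)" using und_sub[OF Q.core] unfolding set_small_circ .
 have nu: "noncrossing f (map_prod up up ` und P.core)"
  by (rule noncrossing_order_iso[OF s1 _ P.core_noncrossing]) (rule asc_order_iso[OF fu P.small_asc])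
 have nd: "noncrossing f (map_prod dn dn ` und Q.core)"
  by (rule noncrossing_order_iso[OF s2 _ Q.core_noncrossing]) (rule asc_order_iso[OF fd Q.small_asc])
 have bl: "\<forall>x\<in>set (A1 @ Mu). \<forall>y\<in>set (Md @ D2). f x < f y" "\<forall>x\<in>set A2. \<forall>y\<in>set (Md @ D2). f y < f x"
  using ascZ unfolding Z_def by (auto simp: sorted_wrt_append)
 have block: "\<not> (f a < f x \<and> f x < f b)" if abx: "a \<in> set (Md @ D2)" "b \<in> set (Md @ D2)" "x \<in> set (A1 @ Mu @ A2)" for a b x
 proof -
  have "x \<in> set (A1 @ Mu) \<or> x \<in> set A2" using abx(3) by auto
  thus ?thesis
  proof
   assume "x \<in> set (A1 @ Mu)"
   hence "f x < f a" using bl(1) abx(1) by blast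
   thus ?thesis by simp
  next
   assume "x \<in> set A2"
   hence "f b < f x" using bl(2) abx(2) by blast
   thus ?thesis by simp
  qed
 qed
 have uset: "p \<in> set (A1 @ Mu @ A2) \<and> q \<in> set (A1 @ Mu @ A2)" if "(p, q) \<in> map_prod up up ` und P.core" for p q
  using that s1 unfolding up_circ[symmetric] by auto
 have dset: "p \<in> set (Md @ D2) \<and> q \<in> set (Md @ D2)" if "(p, q) \<in> map_prod dn dn ` und Q.core" for p q
  using that s2 unfolding dn_circ[symmetric] by auto
 have nc12: "noncrossing f (und core12)" unfolding core12_def layers_def und_Un und_img noncrossing_def
 proof (intro notI, elim exE conjE)
  fix p q r s assume h: "(p, q) \<in> map_prod up up ` und P.core \<union> map_prod dn dn ` und Q.core"
   "(r, s) \<in> map_prod up up ` und P.core \<union> map_prod dn dn ` und Q.core" "f p < f r" "f r < f q" "f q < f s"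
  from h(1) show False
  proof
   assume 1: "(p, q) \<in> map_prod up up ` und P.core"
   from h(2) show False
   proof
    assume "(r, s) \<in> map_prod up up ` und P.core"
    thus False using nu 1 h(3-5) unfolding noncrossing_def by blast
   next
    assume "(r, s) \<in> map_prod dn dn ` und Q.core"
    thus False using block[of r s q] dset uset 1 h(4,5) by blast
   qed
  next
   assume 1: "(p, q) \<in> map_prod dn dn ` und Q.core"
   from h(2) show False
   proof
    assume "(r, s) \<in> map_prod up up ` und P.core"
    thus False using block[of p q r] dset uset 1 h(3,4) by blast
   next
    assume "(r, s) \<in> map_prod dn dn ` und Q.core"
    thus False using nd 1 h(3-5) unfolding noncrossing_def by blast
   qed
  qed
 qed
 define c where "c = length A1"
 have lM: "length Mu = n" "length Md = n" unfolding Mu_def Md_def by simp_all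
 have zu: "Z ! (c + (n - i)) = up (Bot i)" if "i \<in> {1..n}" for i
 proof -
  have "Z ! (c + (n - i)) = Mu ! (n - i)" unfolding Z_def c_def nth_append_length_plus using that lM by (simp add: nth_append)
  also have "\<dots> = up (Bot i)"
  proof -
   have "1 \<le> i" "i \<le> n" using that by simp_all
   hence "i - Suc 0 < n" by linarith
   thus ?thesis unfolding Mu_def using that by (simp add: rev_nth del: upt_Suc up.simps)
  qed
  finally show ?thesis .
 qed
 have zd: "Z ! (c + (n + (i - 1))) = dn (Top i)" if "i \<in> {1..n}" for i
 proof -
  have "Z ! (c + (n + (i - 1))) = (Mu @ Md @ D2 @ A2) ! (length Mu + (i - 1))" unfolding Z_def c_def nth_append_length_plus lM ..
  also have "\<dots> = Md ! (i - 1)" unfolding nth_append_length_plus using that lM by (simp add: nth_append) linarith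
  also have "\<dots> = dn (Top i)"
  proof -
   have "1 \<le> i" "i \<le> n" using that by simp_all
   hence "i - Suc 0 < n" by linarith
   thus ?thesis unfolding Md_def using that by (simp del: upt_Suc dn.simps)
  qed
  finally show ?thesis .
 qed
 have lZ: "c + 2 * n \<le> length Z" unfolding Z_def c_def using lM by simp
 have pu: "f (up (Bot i)) = c + (n - i)" if "i \<in> {1..n}" for i using f[of "c + (n - i)"] zu[OF that] that lZ by auto
 have pd: "f (dn (Top i)) = c + (n + (i - 1))" if "i \<in> {1..n}" for i using f[of "c + (n + (i - 1))"] zd[OF that] that lZ by auto
 have outer: "outer_planar f V12 (mids n) (mid n :: diagram)" unfolding outer_planar_def
 proof (intro allI impI)
  fix a u b x assume A: "(a, u, b) \<in> (mid n :: diagram)" "x \<in> V12" "f a < f x" "f x < f b"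
  obtain i where i: "i \<in> {1..n}" "(a = up (Bot i) \<and> b = dn (Top i)) \<or> (a = dn (Top i) \<and> b = up (Bot i))"
   using A(1) unfolding mid_iff by blast
  have lt: "f (up (Bot i)) < f (dn (Top i))" using pu[OF i(1)] pd[OF i(1)] i(1) by auto
  hence ab: "a = up (Bot i)" "b = dn (Top i)" using i(2) A(3,4) by auto
  obtain k where k: "k < length Z" "x = Z ! k" using A(2) unfolding set_Z[symmetric] by (metis in_set_conv_nth)
  have kb: "c + (n - i) < k" "k < c + (n + (i - 1))" using A(3,4) f[OF k(1)] k(2) pu[OF i(1)] pd[OF i(1)] unfolding ab by auto
  have "\<exists>j\<in>{1..<i}. x = up (Bot j) \<or> x = dn (Top j)"
  proof (cases "k < c + n")
   case True
   have j: "c + n - k \<in> {1..n}" "c + n - k < i" using True kb i(1) by auto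
   have "k = c + (n - (c + n - k))" using True kb by simp
   hence "x = up (Bot (c + n - k))" using zu[OF j(1)] k(2) by simp
   thus ?thesis using j by (intro bexI[of _ "c + n - k"]) auto
  next
   case False
   have j: "k - (c + n) + 1 \<in> {1..n}" "k - (c + n) + 1 < i" using False kb i(1) by auto
   have "k = c + (n + ((k - (c + n) + 1) - 1))" using False by simp
   hence "x = dn (Top (k - (c + n) + 1))" using zd[OF j(1)] k(2) by simp
   thus ?thesis using j by (intro bexI[of _ "k - (c + n) + 1"]) auto
  qed
  then obtain j where j: "j \<in> {1..<i}" "x = up (Bot j) \<or> x = dn (Top j)" by blast
  have jn: "j \<in> {1..n}" using j i(1) by auto
  have xm: "x \<in> mids n" using j(2) jn unfolding mids_def by blast
  have "f a < f y \<and> f y < f b" if "(x, v, y) \<in> (mid n :: diagram)" for v y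
  proof -
   have "(x, [], if x = up (Bot j) then dn (Top j) else up (Bot j)) \<in> (mid n :: diagram)" unfolding mid_iff using j(2) jn by auto
   hence "y = (if x = up (Bot j) then dn (Top j) else up (Bot j))" using matching_uniq[OF matching_mid that] by blast
   thus ?thesis unfolding ab using pu[OF i(1)] pd[OF i(1)] pu[OF jn] pd[OF jn] j(1) i(1) by (auto split: if_splits)
  qed
  thus "x \<in> mids n \<and> (\<forall>v y. (x, v, y) \<in> (mid n :: diagram) \<longrightarrow> f a < f y \<and> f y < f b)" using xm by blast
 qed
 have injf: "inj_on f V12" using asc_inj[OF ascZ] unfolding set_Z .
 have nci: "noncrossing f (und inner)" unfolding inner_def by (rule noncrossing_glued[OF core12 matching_mid mids_sub finite_V12 injf nc12 outer])
 have inner_eq: "unlabelled (und inner) = inner"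
 proof -
  have "(p, w, q) \<in> unlabelled (und inner) \<longleftrightarrow> (p, w, q) \<in> inner" for p w q
   unfolding unlabelled_iff und_iff using inner_nil by blast
  thus ?thesis by auto
 qed
 have pair: "pairing (set (small_circ n ls rs)) (und inner)" using inner matching_pairing[of _ "und inner"] inner_eq unfolding set_small_circ by metis
 show ?thesis
 proof (rule planar_add_hooks[OF asc_distinct[OF fo] _ _ _ pair fo nci])
  show "even (length ls)" "even (length rs)" unfolding ls_def rs_def using P.even_ls Q.even_ls P.even_rs Q.even_rs by simp_all
  show "x \<notin> hook_ends n" if "x \<in> set ls \<union> set rs" for x
   using that walls_off[of n] unfolding ls_def rs_def by (auto simp: vertices_Suc)
 qed
qed

end

section \<open>Euler's relation for the two ways to close a wall\<close>

lemma comp_pair_even: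
 assumes F: "matching V F" and ab: "(a, w0, b) \<in> F" and d: "distinct (A @ [a, b] @ C)" and even: "even (length A)"
 shows "(und F \<union> und (link u (A @ [a, b] @ C)))\<^sup>* `` {a} = {a, b}" (is "?R\<^sup>* `` {a} = _")
proof
 have l: "y = b" if "(a, y) \<in> und (link u (A @ [a, b] @ C))" for y
 proof -
  have "(a, y) \<notin> und (link u (A @ C))" using und_link_sub[of a y u "A @ C"] d by auto
  thus ?thesis using that d unfolding link_even[OF even] und_Un by auto
 qed
 have l': "y = a" if "(b, y) \<in> und (link u (A @ [a, b] @ C))" for y
 proof -
  have "(b, y) \<notin> und (link u (A @ C))" using und_link_sub[of b y u "A @ C"] d by auto
  thus ?thesis using that d unfolding link_even[OF even] und_Un by auto
 qed
 have f: "y = b" if "(a, y) \<in> und F" for y using that matching_uniq[OF F ab] unfolding und_iff by blast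
 have f': "y = a" if "(b, y) \<in> und F" for y using that matching_uniq[OF F matchingD(4)[OF F ab]] unfolding und_iff by blast
 show "?R\<^sup>* `` {a} \<subseteq> {a, b}"
 proof
  fix y assume "y \<in> ?R\<^sup>* `` {a}"
  hence "(a, y) \<in> ?R\<^sup>*" by simp
  thus "y \<in> {a, b}" by (rule rtrancl_closed) (use l l' f f' in blast)+
 qed
 have "(a, b) \<in> ?R" using ab by (auto simp: und_iff)
 thus "{a, b} \<subseteq> ?R\<^sup>* `` {a}" by blast
qed

lemma sym_link: "sym (und (link u xs))" unfolding und_def link_nth sym_def by auto

text \<open>
  A pair of neighbours that is joined by a line and glued to itself is a component of its own; otherwise
  it is a detour in a component that survives.
\<close>

lemma card_comps_delete_pair:
 assumes F: "matching V F" and ab: "(a, w0, b) \<in> F" and d: "distinct (A @ [a, b] @ C)" and len: "even (length (A @ C))"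
  and S: "finite S" "set A \<union> set C \<subseteq> S" "a \<in> S" "b \<in> S"
 shows "card (comps (und F \<union> und (link u (A @ [a, b] @ C))) S) =
  (if even (length A) then 1 else 0) + card (comps (und (del {a, b} F) \<union> und (link u (A @ C))) (S - {a, b}))"
  (is "card (comps ?R S) = _ + card (comps ?R' ?S')")
proof -
 have symR: "sym ?R" using und_sym[OF F] sym_link by (rule sym_Un)
 have m: "matching (V - {a, b}) (del {a, b} F)"
 proof (rule matching_del[OF F])
  fix p w q assume h: "(p, w, q) \<in> F" "p \<in> {a, b}"
  thus "q \<in> {a, b}" using matching_uniq[OF F ab, of w q] matching_uniq[OF F matchingD(4)[OF F ab], of w q] by auto
 qed
 have symR': "sym ?R'" using und_sym[OF m] sym_link by (rule sym_Un)
 have eq: "card (comps ?R ?S') = card (comps ?R' ?S')"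
 proof -
  have "card (comps ?R ?S') = card (comps ?R' ((\<lambda>x. x) ` ?S'))"
  proof (rule card_comps_cong[OF symR symR'])
   fix p q assume "p \<in> ?S'" "q \<in> ?S'"
   hence "p \<notin> {a, b}" "q \<notin> {a, b}" by blast+
   from rtrancl_delete_pair[OF F ab d len _ this, of "{}" u]
   show "(p, q) \<in> ?R\<^sup>* \<longleftrightarrow> (p, q) \<in> ?R'\<^sup>*" by simp
  qed
  thus ?thesis by simp
 qed
 have abR: "(a, b) \<in> ?R" using ab by (auto simp: und_iff)
 have cab: "?R\<^sup>* `` {b} = ?R\<^sup>* `` {a}" using comp_eq_iff[OF symR, of a b] abR by blast
 have SS: "comps ?R S = insert (?R\<^sup>* `` {a}) (comps ?R ?S')"
 proof -
  have "S = {a, b} \<union> ?S'" using S by blast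
  hence "comps ?R S = comps ?R {a, b} \<union> comps ?R ?S'" using comps_Un by metis
  thus ?thesis using cab unfolding comps_def by auto
 qed
 show ?thesis
 proof (cases "even (length A)")
  case True
  have "?R\<^sup>* `` {a} \<notin> comps ?R ?S'"
  proof
   assume "?R\<^sup>* `` {a} \<in> comps ?R ?S'"
   then obtain y where y: "y \<in> ?S'" "?R\<^sup>* `` {a} = ?R\<^sup>* `` {y}" unfolding comps_def by blast
   hence "y \<in> {a, b}" using comp_pair_even[OF F ab d True, of u] by blast
   thus False using y by blast
  qed
  thus ?thesis unfolding SS using S(1) True eq by simp
 next
  case False
  hence "A \<noteq> []" "C \<noteq> []" using len by auto
  then obtain A' x y C' where AC: "A = A' @ [x]" "C = y # C'" by (metis rev_exhaust neq_Nil_conv)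
  have "(a, x) \<in> ?R" unfolding link_odd(1)[OF False AC] by (auto simp: und_iff)
  hence "?R\<^sup>* `` {a} = ?R\<^sup>* `` {x}" using comp_eq_iff[OF symR] by blast
  moreover have "x \<in> ?S'" using S AC d by auto
  ultimately have "?R\<^sup>* `` {a} \<in> comps ?R ?S'" unfolding comps_def by blast
  thus ?thesis unfolding SS using False eq by (simp add: insert_absorb)
 qed
qed

text \<open>
  The points of \<open>rs\<close> are consecutive on the boundary. Gluing them pairwise, and gluing them with a shift
  by one to \<open>s0\<close> and \<open>s1\<close>, gives together a fixed number of components. If two neighbours are joined by a line, exactly one of
  the two gluings closes that line up, and deleting the pair removes one component. If no two neighbours are
  joined, planarity forbids all lines inside \<open>rs\<close>, and both numbers can be counted directly.
\<close>

theorem euler: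
 fixes F :: "('a \<times> 'l list \<times> 'a) set" and u v :: "'l list"
 assumes "matching V F" "finite V" "inj_on pos V" "noncrossing pos (und F)"
  and "ascending pos rs" "set rs \<subseteq> V" "even (length rs)"
  and "\<And>x a b. x \<in> V \<Longrightarrow> a \<in> set rs \<Longrightarrow> b \<in> set rs \<Longrightarrow> pos a < pos x \<Longrightarrow> pos x < pos b \<Longrightarrow> x \<in> set rs"
  and s: "s0 \<in> V" "s1 \<in> V" "s0 \<notin> set rs" "s1 \<notin> set rs" "s0 \<noteq> s1"
  and t: "\<And>w q. (s0, w, q) \<in> F \<Longrightarrow> q \<notin> set rs \<union> {s0, s1}" "\<And>w q. (s1, w, q) \<in> F \<Longrightarrow> q \<notin> set rs \<union> {s0, s1}"
 shows "2 * (card (comps (und F \<union> und (link u ([s0] @ rs @ [s1]))) V) + card (comps (und F \<union> und (link v rs)) (set rs)) + 1) = card V"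
 using assms
proof (induction "length rs" arbitrary: V F rs rule: less_induct)
 case less
 note F = less.prems(1) and fin = less.prems(2) and inj = less.prems(3) and nc = less.prems(4) and asc = less.prems(5)
  and sub = less.prems(6) and even = less.prems(7) and cont = less.prems(8) and s = less.prems(9-13) and t = less.prems(14,15)
 have dist: "distinct rs" by (rule asc_distinct[OF asc])
 let ?sg = "[s0] @ rs @ [s1]"
 have dsg: "distinct ?sg" using dist s by auto
 show ?case
 proof (cases "\<exists>A a b C w. rs = A @ [a, b] @ C \<and> (a, w, b) \<in> F")
  case True
  then obtain A a b C w where rs: "rs = A @ [a, b] @ C" and ab: "(a, w, b) \<in> F" by blast
  let ?F = "del {a, b} F" and ?V = "V - {a, b}"
  have dA: "distinct (A @ [a, b] @ C)" using dist unfolding rs .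
  have abrs: "a \<in> set rs" "b \<in> set rs" "a \<noteq> b" using dA unfolding rs by auto
  have m: "matching ?V ?F"
  proof (rule matching_del[OF F])
   fix p w' q assume h: "(p, w', q) \<in> F" "p \<in> {a, b}"
   thus "q \<in> {a, b}" using matching_uniq[OF F ab, of w' q] matching_uniq[OF F matchingD(4)[OF F ab], of w' q] by auto
  qed
  have set': "set (A @ C) = set rs - {a, b}" using dA unfolding rs by auto
  have IH: "2 * (card (comps (und ?F \<union> und (link u ([s0] @ (A @ C) @ [s1]))) ?V) + card (comps (und ?F \<union> und (link v (A @ C))) (set (A @ C))) + 1) = card ?V"
  proof (rule less.hyps[OF _ m])
   show "length (A @ C) < length rs" unfolding rs by simp
   show "noncrossing pos (und ?F)" by (rule noncrossing_mono[OF nc]) (auto simp: und_iff del_iff)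
   show "ascending pos (A @ C)" using asc unfolding rs by (auto simp: sorted_wrt_append)
   show "inj_on pos ?V" using inj by (rule inj_on_subset) auto
   show "even (length (A @ C))" using even unfolding rs by simp
   show "set (A @ C) \<subseteq> ?V" using sub unfolding set' by blast
   show "x \<in> set (A @ C)" if "x \<in> ?V" "a' \<in> set (A @ C)" "b' \<in> set (A @ C)" "pos a' < pos x" "pos x < pos b'" for x a' b'
    using cont[of x a' b'] that unfolding set' by blast
   show "q \<notin> set (A @ C) \<union> {s0, s1}" if "(s0, w', q) \<in> ?F" for w' q using t(1)[of w' q] that unfolding del_iff set' by blast
   show "q \<notin> set (A @ C) \<union> {s0, s1}" if "(s1, w', q) \<in> ?F" for w' q using t(2)[of w' q] that unfolding del_iff set' by blast
  qed (use fin s abrs set' in auto)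
  have sg: "?sg = ([s0] @ A) @ [a, b] @ (C @ [s1])" "[s0] @ (A @ C) @ [s1] = ([s0] @ A) @ (C @ [s1])" unfolding rs by simp_all
  have T: "card (comps (und F \<union> und (link u ?sg)) V) =
    (if even (length ([s0] @ A)) then 1 else 0) + card (comps (und ?F \<union> und (link u ([s0] @ (A @ C) @ [s1]))) ?V)"
   unfolding sg by (rule card_comps_delete_pair[OF F ab dsg[unfolded sg]]) (use even fin sub s abrs rs in auto)
  have B: "card (comps (und F \<union> und (link v rs)) (set rs)) =
    (if even (length A) then 1 else 0) + card (comps (und ?F \<union> und (link v (A @ C))) (set (A @ C)))"
   unfolding set' unfolding rs by (rule card_comps_delete_pair[OF F ab dA]) (use even rs in auto)
  have "card ?V + 2 = card V"
  proof -
   have "{a, b} \<subseteq> V" using abrs sub by blast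
   hence "card ?V = card V - 2" "2 \<le> card V" using abrs(3) card_mono[OF fin, of "{a, b}"] by (simp_all add: card_Diff_subset)
   thus ?thesis by simp
  qed
  thus ?thesis using IH T B by auto
 next
  case False
  have nopair: "(rs ! i, w, rs ! j) \<notin> F" if "i < j" "j < length rs" for i j w using that
  proof (induction "j - i" arbitrary: i j w rule: less_induct)
   case less
   show ?case
   proof
    assume e: "(rs ! i, w, rs ! j) \<in> F"
    have lt: "pos (rs ! k) < pos (rs ! l) \<longleftrightarrow> k < l" if "k < length rs" "l < length rs" for k l
     by (rule asc_nth_less_iff[OF asc that])
    show False
    proof (cases "j = Suc i")
     case True
     have "rs = take i rs @ [rs ! i, rs ! j] @ drop (Suc (Suc i)) rs"
      using True less.prems by (simp add: Cons_nth_drop_Suc id_take_nth_drop[symmetric])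
     thus False using False e \<open>\<nexists>A a b C w. rs = A @ [a, b] @ C \<and> (a, w, b) \<in> F\<close> by blast
    next
     case False
     let ?k = "Suc i"
     have k: "?k < j" "?k < length rs" using False less.prems by simp_all
     hence "rs ! ?k \<in> V" using sub by auto
     then obtain v y where y: "(rs ! ?k, v, y) \<in> F" using matching_ex[OF F] by blast
     have "(rs ! i, rs ! j) \<in> und F" "(rs ! ?k, y) \<in> und F" using e y unfolding und_iff by blast+
     moreover have "pos (rs ! i) < pos (rs ! ?k)" "pos (rs ! ?k) < pos (rs ! j)" using lt k less.prems by auto
     ultimately have b: "pos (rs ! i) < pos y \<and> pos y < pos (rs ! j)" using noncrossing_iff[OF F inj] nc by blast
     have "y \<in> set rs" using cont[of y "rs ! i" "rs ! j"] matchingD(2)[OF F y] b less.prems by auto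
     then obtain l where l: "l < length rs" "y = rs ! l" by (metis in_set_conv_nth)
     have il: "i < l" "l < j" using b l lt less.prems by auto
     have "l \<noteq> ?k" using matchingD(3)[OF F y] l by auto
     hence "?k < l" using il by simp
     thus False using less.hyps[of l ?k v] y l il less.prems by auto
    qed
   qed
  qed
  have out: "q \<notin> set rs" if "(p, w, q) \<in> F" "p \<in> set rs" for p w q
  proof
   assume "q \<in> set rs"
   then obtain i j where ij: "i < length rs" "p = rs ! i" "j < length rs" "q = rs ! j" using \<open>p \<in> set rs\<close> by (metis in_set_conv_nth)
   have "i \<noteq> j" using matchingD(3)[OF F that(1)] ij by auto
   thus False using nopair[of i j w] nopair[of j i "rev w"] that(1) matchingD(4)[OF F that(1)] ij by (metis linorder_neqE_nat)
  qed
  \<comment> \<open>every edge at a wall point or at \<open>s0\<close>, \<open>s1\<close> leaves the strand, so no component closes up on it\<close>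
  have ml: "matching (set ?sg) (link u ?sg)" using dsg even by (intro matching_link) auto
  have ssg: "set ?sg \<subseteq> V" using sub s by auto
  have noclosed: "closed_comps (und F \<union> und (link u ?sg)) V (V - set ?sg) = {}"
  proof (rule ccontr)
   assume "closed_comps (und F \<union> und (link u ?sg)) V (V - set ?sg) \<noteq> {}"
   then obtain x where x: "x \<in> V" "(und F \<union> und (link u ?sg))\<^sup>* `` {x} \<inter> (V - set ?sg) = {}"
    unfolding closed_comps_def comps_def by blast
   hence xsg: "x \<in> set ?sg" by auto
   obtain w q where q: "(x, w, q) \<in> F" using matching_ex[OF F x(1)] by blast
   have "q \<notin> set ?sg"
   proof -
    from xsg consider "x = s0" | "x = s1" | "x \<in> set rs" by auto
    thus ?thesis
    proof cases
     case 1 thus ?thesis using t(1) q by auto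
    next
     case 2 thus ?thesis using t(2) q by auto
    next
     case 3
     hence "q \<noteq> s0" "q \<noteq> s1" using t(1)[of "rev w" x] t(2)[of "rev w" x] matchingD(4)[OF F q] by auto
     thus ?thesis using out[OF q 3] by auto
    qed
   qed
   moreover have "q \<in> V" by (rule matchingD(2)[OF F q])
   moreover have "(x, q) \<in> (und F \<union> und (link u ?sg))\<^sup>*" by (intro r_into_rtrancl UnI1) (use q in \<open>auto simp: und_iff\<close>)
   ultimately show False using x(2) by blast
  qed
  have "2 * card (comps (und F \<union> und (link u ?sg)) V) = card (V - set ?sg)" using card_comps_glued[OF F ml ssg fin] unfolding noclosed by simp
  moreover have "card (V - set ?sg) + (length rs + 2) = card V"
  proof -
   have c: "card (set ?sg) = length rs + 2" using distinct_card[OF dsg] by simp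
   have "card (set ?sg) \<le> card V" by (rule card_mono[OF fin ssg])
   thus ?thesis using card_Diff_subset[OF _ ssg] c by simp
  qed
  moreover have "2 * card (comps (und F \<union> und (link v rs)) (set rs)) = length rs"
  proof -
   let ?R = "und F \<union> und (link v rs)"
   define r where "r = length rs div 2"
   have lr: "length rs = 2 * r" unfolding r_def using even by simp
   have symR: "sym ?R" using und_sym[OF F] sym_link by (rule sym_Un)
   have adj: "(rs ! (2 * j), rs ! (2 * j + 1)) \<in> ?R" if "j < r" for j
   proof -
    have "(rs ! (2 * j), v, rs ! (2 * j + 1)) \<in> link v rs" unfolding link_nth using that lr by (intro exI[of _ j]) auto
    thus ?thesis unfolding und_def by blast
   qed
   have "comps ?R (set rs) = (\<lambda>j. ?R\<^sup>* `` {rs ! (2 * j)}) ` {..<r}"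
   proof
    show "comps ?R (set rs) \<subseteq> (\<lambda>j. ?R\<^sup>* `` {rs ! (2 * j)}) ` {..<r}"
    proof
     fix X assume "X \<in> comps ?R (set rs)"
     then obtain i where i: "i < length rs" "X = ?R\<^sup>* `` {rs ! i}" unfolding comps_def by (auto simp: in_set_conv_nth)
     show "X \<in> (\<lambda>j. ?R\<^sup>* `` {rs ! (2 * j)}) ` {..<r}"
     proof (cases "even i")
      case True
      thus ?thesis using i lr by (auto elim!: evenE)
     next
      case False
      then obtain j where j: "i = 2 * j + 1" by (rule oddE)
      hence jr: "j < r" using i lr by simp
      have "?R\<^sup>* `` {rs ! (2 * j)} = X" unfolding i(2) j using comp_eq_iff[OF symR] adj[OF jr] by blast
      thus ?thesis using jr by blast
     qed
    qed
    show "(\<lambda>j. ?R\<^sup>* `` {rs ! (2 * j)}) ` {..<r} \<subseteq> comps ?R (set rs)" unfolding comps_def using lr by auto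
   qed
   moreover have "inj_on (\<lambda>j. ?R\<^sup>* `` {rs ! (2 * j)}) {..<r}"
   proof (rule inj_onI)
    fix j j' assume j: "j \<in> {..<r}" "j' \<in> {..<r}" and eq: "?R\<^sup>* `` {rs ! (2 * j)} = ?R\<^sup>* `` {rs ! (2 * j')}"
    have l: "2 * j < length rs" "2 * j + 1 < length rs" "2 * j' < length rs" using j lr by auto
    obtain w q where q: "(rs ! (2 * j), w, q) \<in> F" using matching_ex[OF F] sub l by (metis nth_mem subsetD)
    obtain w' q' where q': "(rs ! (2 * j + 1), w', q') \<in> F" using matching_ex[OF F] sub l by (metis nth_mem subsetD)
    let ?S = "{rs ! (2 * j), rs ! (2 * j + 1), q, q'}"
    have qo: "q \<notin> set rs" "q' \<notin> set rs" using out[OF q] out[OF q'] l by auto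
    have ne: "rs ! (2 * j) \<noteq> rs ! (2 * j + 1)" using nth_eq_iff_index_eq[OF dist l(1,2)] by simp
    have "(rs ! (2 * j), rs ! (2 * j')) \<in> ?R\<^sup>*" using eq comp_eq_iff[OF symR] by blast
    hence "rs ! (2 * j') \<in> ?S"
    proof (rule rtrancl_closed)
     fix x y assume xy: "(x, y) \<in> ?R" "x \<in> ?S"
     show "y \<in> ?S"
     proof (cases "(x, y) \<in> und F")
      case True
      then obtain z where z: "(x, z, y) \<in> F" unfolding und_iff by blast
      from xy(2) show ?thesis
      proof (elim insertE emptyE)
       assume "x = rs ! (2 * j)" thus ?thesis using matching_uniq[OF F q] z by blast
      next assume "x = rs ! (2 * j + 1)" thus ?thesis using matching_uniq[OF F q'] z by blast
      next assume "x = q" thus ?thesis using matching_uniq[OF F matchingD(4)[OF F q]] z by blast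
      next assume "x = q'" thus ?thesis using matching_uniq[OF F matchingD(4)[OF F q']] z by blast
      qed
     next
      case False
      hence lk: "(x, y) \<in> und (link v rs)" using xy(1) by blast
      hence "x \<in> set rs" using und_link_sub by fast
      hence x: "x = rs ! (2 * j) \<or> x = rs ! (2 * j + 1)" using xy(2) qo by blast
      obtain u' where u': "(x, u', y) \<in> link v rs" using lk unfolding und_iff by blast
      have ml': "matching (set rs) (link v rs)" using dist even by (rule matching_link)
      have "(rs ! (2 * j), v, rs ! (2 * j + 1)) \<in> link v rs" unfolding link_nth using l by blast
      from matching_uniq[OF ml' this] matching_uniq[OF ml' matchingD(4)[OF ml' this]] x u' show ?thesis by blast
     qed
    qed simp
    hence "rs ! (2 * j') = rs ! (2 * j) \<or> rs ! (2 * j') = rs ! (2 * j + 1)" using qo l by (metis insertE nth_mem singletonD)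
    hence "2 * j' = 2 * j \<or> 2 * j' = 2 * j + 1" using nth_eq_iff_index_eq[OF dist l(3,1)] nth_eq_iff_index_eq[OF dist l(3,2)] by blast
    thus "j = j'" by presburger
   qed
   ultimately have "card (comps ?R (set rs)) = r" by (simp add: card_image)
   thus ?thesis using lr by simp
  qed
  ultimately show ?thesis by simp
 qed
qed

lemma rtrancl_disjoint:
 assumes "R \<subseteq> S \<times> S" "H \<subseteq> T \<times> T" "S \<inter> T = {}" "p \<in> S"
 shows "(R \<union> H)\<^sup>* `` {p} = R\<^sup>* `` {p}"
proof
 show "(R \<union> H)\<^sup>* `` {p} \<subseteq> R\<^sup>* `` {p}"
 proof
  fix q assume "q \<in> (R \<union> H)\<^sup>* `` {p}"
  hence "(p, q) \<in> (R \<union> H)\<^sup>*" by simp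
  hence "q \<in> R\<^sup>* `` {p} \<inter> S"
  proof (rule rtrancl_closed)
   fix u v assume h: "(u, v) \<in> R \<union> H" "u \<in> R\<^sup>* `` {p} \<inter> S"
   hence "(u, v) \<in> R" using assms by blast
   thus "v \<in> R\<^sup>* `` {p} \<inter> S" using h(2) assms(1) by (auto intro: rtrancl.rtrancl_into_rtrancl)
  qed (use assms in auto)
  thus "q \<in> R\<^sup>* `` {p}" by blast
 qed
 show "R\<^sup>* `` {p} \<subseteq> (R \<union> H)\<^sup>* `` {p}" using rtrancl_mono[of R "R \<union> H"] by auto
qed

context planar begin

definition "free = glued E (link [] ls)"

lemma free: "matching (V - set ls) free" unfolding free_def by (rule glued_matching[OF E left_glue _ finite_V]) (use blob_sub in blast)

lemma free_noncrossing: "noncrossing pos (und free)" unfolding free_def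
 by (rule noncrossing_glued[OF E left_glue _ finite_V inj nc outer_left]) (use blob_sub in blast)

lemma card_free: "card (V - set ls) = 2 * n + 4 + length rs"
proof -
 have d: "distinct ((tops @ rs @ bots) @ rev ls)" using distinct_circ unfolding circ_split by simp
 have "V - set ls = set (tops @ rs @ bots)" using d unfolding circ_split by auto
 moreover have "distinct (tops @ rs @ bots)" using d by (simp only: distinct_append)
 moreover have "length (tops @ rs @ bots) = 2 * n + 4 + length rs" unfolding tops_def bots_def by simp
 ultimately show ?thesis using distinct_card by metis
qed

theorem euler_free:
 fixes u v :: "blob list"
 shows "2 * (card (comps (und free \<union> und (link u ([Top 0] @ rs @ [Bot 0]))) (V - set ls)) +
  card (comps (und free \<union> und (link v rs)) (set rs)) + 1) = 2 * n + 4 + length rs"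
proof -
 have h: "(Top (n + 1), [], Top 0) \<in> free" "(Bot 0, [], Bot (n + 1)) \<in> free"
  unfolding free_def glued_def dom3_matching[OF left_glue] using disj hook_top hook_bot by (auto simp: vertices_Suc intro: apath.start)
 have ni: "Top (n + 1) \<notin> set rs \<union> {Top 0, Bot 0}" "Bot (n + 1) \<notin> set rs \<union> {Top 0, Bot 0}"
  using disj by (auto simp: vertices_Suc)
 show ?thesis unfolding card_free[symmetric]
 proof (rule euler[OF free _ _ free_noncrossing asc_parts(2)])
  show "inj_on pos (V - set ls)" using inj by (rule inj_on_subset) auto
  show "q \<notin> set rs \<union> {Top 0, Bot 0}" if "(Top 0, w, q) \<in> free" for w q
   using matching_uniq[OF free matchingD(4)[OF free h(1)] that] ni by simp
  show "q \<notin> set rs \<union> {Top 0, Bot 0}" if "(Bot 0, w, q) \<in> free" for w q using matching_uniq[OF free h(2) that] ni by simp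
  show "x \<in> set rs" if "x \<in> V - set ls" "a \<in> set rs" "b \<in> set rs" "pos a < pos x" "pos x < pos b" for x a b
   using that asc_parts(5)[of x a] asc_parts(6)[of b x] unfolding V_split by auto
  show "set rs \<subseteq> V - set ls" using disj blob_sub by blast
  show "Top 0 \<in> V - set ls" "Bot 0 \<in> V - set ls" unfolding set_circ using disj by auto
 qed (use even_rs disj in auto)
qed

end

section \<open>Counting the loops of a stack\<close>

lemma rtrancl_map: "(x, y) \<in> R\<^sup>* \<Longrightarrow> (f x, f y) \<in> (map_prod f f ` R)\<^sup>*"
proof (induction rule: rtrancl_induct)
 case (step y z)
 have "(f y, f z) \<in> map_prod f f ` R" using step(2) by force
 thus ?case using step(3) by simp
qed simp

text \<open>
  In a stack of drawings the inner hooks are dropped; these are the outer ones.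
\<close>

definition hook_pairs :: "nat \<Rightarrow> diagram" where
 "hook_pairs n = {(Top (n + 1), [], Top 0), (Top 0, [], Top (n + 1)), (Bot (n + 1), [], Bot 0), (Bot 0, [], Bot (n + 1))}"

lemma matching_hooks: "matching (hook_ends n) (hook_pairs n)"
proof -
 have "matching ({Top (n + 1), Top 0} \<union> {Bot (n + 1), Bot 0}) ({(Top (n + 1), [] :: blob list, Top 0), (Top 0, rev [], Top (n + 1))} \<union> {(Bot (n + 1), [], Bot 0), (Bot 0, rev [], Bot (n + 1))})"
  by (intro matching_Un matching_pair) auto
 moreover have "{Top (n + 1), Top 0} \<union> {Bot (n + 1), Bot 0} = hook_ends n" by blast
 moreover have "{(Top (n + 1), [] :: blob list, Top 0), (Top 0, rev [], Top (n + 1))} \<union> {(Bot (n + 1), [], Bot 0), (Bot 0, rev [], Bot (n + 1))} = hook_pairs n"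
  unfolding hook_pairs_def by auto
 ultimately show ?thesis by (simp only:)
qed

lemma und_hooks: "und (hook_pairs n) = hook_edges n"
 unfolding hook_pairs_def und_def by auto

lemma (in planar) E_core: "E = core \<union> hook_pairs n"
proof -
 have h: "hook_pairs n \<subseteq> E" using hook_top hook_bot symE[OF hook_top] symE[OF hook_bot] unfolding hook_pairs_def by blast
 have "V = (vertices n \<union> set ls \<union> set rs) \<union> hook_ends n"
  unfolding set_circ by (auto simp: vertices_Suc)
 moreover have "(vertices n \<union> set ls \<union> set rs) \<inter> hook_ends n = {}"
  using disj by (auto simp: vertices_Suc)
 ultimately have m: "matching V (core \<union> hook_pairs n)" using matching_Un[OF core matching_hooks] by simp
 have "core \<union> hook_pairs n \<subseteq> E" using h core_sub by blast
 from matching_eqI[OF m E this] show ?thesis by simp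
qed

context stacking begin

abbreviation "hooks \<equiv> hook_ends n"

lemma inner_unlabelled: "unlabelled (und inner) = inner"
proof -
 have "(p, w, q) \<in> unlabelled (und inner) \<longleftrightarrow> (p, w, q) \<in> inner" for p w q
  unfolding unlabelled_iff und_iff using inner_nil by blast
 thus ?thesis by auto
qed

definition "composite = inner \<union> hook_pairs n"

lemma planar_composite: "\<exists>pos. planar n ls rs pos composite"
proof -
 have "unlabelled (und inner \<union> hook_edges n) = unlabelled (und inner) \<union> hook_pairs n"
  unfolding unlabelled_def hook_pairs_def by auto
 thus ?thesis using ex_composite unfolding inner_unlabelled composite_def by simp
qed

definition "cpos = (SOME pos. planar n ls rs pos composite)"

sublocale N: planar n ls rs cpos composite unfolding cpos_def using planar_composite by (rule someI_ex)

theorem lines_composite: "drawn_lines n ls rs composite = stack n (drawn_lines n ls1 rs1 E1) (drawn_lines n ls2 rs2 E2)"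
proof -
 have "(vertices n \<union> set ls \<union> set rs) \<inter> hooks = {}" using N.disj by (auto simp: vertices_Suc)
 hence "p \<notin> hooks \<and> q \<notin> hooks" if "(p, w, q) \<in> inner" for p w q
  using matchingD(1)[OF inner that] matchingD(2)[OF inner that] by blast
 hence "del hooks inner = inner" by (rule del_disjoint)
 moreover have "del hooks (hook_pairs n) = {}" unfolding del_def hook_pairs_def by auto
 ultimately have "N.core = inner" unfolding N.core_def unfolding N.hooks_def composite_def del_subset_Un by simp
 thus ?thesis using N.lines_core glued_inner by simp
qed

definition "V1 = V12 \<union> hooks"
definition "EH = core12 \<union> hook_pairs n"

lemma V12_hooks: "V12 \<inter> hooks = {}"
proof -
 have "V12 = (vertices n \<union> set ls \<union> set rs) \<union> mids n" using V12_split mids_sub by blast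
 moreover have "(vertices n \<union> set ls \<union> set rs) \<inter> hooks = {}" using N.disj by (auto simp: vertices_Suc)
 moreover have "mids n \<inter> hooks = {}" unfolding mids_def by auto
 ultimately show ?thesis by blast
qed

lemma EH: "matching V1 EH" unfolding V1_def EH_def by (rule matching_Un[OF core12 matching_hooks V12_hooks])

lemma finite_V1: "finite V1" unfolding V1_def using finite_V12 by simp

lemma V1_mids: "V1 - mids n = N.V" "mids n \<subseteq> V1"
proof -
 have "mids n \<inter> hooks = {}" unfolding mids_def by auto
 hence "V1 - mids n = (vertices n \<union> set ls \<union> set rs) \<union> hooks" unfolding V1_def V12_split[symmetric] by blast
 thus "V1 - mids n = N.V" unfolding set_circ by (auto simp: vertices_Suc)
 show "mids n \<subseteq> V1" using mids_sub unfolding V1_def by blast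
qed

lemma EH_mid: "glued EH (mid n) = composite"
proof (rule sym, rule matching_total_eq)
 show m: "matching N.V (glued EH (mid n))" using glued_matching[OF EH matching_mid V1_mids(2) finite_V1] unfolding V1_mids(1) .
 have d: "dom3 (mid n :: diagram) = mids n" by (rule dom3_matching[OF matching_mid])
 show "composite \<subseteq> glued EH (mid n)" unfolding composite_def
 proof (rule Un_least)
  show "inner \<subseteq> glued EH (mid n)" unfolding inner_def glued_def EH_def by (auto intro: apath_mono[OF _ Un_upper1 subset_refl])
  show "hook_pairs n \<subseteq> glued EH (mid n)"
  proof
   fix z assume z: "z \<in> hook_pairs n"
   obtain p w q where zz: "z = (p, w, q)" by (cases z)
   have "apath EH (mid n) p w q" using z zz unfolding EH_def by (auto intro: apath.start)
   moreover have "p \<notin> mids n" "q \<notin> mids n" using z zz unfolding hook_pairs_def mids_def by auto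
   ultimately show "z \<in> glued EH (mid n)" unfolding zz glued_def d by simp
  qed
 qed
 show "\<exists>w q. (p, w, q) \<in> composite" if "p \<in> N.V" for p by (rule matching_ex[OF N.E that])
qed

definition "EE = layers E1 E2"
definition "VV = up ` P.V \<union> dn ` Q.V"
definition "S12 = img up (strand_glue ls1 rs1) \<union> img dn (strand_glue ls2 rs2)"
definition "W12 = up ` (set ls1 \<union> set ([Top 0] @ rs1 @ [Bot 0])) \<union> dn ` (set ls2 \<union> set ([Top 0] @ rs2 @ [Bot 0]))"
definition "XX = {up (Bot 0), up (Bot (n + 1)), dn (Top (n + 1)), dn (Top 0)}"
definition "AA = [Top 0] @ map up rs1"
definition "CC = map dn rs2 @ [Bot 0]"
definition "RT = und EE \<union> und S12 \<union> und (mid (n + 1) :: diagram)"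
definition "R1 = und EH \<union> und (mid n :: diagram) \<union> und (strand_glue ls rs)"

lemma EE: "matching VV EE" unfolding EE_def VV_def layers_def
 by (rule matching_Un[OF matching_img[OF inj_up P.E] matching_img[OF inj_dn Q.E]]) (use up_dn_range in blast)

lemma S12: "matching W12 S12" unfolding S12_def W12_def
 by (rule matching_Un[OF matching_img[OF inj_up P.strand_glue] matching_img[OF inj_dn Q.strand_glue]]) (use up_dn_range in blast)

lemma finite_VV: "finite VV" unfolding VV_def by simp

lemma W12_sub: "W12 \<subseteq> VV" unfolding W12_def VV_def using P.strand_sub Q.strand_sub by blast

lemma VV_W12: "VV - W12 = layer_vertices (n + 1)"
proof -
 have "VV - W12 = up ` (P.V - (set ls1 \<union> set ([Top 0] @ rs1 @ [Bot 0]))) \<union> dn ` (Q.V - (set ls2 \<union> set ([Top 0] @ rs2 @ [Bot 0])))"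
  unfolding VV_def W12_def image_set_diff[OF inj_up] image_set_diff[OF inj_dn] using up_dn_range by blast
 thus ?thesis unfolding P.strand_rest Q.strand_rest layer_vertices_def .
qed

lemma glued_strands: "glued EE S12 = layers (strand_diagram ls1 rs1 E1) (strand_diagram ls2 rs2 E2)"
 unfolding EE_def S12_def layers_def strand_diagram_def
 by (rule glued_img[OF inj_up inj_dn up_dn_range P.E Q.E P.strand_glue Q.strand_glue P.strand_sub Q.strand_sub P.finite_V Q.finite_V])

lemma tl_mids: "mids (n + 1) \<subseteq> layer_vertices (n + 1)" "layer_vertices (n + 1) - mids (n + 1) = vertices (n + 1)"
 using layer_vertices_split[of "n + 1"] by blast+

lemma finite_layer: "finite (layer_vertices k)" unfolding layer_vertices_def vertices_def by simp

lemma tl_stack: "stack (n + 1) (strand_diagram ls1 rs1 E1) (strand_diagram ls2 rs2 E2) = glued EE (S12 \<union> mid (n + 1))"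
proof -
 have "W12 \<inter> mids (n + 1) = {}" using VV_W12 tl_mids(1) by blast
 from glued_glued_matching[OF S12 matching_mid this, of EE]
 show ?thesis unfolding stack_glued[OF P.strand_matching Q.strand_matching] glued_strands .
qed

lemma XX_V1: "XX \<inter> V1 = {}"
proof -
 have "Bot 0 \<notin> vertices n \<union> set ls1 \<union> set rs1" "Bot (n + 1) \<notin> vertices n \<union> set ls1 \<union> set rs1"
  using P.disj by (auto simp: vertices_Suc)
 moreover have "Top 0 \<notin> vertices n \<union> set ls2 \<union> set rs2" "Top (n + 1) \<notin> vertices n \<union> set ls2 \<union> set rs2"
  using Q.disj by (auto simp: vertices_Suc)
 ultimately have "XX \<inter> V12 = {}"
  unfolding XX_def V12_def by (auto simp del: up.simps dn.simps simp: inj_image_mem_iff[OF inj_up] inj_image_mem_iff[OF inj_dn])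
 moreover have "XX \<inter> hooks = {}" unfolding XX_def by auto
 ultimately show ?thesis unfolding V1_def by blast
qed

lemma VV_eq: "VV = V1 \<union> XX"
proof -
 have "up ` hook_ends n \<union> dn ` hook_ends n = hooks \<union> XX"
  unfolding XX_def by auto
 moreover have "P.V = (vertices n \<union> set ls1 \<union> set rs1) \<union> hooks" "Q.V = (vertices n \<union> set ls2 \<union> set rs2) \<union> hooks"
  unfolding set_circ by (auto simp: vertices_Suc)
 ultimately show ?thesis unfolding VV_def V1_def V12_def by (simp only: image_Un Un_ac)
qed

lemma und_EE: "und EE = und EH \<union> {(up (Bot 0), up (Bot (n + 1))), (up (Bot (n + 1)), up (Bot 0)), (dn (Top (n + 1)), dn (Top 0)), (dn (Top 0), dn (Top (n + 1)))}"
proof -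
 have a: "EE = core12 \<union> (img up (hook_pairs n) \<union> img dn (hook_pairs n))"
  unfolding EE_def core12_def layers_def using P.E_core Q.E_core by (metis (no_types, lifting) img_Un sup_assoc sup_commute)
 have b: "und (img up (hook_pairs n) \<union> img dn (hook_pairs n)) = und (hook_pairs n) \<union>
   {(up (Bot 0), up (Bot (n + 1))), (up (Bot (n + 1)), up (Bot 0)), (dn (Top (n + 1)), dn (Top 0)), (dn (Top 0), dn (Top (n + 1)))}"
  unfolding und_Un und_img und_hooks by auto
 show ?thesis by (simp only: a EH_def und_Un[of core12] b Un_assoc)
qed

lemma und_mid_Suc: "und (mid (n + 1) :: diagram) =
 und (mid n :: diagram) \<union> {(up (Bot (n + 1)), dn (Top (n + 1))), (dn (Top (n + 1)), up (Bot (n + 1)))}"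
proof -
 have "{1..n + 1} = insert (n + 1) {1..n}" by auto
 thus ?thesis unfolding mid_def by (auto simp: und_def)
qed

lemma strands_split: "und S12 = und (link [] ls :: diagram) \<union> und (link [] (AA @ [up (Bot 0), dn (Top 0)] @ CC) :: diagram)"
 "und (strand_glue ls rs) = und (link [] ls :: diagram) \<union> und (link [] (AA @ CC) :: diagram)"
proof -
 have e1: "even (length (map up ls1))" and e2: "even (length (AA @ [up (Bot 0)]))" using P.even_ls P.even_rs unfolding AA_def by simp_all
 have ac: "map up ([Top 0] @ rs1 @ [Bot 0]) = AA @ [up (Bot 0)]" "map dn ([Top 0] @ rs2 @ [Bot 0]) = [dn (Top 0)] @ CC"
  unfolding AA_def CC_def by simp_all
 have "S12 = link [] (map up ls1) \<union> link [] (AA @ [up (Bot 0)]) \<union> (link [] (map dn ls2) \<union> link [] ([dn (Top 0)] @ CC))"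
  unfolding S12_def strand_glue_def img_Un link_map[symmetric] ac ..
 also have "\<dots> = link [] ls \<union> link [] ((AA @ [up (Bot 0)]) @ ([dn (Top 0)] @ CC))"
  unfolding ls_def link_append[OF e1] link_append[OF e2] by blast
 finally show "und S12 = und (link [] ls :: diagram) \<union> und (link [] (AA @ [up (Bot 0), dn (Top 0)] @ CC) :: diagram)"
  unfolding und_Un[symmetric] by simp
 have "[Top 0] @ rs @ [Bot 0] = AA @ CC" unfolding rs_def AA_def CC_def by simp
 thus "und (strand_glue ls rs) = und (link [] ls :: diagram) \<union> und (link [] (AA @ CC) :: diagram)" unfolding strand_glue_def und_Un by simp
qed

lemma odd_AA: "odd (length AA)" unfolding AA_def using P.even_rs by simp

lemma AA_CC: obtains A' x y C' where "AA = A' @ [x]" "CC = y # C'"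
 "und (link [] (AA @ [up (Bot 0), dn (Top 0)] @ CC) :: diagram) =
   und (link [] A' :: diagram) \<union> und (link [] C' :: diagram) \<union>
   {(x, up (Bot 0)), (up (Bot 0), x), (dn (Top 0), y), (y, dn (Top 0))}"
 "und (link [] (AA @ CC) :: diagram) =
   und (link [] A' :: diagram) \<union> und (link [] C' :: diagram) \<union> {(x, y), (y, x)}"
 "x \<in> V1" "y \<in> V1"
proof -
 have "AA \<noteq> []" "CC \<noteq> []" unfolding AA_def CC_def by auto
 then obtain A' x y C' where AC: "AA = A' @ [x]" "CC = y # C'" by (metis rev_exhaust neq_Nil_conv)
 have sub: "set AA \<subseteq> V1" "set CC \<subseteq> V1" unfolding AA_def CC_def V1_def V12_def by auto
 show ?thesis
 proof (rule that[OF AC])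
  show "und (link [] (AA @ [up (Bot 0), dn (Top 0)] @ CC) :: diagram) =
   und (link [] A' :: diagram) \<union> und (link [] C' :: diagram) \<union>
   {(x, up (Bot 0)), (up (Bot 0), x), (dn (Top 0), y), (y, dn (Top 0))}"
   unfolding link_odd(1)[OF odd_AA AC] und_def by auto
  show "und (link [] (AA @ CC) :: diagram) =
   und (link [] A' :: diagram) \<union> und (link [] C' :: diagram) \<union> {(x, y), (y, x)}"
   unfolding link_odd(2)[OF odd_AA AC] und_def by auto
  show "x \<in> V1" "y \<in> V1" using sub AC by auto
 qed
qed

lemma strand_glue_sub: "und (strand_glue ls rs) \<subseteq> N.V \<times> N.V" using und_sub[OF N.strand_glue] N.strand_sub by blast

lemma R1_sub: "R1 \<subseteq> V1 \<times> V1"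
proof -
 have "und EH \<subseteq> V1 \<times> V1" by (rule und_sub[OF EH])
 moreover have "und (mid n :: diagram) \<subseteq> V1 \<times> V1" using und_sub[OF matching_mid[of n]] V1_mids(2) by blast
 moreover have "und (strand_glue ls rs) \<subseteq> V1 \<times> V1" using strand_glue_sub V1_mids(1) by blast
 ultimately show ?thesis unfolding R1_def by blast
qed

lemma symR1: "sym R1" unfolding R1_def by (intro sym_Un und_sym[OF EH] und_sym[OF matching_mid] und_sym[OF N.strand_glue])

lemma symRT: "sym RT" unfolding RT_def by (intro sym_Un und_sym[OF EE] und_sym[OF matching_mid] und_sym[OF S12])

text \<open>
  Between the two layers the strand runs through \<open>Bot 0\<close> and \<open>Bot (n + 1)\<close> of the upper and \<open>Top (n + 1)\<close>
  and \<open>Top 0\<close> of the lower drawing. These four points \<open>XX\<close> are a detour from the last right blob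
  above to the first one below, which the composite joins directly.
\<close>

lemma RT_R1: "p \<in> V1 \<Longrightarrow> q \<in> V1 \<Longrightarrow> (p, q) \<in> RT\<^sup>* \<longleftrightarrow> (p, q) \<in> R1\<^sup>*"
 and XX_conn: "z \<in> XX \<Longrightarrow> \<exists>v\<in>V1. (z, v) \<in> RT\<^sup>*"
proof -
 from AA_CC obtain A' x y C' where AC: "AA = A' @ [x]" "CC = y # C'" and
  l1: "und (link [] (AA @ [up (Bot 0), dn (Top 0)] @ CC) :: diagram) =
   und (link [] A' :: diagram) \<union> und (link [] C' :: diagram) \<union>
   {(x, up (Bot 0)), (up (Bot 0), x), (dn (Top 0), y), (y, dn (Top 0))}" and
  l2: "und (link [] (AA @ CC) :: diagram) =
   und (link [] A' :: diagram) \<union> und (link [] C' :: diagram) \<union> {(x, y), (y, x)}" and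
  xy: "x \<in> V1" "y \<in> V1" .
 define a b c d where "a = up (Bot 0)" and "b = dn (Top 0)" and "c = up (Bot (n + 1))" and "d = dn (Top (n + 1))"
 define K where "K = und EH \<union> und (mid n :: diagram) \<union> und (link [] ls :: diagram) \<union>
  und (link [] A' :: diagram) \<union> und (link [] C' :: diagram)"
 have X: "XX = {a, b, c, d}" unfolding XX_def a_def b_def c_def d_def by auto
 have RT: "RT = K \<union> {(a, c), (c, a), (d, b), (b, d)} \<union> {(c, d), (d, c)} \<union> {(x, a), (a, x), (b, y), (y, b)}"
  unfolding RT_def und_EE strands_split(1) und_mid_Suc l1 K_def a_def b_def c_def d_def by blast
 have R1: "R1 = K \<union> {(x, y), (y, x)}" unfolding R1_def strands_split(2) l2 K_def by blast
 have KV: "K \<subseteq> V1 \<times> V1" using R1_sub unfolding R1 by blast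
 have nX: "v \<notin> {a, b, c, d}" if "v \<in> V1" for v using XX_V1 that unfolding X by blast
 have ne: "a \<noteq> b" "a \<noteq> d" "c \<noteq> b" "c \<noteq> d" unfolding a_def b_def c_def d_def by simp_all
 define f where "f = (\<lambda>z. if z \<in> {a, c} then x else if z \<in> {b, d} then y else z)"
 have fid: "f v = v" if "v \<in> V1" for v using nX[OF that] unfolding f_def by simp
 have fX: "f a = x" "f c = x" "f b = y" "f d = y" using ne unfolding f_def by auto
 have path: "(x, a) \<in> RT" "(a, c) \<in> RT" "(c, d) \<in> RT" "(d, b) \<in> RT" "(b, y) \<in> RT" unfolding RT by blast+
 have xyRT: "(x, y) \<in> RT\<^sup>*" using path by (meson r_into_rtrancl rtrancl_trans)
 show "(p, q) \<in> RT\<^sup>* \<longleftrightarrow> (p, q) \<in> R1\<^sup>*" if pq: "p \<in> V1" "q \<in> V1" for p q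
 proof (rule rtrancl_retract[where f = f])
  fix v w assume "(v, w) \<in> RT"
  hence "(v, w) \<in> K \<or> (v, w) \<in> {(a, c), (c, a), (d, b), (b, d), (x, a), (a, x), (b, y), (y, b)} \<or> (v, w) = (c, d) \<or> (v, w) = (d, c)"
   unfolding RT Un_iff by (elim disjE insertE emptyE) simp_all
  then consider "(v, w) \<in> K" | "(v, w) \<in> {(a, c), (c, a), (d, b), (b, d), (x, a), (a, x), (b, y), (y, b)}" | "(v, w) = (c, d)" | "(v, w) = (d, c)"
   by (elim disjE)
  thus "(f v, f w) \<in> R1\<^sup>*"
  proof cases
   case 1
   hence "f v = v" "f w = w" using KV fid by blast+
   moreover have "(v, w) \<in> R1" using 1 unfolding R1 by blast
   ultimately show ?thesis by (simp only: r_into_rtrancl)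
  next
   case 2
   hence "f v = f w" using fX fid[OF xy(1)] fid[OF xy(2)] by auto
   thus ?thesis by (simp only: rtrancl.rtrancl_refl)
  next
   case 3
   hence "f v = x" "f w = y" using fX by simp_all
   moreover have "(x, y) \<in> R1" unfolding R1 by blast
   ultimately show ?thesis by (simp only: r_into_rtrancl)
  next
   case 4
   hence "f v = y" "f w = x" using fX by simp_all
   moreover have "(y, x) \<in> R1" unfolding R1 by blast
   ultimately show ?thesis by (simp only: r_into_rtrancl)
  qed
 next
  have "(y, x) \<in> RT\<^sup>*" using xyRT symD[OF sym_rtrancl[OF symRT]] by blast
  moreover have "R1 \<subseteq> RT \<union> {(x, y), (y, x)}" unfolding RT R1 by blast
  ultimately show "R1 \<subseteq> RT\<^sup>*" using xyRT by (intro sub_rtrancl2)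
 qed (use fid pq in simp_all)
 show "\<exists>v\<in>V1. (z, v) \<in> RT\<^sup>*" if "z \<in> XX" for z
 proof -
  have "(a, x) \<in> RT\<^sup>*" "(b, y) \<in> RT\<^sup>*" unfolding RT by blast+
  moreover have "(c, x) \<in> RT\<^sup>*"
  proof -
   have "(c, a) \<in> RT" "(a, x) \<in> RT" unfolding RT by blast+
   thus ?thesis by (meson r_into_rtrancl rtrancl_trans)
  qed
  moreover have "(d, y) \<in> RT\<^sup>*"
  proof -
   have "(d, b) \<in> RT" "(b, y) \<in> RT" unfolding RT by blast+
   thus ?thesis by (meson r_into_rtrancl rtrancl_trans)
  qed
  ultimately show ?thesis using that xy unfolding X by blast
 qed
qed

theorem strand_composite: "strand_diagram ls rs composite = stack (n + 1) (strand_diagram ls1 rs1 E1) (strand_diagram ls2 rs2 E2)"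
proof -
 let ?T = "glued EE (S12 \<union> mid (n + 1))"
 have mG: "matching (W12 \<union> mids (n + 1)) (S12 \<union> mid (n + 1))" using VV_W12 tl_mids(1) by (intro matching_Un[OF S12 matching_mid]) blast
 have sub: "W12 \<union> mids (n + 1) \<subseteq> VV" using W12_sub VV_W12 tl_mids(1) by blast
 have rest: "VV - (W12 \<union> mids (n + 1)) = vertices (n + 1)" using VV_W12 tl_mids by blast
 have mT: "matching (vertices (n + 1)) ?T" using glued_matching[OF EE mG sub finite_VV] unfolding rest .
 have nilT: "w = []" if "(p, w, q) \<in> ?T" for p w q
 proof -
  have a: "apath EE (S12 \<union> mid (n + 1)) p w q" using that unfolding glued_def by blast
  have "set w \<subseteq> {}"
  proof (rule apath_labels[OF a])
   show "set w \<subseteq> {}" if "(p, w, q) \<in> EE" for p w q using that P.lab Q.lab unfolding EE_def layers_def by (auto elim!: imgE)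
   show "set w \<subseteq> {}" if "(p, w, q) \<in> S12 \<union> mid (n + 1)" for p w q
    using that unfolding S12_def strand_glue_def mid_iff by (auto elim!: imgE dest: link_sub simp: mid_iff)
  qed
  thus ?thesis by simp
 qed
 have vV: "p \<in> V1 \<and> p \<in> N.V" if "p \<in> vertices (n + 1)" for p using that V1_mids(1) unfolding set_circ by blast
 have "und ?T = ends (vertices (n + 1)) RT" using ends_glued[OF EE mG sub finite_VV] unfolding rest und_Un RT_def by (simp only: Un_assoc)
 also have "\<dots> = ends (vertices (n + 1)) R1" unfolding ends_def using RT_R1 vV by blast
 also have "\<dots> = ends (vertices (n + 1)) (und composite \<union> und (strand_glue ls rs))"
 proof -
  have "sym (und EH \<union> und (mid n :: diagram))" by (intro sym_Un und_sym[OF EH] und_sym[OF matching_mid])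
  from ends_rtrancl[OF this strand_glue_sub]
  have "(p, q) \<in> R1\<^sup>* \<longleftrightarrow> (p, q) \<in> (und composite \<union> und (strand_glue ls rs))\<^sup>*" if "p \<in> N.V" "q \<in> N.V" for p q
   using that ends_glued[OF EH matching_mid V1_mids(2) finite_V1] unfolding V1_mids(1) EH_mid R1_def by simp
  thus ?thesis unfolding ends_def using vV by blast
 qed
 also have "\<dots> = und (strand_diagram ls rs composite)" by (rule N.und_strand[symmetric])
 finally have eq: "und ?T = und (strand_diagram ls rs composite)" .
 have "(p, w, q) \<in> ?T \<longleftrightarrow> w = [] \<and> (p, q) \<in> und ?T" for p w q using nilT unfolding und_iff by blast
 moreover have "(p, w, q) \<in> strand_diagram ls rs composite \<longleftrightarrow> w = [] \<and> (p, q) \<in> und (strand_diagram ls rs composite)" for p w q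
  using N.strand_nil unfolding und_iff by blast
 ultimately have "(p, w, q) \<in> ?T \<longleftrightarrow> (p, w, q) \<in> strand_diagram ls rs composite" for p w q using eq by simp
 thus ?thesis unfolding tl_stack by auto
qed

text \<open>
  Left blobs and middle vertices are glued in the same way for both diagrams. Gluing them first leaves the free
  lines to which Euler's relation applies; \<open>k\<close> counts the closed curves that arise, those
  without right blobs.
\<close>

definition "GL = mid n \<union> (link [] ls :: diagram)"
definition "RL = und EH \<union> und GL"
definition "VL = N.V - set ls"
definition "k = card (closed_comps RL V1 VL)"

lemma GL: "matching (mids n \<union> set ls) GL" unfolding GL_def using mids_walls by (intro matching_Un[OF matching_mid N.left_glue]) blast

lemma GL_sub: "mids n \<union> set ls \<subseteq> V1" "V1 - (mids n \<union> set ls) = VL" using V1_mids N.blob_sub unfolding VL_def by blast+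

lemma free_GL: "glued EH GL = N.free" unfolding GL_def N.free_def unfolding EH_mid[symmetric]
 using mids_walls by (intro glued_glued_matching[OF matching_mid N.left_glue, symmetric]) blast

lemma ends_RL: "ends VL RL = und N.free" using ends_glued[OF EH GL GL_sub(1) finite_V1] unfolding GL_sub(2) free_GL RL_def .

lemma symRL: "sym RL" unfolding RL_def by (intro sym_Un und_sym[OF EH] und_sym[OF GL])

lemma RL_sub: "RL \<subseteq> V1 \<times> V1" unfolding RL_def using und_sub[OF EH] und_sub[OF GL] GL_sub(1) by blast

lemma rs_VL: "set rs \<subseteq> VL" "set ([Top 0] @ rs @ [Bot 0]) \<subseteq> VL" unfolding VL_def using N.strand_sub N.strand_list(3) by auto

lemma card_RT: "card (comps RT VV) = k + card (comps (und N.free \<union> und (link [] ([Top 0] @ rs @ [Bot 0]) :: diagram)) VL)"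
proof -
 let ?Y = "und (link [] ([Top 0] @ rs @ [Bot 0]) :: diagram)"
 have "closed_comps RT VV V1 = {}"
 proof (rule ccontr)
  assume "closed_comps RT VV V1 \<noteq> {}"
  then obtain z where z: "z \<in> VV" "RT\<^sup>* `` {z} \<inter> V1 = {}" unfolding closed_comps_def comps_def by blast
  thus False using XX_conn[of z] VV_eq by (cases "z \<in> XX") auto
 qed
 hence "card (comps RT VV) = card (comps RT V1)" using card_comps_split[OF symRT _ finite_VV, of V1] VV_eq by simp
 also have "\<dots> = card (comps R1 V1)" using card_comps_cong[OF symRT symR1, of V1 "\<lambda>x. x"] RT_R1 by simp
 also have "R1 = RL \<union> ?Y" unfolding R1_def RL_def GL_def strand_glue_def und_Un by blast
 also have "card (comps (RL \<union> ?Y) V1) = k + card (comps (ends VL RL \<union> ?Y) VL)" unfolding k_def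
 proof (rule card_comps_glue[OF symRL RL_sub sym_link _ _ finite_V1])
  show "?Y \<subseteq> VL \<times> VL" using und_link_sub rs_VL(2) by fast
  show "VL \<subseteq> V1" using GL_sub(2) by blast
 qed
 finally show ?thesis unfolding ends_RL .
qed

definition "RB = und core12 \<union> und (mid n :: diagram) \<union> und (blob_glue ls rs)"
definition "Lam = card (comps RB (set rs))"

lemma RB_sub: "RB \<subseteq> V12 \<times> V12"
proof -
 have "set ls \<union> set rs \<subseteq> V12" using V12_split by blast
 thus ?thesis unfolding RB_def using und_sub[OF core12] und_sub[OF matching_mid[of n]] mids_sub und_sub[OF blob_glue12] by blast
qed

lemma symRB: "sym RB" unfolding RB_def by (intro sym_Un und_sym[OF core12] und_sym[OF matching_mid] und_sym[OF blob_glue12])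

lemma RB_hooks: "RB \<union> und (hook_pairs n) = RL \<union> und (link [RightBlob] rs)"
 unfolding RB_def RL_def GL_def EH_def blob_glue_def und_Un und_link_any[of "[LeftBlob]" ls "[] :: blob list"] by blast

lemma RB_comp: "p \<in> V12 \<Longrightarrow> (RL \<union> und (link [RightBlob] rs))\<^sup>* `` {p} = RB\<^sup>* `` {p}"
 unfolding RB_hooks[symmetric] by (rule rtrancl_disjoint[OF RB_sub und_sub[OF matching_hooks] V12_hooks])

lemma Lam_free: "Lam = card (comps (und N.free \<union> und (link [RightBlob] rs)) (set rs))"
proof -
 have "set rs \<subseteq> V12" using V12_split by blast
 hence "comps RB (set rs) = comps (RL \<union> und (link [RightBlob] rs)) (set rs)" unfolding comps_def using RB_comp by (intro image_cong) auto
 moreover have "und (link [RightBlob] rs) \<subseteq> VL \<times> VL" using und_link_sub rs_VL(1) by fast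
 ultimately show ?thesis unfolding Lam_def ends_RL[symmetric] using card_comps_ends[OF symRL sym_link _ rs_VL(1)] by simp
qed

theorem card_strand_comps: "2 * (card (comps RT VV) + Lam + 1) = 2 * k + 2 * n + 4 + length rs"
 using N.euler_free[of "[]" "[RightBlob]"] unfolding card_RT Lam_free VL_def by simp

lemma k_RB: "k = card (closed_comps RB V12 (vertices n \<union> set rs))"
proof -
 have Y: "und (link [RightBlob] rs) \<subseteq> VL \<times> VL" using und_link_sub rs_VL(1) by fast
 have VLV: "VL \<subseteq> V1" using GL_sub(2) by blast
 have VL: "VL = vertices n \<union> set rs \<union> hooks"
 proof -
  have "VL = vertices (n + 1) \<union> {Top 0, Bot 0} \<union> set rs" unfolding VL_def set_circ using N.disj by blast
  thus ?thesis by (auto simp: vertices_Suc)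
 qed
 let ?R = "RL \<union> und (link [RightBlob] rs)"
 have "closed_comps RL V1 VL = closed_comps ?R V1 VL" by (rule closed_comps_Un[OF symRL RL_sub sym_link Y VLV, symmetric])
 also have "\<dots> = closed_comps RB V12 (vertices n \<union> set rs)"
 proof
  show "closed_comps ?R V1 VL \<subseteq> closed_comps RB V12 (vertices n \<union> set rs)"
  proof
   fix X assume "X \<in> closed_comps ?R V1 VL"
   then obtain x where x: "x \<in> V1" "X = ?R\<^sup>* `` {x}" "X \<inter> VL = {}" unfolding closed_comps_def comps_def by blast
   have "x \<in> X" using x(2) by blast
   hence "x \<in> V12" using x(1,3) unfolding VL V1_def by blast
   thus "X \<in> closed_comps RB V12 (vertices n \<union> set rs)" using x RB_comp[of x] unfolding VL closed_comps_def comps_def by blast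
  qed
  show "closed_comps RB V12 (vertices n \<union> set rs) \<subseteq> closed_comps ?R V1 VL"
  proof
   fix X assume "X \<in> closed_comps RB V12 (vertices n \<union> set rs)"
   then obtain x where x: "x \<in> V12" "X = RB\<^sup>* `` {x}" "X \<inter> (vertices n \<union> set rs) = {}" unfolding closed_comps_def comps_def by blast
   have "X \<subseteq> V12" using x(1,2) rtrancl_in[OF _ RB_sub x(1)] by blast
   hence "X \<inter> hooks = {}" using V12_hooks by blast
   thus "X \<in> closed_comps ?R V1 VL" using x RB_comp[OF x(1)] unfolding VL closed_comps_def comps_def V1_def by blast
  qed
 qed
 finally show ?thesis unfolding k_def by simp
qed

end

subsection \<open>Stacks of irreducible drawings\<close>

context irreducible begin

lemma N0_rtrancl: "(x, [], v) \<in> N0 \<Longrightarrow> x \<notin> hooks \<Longrightarrow> (x, v) \<in> (und core \<union> und (link [] ls :: diagram))\<^sup>*"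
proof -
 assume h: "(x, [], v) \<in> N0" "x \<notin> hooks"
 have a: "apath E (link [] ls) x [] v" using h unfolding N0_def glued_def by blast
 have "apath (del hooks E) (del hooks (link [] ls)) x [] v"
 proof (rule conjunct1[OF apath_del[OF a h(2)]])
  fix p w q assume "(p, w, q) \<in> E"
  hence e: "(p, [], q) \<in> E" using lab by blast
  show "p \<in> hooks \<longleftrightarrow> q \<in> hooks"
   unfolding hooks_def using uniqE[OF e] uniqE[OF symE[OF e]] hook_top hook_bot symE[OF hook_top] symE[OF hook_bot] by blast
 next
  fix p w q assume "(p, w, q) \<in> (link [] ls :: diagram)"
  hence "p \<in> set ls" "q \<in> set ls" by (auto dest: link_sub)
  thus "p \<in> hooks \<longleftrightarrow> q \<in> hooks" unfolding hooks_def using disj by (auto simp: vertices_Suc)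
 qed
 hence "apath core (link [] ls) x [] v" unfolding core_def[symmetric] by (rule apath_mono) (auto simp: del_def)
 thus ?thesis by (rule apath_rtrancl)
qed

lemma rs_vs_conn: assumes "i < length rs" shows "(rs ! i, vs ! i) \<in> (und core \<union> und (blob_glue ls rs))\<^sup>*"
 "(rs ! i, vs ! i) \<in> (und E \<union> und (strand_glue ls rs))\<^sup>*"
proof -
 have "rs ! i \<in> set rs" using assms by simp
 hence "rs ! i \<notin> hooks" unfolding hooks_def using disj by (auto simp: vertices_Suc)
 from N0_rtrancl[OF vs_nth(1)[OF assms] this]
 have c: "(rs ! i, vs ! i) \<in> (und core \<union> und (link [] ls :: diagram))\<^sup>*" .
 have "und core \<union> und (link [] ls :: diagram) \<subseteq> und core \<union> und (blob_glue ls rs)"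
  unfolding blob_glue_def und_Un und_link_any[of "[LeftBlob]" ls "[] :: blob list"] by blast
 thus "(rs ! i, vs ! i) \<in> (und core \<union> und (blob_glue ls rs))\<^sup>*" using c rtrancl_mono by blast
 have "und core \<union> und (link [] ls :: diagram) \<subseteq> und E \<union> und (strand_glue ls rs)"
  unfolding strand_glue_def und_Un using und_mono[OF core_sub] by blast
 thus "(rs ! i, vs ! i) \<in> (und E \<union> und (strand_glue ls rs))\<^sup>*" using c rtrancl_mono by blast
qed

lemma ls_conn:
 assumes x: "x \<in> set ls"
 shows "\<exists>v\<in>vertices n. (x, v) \<in> (und core \<union> und (blob_glue ls rs))\<^sup>* \<and> (x, v) \<in> (und E \<union> und (strand_glue ls rs))\<^sup>*"
proof -
 have xc: "x \<in> vertices n \<union> set ls \<union> set rs" using x by blast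
 then obtain y where y: "(x, [], y) \<in> core" using matching_ex[OF core] core_nil by blast
 hence yE: "(x, [], y) \<in> E" using core_sub by blast
 have e: "(x, y) \<in> und core" "(x, y) \<in> und E" using y yE unfolding und_iff by blast+
 have "y \<in> vertices n \<union> set ls \<union> set rs" using matchingD(2)[OF core y] .
 moreover have "y \<notin> set ls" using no_ls[OF x] yE by blast
 ultimately consider "y \<in> vertices n" | "y \<in> set rs" by blast
 thus ?thesis
 proof cases
  case 1
  have "(x, y) \<in> (und core \<union> und (blob_glue ls rs))\<^sup>*" "(x, y) \<in> (und E \<union> und (strand_glue ls rs))\<^sup>*"
   by (intro r_into_rtrancl UnI1 e)+
  thus ?thesis using 1 by blast
 next
  case 2
  then obtain i where i: "i < length rs" "y = rs ! i" by (metis in_set_conv_nth)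
  have "(x, vs ! i) \<in> (und core \<union> und (blob_glue ls rs))\<^sup>*"
   using rs_vs_conn(1)[OF i(1)] e(1) unfolding i(2) by (meson UnI1 converse_rtrancl_into_rtrancl)
  moreover have "(x, vs ! i) \<in> (und E \<union> und (strand_glue ls rs))\<^sup>*"
   using rs_vs_conn(2)[OF i(1)] e(2) unfolding i(2) by (meson UnI1 converse_rtrancl_into_rtrancl)
  ultimately show ?thesis using vs_nth(2)[OF i(1)] by blast
 qed
qed

lemma core_conn:
 assumes "x \<in> vertices n \<union> set ls \<union> set rs"
 shows "\<exists>v\<in>vertices n. (x, v) \<in> (und core \<union> und (blob_glue ls rs))\<^sup>*" using assms
proof (elim UnE)
 assume "x \<in> set ls" thus ?thesis using ls_conn by blast
next
 assume "x \<in> set rs"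
 then obtain i where i: "i < length rs" "x = rs ! i" by (metis in_set_conv_nth)
 thus ?thesis using rs_vs_conn(1)[OF i(1)] vs_nth(2)[OF i(1)] by blast
qed blast

lemma strand_conn:
 assumes "x \<in> V"
 shows "\<exists>v\<in>vertices (n + 1). (x, v) \<in> (und E \<union> und (strand_glue ls rs))\<^sup>*"
proof -
 have sub: "vertices n \<subseteq> vertices (n + 1)" by (auto simp: vertices_Suc)
 from assms consider "x \<in> vertices (n + 1)" | "x = Top 0" | "x = Bot 0" | "x \<in> set ls" | "x \<in> set rs" unfolding set_circ by blast
 thus ?thesis
 proof cases
  case 1 thus ?thesis by blast
 next
  case 2
  have "(x, Top (n + 1)) \<in> und E" using symE[OF hook_top] 2 unfolding und_iff by blast
  hence "(x, Top (n + 1)) \<in> (und E \<union> und (strand_glue ls rs))\<^sup>*" by (intro r_into_rtrancl UnI1)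
  thus ?thesis by (intro bexI[of _ "Top (n + 1)"]) (auto simp: vertices_Suc)
 next
  case 3
  have "(x, Bot (n + 1)) \<in> und E" using hook_bot 3 unfolding und_iff by blast
  hence "(x, Bot (n + 1)) \<in> (und E \<union> und (strand_glue ls rs))\<^sup>*" by (intro r_into_rtrancl UnI1)
  thus ?thesis by (intro bexI[of _ "Bot (n + 1)"]) (auto simp: vertices_Suc)
 next
  case 4 thus ?thesis using ls_conn sub by blast
 next
  case 5
  then obtain i where i: "i < length rs" "x = rs ! i" by (metis in_set_conv_nth)
  thus ?thesis using rs_vs_conn(2)[OF i(1)] vs_nth(2)[OF i(1)] sub by blast
 qed
qed

end

locale irreducible_stacking = P: irreducible n ls1 rs1 pos1 E1 + Q: irreducible n ls2 rs2 pos2 E2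
 for n ls1 rs1 pos1 E1 ls2 rs2 pos2 E2

sublocale irreducible_stacking \<subseteq> stacking n ls1 rs1 pos1 E1 ls2 rs2 pos2 E2 ..

context irreducible_stacking begin

definition "d = drawn_lines n ls1 rs1 E1"
definition "d' = drawn_lines n ls2 rs2 E2"
definition "Rd = und (layers d d') \<union> und (mid n :: diagram)"
definition "RV = up ` set P.vs \<union> dn ` set Q.vs"
definition "Rt = und (layers (strand_diagram ls1 rs1 E1) (strand_diagram ls2 rs2 E2)) \<union> und (mid (n + 1) :: diagram)"

lemma d_matching: "matching (vertices n) d" "matching (vertices n) d'" unfolding d_def d'_def by (rule P.lines_matching, rule Q.lines_matching)

lemma symRd: "sym Rd" unfolding Rd_def by (intro sym_Un und_sym[OF layers_matching[OF d_matching]] und_sym[OF matching_mid])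

lemma V12_walls: "V12 - (set ls \<union> set rs) = layer_vertices n" "set ls \<union> set rs \<subseteq> V12"
proof -
 have m: "mids n \<union> vertices n = layer_vertices n" using layer_vertices_split(1) by blast
 have "vertices n \<inter> (set ls \<union> set rs) = {}" using N.disj by (auto simp: vertices_Suc)
 thus "V12 - (set ls \<union> set rs) = layer_vertices n" using V12_split mids_sub mids_walls m by blast
 show "set ls \<union> set rs \<subseteq> V12" using V12_split by blast
qed

lemma ends_core12: "ends (layer_vertices n) (und core12 \<union> und (blob_glue ls rs)) = und (layers d d')"
 using ends_glued[OF core12 blob_glue12 V12_walls(2) finite_V12] unfolding V12_walls(1) glued_layers d_def d'_def .

lemma mid_sub: "und (mid n :: diagram) \<subseteq> layer_vertices n \<times> layer_vertices n"
 using und_sub[OF matching_mid[of n]] layer_vertices_split[of n] by blast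

lemma Rd_RB:
 assumes "p \<in> layer_vertices n" "q \<in> layer_vertices n"
 shows "(p, q) \<in> RB\<^sup>* \<longleftrightarrow> (p, q) \<in> Rd\<^sup>*"
proof -
 have "sym (und core12 \<union> und (blob_glue ls rs))" by (intro sym_Un und_sym[OF core12] und_sym[OF blob_glue12])
 from ends_rtrancl[OF this mid_sub assms] show ?thesis unfolding RB_def Rd_def ends_core12 by (simp only: ac_simps)
qed

lemma wall_conn: "x \<in> V12 \<Longrightarrow> \<exists>v\<in>layer_vertices n. (x, v) \<in> RB\<^sup>*"
proof -
 have img: "(f x, f v) \<in> RB\<^sup>*" if "(x, v) \<in> (und C \<union> und G)\<^sup>*" "map_prod f f ` und C \<subseteq> RB" "map_prod f f ` und G \<subseteq> RB"
  for f :: "point \<Rightarrow> point" and x v and C G :: "diagram"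
 proof -
  have "(f x, f v) \<in> (map_prod f f ` (und C \<union> und G))\<^sup>*" by (rule rtrancl_map[OF that(1)])
  moreover have "map_prod f f ` (und C \<union> und G) \<subseteq> RB" using that(2,3) by blast
  ultimately show ?thesis using rtrancl_mono by blast
 qed
 have sub: "map_prod up up ` und P.core \<subseteq> RB" "map_prod up up ` und (blob_glue ls1 rs1) \<subseteq> RB"
  "map_prod dn dn ` und Q.core \<subseteq> RB" "map_prod dn dn ` und (blob_glue ls2 rs2) \<subseteq> RB"
  unfolding RB_def core12_def layers_def blob_glue_layers und_Un und_img by blast+
 assume "x \<in> V12"
 then consider y where "x = up y" "y \<in> vertices n \<union> set ls1 \<union> set rs1" | y where "x = dn y" "y \<in> vertices n \<union> set ls2 \<union> set rs2"
  unfolding V12_def by blast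
 thus ?thesis
 proof cases
  case 1
  then obtain v where "v \<in> vertices n" "(y, v) \<in> (und P.core \<union> und (blob_glue ls1 rs1))\<^sup>*" using P.core_conn by blast
  thus ?thesis using img[OF _ sub(1,2)] 1 unfolding layer_vertices_def by blast
 next
  case 2
  then obtain v where "v \<in> vertices n" "(y, v) \<in> (und Q.core \<union> und (blob_glue ls2 rs2))\<^sup>*" using Q.core_conn by blast
  thus ?thesis using img[OF _ sub(3,4)] 2 unfolding layer_vertices_def by blast
 qed
qed

lemma rs_RV: "comps RB (set rs) = comps RB RV"
proof -
 have sub: "map_prod up up ` (und P.core \<union> und (blob_glue ls1 rs1)) \<subseteq> RB" "map_prod dn dn ` (und Q.core \<union> und (blob_glue ls2 rs2)) \<subseteq> RB"
  unfolding RB_def core12_def layers_def blob_glue_layers und_Un und_img by blast+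
 have 1: "RB\<^sup>* `` {up (rs1 ! i)} = RB\<^sup>* `` {up (P.vs ! i)}" if "i < length rs1" for i
  using rtrancl_map[OF P.rs_vs_conn(1)[OF that], of up] rtrancl_mono[OF sub(1)] comp_eq_iff[OF symRB] by blast
 have 2: "RB\<^sup>* `` {dn (rs2 ! i)} = RB\<^sup>* `` {dn (Q.vs ! i)}" if "i < length rs2" for i
  using rtrancl_map[OF Q.rs_vs_conn(1)[OF that], of dn] rtrancl_mono[OF sub(2)] comp_eq_iff[OF symRB] by blast
 have s: "set zs = (\<lambda>i. zs ! i) ` {..<length zs}" for zs :: "point list" by (auto simp: in_set_conv_nth)
 have "comps RB (up ` set rs1) = comps RB (up ` set P.vs)"
  unfolding s[of rs1] s[of P.vs] P.length_vs comps_def image_image by (rule image_cong) (use 1 in auto)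
 moreover have "comps RB (dn ` set rs2) = comps RB (dn ` set Q.vs)"
  unfolding s[of rs2] s[of Q.vs] Q.length_vs comps_def image_image by (rule image_cong) (use 2 in auto)
 ultimately show ?thesis unfolding rs_def RV_def by (simp add: comps_Un)
qed

lemma RV_sub: "RV \<subseteq> layer_vertices n" unfolding RV_def layer_vertices_def using P.vs_vertices Q.vs_vertices by blast

lemma comps_Rd_RB: "S \<subseteq> layer_vertices n \<Longrightarrow> card (comps Rd S) = card (comps RB S)"
 using card_comps_cong[OF symRB symRd, of S "\<lambda>x. x"] Rd_RB by (metis image_ident subsetD)

lemma Lam_Rd: "Lam = card (comps Rd RV)" unfolding Lam_def rs_RV using comps_Rd_RB[OF RV_sub] by simp

lemma k_Rd: "k = card (closed_comps Rd (layer_vertices n) (vertices n \<union> RV))"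
proof -
 have "closed_comps RB V12 (layer_vertices n) = {}"
 proof (rule ccontr)
  assume "closed_comps RB V12 (layer_vertices n) \<noteq> {}"
  then obtain z where z: "z \<in> V12" "RB\<^sup>* `` {z} \<inter> layer_vertices n = {}" unfolding closed_comps_def comps_def by blast
  thus False using wall_conn[OF z(1)] by blast
 qed
 hence "card (comps RB V12) = card (comps RB (layer_vertices n))"
  using card_comps_split[OF symRB _ finite_V12, of "layer_vertices n"] V12_walls(1) by (metis Diff_subset add_0 card.empty)
 also have "\<dots> = card (comps Rd (layer_vertices n))" using comps_Rd_RB by simp
 finally have 1: "card (comps RB V12) = card (comps Rd (layer_vertices n))" .
 have v: "vertices n \<subseteq> layer_vertices n" using layer_vertices_split(1) by blast
 have "card (comps RB V12) = k + card (comps RB (vertices n \<union> set rs))"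
  unfolding k_RB by (rule card_comps_split[OF symRB _ finite_V12]) (use V12_split in blast)
 moreover have "comps RB (vertices n \<union> set rs) = comps RB (vertices n \<union> RV)" unfolding comps_Un rs_RV ..
 moreover have "card (comps Rd (vertices n \<union> RV)) = card (comps RB (vertices n \<union> RV))" by (rule comps_Rd_RB) (use v RV_sub in blast)
 moreover have "card (comps Rd (layer_vertices n)) = card (closed_comps Rd (layer_vertices n) (vertices n \<union> RV)) + card (comps Rd (vertices n \<union> RV))"
  by (rule card_comps_split[OF symRd _ finite_layer]) (use v RV_sub in blast)
 ultimately show ?thesis using 1 by simp
qed

text \<open>
  The curves of the redrawn stack that end at a vertex are as many as the lines of a diagram; the rest
  of \<open>card_strand_comps\<close> is closed.
\<close>

theorem card_tl_loops:
 "card (closed_comps Rt (layer_vertices (n + 1)) (vertices (n + 1))) + Lam = k + length rs div 2"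
proof -
 let ?RS = "und EE \<union> und S12" and ?Y = "und (mid (n + 1) :: diagram)"
 have symS: "sym ?RS" by (intro sym_Un und_sym[OF EE] und_sym[OF S12])
 have "closed_comps ?RS VV (layer_vertices (n + 1)) = {}"
 proof (rule ccontr)
  assume "closed_comps ?RS VV (layer_vertices (n + 1)) \<noteq> {}"
  then obtain z where z: "z \<in> VV" "?RS\<^sup>* `` {z} \<inter> layer_vertices (n + 1) = {}" unfolding closed_comps_def comps_def by blast
  have sub: "map_prod up up ` (und E1 \<union> und (strand_glue ls1 rs1)) \<subseteq> ?RS" "map_prod dn dn ` (und E2 \<union> und (strand_glue ls2 rs2)) \<subseteq> ?RS"
   unfolding EE_def layers_def S12_def und_Un und_img by blast+
  from z(1) consider y where "z = up y" "y \<in> P.V" | y where "z = dn y" "y \<in> Q.V" unfolding VV_def by blast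
  thus False
  proof cases
   case 1
   then obtain v where v: "v \<in> vertices (n + 1)" "(y, v) \<in> (und E1 \<union> und (strand_glue ls1 rs1))\<^sup>*" using P.strand_conn by blast
   hence "(z, up v) \<in> ?RS\<^sup>*" using rtrancl_map[OF v(2), of up] rtrancl_mono[OF sub(1)] 1 by blast
   moreover have "up v \<in> layer_vertices (n + 1)" using v(1) unfolding layer_vertices_def by blast
   ultimately show False using z(2) by blast
  next
   case 2
   then obtain v where v: "v \<in> vertices (n + 1)" "(y, v) \<in> (und E2 \<union> und (strand_glue ls2 rs2))\<^sup>*" using Q.strand_conn by blast
   hence "(z, dn v) \<in> ?RS\<^sup>*" using rtrancl_map[OF v(2), of dn] rtrancl_mono[OF sub(2)] 2 by blast
   moreover have "dn v \<in> layer_vertices (n + 1)" using v(1) unfolding layer_vertices_def by blast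
   ultimately show False using z(2) by blast
  qed
 qed
 moreover have "?RS \<subseteq> VV \<times> VV" using und_sub[OF EE] und_sub[OF S12] W12_sub by blast
 moreover have "?Y \<subseteq> layer_vertices (n + 1) \<times> layer_vertices (n + 1)" using und_sub[OF matching_mid[of "n + 1"]] tl_mids(1) by blast
 moreover have "layer_vertices (n + 1) \<subseteq> VV" using VV_W12 by blast
 ultimately have "card (comps (?RS \<union> ?Y) VV) = card (comps (ends (layer_vertices (n + 1)) ?RS \<union> ?Y) (layer_vertices (n + 1)))"
  using card_comps_glue[OF symS _ und_sym[OF matching_mid[of "n + 1"]] _ _ finite_VV, of "layer_vertices (n + 1)"] by simp
 moreover have "ends (layer_vertices (n + 1)) ?RS = und (layers (strand_diagram ls1 rs1 E1) (strand_diagram ls2 rs2 E2))"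
  using ends_glued[OF EE S12 W12_sub finite_VV] unfolding VV_W12 glued_strands .
 ultimately have "card (comps RT VV) = card (comps Rt (layer_vertices (n + 1)))" unfolding RT_def Rt_def by simp
 moreover have "2 * card (comps Rt (layer_vertices (n + 1))) = 2 * card (closed_comps Rt (layer_vertices (n + 1)) (vertices (n + 1))) + card (vertices (n + 1))"
  using card_comps_glued[OF layers_matching[OF P.strand_matching Q.strand_matching] matching_mid[of "n + 1"] tl_mids(1) finite_layer]
  unfolding tl_mids(2) Rt_def .
 moreover have "card (vertices (n + 1)) = 2 * n + 2"
 proof -
  have "card (Top ` {1..n + 1}) = n + 1" "card (Bot ` {1..n + 1}) = n + 1" by (simp_all add: card_image inj_on_def)
  moreover have "Top ` {1..n + 1} \<inter> Bot ` {1..n + 1} = {}" by auto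
  ultimately show ?thesis unfolding vertices_def by (simp add: card_Un_disjoint)
 qed
 moreover have "even (length rs)" by (rule N.even_rs)
 ultimately show ?thesis using card_strand_comps by (auto elim!: evenE)
qed

end

section \<open>Loops and scalars\<close>

text \<open>
  A loop is given by its middle vertices; its shadow is the set of both copies of them in the two layers.
\<close>

definition shadow :: "nat set \<Rightarrow> point set" where
 "shadow C = (\<lambda>j. up (Bot j)) ` C \<union> (\<lambda>j. dn (Top j)) ` C"

lemma up_Bot_eq [simp]: "up (Bot i) = up (Bot j) \<longleftrightarrow> i = j" "dn (Top i) = dn (Top j) \<longleftrightarrow> i = j" by simp_all

lemma shadow_iff: "up (Bot j) \<in> shadow C \<longleftrightarrow> j \<in> C" "dn (Top j) \<in> shadow C \<longleftrightarrow> j \<in> C"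
 unfolding shadow_def by (auto simp del: up.simps dn.simps)

lemma inj_shadow: "inj shadow"
proof (rule injI)
 fix C C' assume "shadow C = shadow C'"
 hence "j \<in> C \<longleftrightarrow> j \<in> C'" for j using shadow_iff(1)[of j C] shadow_iff(1)[of j C'] by simp
 thus "C = C'" by blast
qed

lemma shadow_mids: "C \<subseteq> {1..m} \<Longrightarrow> shadow C \<subseteq> mids m" unfolding shadow_def mids_def by blast

text \<open>
  Every line of a matching is counted once from each of its two ends.
\<close>

lemma sum_half:
 fixes pos :: "'a \<Rightarrow> nat" and f :: "'l list \<Rightarrow> nat"
 assumes E: "matching V E" and fin: "finite V" and inj: "inj_on pos V" and f: "\<And>w. f (rev w) = f w"
  and g: "\<And>p w q. (p, w, q) \<in> E \<Longrightarrow> g p = f w"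
 shows "2 * (\<Sum>(p, w, q)\<in>{(p, w, q) \<in> E. pos p < pos q}. f w) = (\<Sum>p\<in>V. g p)"
proof -
 let ?F = "\<lambda>(p, w, q). f w"
 have inj3: "inj_on fst E" using matching_uniq[OF E] by (fastforce simp: inj_on_def)
 have im: "fst ` E = V" using matchingD(1)[OF E] matching_ex[OF E] by force
 have finE: "finite E" using finite_imageD[OF _ inj3] im fin by simp
 have "(\<Sum>p\<in>V. g p) = (\<Sum>e\<in>E. g (fst e))" unfolding im[symmetric] by (simp add: sum.reindex[OF inj3])
 also have "\<dots> = (\<Sum>e\<in>E. ?F e)" by (rule sum.cong) (use g in auto)
 also have "E = {(p, w, q) \<in> E. pos p < pos q} \<union> {(p, w, q) \<in> E. pos q < pos p}"
 proof -
  have "pos p \<noteq> pos q" if "(p, w, q) \<in> E" for p w q using matchingD(1-3)[OF E that] inj by (auto simp: inj_on_def)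
  thus ?thesis by (auto simp: neq_iff)
 qed
 also have "(\<Sum>e\<in>\<dots>. ?F e) = (\<Sum>e\<in>{(p, w, q) \<in> E. pos p < pos q}. ?F e) + (\<Sum>e\<in>{(p, w, q) \<in> E. pos q < pos p}. ?F e)"
  by (rule sum.union_disjoint) (use finE in \<open>auto intro: rev_finite_subset\<close>)
 also have "(\<Sum>e\<in>{(p, w, q) \<in> E. pos q < pos p}. ?F e) = (\<Sum>e\<in>{(p, w, q) \<in> E. pos p < pos q}. ?F e)"
  by (rule sum.reindex_bij_witness[where i = "\<lambda>(p, w, q). (q, rev w, p)" and j = "\<lambda>(p, w, q). (q, rev w, p)"])
   (use matchingD(4)[OF E] f in auto)
 finally show ?thesis by simp
qed

locale layered =
 fixes m :: nat and d d' :: diagram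
 assumes d: "matching (vertices m) d" and d': "matching (vertices m) d'"
begin

abbreviation "R \<equiv> und (layers d d') \<union> und (mid m :: diagram)"
abbreviation "A \<equiv> middle_adjacent d d'"

lemma L: "matching (layer_vertices m) (layers d d')" by (rule layers_matching[OF d d'])

lemma symR: "sym R" by (intro sym_Un und_sym[OF L] und_sym[OF matching_mid])

lemma R_up: assumes "(p, w, q) \<in> d" shows "(up p, up q) \<in> R"
proof -
 have "(up p, w, up q) \<in> layers d d'" unfolding layers_def by (intro UnI1 imgI assms)
 thus ?thesis unfolding und_iff Un_iff by (intro disjI1 exI)
qed

lemma R_dn: assumes "(p, w, q) \<in> d'" shows "(dn p, dn q) \<in> R"
proof -
 have "(dn p, w, dn q) \<in> layers d d'" unfolding layers_def by (intro UnI2 imgI assms)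
 thus ?thesis unfolding und_iff Un_iff by (intro disjI1 exI)
qed

lemma mid_edge: "i \<in> {1..m} \<Longrightarrow> (up (Bot i), [], dn (Top i)) \<in> mid m" unfolding mid_iff by blast

lemma R_mid: "i \<in> {1..m} \<Longrightarrow> (up (Bot i), dn (Top i)) \<in> R" "i \<in> {1..m} \<Longrightarrow> (dn (Top i), up (Bot i)) \<in> R"
proof -
 assume "i \<in> {1..m}"
 hence "(up (Bot i), dn (Top i)) \<in> und (mid m :: diagram)" using mid_edge und_iff by fast
 thus "(up (Bot i), dn (Top i)) \<in> R" by blast
 thus "(dn (Top i), up (Bot i)) \<in> R" using symR symD by fast
qed

lemma R_upE: assumes "(up (Bot i), y) \<in> R"
 obtains w q where "(Bot i, w, q) \<in> d" "y = up q" | "y = dn (Top i)" "i \<in> {1..m}"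
proof -
 from assms have "(\<exists>w q. (Bot i, w, q) \<in> d \<and> y = up q) \<or> (y = dn (Top i) \<and> i \<in> {1..m})"
 proof
  assume "(up (Bot i), y) \<in> und (layers d d')"
  then obtain w where "(up (Bot i), w, y) \<in> img up d \<or> (up (Bot i), w, y) \<in> img dn d'" unfolding und_iff layers_def by blast
  thus ?thesis
  proof
   assume "(up (Bot i), w, y) \<in> img up d"
   then obtain p q where h: "up (Bot i) = up p" "y = up q" "(p, w, q) \<in> d" by (rule imgE)
   have "p = Bot i" using injD[OF inj_up h(1)] by simp
   thus ?thesis using h by blast
  next
   assume "(up (Bot i), w, y) \<in> img dn d'"
   then obtain p q where "up (Bot i) = dn p" by (rule imgE)
   thus ?thesis using up_dn(1) by blast
  qed
 next
  assume "(up (Bot i), y) \<in> und (mid m :: diagram)"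
  then obtain u :: "blob list" where u: "(up (Bot i), u, y) \<in> mid m" unfolding und_iff by blast
  hence "up (Bot i) \<in> mids m" by (rule matchingD(1)[OF matching_mid])
  hence "i \<in> {1..m}" unfolding mids_def by (auto simp del: up.simps dn.simps)
  thus ?thesis using matching_uniq[OF matching_mid u mid_edge] by blast
 qed
 thus ?thesis using that by blast
qed

lemma R_dnE: assumes "(dn (Top i), y) \<in> R"
 obtains w q where "(Top i, w, q) \<in> d'" "y = dn q" | "y = up (Bot i)" "i \<in> {1..m}"
proof -
 from assms have "(\<exists>w q. (Top i, w, q) \<in> d' \<and> y = dn q) \<or> (y = up (Bot i) \<and> i \<in> {1..m})"
 proof
  assume "(dn (Top i), y) \<in> und (layers d d')"
  then obtain w where "(dn (Top i), w, y) \<in> img up d \<or> (dn (Top i), w, y) \<in> img dn d'" unfolding und_iff layers_def by blast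
  thus ?thesis
  proof
   assume "(dn (Top i), w, y) \<in> img dn d'"
   then obtain p q where h: "dn (Top i) = dn p" "y = dn q" "(p, w, q) \<in> d'" by (rule imgE)
   have "p = Top i" using injD[OF inj_dn h(1)] by simp
   thus ?thesis using h by blast
  next
   assume "(dn (Top i), w, y) \<in> img up d"
   then obtain p q where "dn (Top i) = up p" by (rule imgE)
   thus ?thesis using up_dn(2) by blast
  qed
 next
  assume "(dn (Top i), y) \<in> und (mid m :: diagram)"
  then obtain u :: "blob list" where u: "(dn (Top i), u, y) \<in> mid m" unfolding und_iff by blast
  hence "dn (Top i) \<in> mids m" by (rule matchingD(1)[OF matching_mid])
  hence i: "i \<in> {1..m}" unfolding mids_def by (auto simp del: up.simps dn.simps)
  have "(dn (Top i), rev [], up (Bot i)) \<in> mid m" by (rule matchingD(4)[OF matching_mid mid_edge[OF i]])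
  thus ?thesis using matching_uniq[OF matching_mid u] i by blast
 qed
 thus ?thesis using that by blast
qed

lemma Bot_range: "(Bot i, w, q) \<in> d \<Longrightarrow> i \<in> {1..m}" "(p, w, Bot i) \<in> d \<Longrightarrow> i \<in> {1..m}"
 "(Top i, w, q) \<in> d' \<Longrightarrow> i \<in> {1..m}" "(p, w, Top i) \<in> d' \<Longrightarrow> i \<in> {1..m}"
 using matchingD(1,2)[OF d] matchingD(1,2)[OF d'] unfolding vertices_def by fastforce+

lemma A_range: "(i, j) \<in> A \<Longrightarrow> i \<in> {1..m} \<and> j \<in> {1..m}" unfolding middle_adjacent_def using Bot_range by blast

lemma A_R: "(i, j) \<in> A\<^sup>* \<Longrightarrow> (up (Bot i), up (Bot j)) \<in> R\<^sup>*"
proof (induction rule: rtrancl_induct)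
 case (step j k)
 have jk: "j \<in> {1..m}" "k \<in> {1..m}" using A_range[OF step(2)] by simp_all
 have "(up (Bot j), up (Bot k)) \<in> R\<^sup>*"
 proof (cases "\<exists>w. (Bot j, w, Bot k) \<in> d")
  case True
  thus ?thesis using R_up by blast
 next
  case False
  then obtain w where "(Top j, w, Top k) \<in> d'" using step(2) unfolding middle_adjacent_def by blast
  note R_dn[OF this] R_mid(1)[OF jk(1)] R_mid(2)[OF jk(2)]
  thus ?thesis by (meson r_into_rtrancl rtrancl_trans)
 qed
 with step(3) show ?case by (rule rtrancl_trans)
qed simp

lemma loop_range: "C \<in> loops m d d' \<Longrightarrow> C \<subseteq> {1..m}"
proof -
 assume "C \<in> loops m d d'"
 then obtain i where i: "i \<in> {1..m}" "C = A\<^sup>* `` {i}" unfolding loops_def by blast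
 show ?thesis
 proof
  fix j assume "j \<in> C"
  hence "(i, j) \<in> A\<^sup>*" using i by simp
  thus "j \<in> {1..m}" by (rule rtrancl_closed) (use i A_range in blast)+
 qed
qed

lemma shadow_comp:
 assumes C: "C \<in> loops m d d'" and i: "i \<in> C"
 shows "shadow C = R\<^sup>* `` {up (Bot i)}"
proof
 have rng: "C \<subseteq> {1..m}" by (rule loop_range[OF C])
 obtain i0 where i0: "C = A\<^sup>* `` {i0}" using C unfolding loops_def by blast
 have symA: "sym A" unfolding sym_def middle_adjacent_def using matchingD(4)[OF d] matchingD(4)[OF d'] by blast
 have Ci: "C = A\<^sup>* `` {i}" using comp_eq_iff[OF symA] i unfolding i0 by blast
 have arcs: "\<exists>k w. (Bot j, w, Bot k) \<in> d" "\<exists>k w. (Top j, w, Top k) \<in> d'" if "j \<in> C" for j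
  using C that unfolding loops_def by blast+
 have cl: "k \<in> C" if "j \<in> C" "(j, k) \<in> A" for j k using that unfolding i0 by (auto intro: rtrancl.rtrancl_into_rtrancl)
 show "R\<^sup>* `` {up (Bot i)} \<subseteq> shadow C"
 proof
  fix y assume "y \<in> R\<^sup>* `` {up (Bot i)}"
  hence "(up (Bot i), y) \<in> R\<^sup>*" by simp
  thus "y \<in> shadow C"
  proof (rule rtrancl_closed)
   show "up (Bot i) \<in> shadow C" unfolding shadow_iff by (rule i)
   fix u v assume uv: "(u, v) \<in> R" "u \<in> shadow C"
   from uv(2) consider j where "j \<in> C" "u = up (Bot j)" | j where "j \<in> C" "u = dn (Top j)" unfolding shadow_def by blast
   thus "v \<in> shadow C"
   proof cases
    case (1 j)
    from uv(1)[unfolded 1(2)] show ?thesis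
    proof (cases rule: R_upE)
     case h: (1 w q)
     obtain k w' where k: "(Bot j, w', Bot k) \<in> d" using arcs(1)[OF 1(1)] by blast
     have "q = Bot k" using matching_uniq[OF d h(1) k] by simp
     moreover have "(j, k) \<in> A" unfolding middle_adjacent_def using k by blast
     ultimately show ?thesis unfolding h(2) using shadow_iff(1) cl[OF 1(1)] by blast
    next
     case 2
     thus ?thesis using shadow_iff(2) 1(1) by blast
    qed
   next
    case (2 j)
    from uv(1)[unfolded 2(2)] show ?thesis
    proof (cases rule: R_dnE)
     case h: (1 w q)
     obtain k w' where k: "(Top j, w', Top k) \<in> d'" using arcs(2)[OF 2(1)] by blast
     have "q = Top k" using matching_uniq[OF d' h(1) k] by simp
     moreover have "(j, k) \<in> A" unfolding middle_adjacent_def using k by blast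
     ultimately show ?thesis unfolding h(2) using shadow_iff(2) cl[OF 2(1)] by blast
    next
     case 2
     thus ?thesis using shadow_iff(1) \<open>j \<in> C\<close> by blast
    qed
   qed
  qed
 qed
 show "shadow C \<subseteq> R\<^sup>* `` {up (Bot i)}"
 proof
  fix y assume "y \<in> shadow C"
  then obtain j where j: "j \<in> C" "y = up (Bot j) \<or> y = dn (Top j)" unfolding shadow_def by blast
  have 1: "(up (Bot i), up (Bot j)) \<in> R\<^sup>*" by (rule A_R) (use j Ci in blast)
  moreover have "(up (Bot j), dn (Top j)) \<in> R" by (rule R_mid(1)) (use j rng in blast)
  ultimately have "(up (Bot i), dn (Top j)) \<in> R\<^sup>*" by (rule rtrancl.rtrancl_into_rtrancl)
  thus "y \<in> R\<^sup>* `` {up (Bot i)}" using 1 j(2) by blast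
 qed
qed

lemma loop_nonempty: "C \<in> loops m d d' \<Longrightarrow> \<exists>i\<in>{1..m}. i \<in> C" unfolding loops_def by blast

theorem shadow_loops: "shadow ` loops m d d' = closed_comps R (layer_vertices m) (vertices m)"
proof
 show "shadow ` loops m d d' \<subseteq> closed_comps R (layer_vertices m) (vertices m)"
 proof
  fix X assume "X \<in> shadow ` loops m d d'"
  then obtain C where C: "C \<in> loops m d d'" "X = shadow C" by blast
  then obtain i where i: "i \<in> {1..m}" "i \<in> C" using loop_nonempty by blast
  have "up (Bot i) \<in> layer_vertices m" unfolding layer_vertices_def vertices_def using i(1) by blast
  moreover have "X \<inter> vertices m = {}" using shadow_mids[OF loop_range[OF C(1)]] layer_vertices_split(2)[of m] C(2) by blast
  ultimately show "X \<in> closed_comps R (layer_vertices m) (vertices m)"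
   using shadow_comp[OF C(1) i(2)] C(2) unfolding closed_comps_def comps_def by blast
 qed
 show "closed_comps R (layer_vertices m) (vertices m) \<subseteq> shadow ` loops m d d'"
 proof
  fix X assume "X \<in> closed_comps R (layer_vertices m) (vertices m)"
  then obtain x where x: "x \<in> layer_vertices m" "X = R\<^sup>* `` {x}" "X \<inter> vertices m = {}" unfolding closed_comps_def comps_def by blast
  have "x \<in> mids m" using x layer_vertices_split(1)[of m] by blast
  then obtain i where i: "i \<in> {1..m}" "x = up (Bot i) \<or> x = dn (Top i)" unfolding mids_def by blast
  have "(x, up (Bot i)) \<in> R\<^sup>*" using i R_mid(2) by blast
  hence X: "X = R\<^sup>* `` {up (Bot i)}" unfolding x(2) using comp_eq_iff[OF symR] by blast
  let ?C = "A\<^sup>* `` {i}"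
  have arcs: "(\<exists>k w. (Bot j, w, Bot k) \<in> d) \<and> (\<exists>k w. (Top j, w, Top k) \<in> d')" if "j \<in> ?C" for j
  proof -
   have ij: "(i, j) \<in> A\<^sup>*" using that by simp
   hence jm: "j \<in> {1..m}" by (rule rtrancl_closed) (use i A_range in blast)+
   have "Bot j \<in> vertices m" "Top j \<in> vertices m" using jm unfolding vertices_def by blast+
   then obtain w q w' q' where e: "(Bot j, w, q) \<in> d" "(Top j, w', q') \<in> d'" using matching_ex[OF d] matching_ex[OF d'] by metis
   have "(up (Bot i), up (Bot j)) \<in> R\<^sup>*" using A_R[OF ij] .
   hence j: "up (Bot j) \<in> X" "dn (Top j) \<in> X" unfolding X using R_mid(1)[OF jm] by (auto intro: rtrancl.rtrancl_into_rtrancl)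
   hence "up q \<in> X" "dn q' \<in> X" unfolding X using R_up[OF e(1)] R_dn[OF e(2)] by (auto intro: rtrancl.rtrancl_into_rtrancl)
   hence nq: "up q \<notin> vertices m" "dn q' \<notin> vertices m" using x(3) by blast+
   have "q \<in> vertices m" "q' \<in> vertices m" using matchingD(2)[OF d e(1)] matchingD(2)[OF d' e(2)] by simp_all
   hence "\<exists>k. q = Bot k" "\<exists>k. q' = Top k" using nq unfolding vertices_def by auto
   thus ?thesis using e by blast
  qed
  hence "?C \<in> loops m d d'" unfolding loops_def using i(1) by blast
  moreover have "shadow ?C = X" unfolding X by (rule shadow_comp[OF calculation]) simp
  ultimately show "X \<in> shadow ` loops m d d'" by blast
 qed
qed

theorem card_loops: "card (loops m d d') = card (closed_comps R (layer_vertices m) (vertices m))"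
 unfolding shadow_loops[symmetric] using card_image[OF inj_on_subset[OF inj_shadow subset_UNIV]] by simp

theorem loop_blobs_sum:
 assumes C: "C \<in> loops m d d'"
 shows "2 * loop_blobs d d' C s = (\<Sum>x\<in>shadow C. wt s (layers d d') x)"
proof -
 have rng: "C \<subseteq> {1..m}" by (rule loop_range[OF C])
 have fin: "finite C" using rng finite_subset by blast
 obtain i0 where i0: "C = A\<^sup>* `` {i0}" using C unfolding loops_def by blast
 have arcs: "\<exists>k w. (Bot j, w, Bot k) \<in> d" "\<exists>k w. (Top j, w, Top k) \<in> d'" if "j \<in> C" for j
  using C that unfolding loops_def by blast+
 have cl: "k \<in> C" if "j \<in> C" "(j, k) \<in> A" for j k using that unfolding i0 by (auto intro: rtrancl.rtrancl_into_rtrancl)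
 let ?B = "{(i, w, j). i \<in> C \<and> (Bot i, w, Bot j) \<in> d}" and ?T = "{(i, w, j). i \<in> C \<and> (Top i, w, Top j) \<in> d'}"
 have adj: "(j, k) \<in> A" if "(Bot j, w, Bot k) \<in> d \<or> (Top j, w, Top k) \<in> d'" for j w k
  unfolding middle_adjacent_def using that by blast
 have mB: "matching C ?B"
 proof (rule matchingI)
  fix p w q assume h: "(p, w, q) \<in> ?B"
  hence e: "p \<in> C" "(Bot p, w, Bot q) \<in> d" by auto
  have "q \<in> C" using cl[OF e(1)] adj e(2) by blast
  thus "p \<in> C \<and> q \<in> C \<and> p \<noteq> q \<and> (q, rev w, p) \<in> ?B" using matchingD(3,4)[OF d e(2)] e(1) by auto
 next
  fix p assume "p \<in> C" thus "\<exists>w q. (p, w, q) \<in> ?B" using arcs(1) by blast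
 next
  fix p w q w' q' assume "(p, w, q) \<in> ?B" "(p, w', q') \<in> ?B"
  hence "(Bot p, w, Bot q) \<in> d" "(Bot p, w', Bot q') \<in> d" by auto
  from matching_uniq[OF d this] show "w = w' \<and> q = q'" by simp
 qed
 have mT: "matching C ?T"
 proof (rule matchingI)
  fix p w q assume h: "(p, w, q) \<in> ?T"
  hence e: "p \<in> C" "(Top p, w, Top q) \<in> d'" by auto
  have "q \<in> C" using cl[OF e(1)] adj e(2) by blast
  thus "p \<in> C \<and> q \<in> C \<and> p \<noteq> q \<and> (q, rev w, p) \<in> ?T" using matchingD(3,4)[OF d' e(2)] e(1) by auto
 next
  fix p assume "p \<in> C" thus "\<exists>w q. (p, w, q) \<in> ?T" using arcs(2) by blast
 next
  fix p w q w' q' assume "(p, w, q) \<in> ?T" "(p, w', q') \<in> ?T"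
  hence "(Top p, w, Top q) \<in> d'" "(Top p, w', Top q') \<in> d'" by auto
  from matching_uniq[OF d' this] show "w = w' \<and> q = q'" by simp
 qed
 have b: "2 * (\<Sum>(i, w, j)\<in>{(i, w, j). i \<in> C \<and> i < j \<and> (Bot i, w, Bot j) \<in> d}. count_list w s) = (\<Sum>j\<in>C. wt s (layers d d') (up (Bot j)))"
 proof -
  have eq: "{(i, w, j). i \<in> C \<and> i < j \<and> (Bot i, w, Bot j) \<in> d} = {(i, w, j) \<in> ?B. id i < id j}" by auto
  have wt: "wt s (layers d d') (up (Bot p)) = count_list w s" if "(p, w, q) \<in> ?B" for p w q
   by (rule wt_eq[OF L, of _ _ "up (Bot q)"]) (use that in \<open>auto simp: layers_def intro: imgI simp del: up.simps\<close>)
  show ?thesis unfolding eq by (rule sum_half[OF mB fin inj_on_id]) (rule count_list_rev, rule wt)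
 qed
 have t: "2 * (\<Sum>(i, w, j)\<in>{(i, w, j). i \<in> C \<and> i < j \<and> (Top i, w, Top j) \<in> d'}. count_list w s) = (\<Sum>j\<in>C. wt s (layers d d') (dn (Top j)))"
 proof -
  have eq: "{(i, w, j). i \<in> C \<and> i < j \<and> (Top i, w, Top j) \<in> d'} = {(i, w, j) \<in> ?T. id i < id j}" by auto
  have wt: "wt s (layers d d') (dn (Top p)) = count_list w s" if "(p, w, q) \<in> ?T" for p w q
   by (rule wt_eq[OF L, of _ _ "dn (Top q)"]) (use that in \<open>auto simp: layers_def intro: imgI simp del: dn.simps\<close>)
  show ?thesis unfolding eq by (rule sum_half[OF mT fin inj_on_id]) (rule count_list_rev, rule wt)
 qed
 have "(\<Sum>x\<in>shadow C. wt s (layers d d') x) = (\<Sum>x\<in>(\<lambda>j. up (Bot j)) ` C. wt s (layers d d') x) + (\<Sum>x\<in>(\<lambda>j. dn (Top j)) ` C. wt s (layers d d') x)"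
  unfolding shadow_def by (rule sum.union_disjoint) (use fin up_dn in auto)
 moreover have "inj_on (\<lambda>j. up (Bot j)) C" "inj_on (\<lambda>j. dn (Top j)) C" by (auto simp: inj_on_def)
 ultimately show ?thesis unfolding loop_blobs_def using b t by (simp only: sum.reindex o_def add_mult_distrib2)
qed

lemma stack: "matching (vertices m) (stack m d d')"
proof -
 have "mids m \<subseteq> layer_vertices m" "layer_vertices m - mids m = vertices m" using layer_vertices_split[of m] by blast+
 moreover have "finite (layer_vertices m)" unfolding layer_vertices_def vertices_def by simp
 ultimately show ?thesis unfolding stack_glued[OF d d'] using glued_matching[OF L matching_mid, of m] by simp
qed

lemma stack_count:
 assumes "(p, w, q) \<in> stack m d d'"
 shows "2 * count_list w s = (\<Sum>x\<in>R\<^sup>* `` {p}. wt s (layers d d') x)"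
proof -
 have sub: "mids m \<subseteq> layer_vertices m" using layer_vertices_split[of m] by blast
 have fin: "finite (layer_vertices m)" unfolding layer_vertices_def vertices_def by simp
 show ?thesis by (rule count_glued[OF L matching_mid sub fin _ assms[unfolded stack_glued[OF d d']]]) (simp add: mid_iff)
qed

lemma clockwise_inj: "inj_on (clockwise m 0 0) (vertices m)" unfolding vertices_def inj_on_def by auto

lemma open_comps:
 "bij_betw (\<lambda>(p, w, q). R\<^sup>* `` {p}) (oriented_lines m (stack m d d')) (comps R (vertices m))"
proof (rule bij_betw_imageI)
 have fin: "finite (layer_vertices m)" unfolding layer_vertices_def vertices_def by simp
 have sub: "mids m \<subseteq> layer_vertices m" "layer_vertices m - mids m = vertices m" using layer_vertices_split[of m] by blast+
 have en: "ends (vertices m) R = und (stack m d d')" using ends_glued[OF L matching_mid sub(1) fin] unfolding sub(2) stack_glued[OF d d'] .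
 have cw: "clockwise m 0 0 p \<noteq> clockwise m 0 0 q" if "(p, w, q) \<in> stack m d d'" for p w q
  using clockwise_inj matchingD(1-3)[OF stack that] unfolding inj_on_def by blast
 show "inj_on (\<lambda>(p, w, q). R\<^sup>* `` {p}) (oriented_lines m (stack m d d'))"
 proof (rule inj_onI)
  fix e e' assume h: "e \<in> oriented_lines m (stack m d d')" "e' \<in> oriented_lines m (stack m d d')"
   "(case e of (p, w, q) \<Rightarrow> R\<^sup>* `` {p}) = (case e' of (p, w, q) \<Rightarrow> R\<^sup>* `` {p})"
  obtain p w q where e: "e = (p, w, q)" by (cases e)
  obtain p' w' q' where e': "e' = (p', w', q')" by (cases e')
  have s: "(p, w, q) \<in> stack m d d'" "clockwise m 0 0 p < clockwise m 0 0 q"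
   "(p', w', q') \<in> stack m d d'" "clockwise m 0 0 p' < clockwise m 0 0 q'" using h(1,2) unfolding e e' oriented_lines_def by auto
  have pp: "(p, p') \<in> R\<^sup>*" using h(3) comp_eq_iff[OF symR] unfolding e e' by simp
  have "p = p'"
  proof (rule ccontr)
   assume "p \<noteq> p'"
   hence "(p, p') \<in> ends (vertices m) R" unfolding ends_def using pp matchingD(1)[OF stack s(1)] matchingD(1)[OF stack s(3)] by simp
   then obtain u where "(p, u, p') \<in> stack m d d'" unfolding en und_iff by blast
   hence "p' = q" using matching_uniq[OF stack s(1)] by blast
   hence "q' = p" using matching_uniq[OF stack s(3) ] matchingD(4)[OF stack s(1)] by blast
   thus False using s(2,4) \<open>p' = q\<close> by simp
  qed
  thus "e = e'" using matching_uniq[OF stack s(1)] s(3) unfolding e e' by blast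
 qed
 show "(\<lambda>(p, w, q). R\<^sup>* `` {p}) ` oriented_lines m (stack m d d') = comps R (vertices m)"
 proof
  show "(\<lambda>(p, w, q). R\<^sup>* `` {p}) ` oriented_lines m (stack m d d') \<subseteq> comps R (vertices m)"
   unfolding comps_def oriented_lines_def using matchingD(1)[OF stack] by auto
  show "comps R (vertices m) \<subseteq> (\<lambda>(p, w, q). R\<^sup>* `` {p}) ` oriented_lines m (stack m d d')"
  proof
   fix X assume "X \<in> comps R (vertices m)"
   then obtain p where p: "p \<in> vertices m" "X = R\<^sup>* `` {p}" unfolding comps_def by blast
   obtain w q where w: "(p, w, q) \<in> stack m d d'" using matching_ex[OF stack p(1)] by blast
   show "X \<in> (\<lambda>(p, w, q). R\<^sup>* `` {p}) ` oriented_lines m (stack m d d')"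
   proof (cases "clockwise m 0 0 p < clockwise m 0 0 q")
    case True
    hence "(p, w, q) \<in> oriented_lines m (stack m d d')" unfolding oriented_lines_def using w by simp
    thus ?thesis using p(2) by force
   next
    case False
    hence "(q, rev w, p) \<in> oriented_lines m (stack m d d')" unfolding oriented_lines_def using cw[OF w] matchingD(4)[OF stack w] by simp
    moreover have "R\<^sup>* `` {q} = X"
    proof -
     have "(p, q) \<in> ends (vertices m) R" unfolding en und_iff using w by blast
     hence "(p, q) \<in> R\<^sup>*" unfolding ends_def by simp
     thus ?thesis unfolding p(2) using comp_eq_iff[OF symR] by blast
    qed
    ultimately show ?thesis by force
   qed
  qed
 qed
qed

end

section \<open>The product of two blob diagrams\<close>

text \<open>
  The exponent of \<open>delta\<close> for a loop with \<open>b\<close> right blobs. A line contributes \<open>b - 1\<close>, which is \<open>0\<close> for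
  \<open>b = 0\<close> as well.
\<close>

definition loop_degree :: "nat \<Rightarrow> nat" where
 "loop_degree b = (if b = 0 then 1 else b - 1)"

context irreducible_stacking begin

sublocale L: layered n d d' by unfold_locales (rule d_matching)+

lemma Rd_R: "L.R = Rd" unfolding Rd_def ..

lemma weight: "x \<in> layer_vertices n \<Longrightarrow> wt RightBlob (layers d d') x = (if x \<in> RV then 1 else 0)"
proof -
 assume "x \<in> layer_vertices n"
 then consider p where "p \<in> vertices n" "x = up p" | p where "p \<in> vertices n" "x = dn p" unfolding layer_vertices_def by blast
 thus ?thesis
 proof cases
  case (1 p)
  obtain w q where w: "(p, w, q) \<in> d" using matching_ex[OF d_matching(1) 1(1)] by blast
  have "(x, w, up q) \<in> layers d d'" unfolding layers_def 1(2) by (intro UnI1 imgI w)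
  hence "wt RightBlob (layers d d') x = count_list w RightBlob" by (rule wt_eq[OF L.L])
  also have "\<dots> = (if p \<in> set P.vs then 1 else 0)" by (rule P.line_count_right[OF w[unfolded d_def]])
  also have "p \<in> set P.vs \<longleftrightarrow> x \<in> RV" unfolding RV_def 1(2) using inj_image_mem_iff[OF inj_up] up_dn(1) by fast
  finally show ?thesis .
 next
  case (2 p)
  obtain w q where w: "(p, w, q) \<in> d'" using matching_ex[OF d_matching(2) 2(1)] by blast
  have "(x, w, dn q) \<in> layers d d'" unfolding layers_def 2(2) by (intro UnI2 imgI w)
  hence "wt RightBlob (layers d d') x = count_list w RightBlob" by (rule wt_eq[OF L.L])
  also have "\<dots> = (if p \<in> set Q.vs then 1 else 0)" by (rule Q.line_count_right[OF w[unfolded d'_def]])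
  also have "p \<in> set Q.vs \<longleftrightarrow> x \<in> RV" unfolding RV_def 2(2) using inj_image_mem_iff[OF inj_dn] up_dn(2) by fast
  finally show ?thesis .
 qed
qed

text \<open>
  Twice the number of right blobs on the component \<open>X\<close>.
\<close>

definition "load X = card (X \<inter> RV)"

lemma Rd_sub: "Rd \<subseteq> layer_vertices n \<times> layer_vertices n" unfolding Rd_def using und_sub[OF L.L] mid_sub by blast

lemma comp_sub: "X \<in> comps Rd (layer_vertices n) \<Longrightarrow> X \<subseteq> layer_vertices n"
 unfolding comps_def using rtrancl_in[OF _ Rd_sub] by blast

lemma weight_sum: "X \<subseteq> layer_vertices n \<Longrightarrow> (\<Sum>x\<in>X. wt RightBlob (layers d d') x) = load X"
proof -
 assume X: "X \<subseteq> layer_vertices n"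
 hence fin: "finite X" using finite_layer finite_subset by blast
 have "(\<Sum>x\<in>X. wt RightBlob (layers d d') x) = (\<Sum>x\<in>X. if x \<in> RV then 1 else 0)" by (rule sum.cong) (use X weight in auto)
 also have "\<dots> = card (X \<inter> RV)" using fin by (simp add: sum.If_cases Int_def)
 finally show ?thesis unfolding load_def .
qed

lemma card_RV: "card RV = length rs"
proof -
 have "distinct P.vs" "distinct Q.vs"
  using P.vs_sorted Q.vs_sorted by (auto simp: distinct_conv_nth sorted_wrt_iff_nth_less) (metis linorder_neqE_nat order_less_irrefl)+
 hence "card (up ` set P.vs) = length rs1" "card (dn ` set Q.vs) = length rs2"
  using card_image[OF inj_on_subset[OF inj_up subset_UNIV], of "set P.vs"] card_image[OF inj_on_subset[OF inj_dn subset_UNIV], of "set Q.vs"]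
  by (simp_all add: distinct_card P.length_vs Q.length_vs)
 moreover have "card RV = card (up ` set P.vs) + card (dn ` set Q.vs)" unfolding RV_def by (rule card_Un_disjoint) (use up_dn_range in auto)
 ultimately show ?thesis unfolding rs_def by simp
qed

definition "Cl = closed_comps Rd (layer_vertices n) (vertices n)"
definition "Op = comps Rd (vertices n)"

lemma Cl_Op: "comps Rd (layer_vertices n) = Cl \<union> Op" "Cl \<inter> Op = {}" "finite Cl" "finite Op"
proof -
 have v: "vertices n \<subseteq> layer_vertices n" using layer_vertices_split(1) by blast
 show "comps Rd (layer_vertices n) = Cl \<union> Op"
 proof
  show "Cl \<union> Op \<subseteq> comps Rd (layer_vertices n)" unfolding Cl_def Op_def closed_comps_def comps_def using v by blast
  show "comps Rd (layer_vertices n) \<subseteq> Cl \<union> Op"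
  proof
   fix X assume X: "X \<in> comps Rd (layer_vertices n)"
   show "X \<in> Cl \<union> Op"
   proof (cases "X \<inter> vertices n = {}")
    case True thus ?thesis using X unfolding Cl_def closed_comps_def by blast
   next
    case False
    then obtain y where y: "y \<in> X" "y \<in> vertices n" by blast
    obtain x where "X = Rd\<^sup>* `` {x}" using X unfolding comps_def by blast
    hence "X = Rd\<^sup>* `` {y}" using y(1) comp_eq_iff[OF symRd] by blast
    thus ?thesis using y(2) unfolding Op_def comps_def by blast
   qed
  qed
 qed
 show "Cl \<inter> Op = {}" unfolding Cl_def Op_def closed_comps_def comps_def by blast
 have "finite (comps Rd (layer_vertices n))" by (rule finite_comps[OF finite_layer])
 thus "finite Cl" unfolding Cl_def closed_comps_def by simp
 show "finite Op" unfolding Op_def by (rule finite_comps) (simp add: vertices_def)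
qed

lemma sum_load: "(\<Sum>X\<in>Cl. load X) + (\<Sum>X\<in>Op. load X) = length rs"
proof -
 have "(\<Sum>X\<in>Cl. load X) + (\<Sum>X\<in>Op. load X) = (\<Sum>X\<in>comps Rd (layer_vertices n). card (X \<inter> RV))"
  unfolding Cl_Op(1) load_def by (rule sum.union_disjoint[OF Cl_Op(3,4,2), symmetric])
 also have "\<dots> = card (\<Union>X\<in>comps Rd (layer_vertices n). X \<inter> RV)"
 proof (rule card_UN_disjoint[symmetric])
  show "finite (comps Rd (layer_vertices n))" by (rule finite_comps[OF finite_layer])
  show "\<forall>X\<in>comps Rd (layer_vertices n). finite (X \<inter> RV)" unfolding RV_def by simp
  show "\<forall>X\<in>comps Rd (layer_vertices n). \<forall>Y\<in>comps Rd (layer_vertices n). X \<noteq> Y \<longrightarrow> (X \<inter> RV) \<inter> (Y \<inter> RV) = {}"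
  proof (intro ballI impI)
   fix X Y assume h: "X \<in> comps Rd (layer_vertices n)" "Y \<in> comps Rd (layer_vertices n)" "X \<noteq> Y"
   obtain x y where xy: "X = Rd\<^sup>* `` {x}" "Y = Rd\<^sup>* `` {y}" using h(1,2) unfolding comps_def by blast
   have "X \<inter> Y = {}"
   proof (rule ccontr)
    assume "X \<inter> Y \<noteq> {}"
    then obtain z where "z \<in> X" "z \<in> Y" by blast
    hence "X = Rd\<^sup>* `` {z}" "Y = Rd\<^sup>* `` {z}" unfolding xy using comp_eq_iff[OF symRd] by blast+
    thus False using h(3) by simp
   qed
   thus "(X \<inter> RV) \<inter> (Y \<inter> RV) = {}" by blast
  qed
 qed
 also have "(\<Union>X\<in>comps Rd (layer_vertices n). X \<inter> RV) = RV" unfolding comps_def using RV_sub by blast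
 finally show ?thesis unfolding card_RV .
qed

lemma load_pos: "load X > 0 \<longleftrightarrow> X \<inter> RV \<noteq> {}" unfolding load_def card_gt_0_iff RV_def by simp

lemma count_Lam: "card {X \<in> Cl. load X > 0} + card {X \<in> Op. load X > 0} = Lam"
proof -
 have "comps Rd RV = {X \<in> Cl. load X > 0} \<union> {X \<in> Op. load X > 0}"
 proof -
  have "comps Rd RV = {X \<in> comps Rd (layer_vertices n). X \<inter> RV \<noteq> {}}"
  proof
   show "comps Rd RV \<subseteq> {X \<in> comps Rd (layer_vertices n). X \<inter> RV \<noteq> {}}" unfolding comps_def using RV_sub by blast
   show "{X \<in> comps Rd (layer_vertices n). X \<inter> RV \<noteq> {}} \<subseteq> comps Rd RV"
   proof
    fix X assume "X \<in> {X \<in> comps Rd (layer_vertices n). X \<inter> RV \<noteq> {}}"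
    then obtain x y where "X = Rd\<^sup>* `` {x}" "y \<in> X" "y \<in> RV" unfolding comps_def by blast
    moreover from this have "X = Rd\<^sup>* `` {y}" using comp_eq_iff[OF symRd] by blast
    ultimately show "X \<in> comps Rd RV" unfolding comps_def by blast
   qed
  qed
  thus ?thesis unfolding Cl_Op(1) load_pos by blast
 qed
 thus ?thesis unfolding Lam_Rd using card_Un_disjoint[of "{X \<in> Cl. load X > 0}" "{X \<in> Op. load X > 0}"] Cl_Op(2-4) by (simp add: disjoint_iff)
qed

lemma count_k: "card {X \<in> Cl. load X = 0} = k"
proof -
 have "load X = 0 \<longleftrightarrow> X \<inter> RV = {}" for X using load_pos[of X] by auto
 hence "{X \<in> Cl. load X = 0} = closed_comps Rd (layer_vertices n) (vertices n \<union> RV)" unfolding Cl_def closed_comps_def by blast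
 thus ?thesis unfolding k_Rd by simp
qed

text \<open>
  Summing over all components, each right blob counts one, each component with right blobs loses one, and each loop without
  right blobs gains one; these three numbers are \<open>length rs div 2\<close>, \<open>Lam\<close> and \<open>k\<close> in \<open>card_tl_loops\<close>.
\<close>

theorem scalar_degree:
 "(\<Sum>C\<in>loops n d d'. loop_degree (loop_blobs d d' C RightBlob)) +
  (\<Sum>(p, w, q)\<in>oriented_lines n (stack n d d'). count_list w RightBlob - 1) =
  card (loops (n + 1) (strand_diagram ls1 rs1 E1) (strand_diagram ls2 rs2 E2))" (is "?l + ?o = ?N")
proof -
 have b: "2 * loop_blobs d d' C RightBlob = load (shadow C)" if C: "C \<in> loops n d d'" for C
 proof -
  have "shadow C \<subseteq> layer_vertices n" using shadow_mids[OF L.loop_range[OF C]] layer_vertices_split(1) by blast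
  thus ?thesis using L.loop_blobs_sum[OF C] weight_sum by simp
 qed
 have c: "2 * count_list w RightBlob = load (Rd\<^sup>* `` {p})" if "(p, w, q) \<in> stack n d d'" for p w q
 proof -
  have "p \<in> layer_vertices n" using matchingD(1)[OF L.stack that] layer_vertices_split(1) by blast
  hence "Rd\<^sup>* `` {p} \<subseteq> layer_vertices n" by (intro comp_sub) (auto simp: comps_def)
  thus ?thesis using L.stack_count[OF that, of RightBlob] weight_sum unfolding Rd_R by simp
 qed
 have shadow_Cl: "bij_betw shadow (loops n d d') Cl"
  unfolding bij_betw_def Cl_def using L.shadow_loops inj_on_subset[OF inj_shadow subset_UNIV] unfolding Rd_R by simp
 note line_Op = L.open_comps[unfolded Rd_R, folded Op_def]
 have evCl: "even (load X)" if X: "X \<in> Cl" for X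
 proof -
  obtain C where "C \<in> loops n d d'" "X = shadow C" using X unfolding bij_betw_imp_surj_on[OF shadow_Cl, symmetric] by blast
  hence "2 * loop_blobs d d' C RightBlob = load X" using b by simp
  thus ?thesis by (metis dvd_triv_left)
 qed
 have evOp: "even (load X)" if X: "X \<in> Op" for X
 proof -
  obtain e where e: "e \<in> oriented_lines n (stack n d d')" "X = (case e of (p, w, q) \<Rightarrow> Rd\<^sup>* `` {p})"
   using X unfolding bij_betw_imp_surj_on[OF line_Op, symmetric] by blast
  obtain p w q where "e = (p, w, q)" by (cases e)
  hence "(p, w, q) \<in> stack n d d'" "X = Rd\<^sup>* `` {p}" using e unfolding oriented_lines_def by auto
  hence "2 * count_list w RightBlob = load X" using c by simp
  thus ?thesis by (metis dvd_triv_left)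
 qed
 have l: "?l = (\<Sum>X\<in>Cl. loop_degree (load X div 2))"
 proof -
  have "?l = (\<Sum>C\<in>loops n d d'. loop_degree (load (shadow C) div 2))" by (rule sum.cong) (use b[symmetric] in simp_all)
  thus ?thesis using sum.reindex_bij_betw[OF shadow_Cl, of "\<lambda>X. loop_degree (load X div 2)"] by simp
 qed
 have o: "?o = (\<Sum>X\<in>Op. load X div 2 - 1)"
 proof -
  have "?o = (\<Sum>e\<in>oriented_lines n (stack n d d'). load (case e of (p, w, q) \<Rightarrow> Rd\<^sup>* `` {p}) div 2 - 1)"
   by (rule sum.cong) (use c[symmetric] in \<open>auto simp: oriented_lines_def\<close>)
  also have "\<dots> = (\<Sum>X\<in>Op. load X div 2 - 1)" by (rule sum.reindex_bij_betw[OF line_Op])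
  finally show ?thesis .
 qed
 have cnt: "card {X \<in> S. P X} = (\<Sum>X\<in>S. if P X then 1 else 0)" if "finite S" for S :: "point set set" and P
  using that by (simp add: sum.If_cases Int_def)
 have 1: "?l + card {X \<in> Cl. load X > 0} = (\<Sum>X\<in>Cl. load X div 2) + card {X \<in> Cl. load X = 0}"
  unfolding l cnt[OF Cl_Op(3)] sum.distrib[symmetric]
 proof (rule sum.cong)
  fix X assume "X \<in> Cl"
  hence "even (load X)" by (rule evCl)
  thus "loop_degree (load X div 2) + (if load X > 0 then 1 else 0) = load X div 2 + (if load X = 0 then 1 else 0)"
   unfolding loop_degree_def by (auto elim!: evenE)
 qed simp
 have 2: "?o + card {X \<in> Op. load X > 0} = (\<Sum>X\<in>Op. load X div 2)" unfolding o cnt[OF Cl_Op(4)] sum.distrib[symmetric]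
 proof (rule sum.cong)
  fix X assume "X \<in> Op"
  hence "even (load X)" by (rule evOp)
  thus "load X div 2 - 1 + (if load X > 0 then 1 else 0) = load X div 2" by (auto elim!: evenE)
 qed simp
 have "2 * ((\<Sum>X\<in>Cl. load X div 2) + (\<Sum>X\<in>Op. load X div 2)) = (\<Sum>X\<in>Cl. load X) + (\<Sum>X\<in>Op. load X)"
  unfolding sum_distrib_left add_mult_distrib2 using evCl evOp by (intro arg_cong2[of _ _ _ _ "(+)"] sum.cong) auto
 hence 3: "(\<Sum>X\<in>Cl. load X div 2) + (\<Sum>X\<in>Op. load X div 2) = length rs div 2" unfolding sum_load by simp
 interpret T: layered "n + 1" "strand_diagram ls1 rs1 E1" "strand_diagram ls2 rs2 E2"
  by unfold_locales (rule P.strand_matching, rule Q.strand_matching)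
 have "?N + Lam = k + length rs div 2" using card_tl_loops unfolding T.card_loops Rt_def by simp
 thus ?thesis using 1 2 3 count_Lam count_k by linarith
qed

end

subsection \<open>Scalars\<close>

text \<open>
  With \<open>delta_L = kappa_LR = 1\<close> only \<open>RR = delta R\<close> leaves a scalar.
\<close>

lemma straighten_eq:
 fixes x :: "'k::field blob_params"
 assumes "delta_L x = 1" "kappa_LR x = 1"
  and "remdups_adj w \<in> short_words"
 shows "straighten x w = (delta_R x ^ (count_list w RightBlob - 1), remdups_adj w)" using assms
 by (induction x w rule: straighten.induct) (auto simp: scale_def split: if_splits)

theorem blob_mult_tl:
 fixes x :: "'k::field blob_params"
 assumes x: "delta x = kappa_L x" "kappa_L x = delta_R x" "delta_L x = 1" "kappa_R x = 1" "kappa_LR x = 1"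
  and n: "even n" and d: "d \<in> blob_diagrams n" and d': "d' \<in> blob_diagrams n"
 shows "fst (blob_mult n x d d') = delta x ^ card (loops (n + 1) (to_tl n d) (to_tl n d'))"
  and "snd (blob_mult n x d d') \<in> blob_diagrams n"
  and "to_tl n (snd (blob_mult n x d d')) = stack (n + 1) (to_tl n d) (to_tl n d')"
proof -
 obtain ls1 rs1 pos1 E1 where P: "irreducible n ls1 rs1 pos1 E1" "drawn_lines n ls1 rs1 E1 = d" using blob_diagram_drawing[OF d n] by blast
 obtain ls2 rs2 pos2 E2 where Q: "irreducible n ls2 rs2 pos2 E2" "drawn_lines n ls2 rs2 E2 = d'" using blob_diagram_drawing[OF d' n] by blast
 interpret S: irreducible_stacking n ls1 rs1 pos1 E1 ls2 rs2 pos2 E2 using P(1) Q(1) by (rule irreducible_stacking.intro)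
 have dd: "S.d = d" "S.d' = d'" unfolding S.d_def S.d'_def P(2) Q(2) by simp_all
 have tl: "to_tl n d = strand_diagram ls1 rs1 E1" "to_tl n d' = strand_diagram ls2 rs2 E2"
  using S.P.to_tl_lines S.Q.to_tl_lines unfolding P(2) Q(2) by simp_all
 define D where "D = stack n d d'"
 have D: "D = drawn_lines n S.ls S.rs S.composite" unfolding D_def S.lines_composite P(2) Q(2) ..
 note nf = normal_form[OF S.N.planar_axioms n, folded D]
 have st: "straighten x w = (delta x ^ (count_list w RightBlob - 1), remdups_adj w)" if "(p, w, q) \<in> D" for p w q
  using straighten_eq[OF x(3,5) nf(3)[OF that]] x(1,2) by simp
 have img: "(\<lambda>(p, w, q). (p, snd (straighten x w), q)) ` D = collapse D" unfolding collapse_def by (rule image_cong) (use st in auto)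
 have top: "topological_reduce x (collapse D) = (1, resolve (collapse D))" unfolding topological_reduce_def resolve_def x(5) by simp
 have lines: "(\<Prod>(p, w, q)\<in>oriented_lines n D. fst (straighten x w)) =
   delta x ^ (\<Sum>(p, w, q)\<in>oriented_lines n D. count_list w RightBlob - 1)"
  unfolding power_sum by (rule prod.cong) (use st in \<open>auto simp: oriented_lines_def\<close>)
 have lf: "loop_factor x a b = delta x ^ loop_degree b" for a b unfolding loop_factor_def loop_degree_def using x by auto
 have loops: "(\<Prod>C\<in>loops n d d'. loop_factor x (loop_blobs d d' C LeftBlob) (loop_blobs d d' C RightBlob)) =
   delta x ^ (\<Sum>C\<in>loops n d d'. loop_degree (loop_blobs d d' C RightBlob))"
  unfolding lf power_sum ..
 have m: "blob_mult n x d d' = (delta x ^ card (loops (n + 1) (to_tl n d) (to_tl n d')), resolve (collapse D))"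
  unfolding blob_mult_def Let_def D_def[symmetric] img top lines loops power_add[symmetric] tl
  using S.scalar_degree unfolding dd D_def[symmetric] by (simp add: scale_def)
 show "fst (blob_mult n x d d') = delta x ^ card (loops (n + 1) (to_tl n d) (to_tl n d'))"
  "snd (blob_mult n x d d') \<in> blob_diagrams n"
  "to_tl n (snd (blob_mult n x d d')) = stack (n + 1) (to_tl n d) (to_tl n d')" unfolding m using nf(1,2) S.strand_composite tl by simp_all
qed

subsection \<open>The identity, surjectivity and finiteness\<close>

lemma to_tl_id: "to_tl n (id_diagram n) = id_diagram (n + 1)"
proof -
 have "right_vertices (id_diagram n) = {}" unfolding right_vertices_def id_diagram_def by auto
 hence "right_list (id_diagram n) = []" by (intro right_list_eq[of _ _ n]) simp_all
 moreover have "{(p, [], q) |p q. \<exists>w. (p, w, q) \<in> id_diagram n \<and> RightBlob \<notin> set w} = id_diagram n"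
  unfolding id_diagram_def by auto
 moreover have "{1..n + 1} = insert (n + 1) {1..n}" by auto
 ultimately show ?thesis unfolding to_tl_def by (auto simp: id_diagram_def)
qed

lemma id_blob_diagram: "id_diagram n \<in> blob_diagrams n"
proof -
 let ?M = "\<Union>i\<in>{1..n}. {(Top i, Bot i), (Bot i, Top i)}"
 have sc: "ascending (clockwise n 0 0) (small_circ n [] [])" using sorted_clockwise[of n 0 0] unfolding wall_def by simp
 have pr: "pairing (set (small_circ n [] [])) ?M" unfolding set_small_circ pairing_def vertices_def sym_def irrefl_def by auto
 have nc: "noncrossing (clockwise n 0 0) ?M" unfolding noncrossing_def by auto
 obtain pos where "planar n [] [] pos (unlabelled (?M \<union> hook_edges n))"
  (is "planar n [] [] pos ?E") using planar_add_hooks[OF asc_distinct[OF sc] _ _ _ pr sc nc] by auto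
 then interpret planar n "[]" "[]" pos ?E .
 have "id_diagram n \<subseteq> drawn_lines n [] [] ?E"
  unfolding id_diagram_def drawn_lines_def vertices_def by (auto intro!: apath.start simp: unlabelled_iff)
 hence "id_diagram n = drawn_lines n [] [] ?E" by (intro matching_total_eq[OF lines_matching]) (auto simp: id_diagram_def vertices_def)
 hence "id_diagram n \<in> left_right_diagrams n" using left_right by simp
 moreover have "\<not> topological_redex (id_diagram n)" unfolding topological_redex_def top_LR_arc_def id_diagram_def by auto
 moreover have "reduced_word w" if "(p, w, q) \<in> id_diagram n" for p w q using that unfolding id_diagram_def reduced_word_def by auto
 ultimately show ?thesis unfolding blob_diagrams_def by auto
qed

text \<open>
  Moving the vertices \<open>Top (n + 1)\<close> and \<open>Bot (n + 1)\<close> to the right side turns the diagram into a drawing with a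
  single right blob, along which the strand restores it.
\<close>

theorem to_tl_onto:
 assumes n: "even n" and T: "T \<in> tl_diagrams (n + 1)"
 shows "\<exists>D\<in>blob_diagrams n. to_tl n D = T"
proof -
 obtain M where M: "T = unlabelled M" "pairing (vertices (n + 1)) M" "noncrossing (clockwise (n + 1) 0 0) M"
  using T unfolding tl_diagrams_def unlabelled_def by blast
 define x y where "x = Wall RightBlob 0" and "y = Wall RightBlob 1"
 define g where "g p = (if p = Top (n + 1) then x else if p = Bot (n + 1) then y else p)" for p
 have mT: "matching (vertices (n + 1)) T" unfolding M(1) matching_pairing by (rule M(2))
 have gv: "g p = p" if "p \<in> vertices n" for p using that unfolding g_def by auto
 have gh: "g (Top (n + 1)) = x" "g (Bot (n + 1)) = y" unfolding g_def by simp_all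
 have V: "vertices (n + 1) = vertices n \<union> {Top (n + 1), Bot (n + 1)}" by (simp add: vertices_Suc)
 have xyv: "x \<notin> vertices n" "y \<notin> vertices n" "x \<noteq> y" unfolding x_def y_def vertices_def by auto
 have g_inj: "inj_on g (vertices (n + 1))" unfolding V inj_on_def using gv gh xyv by (auto simp: g_def)
 have g_img: "g ` vertices (n + 1) = vertices n \<union> {x, y}" unfolding V image_Un using gv gh by auto
 have wall1: "wall RightBlob 1 = [x, y]" "wall LeftBlob 0 = []" unfolding wall_def x_def y_def by (simp_all add: upt_rec)
 have sc: "ascending (clockwise n 0 1) (small_circ n [] [x, y])" using sorted_clockwise[of n 0 1] unfolding wall1 by simp
 have set_sc: "set (small_circ n [] [x, y]) = vertices n \<union> {x, y}" unfolding set_small_circ by auto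
 let ?M = "map_prod g g ` M"
 have MV: "M \<subseteq> vertices (n + 1) \<times> vertices (n + 1)" using M(2) unfolding pairing_def by blast
 have cw: "clockwise n 0 1 (g p) = clockwise (n + 1) 0 0 p" if "p \<in> vertices (n + 1)" for p
 proof -
  from that consider i where "p = Top i" "i \<in> {1..n + 1}" | i where "p = Bot i" "i \<in> {1..n + 1}" unfolding vertices_def by blast
  thus ?thesis by cases (auto simp: g_def x_def y_def)
 qed
 have nc: "noncrossing (clockwise n 0 1) ?M" by (rule noncrossing_order_iso[OF MV _ M(3)]) (use cw in simp)
 have pr: "pairing (set (small_circ n [] [x, y])) ?M" unfolding set_sc g_img[symmetric] pairing_def
 proof (intro conjI ballI)
  show "?M \<subseteq> g ` vertices (n + 1) \<times> g ` vertices (n + 1)" using MV by auto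
  show "sym ?M" using M(2) unfolding pairing_def sym_def by auto
  show "irrefl ?M"
  proof (rule irreflI)
   fix a show "(a, a) \<notin> ?M"
   proof
    assume "(a, a) \<in> ?M"
    then obtain p q where pq: "(p, q) \<in> M" "g p = g q" by auto
    hence "p = q" using g_inj MV unfolding inj_on_def by blast
    thus False using pq(1) M(2) unfolding pairing_def irrefl_def by blast
   qed
  qed
  fix a assume "a \<in> g ` vertices (n + 1)"
  then obtain p where p: "p \<in> vertices (n + 1)" "a = g p" by blast
  then obtain q where q: "(p, q) \<in> M" "\<And>q'. (p, q') \<in> M \<Longrightarrow> q' = q" using M(2) unfolding pairing_def by metis
  show "\<exists>!b. (a, b) \<in> ?M"
  proof (rule ex1I[of _ "g q"])
   show "(a, g q) \<in> ?M" using q(1) p(2) by auto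
   fix b assume "(a, b) \<in> ?M"
   then obtain p' q' where h: "(p', q') \<in> M" "g p = g p'" "b = g q'" using p(2) by auto
   have "p = p'" using g_inj h(1,2) MV p(1) unfolding inj_on_def by blast
   thus "b = g q" using q(2) h by blast
  qed
 qed
 obtain pos where "planar n [] [x, y] pos (unlabelled (?M \<union> hook_edges n))"
  (is "planar n [] [x, y] pos ?E") using planar_add_hooks[OF asc_distinct[OF sc] _ _ _ pr sc nc] unfolding x_def y_def by auto
 then interpret planar n "[]" "[x, y]" pos ?E .
 have "strand_diagram [] [x, y] ?E = T"
 proof (rule sym, rule matching_total_eq[OF strand_matching])
  let ?R = "und ?E \<union> und (strand_glue [] [x, y])"
  have symR: "sym ?R" by (intro sym_Un und_sym[OF E] und_sym[OF strand_glue])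
  have glue: "(Top 0, x) \<in> und (strand_glue [] [x, y])" "(Bot 0, y) \<in> und (strand_glue [] [x, y])" unfolding strand_glue_def und_def by auto
  have to_g: "(p, g p) \<in> ?R\<^sup>*" if "p \<in> vertices (n + 1)" for p
  proof -
   have "(Top (n + 1), x) \<in> ?R\<^sup>*"
   proof -
    have "(Top (n + 1), Top 0) \<in> ?R" unfolding und_unlabelled by blast
    moreover have "(Top 0, x) \<in> ?R" using glue by blast
    ultimately show ?thesis by (meson r_into_rtrancl rtrancl_trans)
   qed
   moreover have "(Bot (n + 1), y) \<in> ?R\<^sup>*"
   proof -
    have "(Bot (n + 1), Bot 0) \<in> ?R" unfolding und_unlabelled by blast
    moreover have "(Bot 0, y) \<in> ?R" using glue by blast
    ultimately show ?thesis by (meson r_into_rtrancl rtrancl_trans)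
   qed
   ultimately show ?thesis using that gv gh unfolding V by auto
  qed
  show "T \<subseteq> strand_diagram [] [x, y] ?E"
  proof
   fix z assume z: "z \<in> T"
   then obtain p q where pq: "z = (p, [], q)" "(p, q) \<in> M" unfolding M(1) unlabelled_def by auto
   have v: "p \<in> vertices (n + 1)" "q \<in> vertices (n + 1)" "p \<noteq> q" using matchingD(1-3)[OF mT] z pq(1) by auto
   have "(g p, g q) \<in> ?R" unfolding und_unlabelled using pq(2) by auto
   moreover have "(g q, q) \<in> ?R\<^sup>*" using to_g[OF v(2)] symD[OF sym_rtrancl[OF symR]] by blast
   ultimately have "(p, q) \<in> ?R\<^sup>*" using to_g[OF v(1)] by (meson r_into_rtrancl rtrancl_trans)
   hence "(p, q) \<in> und (strand_diagram [] [x, y] ?E)" unfolding und_strand ends_def using v by simp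
   then obtain w where "(p, w, q) \<in> strand_diagram [] [x, y] ?E" unfolding und_iff by blast
   thus "z \<in> strand_diagram [] [x, y] ?E" using strand_nil pq(1) by blast
  qed
  show "\<exists>w q. (p, w, q) \<in> T" if "p \<in> vertices (n + 1)" for p by (rule matching_ex[OF mT that])
 qed
 thus ?thesis using normal_form(1,2)[OF planar_axioms n] by metis
qed

theorem to_tl_blob: "even n \<Longrightarrow> D \<in> blob_diagrams n \<Longrightarrow> to_tl n D \<in> tl_diagrams (n + 1)"
proof -
 assume "even n" "D \<in> blob_diagrams n"
 then obtain ls rs pos E where P: "irreducible n ls rs pos E" "drawn_lines n ls rs E = D" using blob_diagram_drawing by blast
 interpret irreducible n ls rs pos E by (rule P(1))
 show ?thesis using strand_tl unfolding to_tl_lines[symmetric] P(2) .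
qed

lemma finite_blob_diagrams: "even n \<Longrightarrow> finite (blob_diagrams n)"
proof -
 assume n: "even n"
 let ?W = "short_words"
 have "D \<subseteq> vertices n \<times> ?W \<times> vertices n" if D: "D \<in> blob_diagrams n" for D
 proof -
  obtain ls rs pos E where P: "irreducible n ls rs pos E" "drawn_lines n ls rs E = D" using blob_diagram_drawing[OF D n] by blast
  interpret irreducible n ls rs pos E by (rule P(1))
  show ?thesis
  proof
   fix z assume "z \<in> D"
   hence "(fst z, fst (snd z), snd (snd z)) \<in> drawn_lines n ls rs E" unfolding P(2) by simp
   from line_shape(1,2,6)[OF this] show "z \<in> vertices n \<times> ?W \<times> vertices n" by (simp only: mem_Times_iff)
  qed
 qed
 hence "blob_diagrams n \<subseteq> Pow (vertices n \<times> ?W \<times> vertices n)" by blast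
 moreover have "finite (vertices n \<times> ?W \<times> vertices n)" unfolding vertices_def by simp
 ultimately show ?thesis using finite_subset finite_Pow_iff by metis
qed

section \<open>Quotients of based algebras\<close>

text \<open>
  Closure of the kernel under multiplication only uses that products with zero vanish.
\<close>

theorem quotient_by_kernel:
 fixes A :: "('k, 'a) module" and B :: "('k, 'b) module"
 assumes A: "abelian_group A" and B: "abelian_group B"
  and clo: "\<And>a b. a \<in> carrier A \<Longrightarrow> b \<in> carrier A \<Longrightarrow> a \<otimes>\<^bsub>A\<^esub> b \<in> carrier A" "\<one>\<^bsub>A\<^esub> \<in> carrier A"
   "\<And>c a. a \<in> carrier A \<Longrightarrow> c \<odot>\<^bsub>A\<^esub> a \<in> carrier A"
  and zero: "\<And>b. b \<otimes>\<^bsub>B\<^esub> \<zero>\<^bsub>B\<^esub> = \<zero>\<^bsub>B\<^esub>" "\<And>b. \<zero>\<^bsub>B\<^esub> \<otimes>\<^bsub>B\<^esub> b = \<zero>\<^bsub>B\<^esub>" "\<And>c. c \<odot>\<^bsub>B\<^esub> \<zero>\<^bsub>B\<^esub> = \<zero>\<^bsub>B\<^esub>"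
  and onto: "h ` carrier A = carrier B"
  and add: "\<And>a b. a \<in> carrier A \<Longrightarrow> b \<in> carrier A \<Longrightarrow> h (a \<oplus>\<^bsub>A\<^esub> b) = h a \<oplus>\<^bsub>B\<^esub> h b"
  and mult: "\<And>a b. a \<in> carrier A \<Longrightarrow> b \<in> carrier A \<Longrightarrow> h (a \<otimes>\<^bsub>A\<^esub> b) = h a \<otimes>\<^bsub>B\<^esub> h b"
  and one: "h \<one>\<^bsub>A\<^esub> = \<one>\<^bsub>B\<^esub>"
  and smult: "\<And>c a. a \<in> carrier A \<Longrightarrow> h (c \<odot>\<^bsub>A\<^esub> a) = c \<odot>\<^bsub>B\<^esub> h a"
 shows "\<exists>I. algebra_ideal I A \<and> algebra_isomorphic (quotient_algebra A I) B"
proof -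
 interpret A: abelian_group A by (rule A)
 interpret B: abelian_group B by (rule B)
 define I where "I = a_kernel A B h"
 have hB: "h a \<in> carrier B" if "a \<in> carrier A" for a using onto that by blast
 have "group_hom (add_monoid A) (add_monoid B) h"
  by (rule group_hom.intro[OF A.a_group B.a_group]) (use add hB in \<open>auto simp: group_hom_axioms_def hom_def\<close>)
 then interpret H: abelian_group_hom A B h by (rule abelian_group_homI[OF A B])
 have I: "a \<in> I \<longleftrightarrow> a \<in> carrier A \<and> h a = \<zero>\<^bsub>B\<^esub>" for a unfolding I_def a_kernel_def' by blast
 have sub: "additive_subgroup I A" unfolding I_def by (rule H.additive_subgroup_a_kernel)
 have ideal: "algebra_ideal I A" unfolding algebra_ideal_def using sub by (auto simp: I mult smult zero clo ideal_axioms_def)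
 have coset: "I +>\<^bsub>A\<^esub> a = {f \<in> carrier A. h f = h a}" if a: "a \<in> carrier A" for a
 proof
  show "I +>\<^bsub>A\<^esub> a \<subseteq> {f \<in> carrier A. h f = h a}" unfolding a_r_coset_def' using a by (auto simp: I add hB)
  show "{f \<in> carrier A. h f = h a} \<subseteq> I +>\<^bsub>A\<^esub> a"
  proof
   fix f assume "f \<in> {f \<in> carrier A. h f = h a}"
   hence f: "f \<in> carrier A" "h f = h a" by simp_all
   have c: "f \<ominus>\<^bsub>A\<^esub> a \<in> carrier A" using f a by simp
   have eq: "f = (f \<ominus>\<^bsub>A\<^esub> a) \<oplus>\<^bsub>A\<^esub> a" using f a by (simp add: a_minus_def A.a_assoc A.l_neg)
   hence "h (f \<ominus>\<^bsub>A\<^esub> a) \<oplus>\<^bsub>B\<^esub> h a = h a" using add[OF c a] f(2) by simp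
   hence "h (f \<ominus>\<^bsub>A\<^esub> a) = \<zero>\<^bsub>B\<^esub>" using hB[OF c] hB[OF a] by (simp add: B.add.r_cancel_one)
   thus "f \<in> I +>\<^bsub>A\<^esub> a" unfolding a_r_coset_def' using eq c I by blast
  qed
 qed
 define Q where "Q = quotient_algebra A I"
 define H where "H X = the_elem (h ` X)" for X
 have carrierQ: "carrier Q = (\<lambda>a. I +>\<^bsub>A\<^esub> a) ` carrier A"
  unfolding Q_def quotient_algebra_def FactRing_def A_RCOSETS_def' by (auto simp: ring.defs module.defs)
 have H: "H (I +>\<^bsub>A\<^esub> a) = h a" if "a \<in> carrier A" for a
 proof -
  have "h ` (I +>\<^bsub>A\<^esub> a) = {h a}" unfolding coset[OF that] using that by auto
  thus ?thesis unfolding H_def by simp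
 qed
 have self: "a \<in> I +>\<^bsub>A\<^esub> a" if "a \<in> carrier A" for a unfolding coset[OF that] using that by simp
 have multQ: "(I +>\<^bsub>A\<^esub> a) \<otimes>\<^bsub>Q\<^esub> (I +>\<^bsub>A\<^esub> b) = I +>\<^bsub>A\<^esub> (a \<otimes>\<^bsub>A\<^esub> b)" if ab: "a \<in> carrier A" "b \<in> carrier A" for a b
 proof -
  have "(I +>\<^bsub>A\<^esub> a) \<otimes>\<^bsub>Q\<^esub> (I +>\<^bsub>A\<^esub> b) = (\<Union>x\<in>I +>\<^bsub>A\<^esub> a. \<Union>y\<in>I +>\<^bsub>A\<^esub> b. I +>\<^bsub>A\<^esub> (x \<otimes>\<^bsub>A\<^esub> y))"
   unfolding Q_def quotient_algebra_def FactRing_def rcoset_mult_def by (simp add: ring.defs module.defs)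
  moreover have "I +>\<^bsub>A\<^esub> (x \<otimes>\<^bsub>A\<^esub> y) = I +>\<^bsub>A\<^esub> (a \<otimes>\<^bsub>A\<^esub> b)" if "x \<in> I +>\<^bsub>A\<^esub> a" "y \<in> I +>\<^bsub>A\<^esub> b" for x y
   using that unfolding coset[OF ab(1)] coset[OF ab(2)] using ab by (simp add: coset clo mult)
  moreover have "I +>\<^bsub>A\<^esub> a \<noteq> {}" "I +>\<^bsub>A\<^esub> b \<noteq> {}" using self[OF ab(1)] self[OF ab(2)] by blast+
  ultimately show ?thesis by (simp cong: SUP_cong_simp)
 qed
 have addQ: "(I +>\<^bsub>A\<^esub> a) \<oplus>\<^bsub>Q\<^esub> (I +>\<^bsub>A\<^esub> b) = I +>\<^bsub>A\<^esub> (a \<oplus>\<^bsub>A\<^esub> b)" if ab: "a \<in> carrier A" "b \<in> carrier A" for a b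
 proof -
  have "(I +>\<^bsub>A\<^esub> a) \<oplus>\<^bsub>Q\<^esub> (I +>\<^bsub>A\<^esub> b) = (I +>\<^bsub>A\<^esub> a) <+>\<^bsub>A\<^esub> (I +>\<^bsub>A\<^esub> b)"
   unfolding Q_def quotient_algebra_def FactRing_def by (simp add: ring.defs module.defs)
  also have "\<dots> = I +>\<^bsub>A\<^esub> (a \<oplus>\<^bsub>A\<^esub> b)" using abelian_subgroup.a_rcos_sum[OF abelian_subgroupI3[OF sub A] ab] .
  finally show ?thesis .
 qed
 have smultQ: "c \<odot>\<^bsub>Q\<^esub> (I +>\<^bsub>A\<^esub> a) = I +>\<^bsub>A\<^esub> (c \<odot>\<^bsub>A\<^esub> a)" if a: "a \<in> carrier A" for c a
 proof -
  have "c \<odot>\<^bsub>Q\<^esub> (I +>\<^bsub>A\<^esub> a) = (\<Union>x\<in>I +>\<^bsub>A\<^esub> a. I +>\<^bsub>A\<^esub> (c \<odot>\<^bsub>A\<^esub> x))"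
   unfolding Q_def quotient_algebra_def by (simp add: ring.defs module.defs)
  moreover have "I +>\<^bsub>A\<^esub> (c \<odot>\<^bsub>A\<^esub> x) = I +>\<^bsub>A\<^esub> (c \<odot>\<^bsub>A\<^esub> a)" if "x \<in> I +>\<^bsub>A\<^esub> a" for x
   using that unfolding coset[OF a] using a by (simp add: coset clo smult)
  moreover have "I +>\<^bsub>A\<^esub> a \<noteq> {}" using self[OF a] by blast
  ultimately show ?thesis by (simp cong: SUP_cong_simp)
 qed
 have oneQ: "\<one>\<^bsub>Q\<^esub> = I +>\<^bsub>A\<^esub> \<one>\<^bsub>A\<^esub>"
  unfolding Q_def quotient_algebra_def FactRing_def by (simp add: ring.defs module.defs)
 have "H \<in> ring_hom Q B"
 proof (rule ring_hom_memI)
  fix X Y assume "X \<in> carrier Q" "Y \<in> carrier Q"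
  then obtain a b where ab: "a \<in> carrier A" "X = I +>\<^bsub>A\<^esub> a" "b \<in> carrier A" "Y = I +>\<^bsub>A\<^esub> b" unfolding carrierQ by blast
  show "H (X \<otimes>\<^bsub>Q\<^esub> Y) = H X \<otimes>\<^bsub>B\<^esub> H Y" "H (X \<oplus>\<^bsub>Q\<^esub> Y) = H X \<oplus>\<^bsub>B\<^esub> H Y"
   using ab by (simp_all add: multQ addQ H clo mult add)
 qed (auto simp: carrierQ H hB oneQ clo one)
 moreover have "bij_betw H (carrier Q) (carrier B)"
 proof (rule bij_betw_imageI)
  show "inj_on H (carrier Q)"
  proof (rule inj_onI)
   fix X Y assume "X \<in> carrier Q" "Y \<in> carrier Q" "H X = H Y"
   then obtain a b where "a \<in> carrier A" "X = I +>\<^bsub>A\<^esub> a" "b \<in> carrier A" "Y = I +>\<^bsub>A\<^esub> b" "h a = h b"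
    unfolding carrierQ using H by force
   thus "X = Y" by (simp add: coset)
  qed
  show "H ` carrier Q = carrier B" unfolding carrierQ onto[symmetric] image_image using H by (auto intro!: image_cong)
 qed
 moreover have "H (c \<odot>\<^bsub>Q\<^esub> X) = c \<odot>\<^bsub>B\<^esub> H X" if "X \<in> carrier Q" for c X
  using that unfolding carrierQ by (auto simp: smultQ H clo smult)
 ultimately have "algebra_isomorphic Q B" unfolding algebra_isomorphic_def ring_iso_def by blast
 thus ?thesis using ideal unfolding Q_def by blast
qed

lemma based_algebra_group: "abelian_group (based_algebra B u mul)"
proof (rule abelian_groupI)
 fix f assume "f \<in> carrier (based_algebra B u mul)"
 thus "\<exists>g\<in>carrier (based_algebra B u mul). g \<oplus>\<^bsub>based_algebra B u mul\<^esub> f = \<zero>\<^bsub>based_algebra B u mul\<^esub>"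
  by (intro bexI[of _ "\<lambda>e. - f e"]) (auto simp: based_algebra_def)
qed (auto simp: based_algebra_def algebra_simps)

text \<open>
  The map \<open>\<phi>\<close> is extended linearly by summing coefficients over its fibres.
\<close>

theorem based_algebra_quotient:
 fixes mul :: "'b \<Rightarrow> 'b \<Rightarrow> 'k::field \<times> 'b" and mul' :: "'t \<Rightarrow> 't \<Rightarrow> 'k \<times> 't"
 assumes fin: "finite B" and onto: "\<phi> ` B = T"
  and closed: "\<And>b b'. b \<in> B \<Longrightarrow> b' \<in> B \<Longrightarrow> snd (mul b b') \<in> B"
  and mul: "\<And>b b'. b \<in> B \<Longrightarrow> b' \<in> B \<Longrightarrow> mul' (\<phi> b) (\<phi> b') = (fst (mul b b'), \<phi> (snd (mul b b')))"
  and unit: "u \<in> B" "\<phi> u = u'"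
 shows "\<exists>I. algebra_ideal I (based_algebra B u mul) \<and>
  algebra_isomorphic (quotient_algebra (based_algebra B u mul) I) (based_algebra T u' mul')"
proof -
 let ?A = "based_algebra B u mul" and ?B = "based_algebra T u' mul'"
 define h :: "('b \<Rightarrow> 'k) \<Rightarrow> 't \<Rightarrow> 'k" where "h f = (\<lambda>t. \<Sum>b\<in>B. f b * basis_vector (\<phi> b) t)" for f
 have finT: "finite T" using fin onto by blast
 have bv: "(\<Sum>e\<in>S. basis_vector b e * F e) = (F b :: 'k)" if "finite S" "b \<in> S" for S :: "'z set" and b F
 proof -
  have "(\<Sum>e\<in>S. basis_vector b e * F e) = (\<Sum>e\<in>S. if e = b then F e else 0)" by (rule sum.cong) (auto simp: basis_vector_def)
  thus ?thesis using that by simp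
 qed
 have cB: "carrier ?A = {f. \<forall>b. b \<notin> B \<longrightarrow> f b = 0}" "carrier ?B = {f. \<forall>b. b \<notin> T \<longrightarrow> f b = 0}"
  unfolding based_algebra_def by simp_all
 have mA: "f \<otimes>\<^bsub>?A\<^esub> g = (\<lambda>e. \<Sum>b\<in>B. \<Sum>b'\<in>B. f b * g b' * fst (mul b b') * basis_vector (snd (mul b b')) e)" for f g
  unfolding based_algebra_def by simp
 have mB: "f \<otimes>\<^bsub>?B\<^esub> g = (\<lambda>e. \<Sum>b\<in>T. \<Sum>b'\<in>T. f b * g b' * fst (mul' b b') * basis_vector (snd (mul' b b')) e)" for f g
  unfolding based_algebra_def by simp
 have hT: "h f \<in> carrier ?B" for f unfolding cB h_def basis_vector_def using onto by (auto intro!: sum.neutral)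
 show ?thesis
 proof (rule quotient_by_kernel[where h = h])
  show "a \<otimes>\<^bsub>?A\<^esub> b \<in> carrier ?A" for a b unfolding cB mA basis_vector_def using closed by (auto intro!: sum.neutral)
  show "\<one>\<^bsub>?A\<^esub> \<in> carrier ?A" unfolding based_algebra_def using unit(1) by (auto simp: basis_vector_def)
  show "c \<odot>\<^bsub>?A\<^esub> a \<in> carrier ?A" if "a \<in> carrier ?A" for c a using that unfolding based_algebra_def by auto
  show "b \<otimes>\<^bsub>?B\<^esub> \<zero>\<^bsub>?B\<^esub> = \<zero>\<^bsub>?B\<^esub>" "\<zero>\<^bsub>?B\<^esub> \<otimes>\<^bsub>?B\<^esub> b = \<zero>\<^bsub>?B\<^esub>" for b unfolding based_algebra_def by simp_all
  show "c \<odot>\<^bsub>?B\<^esub> \<zero>\<^bsub>?B\<^esub> = \<zero>\<^bsub>?B\<^esub>" for c unfolding based_algebra_def by simp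
  show "h ` carrier ?A = carrier ?B"
  proof
   show "h ` carrier ?A \<subseteq> carrier ?B" using hT by blast
   show "carrier ?B \<subseteq> h ` carrier ?A"
   proof
    fix g assume g: "g \<in> carrier ?B"
    define s where "s = inv_into B \<phi>"
    have s: "s t \<in> B" "\<phi> (s t) = t" if "t \<in> T" for t
     unfolding s_def using that onto inv_into_into[of t \<phi> B] f_inv_into_f[of t \<phi> B] by auto
    define f where "f = (\<lambda>b. if b \<in> s ` T then g (\<phi> b) else 0)"
    have "f \<in> carrier ?A" unfolding cB f_def using s by auto
    moreover have "h f = g"
    proof
     fix t
     have "h f t = (\<Sum>b\<in>B. if b \<in> s ` T \<and> \<phi> b = t then g t else 0)"
      unfolding h_def f_def by (rule sum.cong) (auto simp: basis_vector_def)
     also have "\<dots> = (\<Sum>b\<in>B. if b = s t \<and> t \<in> T then g t else 0)" by (rule sum.cong) (use s in auto)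
     also have "\<dots> = g t"
     proof (cases "t \<in> T")
      case True thus ?thesis using fin s(1) by simp
     next
      case False thus ?thesis using g unfolding cB by simp
     qed
     finally show "h f t = g t" .
    qed
    ultimately show "g \<in> h ` carrier ?A" by blast
   qed
  qed
  show "h (a \<oplus>\<^bsub>?A\<^esub> b) = h a \<oplus>\<^bsub>?B\<^esub> h b" for a b
   unfolding based_algebra_def h_def by (simp add: distrib_right sum.distrib)
  show "h (c \<odot>\<^bsub>?A\<^esub> a) = c \<odot>\<^bsub>?B\<^esub> h a" for c a
   unfolding based_algebra_def h_def by (simp add: sum_distrib_left mult.assoc)
  show "h \<one>\<^bsub>?A\<^esub> = \<one>\<^bsub>?B\<^esub>"
   unfolding based_algebra_def h_def using bv[OF fin unit(1), of "\<lambda>b. basis_vector (\<phi> b) _"] unit(2) by simp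
  show "h (f \<otimes>\<^bsub>?A\<^esub> g) = h f \<otimes>\<^bsub>?B\<^esub> h g" for f g
  proof
   fix t
   define c where "c b b' = fst (mul b b') * basis_vector (\<phi> (snd (mul b b'))) t" for b b'
   define c' where "c' s s' = fst (mul' s s') * basis_vector (snd (mul' s s')) t" for s s'
   have cc: "c' (\<phi> b) (\<phi> b') = c b b'" if "b \<in> B" "b' \<in> B" for b b' unfolding c_def c'_def mul[OF that] by simp
   have "h (f \<otimes>\<^bsub>?A\<^esub> g) t = (\<Sum>e\<in>B. \<Sum>b\<in>B. \<Sum>b'\<in>B. basis_vector (snd (mul b b')) e * (f b * g b' * fst (mul b b') * basis_vector (\<phi> e) t))"
    unfolding h_def mA sum_distrib_right by (simp only: ac_simps)
   also have "\<dots> = (\<Sum>b\<in>B. \<Sum>e\<in>B. \<Sum>b'\<in>B. basis_vector (snd (mul b b')) e * (f b * g b' * fst (mul b b') * basis_vector (\<phi> e) t))"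
    by (rule sum.swap)
   also have "\<dots> = (\<Sum>b\<in>B. \<Sum>b'\<in>B. \<Sum>e\<in>B. basis_vector (snd (mul b b')) e * (f b * g b' * fst (mul b b') * basis_vector (\<phi> e) t))"
    by (rule sum.cong[OF refl], rule sum.swap)
   also have "\<dots> = (\<Sum>b\<in>B. \<Sum>b'\<in>B. f b * (g b' * c b b'))"
   proof (intro sum.cong refl)
    fix b b' assume bb: "b \<in> B" "b' \<in> B"
    show "(\<Sum>e\<in>B. basis_vector (snd (mul b b')) e * (f b * g b' * fst (mul b b') * basis_vector (\<phi> e) t)) = f b * (g b' * c b b')"
     unfolding bv[OF fin closed[OF bb], of "\<lambda>e. f b * g b' * fst (mul b b') * basis_vector (\<phi> e) t"] c_def by (simp only: mult.assoc)
   qed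
   finally have l: "h (f \<otimes>\<^bsub>?A\<^esub> g) t = (\<Sum>b\<in>B. \<Sum>b'\<in>B. f b * (g b' * c b b'))" .
   have push: "(\<Sum>s\<in>T. h k s * F s) = (\<Sum>b\<in>B. k b * F (\<phi> b))" for k and F :: "'t \<Rightarrow> 'k"
   proof -
    have "(\<Sum>s\<in>T. h k s * F s) = (\<Sum>s\<in>T. \<Sum>b\<in>B. k b * (basis_vector (\<phi> b) s * F s))"
     unfolding h_def sum_distrib_right by (simp only: mult.assoc)
    also have "\<dots> = (\<Sum>b\<in>B. \<Sum>s\<in>T. k b * (basis_vector (\<phi> b) s * F s))" by (rule sum.swap)
    also have "\<dots> = (\<Sum>b\<in>B. k b * F (\<phi> b))"
    proof (rule sum.cong[OF refl])
     fix b assume "b \<in> B"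
     hence "\<phi> b \<in> T" using onto by blast
     thus "(\<Sum>s\<in>T. k b * (basis_vector (\<phi> b) s * F s)) = k b * F (\<phi> b)"
      unfolding sum_distrib_left[symmetric] using bv[OF finT] by simp
    qed
    finally show ?thesis .
   qed
   have "(h f \<otimes>\<^bsub>?B\<^esub> h g) t = (\<Sum>s\<in>T. h f s * (\<Sum>s'\<in>T. h g s' * c' s s'))"
    unfolding mB c'_def sum_distrib_left by (simp only: mult.assoc)
   also have "\<dots> = (\<Sum>b\<in>B. f b * (\<Sum>b'\<in>B. g b' * c' (\<phi> b) (\<phi> b')))" by (simp only: push)
   also have "\<dots> = (\<Sum>b\<in>B. \<Sum>b'\<in>B. f b * (g b' * c b b'))" unfolding sum_distrib_left by (intro sum.cong refl) (simp add: cc)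
   finally show "h (f \<otimes>\<^bsub>?A\<^esub> g) t = (h f \<otimes>\<^bsub>?B\<^esub> h g) t" using l by simp
  qed
 qed (rule based_algebra_group)+
qed

section \<open>The quotient\<close>

theorem proposition7p1p2:
 fixes x :: "'k::field blob_params" and n :: nat
 assumes "delta x = kappa_L x" and "kappa_L x = delta_R x"
  and "delta_L x = 1" and "kappa_R x = 1" and "kappa_LR x = 1"
  and "even n" and "n \<noteq> 0"
 shows "\<exists>I. algebra_ideal I (symplectic_blob_algebra n x) \<and>
  algebra_isomorphic (quotient_algebra (symplectic_blob_algebra n x) I)
   (temperley_lieb (n + 1) (delta x))"
 unfolding symplectic_blob_algebra_def temperley_lieb_def
proof (rule based_algebra_quotient[where \<phi> = "to_tl n"])
 show "finite (blob_diagrams n)" using assms(6) by (rule finite_blob_diagrams)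
 show "to_tl n ` blob_diagrams n = tl_diagrams (n + 1)" using to_tl_blob[OF assms(6)] to_tl_onto[OF assms(6)] by blast
 show "snd (blob_mult n x b b') \<in> blob_diagrams n" if "b \<in> blob_diagrams n" "b' \<in> blob_diagrams n" for b b'
  using that by (rule blob_mult_tl(2)[OF assms(1-6)])
 show "tl_mult (n + 1) (delta x) (to_tl n b) (to_tl n b') = (fst (blob_mult n x b b'), to_tl n (snd (blob_mult n x b b')))"
  if "b \<in> blob_diagrams n" "b' \<in> blob_diagrams n" for b b' unfolding tl_mult_def blob_mult_tl(1,3)[OF assms(1-6) that] ..
qed (rule id_blob_diagram, rule to_tl_id)

end
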